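(* Let $\mathcal V$ be an extensive, cartesian closed category with pullbacks, and let $\mathcal C$ be a $\mathcal V$-category. The internal Grothendieck construction gives an equivalence of categories $$\textstyle\int_{\mathcal C}\colon \mathcal V\text{-}\mathrm{Cat}(\mathcal C^{\mathrm{op}},\mathcal V)\to \mathrm{DFib}_{/\mathrm{Int}\,\mathcal C}$$ between the category of $\mathcal V$-functors $\mathcal C^{\mathrm{op}}\to\mathcal V$ (and $\mathcal V$-natural transformations) and the full subcategory $\mathrm{DFib}_{/\mathrm{Int}\,\mathcal C}$ of $\mathrm{Cat}(\mathcal V)_{/\mathrm{Int}\,\mathcal C}$ consisting of the internal discrete fibrations over $\mathrm{Int}\,\mathcal C$. Furthermore, this equivalence can be promoted to an equivalence of $\mathcal V$-categories $\int_{\mathcal C}\colon \mathcal V^{\mathcal C^{\mathrm{op}}}\to \underline{\mathrm{DFib}}_{/\mathrm{Int}\,\mathcal C}$ (that is, to an equivalence of $\mathcal V$-categories with underlying functor $\int_{\mathcal C}$).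
   Context: Extensive: $\mathcal V$ has all small coproducts and for every set $I$ and family $\{X_i\}_{i\in I}$ of objects, the functor $\bigsqcup_{i\in I}\colon\prod_{i\in I}\mathcal V_{/X_i}\to\mathcal V_{/\bigsqcup_i X_i}$ is an equivalence. $\ast$ is the terminal object, $[X,Y]$ the internal hom of $\mathcal V$, $\iota$ denotes coproduct inclusions. $\mathcal V$-categories are enriched over the cartesian monoidal structure, have a set of objects, composition $c_{A,B,C}\colon\mathcal C(A,B)\times\mathcal C(B,C)\to\mathcal C(A,C)$ and identities $i_A\colon\ast\to\mathcal C(A,A)$. $\mathcal V$ is a $\mathcal V$-category via $[X,Y]$. For a $\mathcal V$-functor $F\colon\mathcal C^{\mathrm{op}}\to\mathcal V$, $\mathrm{ev}^F_{A,B}\colon\mathcal C(A,B)\times FB\to FA$ is the transpose of $\mathcal C(A,B)\to[FB,FA]$; a $\mathcal V$-natural transformation $\alpha\colon F\Rightarrow G$ amounts to maps $\mathrm{ev}^\alpha_A\colon FA\to GA$ compatible with these. An internal category $\mathbb A$ to $\mathcal V$ consists of objects $\mathbb A_0,\mathbb A_1$ of $\mathcal V$ with source, target, identity and composition maps $s,t\colon\mathbb A_1\to\mathbb A_0$, $i\colon\mathbb A_0\to\mathbb A_1$, $c\colon\mathbb A_1\times_{\mathbb A_0}\mathbb A_1\to\mathbb A_1$ satisfying the usual axioms (in $\mathbb A_1\times_{\mathbb A_0}\mathbb A_1$ the target of the first factor equals the source of the second). Internal functors $H=(H_0,H_1)$ are pairs of maps compatible with the structure; they form the category $\mathrm{Cat}(\mathcal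 V)$, which is cartesian closed with internal hom $\llbracket\mathbb A,\mathbb B\rrbracket$. $P\colon\mathbb A\to\mathbb B$ is an internal discrete fibration if the square $P_0\circ t=t\circ P_1$ exhibits $\mathbb A_1$ as the pullback of $P_0\colon\mathbb A_0\to\mathbb B_0$ along $t\colon\mathbb B_1\to\mathbb B_0$. $\mathrm{Int}\colon\mathcal V\text{-}\mathrm{Cat}\to\mathrm{Cat}(\mathcal V)$: $(\mathrm{Int}\,\mathcal C)_0=\bigsqcup_{A\in\mathcal C}\ast$, $(\mathrm{Int}\,\mathcal C)_1=\bigsqcup_{A,B\in\mathcal C}\mathcal C(A,B)$; $s$ (resp. $t$) sends the $(A,B)$ summand to the summand $A$ (resp. $B$); identity and composition are induced by $i_A$, $c_{A,B,C}$. Internal Grothendieck construction: for $F\colon\mathcal C^{\mathrm{op}}\to\mathcal V$, the internal category of elements $\int_{\mathcal C}F$ has $(\int_{\mathcal C}F)_0=\bigsqcup_{A}FA$, $(\int_{\mathcal C}F)_1=\bigsqcup_{A,B}\mathcal C(A,B)\times FB$; on the $(A,B)$ summand, $s$ is $\mathrm{ev}^F_{A,B}$ into $FA$ and $t$ is the projection onto $FB$; identity is induced by $i_A\times\mathrm{id}_{FA}$ and composition by $c_{A,B,C}\times\mathrm{id}_{FC}$. It has a projection $\pi_F\colon\int_{\mathcal C}F\to\mathrm{Int}\,\mathcal C$ induced by $FA\to\ast$ and $\mathcal C(A,B)\times FB\to\mathcal C(A,B)$. A $\mathcal V$-natural transformation $\alpha$ is sent to the internal functor over $\mathrm{Int}\,\mathcal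 C$ induced by $\mathrm{ev}^\alpha_A$ and $\mathrm{id}_{\mathcal C(A,B)}\times\mathrm{ev}^\alpha_B$. Enrichments: $\mathcal V^{\mathcal C^{\mathrm{op}}}$ is the $\mathcal V$-category of $\mathcal V$-functors $\mathcal C^{\mathrm{op}}\to\mathcal V$ with hom-objects the ends $\int_{A\in\mathcal C}[FA,GA]$. $\mathrm{Cat}(\mathcal V)_{/\mathrm{Int}\,\mathcal C}$ is $\mathcal V$-enriched with hom-object from $P\colon\mathbb A\to\mathrm{Int}\,\mathcal C$ to $Q\colon\mathbb B\to\mathrm{Int}\,\mathcal C$ the pullback of $(Q_* )_0\colon\llbracket\mathbb A,\mathbb B\rrbracket_0\to\llbracket\mathbb A,\mathrm{Int}\,\mathcal C\rrbracket_0$ along $P\colon\ast\to\llbracket\mathbb A,\mathrm{Int}\,\mathcal C\rrbracket_0$; $\underline{\mathrm{DFib}}_{/\mathrm{Int}\,\mathcal C}$ is its full sub-$\mathcal V$-category on the internal discrete fibrations. A $\mathcal V$-functor $F\colon\mathcal A\to\mathcal B$ is an equivalence of $\mathcal V$-categories if there are a $\mathcal V$-functor $G\colon\mathcal B\to\mathcal A$ and $\mathcal V$-natural isomorphisms $\mathrm{id}\cong GF$, $FG\cong\mathrm{id}$. *)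

theory Defs
  imports Main "HOL-Library.FuncSet"
begin

section \<open>Categories, functors, equivalences\<close>

record ('o, 'm) cat =
  Ob :: "'o set"
  Ar :: "'m set"
  Dom :: "'m \<Rightarrow> 'o"
  Cod :: "'m \<Rightarrow> 'o"
  Idn :: "'o \<Rightarrow> 'm"
  Cmp :: "'m \<Rightarrow> 'm \<Rightarrow> 'm"  (infixl "\<cdot>\<index>" 70)

definition Hom :: "('o, 'm) cat \<Rightarrow> 'o \<Rightarrow> 'o \<Rightarrow> 'm set" where
  "Hom K a b = {f \<in> Ar K. Dom K f = a \<and> Cod K f = b}"

locale category =
  fixes K :: "('o, 'm) cat" (structure)
  assumes Dom_Ob: "f \<in> Ar K \<Longrightarrow> Dom K f \<in> Ob K"
    and Cod_Ob: "f \<in> Ar K \<Longrightarrow> Cod K f \<in> Ob K"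
    and Idn_Hom: "a \<in> Ob K \<Longrightarrow> Idn K a \<in> Hom K a a"
    and Cmp_Hom: "\<lbrakk>f \<in> Hom K a b; g \<in> Hom K b c\<rbrakk> \<Longrightarrow> g \<cdot> f \<in> Hom K a c"
    and Cmp_Idn: "f \<in> Hom K a b \<Longrightarrow> f \<cdot> Idn K a = f"
    and Idn_Cmp: "f \<in> Hom K a b \<Longrightarrow> Idn K b \<cdot> f = f"
    and Cmp_assoc: "\<lbrakk>f \<in> Hom K a b; g \<in> Hom K b c; h \<in> Hom K c d\<rbrakk>
      \<Longrightarrow> h \<cdot> (g \<cdot> f) = (h \<cdot> g) \<cdot> f"

definition full_subcat :: "('o, 'm) cat \<Rightarrow> 'o set \<Rightarrow> ('o, 'm) cat" where
  "full_subcat K S = K\<lparr>Ob := Ob K \<inter> S, Ar := {f \<in> Ar K. Dom K f \<in> S \<and> Cod K f \<in> S}\<rparr>"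

text \<open>Functors are extensional (undefined off the source category), so that HOL equality of
  functors is equality on objects and arrows.  The same convention is used below for
  enriched functors and natural transformations.\<close>

record ('o, 'm, 'p, 'n) fctr =
  FOb :: "'o \<Rightarrow> 'p"
  FAr :: "'m \<Rightarrow> 'n"

definition is_functor :: "('o, 'm) cat \<Rightarrow> ('p, 'n) cat \<Rightarrow> ('o, 'm, 'p, 'n) fctr \<Rightarrow> bool" where
  "is_functor C D F \<longleftrightarrow> category C \<and> category D \<and>
     FOb F \<in> Ob C \<rightarrow>\<^sub>E Ob D \<and> FAr F \<in> extensional (Ar C) \<and>
     (\<forall>a b. \<forall>f \<in> Hom C a b. FAr F f \<in> Hom D (FOb F a) (FOb F b)) \<and>
     (\<forall>a \<in> Ob C. FAr F (Idn C a) = Idn D (FOb F a)) \<and>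
     (\<forall>a b c. \<forall>f \<in> Hom C a b. \<forall>g \<in> Hom C b c.
        FAr F (g \<cdot>\<^bsub>C\<^esub> f) = FAr F g \<cdot>\<^bsub>D\<^esub> FAr F f)"

definition id_functor :: "('o, 'm) cat \<Rightarrow> ('o, 'm, 'o, 'm) fctr" where
  "id_functor C = \<lparr>FOb = (\<lambda>a \<in> Ob C. a), FAr = (\<lambda>f \<in> Ar C. f)\<rparr>"

text \<open>The first argument is the source category of \<open>F\<close>.\<close>

definition functor_comp :: "('o, 'm) cat \<Rightarrow> ('p, 'n, 'q, 'l) fctr \<Rightarrow> ('o, 'm, 'p, 'n) fctr
    \<Rightarrow> ('o, 'm, 'q, 'l) fctr" where
  "functor_comp C G F =
     \<lparr>FOb = (\<lambda>a \<in> Ob C. FOb G (FOb F a)), FAr = (\<lambda>f \<in> Ar C. FAr G (FAr F f))\<rparr>"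

definition is_iso :: "('o, 'm) cat \<Rightarrow> 'm \<Rightarrow> bool" where
  "is_iso K f \<longleftrightarrow> f \<in> Ar K \<and> (\<exists>g \<in> Hom K (Cod K f) (Dom K f).
     g \<cdot>\<^bsub>K\<^esub> f = Idn K (Dom K f) \<and> f \<cdot>\<^bsub>K\<^esub> g = Idn K (Cod K f))"

definition naturally_isomorphic ::
  "('o, 'm) cat \<Rightarrow> ('p, 'n) cat \<Rightarrow> ('o, 'm, 'p, 'n) fctr \<Rightarrow> ('o, 'm, 'p, 'n) fctr \<Rightarrow> bool" where
  "naturally_isomorphic C D F G \<longleftrightarrow> (\<exists>\<eta>.
     (\<forall>a \<in> Ob C. \<eta> a \<in> Hom D (FOb F a) (FOb G a) \<and> is_iso D (\<eta> a)) \<and>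
     (\<forall>a b. \<forall>f \<in> Hom C a b. \<eta> b \<cdot>\<^bsub>D\<^esub> FAr F f = FAr G f \<cdot>\<^bsub>D\<^esub> \<eta> a))"

definition is_equivalence ::
  "('o, 'm) cat \<Rightarrow> ('p, 'n) cat \<Rightarrow> ('o, 'm, 'p, 'n) fctr \<Rightarrow> bool" where
  "is_equivalence C D F \<longleftrightarrow> is_functor C D F \<and> (\<exists>G. is_functor D C G \<and>
     naturally_isomorphic C C (id_functor C) (functor_comp C G F) \<and>
     naturally_isomorphic D D (functor_comp D F G) (id_functor D))"

text \<open>The slice over \<open>x\<close>: objects are the arrows with codomain \<open>x\<close>; an arrow from \<open>p\<close> to \<open>q\<close>
  is a triple \<open>(p, q, h)\<close> with \<open>q \<cdot> h = p\<close>.\<close>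

definition slice :: "('o, 'm) cat \<Rightarrow> 'o \<Rightarrow> ('m, 'm \<times> 'm \<times> 'm) cat" where
  "slice K x = \<lparr>
     Ob = {p \<in> Ar K. Cod K p = x},
     Ar = {(p, q, h). p \<in> Ar K \<and> Cod K p = x \<and> q \<in> Ar K \<and> Cod K q = x \<and>
             h \<in> Hom K (Dom K p) (Dom K q) \<and> q \<cdot>\<^bsub>K\<^esub> h = p},
     Dom = (\<lambda>(p, q, h). p),
     Cod = (\<lambda>(p, q, h). q),
     Idn = (\<lambda>p. (p, p, Idn K (Dom K p))),
     Cmp = (\<lambda>(q', r, k) (p, q, h). (p, r, k \<cdot>\<^bsub>K\<^esub> h))\<rparr>"

definition prod_cat :: "'i set \<Rightarrow> ('i \<Rightarrow> ('o, 'm) cat) \<Rightarrow> ('i \<Rightarrow> 'o, 'i \<Rightarrow> 'm) cat" where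
  "prod_cat I D = \<lparr>
     Ob = (\<Pi>\<^sub>E i \<in> I. Ob (D i)),
     Ar = (\<Pi>\<^sub>E i \<in> I. Ar (D i)),
     Dom = (\<lambda>f. \<lambda>i \<in> I. Dom (D i) (f i)),
     Cod = (\<lambda>f. \<lambda>i \<in> I. Cod (D i) (f i)),
     Idn = (\<lambda>a. \<lambda>i \<in> I. Idn (D i) (a i)),
     Cmp = (\<lambda>g f. \<lambda>i \<in> I. g i \<cdot>\<^bsub>D i\<^esub> f i)\<rparr>"


section \<open>Limits, exponentials and coproducts\<close>

text \<open>Each (co)limit is given by its universal property; a choice of (co)limits is made with
  the choice operator, and is meaningful only when the (co)limit exists.\<close>

definition is_terminal :: "('o, 'm) cat \<Rightarrow> 'o \<Rightarrow> bool" where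
  "is_terminal K t \<longleftrightarrow> t \<in> Ob K \<and> (\<forall>a \<in> Ob K. \<exists>!f. f \<in> Hom K a t)"

definition terminal :: "('o, 'm) cat \<Rightarrow> 'o" where
  "terminal K = (SOME t. is_terminal K t)"

definition bang :: "('o, 'm) cat \<Rightarrow> 'o \<Rightarrow> 'm" where
  "bang K a = (THE f. f \<in> Hom K a (terminal K))"

definition is_product :: "('o, 'm) cat \<Rightarrow> 'o \<Rightarrow> 'o \<Rightarrow> 'o \<Rightarrow> 'm \<Rightarrow> 'm \<Rightarrow> bool" where
  "is_product K a b p u v \<longleftrightarrow> u \<in> Hom K p a \<and> v \<in> Hom K p b \<and>
     (\<forall>x. \<forall>f \<in> Hom K x a. \<forall>g \<in> Hom K x b.
        \<exists>!h. h \<in> Hom K x p \<and> u \<cdot>\<^bsub>K\<^esub> h = f \<and> v \<cdot>\<^bsub>K\<^esub> h = g)"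

definition product :: "('o, 'm) cat \<Rightarrow> 'o \<Rightarrow> 'o \<Rightarrow> 'o \<times> 'm \<times> 'm" where
  "product K a b = (SOME (p, u, v). is_product K a b p u v)"

definition Prod :: "('o, 'm) cat \<Rightarrow> 'o \<Rightarrow> 'o \<Rightarrow> 'o" where
  "Prod K a b = fst (product K a b)"

definition pr1 :: "('o, 'm) cat \<Rightarrow> 'o \<Rightarrow> 'o \<Rightarrow> 'm" where
  "pr1 K a b = fst (snd (product K a b))"

definition pr2 :: "('o, 'm) cat \<Rightarrow> 'o \<Rightarrow> 'o \<Rightarrow> 'm" where
  "pr2 K a b = snd (snd (product K a b))"

text \<open>The factorization of \<open>(f, g)\<close> through a product or pullback cone \<open>(u, v)\<close>.\<close>

definition pairing :: "('o, 'm) cat \<Rightarrow> 'm \<Rightarrow> 'm \<Rightarrow> 'm \<Rightarrow> 'm \<Rightarrow> 'm" where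
  "pairing K u v f g =
     (THE h. h \<in> Hom K (Dom K f) (Dom K u) \<and> u \<cdot>\<^bsub>K\<^esub> h = f \<and> v \<cdot>\<^bsub>K\<^esub> h = g)"

definition tuple :: "('o, 'm) cat \<Rightarrow> 'm \<Rightarrow> 'm \<Rightarrow> 'm" where
  "tuple K f g = pairing K (pr1 K (Cod K f) (Cod K g)) (pr2 K (Cod K f) (Cod K g)) f g"

definition cross :: "('o, 'm) cat \<Rightarrow> 'm \<Rightarrow> 'm \<Rightarrow> 'm" where
  "cross K f g = tuple K (f \<cdot>\<^bsub>K\<^esub> pr1 K (Dom K f) (Dom K g)) (g \<cdot>\<^bsub>K\<^esub> pr2 K (Dom K f) (Dom K g))"

definition assoc :: "('o, 'm) cat \<Rightarrow> 'o \<Rightarrow> 'o \<Rightarrow> 'o \<Rightarrow> 'm" where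
  "assoc K a b c = tuple K
     (pr1 K a b \<cdot>\<^bsub>K\<^esub> pr1 K (Prod K a b) c)
     (tuple K (pr2 K a b \<cdot>\<^bsub>K\<^esub> pr1 K (Prod K a b) c) (pr2 K (Prod K a b) c))"

definition is_pullback :: "('o, 'm) cat \<Rightarrow> 'm \<Rightarrow> 'm \<Rightarrow> 'o \<Rightarrow> 'm \<Rightarrow> 'm \<Rightarrow> bool" where
  "is_pullback K f g p u v \<longleftrightarrow>
     f \<in> Ar K \<and> g \<in> Ar K \<and> Cod K f = Cod K g \<and>
     u \<in> Hom K p (Dom K f) \<and> v \<in> Hom K p (Dom K g) \<and> f \<cdot>\<^bsub>K\<^esub> u = g \<cdot>\<^bsub>K\<^esub> v \<and>
     (\<forall>x. \<forall>h \<in> Hom K x (Dom K f). \<forall>k \<in> Hom K x (Dom K g). f \<cdot>\<^bsub>K\<^esub> h = g \<cdot>\<^bsub>K\<^esub> k \<longrightarrow>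
        (\<exists>!w. w \<in> Hom K x p \<and> u \<cdot>\<^bsub>K\<^esub> w = h \<and> v \<cdot>\<^bsub>K\<^esub> w = k))"

definition pullback :: "('o, 'm) cat \<Rightarrow> 'm \<Rightarrow> 'm \<Rightarrow> 'o \<times> 'm \<times> 'm" where
  "pullback K f g = (SOME (p, u, v). is_pullback K f g p u v)"

definition Pb :: "('o, 'm) cat \<Rightarrow> 'm \<Rightarrow> 'm \<Rightarrow> 'o" where
  "Pb K f g = fst (pullback K f g)"

definition pb1 :: "('o, 'm) cat \<Rightarrow> 'm \<Rightarrow> 'm \<Rightarrow> 'm" where
  "pb1 K f g = fst (snd (pullback K f g))"

definition pb2 :: "('o, 'm) cat \<Rightarrow> 'm \<Rightarrow> 'm \<Rightarrow> 'm" where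
  "pb2 K f g = snd (snd (pullback K f g))"

definition pb_tuple :: "('o, 'm) cat \<Rightarrow> 'm \<Rightarrow> 'm \<Rightarrow> 'm \<Rightarrow> 'm \<Rightarrow> 'm" where
  "pb_tuple K f g = pairing K (pb1 K f g) (pb2 K f g)"

definition has_pullbacks :: "('o, 'm) cat \<Rightarrow> bool" where
  "has_pullbacks K \<longleftrightarrow> (\<forall>f \<in> Ar K. \<forall>g \<in> Ar K. Cod K f = Cod K g \<longrightarrow>
     (\<exists>p u v. is_pullback K f g p u v))"

text \<open>\<open>e\<close> is the exponential \<open>[a, b]\<close>, with evaluation \<open>w : e \<times> a \<rightarrow> b\<close>.\<close>

definition is_exponential :: "('o, 'm) cat \<Rightarrow> 'o \<Rightarrow> 'o \<Rightarrow> 'o \<Rightarrow> 'm \<Rightarrow> bool" where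
  "is_exponential K a b e w \<longleftrightarrow> e \<in> Ob K \<and> w \<in> Hom K (Prod K e a) b \<and>
     (\<forall>x \<in> Ob K. \<forall>f \<in> Hom K (Prod K x a) b.
        \<exists>!h. h \<in> Hom K x e \<and> w \<cdot>\<^bsub>K\<^esub> cross K h (Idn K a) = f)"

definition exponential :: "('o, 'm) cat \<Rightarrow> 'o \<Rightarrow> 'o \<Rightarrow> 'o \<times> 'm" where
  "exponential K a b = (SOME (e, w). is_exponential K a b e w)"

definition Exp :: "('o, 'm) cat \<Rightarrow> 'o \<Rightarrow> 'o \<Rightarrow> 'o" where
  "Exp K a b = fst (exponential K a b)"

definition eval_ar :: "('o, 'm) cat \<Rightarrow> 'o \<Rightarrow> 'o \<Rightarrow> 'm" where
  "eval_ar K a b = snd (exponential K a b)"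

text \<open>The transpose \<open>x \<rightarrow> [a, b]\<close> of \<open>f : x \<times> a \<rightarrow> b\<close>.\<close>

definition transp :: "('o, 'm) cat \<Rightarrow> 'o \<Rightarrow> 'o \<Rightarrow> 'o \<Rightarrow> 'm \<Rightarrow> 'm" where
  "transp K x a b f =
     (THE h. h \<in> Hom K x (Exp K a b) \<and> eval_ar K a b \<cdot>\<^bsub>K\<^esub> cross K h (Idn K a) = f)"

definition cartesian_closed :: "('o, 'm) cat \<Rightarrow> bool" where
  "cartesian_closed K \<longleftrightarrow> (\<exists>t. is_terminal K t) \<and>
     (\<forall>a \<in> Ob K. \<forall>b \<in> Ob K. \<exists>p u v. is_product K a b p u v) \<and>
     (\<forall>a \<in> Ob K. \<forall>b \<in> Ob K. \<exists>e w. is_exponential K a b e w)"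

definition is_coproduct :: "('o, 'm) cat \<Rightarrow> 'i set \<Rightarrow> ('i \<Rightarrow> 'o) \<Rightarrow> 'o \<Rightarrow> ('i \<Rightarrow> 'm) \<Rightarrow> bool" where
  "is_coproduct K I X q j \<longleftrightarrow> q \<in> Ob K \<and> (\<forall>i \<in> I. j i \<in> Hom K (X i) q) \<and>
     (\<forall>y \<in> Ob K. \<forall>f. (\<forall>i \<in> I. f i \<in> Hom K (X i) y) \<longrightarrow>
        (\<exists>!h. h \<in> Hom K q y \<and> (\<forall>i \<in> I. h \<cdot>\<^bsub>K\<^esub> j i = f i)))"

definition coproduct :: "('o, 'm) cat \<Rightarrow> 'i set \<Rightarrow> ('i \<Rightarrow> 'o) \<Rightarrow> 'o \<times> ('i \<Rightarrow> 'm)" where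
  "coproduct K I X = (SOME (q, j). is_coproduct K I X q j)"

definition Coprod :: "('o, 'm) cat \<Rightarrow> 'i set \<Rightarrow> ('i \<Rightarrow> 'o) \<Rightarrow> 'o" where
  "Coprod K I X = fst (coproduct K I X)"

definition coin :: "('o, 'm) cat \<Rightarrow> 'i set \<Rightarrow> ('i \<Rightarrow> 'o) \<Rightarrow> 'i \<Rightarrow> 'm" where
  "coin K I X = snd (coproduct K I X)"

definition copair :: "('o, 'm) cat \<Rightarrow> 'i set \<Rightarrow> ('i \<Rightarrow> 'o) \<Rightarrow> 'o \<Rightarrow> ('i \<Rightarrow> 'm) \<Rightarrow> 'm" where
  "copair K I X y f =
     (THE h. h \<in> Hom K (Coprod K I X) y \<and> (\<forall>i \<in> I. h \<cdot>\<^bsub>K\<^esub> coin K I X i = f i))"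

definition coprod_map ::
  "('o, 'm) cat \<Rightarrow> 'i set \<Rightarrow> ('i \<Rightarrow> 'o) \<Rightarrow> ('i \<Rightarrow> 'o) \<Rightarrow> ('i \<Rightarrow> 'm) \<Rightarrow> 'm" where
  "coprod_map K I X Y f = copair K I X (Coprod K I Y) (\<lambda>i. coin K I Y i \<cdot>\<^bsub>K\<^esub> f i)"

definition coprod_functor :: "('o, 'm) cat \<Rightarrow> 'i set \<Rightarrow> ('i \<Rightarrow> 'o)
    \<Rightarrow> ('i \<Rightarrow> 'm, 'i \<Rightarrow> 'm \<times> 'm \<times> 'm, 'm, 'm \<times> 'm \<times> 'm) fctr" where
  "coprod_functor K I X =
     (let D = prod_cat I (\<lambda>i. slice K (X i));
          S = (\<lambda>p. coprod_map K I (\<lambda>i. Dom K (p i)) X p)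
      in \<lparr>FOb = (\<lambda>p \<in> Ob D. S p),
          FAr = (\<lambda>f \<in> Ar D. (S (Dom D f), S (Cod D f),
             coprod_map K I (\<lambda>i. Dom K (Dom D f i)) (\<lambda>i. Dom K (Cod D f i))
               (\<lambda>i. snd (snd (f i)))))\<rparr>)"

text \<open>The type \<open>'i\<close> is the universe of small sets: a set is small if it is in bijection with a
  subset of \<open>'i\<close>.  It is meant to be used with \<open>'i\<close> infinite, so that small sets are closed
  under binary products.\<close>

definition extensive :: "'i itself \<Rightarrow> ('o, 'm) cat \<Rightarrow> bool" where
  "extensive _ K \<longleftrightarrow> (\<forall>(I :: 'i set) X. (\<forall>i \<in> I. X i \<in> Ob K) \<longrightarrow>
     (\<exists>q j. is_coproduct K I X q j) \<and>
     is_equivalence (prod_cat I (\<lambda>i. slice K (X i))) (slice K (Coprod K I X))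
       (coprod_functor K I X))"


section \<open>Enriched categories\<close>

text \<open>Enrichment is over the cartesian monoidal structure of \<open>V\<close>; composition is in
  diagrammatic order, \<open>VCmp C a b c : C(a,b) \<times> C(b,c) \<rightarrow> C(a,c)\<close>.\<close>

record ('c, 'o, 'm) vcat =
  VOb :: "'c set"
  VHom :: "'c \<Rightarrow> 'c \<Rightarrow> 'o"
  VCmp :: "'c \<Rightarrow> 'c \<Rightarrow> 'c \<Rightarrow> 'm"
  VId :: "'c \<Rightarrow> 'm"

definition vcategory :: "('o, 'm) cat \<Rightarrow> ('c, 'o, 'm) vcat \<Rightarrow> bool" where
  "vcategory V C \<longleftrightarrow>
     (\<forall>a \<in> VOb C. \<forall>b \<in> VOb C. VHom C a b \<in> Ob V) \<and>
     (\<forall>a \<in> VOb C. \<forall>b \<in> VOb C. \<forall>c \<in> VOb C.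
        VCmp C a b c \<in> Hom V (Prod V (VHom C a b) (VHom C b c)) (VHom C a c)) \<and>
     (\<forall>a \<in> VOb C. VId C a \<in> Hom V (terminal V) (VHom C a a)) \<and>
     (\<forall>a \<in> VOb C. \<forall>b \<in> VOb C. \<forall>c \<in> VOb C. \<forall>d \<in> VOb C.
        VCmp C a c d \<cdot>\<^bsub>V\<^esub> cross V (VCmp C a b c) (Idn V (VHom C c d)) =
        VCmp C a b d \<cdot>\<^bsub>V\<^esub> cross V (Idn V (VHom C a b)) (VCmp C b c d)
          \<cdot>\<^bsub>V\<^esub> assoc V (VHom C a b) (VHom C b c) (VHom C c d)) \<and>
     (\<forall>a \<in> VOb C. \<forall>b \<in> VOb C.
        VCmp C a a b \<cdot>\<^bsub>V\<^esub> tuple V (VId C a \<cdot>\<^bsub>V\<^esub> bang V (VHom C a b)) (Idn V (VHom C a b))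
          = Idn V (VHom C a b) \<and>
        VCmp C a b b \<cdot>\<^bsub>V\<^esub> tuple V (Idn V (VHom C a b)) (VId C b \<cdot>\<^bsub>V\<^esub> bang V (VHom C a b))
          = Idn V (VHom C a b))"

definition vop :: "('o, 'm) cat \<Rightarrow> ('c, 'o, 'm) vcat \<Rightarrow> ('c, 'o, 'm) vcat" where
  "vop V C = \<lparr>VOb = VOb C, VHom = (\<lambda>a b. VHom C b a),
     VCmp = (\<lambda>a b c. VCmp C c b a \<cdot>\<^bsub>V\<^esub>
        tuple V (pr2 V (VHom C b a) (VHom C c b)) (pr1 V (VHom C b a) (VHom C c b))),
     VId = VId C\<rparr>"

definition vself :: "('o, 'm) cat \<Rightarrow> ('o, 'o, 'm) vcat" where
  "vself V = \<lparr>VOb = Ob V, VHom = Exp V,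
     VCmp = (\<lambda>x y z.
        let e = Exp V x y; d = Exp V y z; p = pr1 V (Prod V e d) x
        in transp V (Prod V e d) x z
             (eval_ar V y z \<cdot>\<^bsub>V\<^esub> tuple V (pr2 V e d \<cdot>\<^bsub>V\<^esub> p)
                (eval_ar V x y \<cdot>\<^bsub>V\<^esub> tuple V (pr1 V e d \<cdot>\<^bsub>V\<^esub> p) (pr2 V (Prod V e d) x)))),
     VId = (\<lambda>x. transp V (terminal V) x x (pr2 V (terminal V) x))\<rparr>"

definition vfull :: "('c, 'o, 'm) vcat \<Rightarrow> 'c set \<Rightarrow> ('c, 'o, 'm) vcat" where
  "vfull A S = A\<lparr>VOb := VOb A \<inter> S\<rparr>"

record ('c, 'd, 'm) vfun =
  VFOb :: "'c \<Rightarrow> 'd"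
  VFHom :: "'c \<Rightarrow> 'c \<Rightarrow> 'm"

definition vfunctor :: "('o, 'm) cat \<Rightarrow> ('c, 'o, 'm) vcat \<Rightarrow> ('d, 'o, 'm) vcat
    \<Rightarrow> ('c, 'd, 'm) vfun \<Rightarrow> bool" where
  "vfunctor V A B F \<longleftrightarrow> vcategory V A \<and> vcategory V B \<and>
     VFOb F \<in> VOb A \<rightarrow>\<^sub>E VOb B \<and>
     (\<forall>a b. \<not> (a \<in> VOb A \<and> b \<in> VOb A) \<longrightarrow> VFHom F a b = undefined) \<and>
     (\<forall>a \<in> VOb A. \<forall>b \<in> VOb A. VFHom F a b \<in> Hom V (VHom A a b) (VHom B (VFOb F a) (VFOb F b))) \<and>
     (\<forall>a \<in> VOb A. \<forall>b \<in> VOb A. \<forall>c \<in> VOb A.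
        VFHom F a c \<cdot>\<^bsub>V\<^esub> VCmp A a b c =
        VCmp B (VFOb F a) (VFOb F b) (VFOb F c) \<cdot>\<^bsub>V\<^esub> cross V (VFHom F a b) (VFHom F b c)) \<and>
     (\<forall>a \<in> VOb A. VFHom F a a \<cdot>\<^bsub>V\<^esub> VId A a = VId B (VFOb F a))"

definition vid_functor :: "('o, 'm) cat \<Rightarrow> ('c, 'o, 'm) vcat \<Rightarrow> ('c, 'c, 'm) vfun" where
  "vid_functor V A = \<lparr>VFOb = (\<lambda>a \<in> VOb A. a),
     VFHom = (\<lambda>a b. if a \<in> VOb A \<and> b \<in> VOb A then Idn V (VHom A a b) else undefined)\<rparr>"

definition vfunctor_comp :: "('o, 'm) cat \<Rightarrow> ('c, 'o, 'm) vcat \<Rightarrow> ('d, 'e, 'm) vfun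
    \<Rightarrow> ('c, 'd, 'm) vfun \<Rightarrow> ('c, 'e, 'm) vfun" where
  "vfunctor_comp V A G F = \<lparr>VFOb = (\<lambda>a \<in> VOb A. VFOb G (VFOb F a)),
     VFHom = (\<lambda>a b. if a \<in> VOb A \<and> b \<in> VOb A
        then VFHom G (VFOb F a) (VFOb F b) \<cdot>\<^bsub>V\<^esub> VFHom F a b else undefined)\<rparr>"

definition vnat :: "('o, 'm) cat \<Rightarrow> ('c, 'o, 'm) vcat \<Rightarrow> ('d, 'o, 'm) vcat
    \<Rightarrow> ('c, 'd, 'm) vfun \<Rightarrow> ('c, 'd, 'm) vfun \<Rightarrow> ('c \<Rightarrow> 'm) \<Rightarrow> bool" where
  "vnat V A B F G \<alpha> \<longleftrightarrow> vfunctor V A B F \<and> vfunctor V A B G \<and> \<alpha> \<in> extensional (VOb A) \<and>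
     (\<forall>a \<in> VOb A. \<alpha> a \<in> Hom V (terminal V) (VHom B (VFOb F a) (VFOb G a))) \<and>
     (\<forall>a \<in> VOb A. \<forall>b \<in> VOb A.
        VCmp B (VFOb F a) (VFOb F b) (VFOb G b)
          \<cdot>\<^bsub>V\<^esub> tuple V (VFHom F a b) (\<alpha> b \<cdot>\<^bsub>V\<^esub> bang V (VHom A a b)) =
        VCmp B (VFOb F a) (VFOb G a) (VFOb G b)
          \<cdot>\<^bsub>V\<^esub> tuple V (\<alpha> a \<cdot>\<^bsub>V\<^esub> bang V (VHom A a b)) (VFHom G a b))"

text \<open>The category of \<open>V\<close>-functors \<open>A \<rightarrow> B\<close> and \<open>V\<close>-natural transformations.\<close>

definition vfun_cat :: "('o, 'm) cat \<Rightarrow> ('c, 'o, 'm) vcat \<Rightarrow> ('d, 'o, 'm) vcat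
    \<Rightarrow> (('c, 'd, 'm) vfun, ('c, 'd, 'm) vfun \<times> ('c, 'd, 'm) vfun \<times> ('c \<Rightarrow> 'm)) cat" where
  "vfun_cat V A B = \<lparr>
     Ob = {F. vfunctor V A B F},
     Ar = {(F, G, \<alpha>). vnat V A B F G \<alpha>},
     Dom = (\<lambda>(F, G, \<alpha>). F),
     Cod = (\<lambda>(F, G, \<alpha>). G),
     Idn = (\<lambda>F. (F, F, \<lambda>a \<in> VOb A. VId B (VFOb F a))),
     Cmp = (\<lambda>(G, H, \<beta>) (F, G', \<alpha>). (F, H, \<lambda>a \<in> VOb A.
        VCmp B (VFOb F a) (VFOb G a) (VFOb H a) \<cdot>\<^bsub>V\<^esub> tuple V (\<alpha> a) (\<beta> a)))\<rparr>"

definition vnaturally_isomorphic :: "('o, 'm) cat \<Rightarrow> ('c, 'o, 'm) vcat \<Rightarrow> ('d, 'o, 'm) vcat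
    \<Rightarrow> ('c, 'd, 'm) vfun \<Rightarrow> ('c, 'd, 'm) vfun \<Rightarrow> bool" where
  "vnaturally_isomorphic V A B F G \<longleftrightarrow>
     (\<exists>\<alpha>. \<alpha> \<in> Hom (vfun_cat V A B) F G \<and> is_iso (vfun_cat V A B) \<alpha>)"

definition is_vequivalence :: "('o, 'm) cat \<Rightarrow> ('c, 'o, 'm) vcat \<Rightarrow> ('d, 'o, 'm) vcat
    \<Rightarrow> ('c, 'd, 'm) vfun \<Rightarrow> bool" where
  "is_vequivalence V A B F \<longleftrightarrow> vfunctor V A B F \<and> (\<exists>G. vfunctor V B A G \<and>
     vnaturally_isomorphic V A A (vid_functor V A) (vfunctor_comp V A G F) \<and>
     vnaturally_isomorphic V B B (vfunctor_comp V B F G) (vid_functor V B))"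

definition underlying :: "('o, 'm) cat \<Rightarrow> ('c, 'o, 'm) vcat \<Rightarrow> ('c, 'c \<times> 'c \<times> 'm) cat" where
  "underlying V A = \<lparr>
     Ob = VOb A,
     Ar = {(a, b, f). a \<in> VOb A \<and> b \<in> VOb A \<and> f \<in> Hom V (terminal V) (VHom A a b)},
     Dom = (\<lambda>(a, b, f). a),
     Cod = (\<lambda>(a, b, f). b),
     Idn = (\<lambda>a. (a, a, VId A a)),
     Cmp = (\<lambda>(b, c, g) (a, b', f). (a, c, VCmp A a b c \<cdot>\<^bsub>V\<^esub> tuple V f g))\<rparr>"

definition underlying_functor :: "('o, 'm) cat \<Rightarrow> ('c, 'o, 'm) vcat \<Rightarrow> ('c, 'd, 'm) vfun
    \<Rightarrow> ('c, 'c \<times> 'c \<times> 'm, 'd, 'd \<times> 'd \<times> 'm) fctr" where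
  "underlying_functor V A F = \<lparr>
     FOb = (\<lambda>a \<in> Ob (underlying V A). VFOb F a),
     FAr = (\<lambda>(a, b, f) \<in> Ar (underlying V A). (VFOb F a, VFOb F b, VFHom F a b \<cdot>\<^bsub>V\<^esub> f))\<rparr>"

text \<open>The end \<open>\<integral>\<^sub>a B(F a, G a)\<close>: a wedge with vertex \<open>x\<close> is a family
  \<open>w a : x \<rightarrow> B(F a, G a)\<close> whose two induced maps \<open>x \<times> A(a,b) \<rightarrow> B(F a, G b)\<close> agree.\<close>

definition is_wedge :: "('o, 'm) cat \<Rightarrow> ('c, 'o, 'm) vcat \<Rightarrow> ('d, 'o, 'm) vcat
    \<Rightarrow> ('c, 'd, 'm) vfun \<Rightarrow> ('c, 'd, 'm) vfun \<Rightarrow> 'o \<Rightarrow> ('c \<Rightarrow> 'm) \<Rightarrow> bool" where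
  "is_wedge V A B F G x w \<longleftrightarrow> x \<in> Ob V \<and>
     (\<forall>a \<in> VOb A. w a \<in> Hom V x (VHom B (VFOb F a) (VFOb G a))) \<and>
     (\<forall>a \<in> VOb A. \<forall>b \<in> VOb A.
        VCmp B (VFOb F a) (VFOb F b) (VFOb G b)
          \<cdot>\<^bsub>V\<^esub> tuple V (VFHom F a b \<cdot>\<^bsub>V\<^esub> pr2 V x (VHom A a b)) (w b \<cdot>\<^bsub>V\<^esub> pr1 V x (VHom A a b)) =
        VCmp B (VFOb F a) (VFOb G a) (VFOb G b)
          \<cdot>\<^bsub>V\<^esub> tuple V (w a \<cdot>\<^bsub>V\<^esub> pr1 V x (VHom A a b)) (VFHom G a b \<cdot>\<^bsub>V\<^esub> pr2 V x (VHom A a b)))"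

definition is_end :: "('o, 'm) cat \<Rightarrow> ('c, 'o, 'm) vcat \<Rightarrow> ('d, 'o, 'm) vcat
    \<Rightarrow> ('c, 'd, 'm) vfun \<Rightarrow> ('c, 'd, 'm) vfun \<Rightarrow> 'o \<Rightarrow> ('c \<Rightarrow> 'm) \<Rightarrow> bool" where
  "is_end V A B F G e l \<longleftrightarrow> is_wedge V A B F G e l \<and>
     (\<forall>x w. is_wedge V A B F G x w \<longrightarrow>
        (\<exists>!h. h \<in> Hom V x e \<and> (\<forall>a \<in> VOb A. l a \<cdot>\<^bsub>V\<^esub> h = w a)))"

definition vend :: "('o, 'm) cat \<Rightarrow> ('c, 'o, 'm) vcat \<Rightarrow> ('d, 'o, 'm) vcat
    \<Rightarrow> ('c, 'd, 'm) vfun \<Rightarrow> ('c, 'd, 'm) vfun \<Rightarrow> 'o \<times> ('c \<Rightarrow> 'm)" where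
  "vend V A B F G = (SOME (e, l). is_end V A B F G e l)"

definition End :: "('o, 'm) cat \<Rightarrow> ('c, 'o, 'm) vcat \<Rightarrow> ('d, 'o, 'm) vcat
    \<Rightarrow> ('c, 'd, 'm) vfun \<Rightarrow> ('c, 'd, 'm) vfun \<Rightarrow> 'o" where
  "End V A B F G = fst (vend V A B F G)"

definition end_pr :: "('o, 'm) cat \<Rightarrow> ('c, 'o, 'm) vcat \<Rightarrow> ('d, 'o, 'm) vcat
    \<Rightarrow> ('c, 'd, 'm) vfun \<Rightarrow> ('c, 'd, 'm) vfun \<Rightarrow> 'c \<Rightarrow> 'm" where
  "end_pr V A B F G = snd (vend V A B F G)"

definition end_lift :: "('o, 'm) cat \<Rightarrow> ('c, 'o, 'm) vcat \<Rightarrow> ('d, 'o, 'm) vcat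
    \<Rightarrow> ('c, 'd, 'm) vfun \<Rightarrow> ('c, 'd, 'm) vfun \<Rightarrow> 'o \<Rightarrow> ('c \<Rightarrow> 'm) \<Rightarrow> 'm" where
  "end_lift V A B F G x w = (THE h. h \<in> Hom V x (End V A B F G) \<and>
     (\<forall>a \<in> VOb A. end_pr V A B F G a \<cdot>\<^bsub>V\<^esub> h = w a))"

text \<open>The \<open>V\<close>-category of \<open>V\<close>-functors \<open>A \<rightarrow> B\<close>.\<close>

definition vfun_vcat :: "('o, 'm) cat \<Rightarrow> ('c, 'o, 'm) vcat \<Rightarrow> ('d, 'o, 'm) vcat
    \<Rightarrow> (('c, 'd, 'm) vfun, 'o, 'm) vcat" where
  "vfun_vcat V A B = \<lparr>
     VOb = {F. vfunctor V A B F},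
     VHom = End V A B,
     VCmp = (\<lambda>F G H. end_lift V A B F H (Prod V (End V A B F G) (End V A B G H))
        (\<lambda>a. VCmp B (VFOb F a) (VFOb G a) (VFOb H a)
           \<cdot>\<^bsub>V\<^esub> cross V (end_pr V A B F G a) (end_pr V A B G H a))),
     VId = (\<lambda>F. end_lift V A B F F (terminal V) (\<lambda>a. VId B (VFOb F a)))\<rparr>"

text \<open>The comparison from the category of \<open>V\<close>-functors and \<open>V\<close>-natural transformations to the
  underlying category of the \<open>V\<close>-category of \<open>V\<close>-functors: a \<open>V\<close>-natural transformation is a
  wedge with vertex the terminal object.\<close>

definition vfun_comparison where
  "vfun_comparison V A B = \<lparr>
     FOb = (\<lambda>F \<in> Ob (vfun_cat V A B). F),
     FAr = (\<lambda>(F, G, \<alpha>) \<in> Ar (vfun_cat V A B).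
              (F, G, end_lift V A B F G (terminal V) \<alpha>))\<rparr>"


section \<open>Internal categories\<close>

record ('o, 'm) icat =
  IOb :: "'o"
  IAr :: "'o"
  ISrc :: "'m"
  ITgt :: "'m"
  IIdn :: "'m"
  ICmp :: "'m"

text \<open>The object of composable pairs is the pullback of \<open>t\<close> (first factor) and \<open>s\<close>
  (second factor); \<open>trip1\<close>, \<open>trip2\<close> present the object of composable triples as a pullback of
  the object of composable pairs.\<close>

abbreviation ipairs :: "('o, 'm) cat \<Rightarrow> ('o, 'm) icat \<Rightarrow> 'o" where
  "ipairs V A \<equiv> Pb V (ITgt A) (ISrc A)"

abbreviation ip1 :: "('o, 'm) cat \<Rightarrow> ('o, 'm) icat \<Rightarrow> 'm" where
  "ip1 V A \<equiv> pb1 V (ITgt A) (ISrc A)"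

abbreviation ip2 :: "('o, 'm) cat \<Rightarrow> ('o, 'm) icat \<Rightarrow> 'm" where
  "ip2 V A \<equiv> pb2 V (ITgt A) (ISrc A)"

abbreviation ipair :: "('o, 'm) cat \<Rightarrow> ('o, 'm) icat \<Rightarrow> 'm \<Rightarrow> 'm \<Rightarrow> 'm" where
  "ipair V A f g \<equiv> pb_tuple V (ITgt A) (ISrc A) f g"

definition trip1 :: "('o, 'm) cat \<Rightarrow> ('o, 'm) icat \<Rightarrow> 'm" where
  "trip1 V A = pb1 V (ITgt A \<cdot>\<^bsub>V\<^esub> ip2 V A) (ISrc A)"

definition trip2 :: "('o, 'm) cat \<Rightarrow> ('o, 'm) icat \<Rightarrow> 'm" where
  "trip2 V A = pb2 V (ITgt A \<cdot>\<^bsub>V\<^esub> ip2 V A) (ISrc A)"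

definition internal_category :: "('o, 'm) cat \<Rightarrow> ('o, 'm) icat \<Rightarrow> bool" where
  "internal_category V A \<longleftrightarrow>
     IOb A \<in> Ob V \<and> IAr A \<in> Ob V \<and>
     ISrc A \<in> Hom V (IAr A) (IOb A) \<and> ITgt A \<in> Hom V (IAr A) (IOb A) \<and>
     IIdn A \<in> Hom V (IOb A) (IAr A) \<and> ICmp A \<in> Hom V (ipairs V A) (IAr A) \<and>
     ISrc A \<cdot>\<^bsub>V\<^esub> IIdn A = Idn V (IOb A) \<and> ITgt A \<cdot>\<^bsub>V\<^esub> IIdn A = Idn V (IOb A) \<and>
     ISrc A \<cdot>\<^bsub>V\<^esub> ICmp A = ISrc A \<cdot>\<^bsub>V\<^esub> ip1 V A \<and>
     ITgt A \<cdot>\<^bsub>V\<^esub> ICmp A = ITgt A \<cdot>\<^bsub>V\<^esub> ip2 V A \<and>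
     ICmp A \<cdot>\<^bsub>V\<^esub> ipair V A (IIdn A \<cdot>\<^bsub>V\<^esub> ISrc A) (Idn V (IAr A)) = Idn V (IAr A) \<and>
     ICmp A \<cdot>\<^bsub>V\<^esub> ipair V A (Idn V (IAr A)) (IIdn A \<cdot>\<^bsub>V\<^esub> ITgt A) = Idn V (IAr A) \<and>
     ICmp A \<cdot>\<^bsub>V\<^esub> ipair V A (ICmp A \<cdot>\<^bsub>V\<^esub> trip1 V A) (trip2 V A) =
     ICmp A \<cdot>\<^bsub>V\<^esub> ipair V A (ip1 V A \<cdot>\<^bsub>V\<^esub> trip1 V A)
       (ICmp A \<cdot>\<^bsub>V\<^esub> ipair V A (ip2 V A \<cdot>\<^bsub>V\<^esub> trip1 V A) (trip2 V A))"

record ('o, 'm) ifun =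
  IDom :: "('o, 'm) icat"
  ICod :: "('o, 'm) icat"
  I0 :: "'m"
  I1 :: "'m"

definition internal_functor :: "('o, 'm) cat \<Rightarrow> ('o, 'm) ifun \<Rightarrow> bool" where
  "internal_functor V H \<longleftrightarrow>
     internal_category V (IDom H) \<and> internal_category V (ICod H) \<and>
     I0 H \<in> Hom V (IOb (IDom H)) (IOb (ICod H)) \<and> I1 H \<in> Hom V (IAr (IDom H)) (IAr (ICod H)) \<and>
     ISrc (ICod H) \<cdot>\<^bsub>V\<^esub> I1 H = I0 H \<cdot>\<^bsub>V\<^esub> ISrc (IDom H) \<and>
     ITgt (ICod H) \<cdot>\<^bsub>V\<^esub> I1 H = I0 H \<cdot>\<^bsub>V\<^esub> ITgt (IDom H) \<and>
     I1 H \<cdot>\<^bsub>V\<^esub> IIdn (IDom H) = IIdn (ICod H) \<cdot>\<^bsub>V\<^esub> I0 H \<and>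
     I1 H \<cdot>\<^bsub>V\<^esub> ICmp (IDom H) = ICmp (ICod H) \<cdot>\<^bsub>V\<^esub>
       ipair V (ICod H) (I1 H \<cdot>\<^bsub>V\<^esub> ip1 V (IDom H)) (I1 H \<cdot>\<^bsub>V\<^esub> ip2 V (IDom H))"

definition cat_of :: "('o, 'm) cat \<Rightarrow> (('o, 'm) icat, ('o, 'm) ifun) cat" where
  "cat_of V = \<lparr>
     Ob = {A. internal_category V A},
     Ar = {H. internal_functor V H},
     Dom = IDom,
     Cod = ICod,
     Idn = (\<lambda>A. \<lparr>IDom = A, ICod = A, I0 = Idn V (IOb A), I1 = Idn V (IAr A)\<rparr>),
     Cmp = (\<lambda>H G. \<lparr>IDom = IDom G, ICod = ICod H,
                     I0 = I0 H \<cdot>\<^bsub>V\<^esub> I0 G, I1 = I1 H \<cdot>\<^bsub>V\<^esub> I1 G\<rparr>)\<rparr>"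

definition discrete_fibration :: "('o, 'm) cat \<Rightarrow> ('o, 'm) ifun \<Rightarrow> bool" where
  "discrete_fibration V P \<longleftrightarrow> internal_functor V P \<and>
     is_pullback V (I0 P) (ITgt (ICod P)) (IAr (IDom P)) (ITgt (IDom P)) (I1 P)"

definition DFib where
  "DFib V X = full_subcat (slice (cat_of V) X) {P. discrete_fibration V P}"


subsection \<open>The enrichment of the slices of the category of internal categories\<close>

text \<open>Internal homs are the exponentials \<open>Exp (cat_of V) A B\<close>.  The name of an internal functor
  \<open>H : A \<rightarrow> B\<close> is a point of \<open>Exp (cat_of V) A B\<close>; at the level of objects it is a point in
  \<open>V\<close>.\<close>

definition iname :: "('o, 'm) cat \<Rightarrow> ('o, 'm) ifun \<Rightarrow> 'm" where
  "iname V H =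
     (let W = cat_of V
      in I0 (transp W (terminal W) (IDom H) (ICod H) (H \<cdot>\<^bsub>W\<^esub> pr2 W (terminal W) (IDom H)))
           \<cdot>\<^bsub>V\<^esub> (THE u. u \<in> Hom V (terminal V) (IOb (terminal W))))"

text \<open>Postcomposition with \<open>Q : B \<rightarrow> X\<close>, as an internal functor
  \<open>Exp (cat_of V) A B \<rightarrow> Exp (cat_of V) A X\<close>.\<close>

definition ipostcomp :: "('o, 'm) cat \<Rightarrow> ('o, 'm) icat \<Rightarrow> ('o, 'm) ifun \<Rightarrow> ('o, 'm) ifun" where
  "ipostcomp V A Q =
     (let W = cat_of V
      in transp W (Exp W A (IDom Q)) A (ICod Q) (Q \<cdot>\<^bsub>W\<^esub> eval_ar W A (IDom Q)))"

text \<open>Composition \<open>Exp A B \<times> Exp B D \<rightarrow> Exp A D\<close> at the level of objects.  The object of objects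
  of the chosen product of internal categories is a product in \<open>V\<close> but need not be the chosen
  one; the \<open>pairing\<close> is the canonical comparison.\<close>

definition icomp0 :: "('o, 'm) cat \<Rightarrow> ('o, 'm) icat \<Rightarrow> ('o, 'm) icat \<Rightarrow> ('o, 'm) icat \<Rightarrow> 'm" where
  "icomp0 V A B D =
     (let W = cat_of V; E = Exp W A B; E' = Exp W B D
      in I0 (VCmp (vself W) A B D)
           \<cdot>\<^bsub>V\<^esub> pairing V (I0 (pr1 W E E')) (I0 (pr2 W E E'))
                  (pr1 V (IOb E) (IOb E')) (pr2 V (IOb E) (IOb E')))"

text \<open>The hom-object from \<open>P\<close> to \<open>Q\<close> is the pullback of \<open>slice_post V P Q\<close> and the name of \<open>P\<close>.\<close>

definition slice_post :: "('o, 'm) cat \<Rightarrow> ('o, 'm) ifun \<Rightarrow> ('o, 'm) ifun \<Rightarrow> 'm" where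
  "slice_post V P Q = I0 (ipostcomp V (IDom P) Q)"

definition slice_hom :: "('o, 'm) cat \<Rightarrow> ('o, 'm) ifun \<Rightarrow> ('o, 'm) ifun \<Rightarrow> 'o" where
  "slice_hom V P Q = Pb V (slice_post V P Q) (iname V P)"

definition slice_hom_pr :: "('o, 'm) cat \<Rightarrow> ('o, 'm) ifun \<Rightarrow> ('o, 'm) ifun \<Rightarrow> 'm" where
  "slice_hom_pr V P Q = pb1 V (slice_post V P Q) (iname V P)"

text \<open>The map \<open>x \<rightarrow> slice_hom V P Q\<close> induced by \<open>f : x \<rightarrow> (Exp (cat_of V) (IDom P) (IDom Q))\<^sub>0\<close>.\<close>

definition slice_lift :: "('o, 'm) cat \<Rightarrow> ('o, 'm) ifun \<Rightarrow> ('o, 'm) ifun \<Rightarrow> 'm \<Rightarrow> 'm" where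
  "slice_lift V P Q f = pb_tuple V (slice_post V P Q) (iname V P) f (bang V (Dom V f))"

definition slice_vcat ::
  "('o, 'm) cat \<Rightarrow> ('o, 'm) icat \<Rightarrow> (('o, 'm) ifun, 'o, 'm) vcat" where
  "slice_vcat V X = \<lparr>
     VOb = Ob (slice (cat_of V) X),
     VHom = slice_hom V,
     VCmp = (\<lambda>P Q R. slice_lift V P R
        (icomp0 V (IDom P) (IDom Q) (IDom R)
           \<cdot>\<^bsub>V\<^esub> cross V (slice_hom_pr V P Q) (slice_hom_pr V Q R))),
     VId = (\<lambda>P. slice_lift V P P (iname V (Idn (cat_of V) (IDom P))))\<rparr>"

definition DFib_vcat ::
  "('o, 'm) cat \<Rightarrow> ('o, 'm) icat \<Rightarrow> (('o, 'm) ifun, 'o, 'm) vcat" where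
  "DFib_vcat V X = vfull (slice_vcat V X) {P. discrete_fibration V P}"

text \<open>The comparison from \<open>DFib V X\<close> to the underlying category of \<open>DFib_vcat V X\<close>.\<close>

definition DFib_comparison where
  "DFib_comparison V X = \<lparr>
     FOb = (\<lambda>P \<in> Ob (DFib V X). P),
     FAr = (\<lambda>(P, Q, H) \<in> Ar (DFib V X). (P, Q, slice_lift V P Q (iname V H)))\<rparr>"


section \<open>The internal Grothendieck construction\<close>

text \<open>In the two constructions below, composition is the map out of the object of composable
  pairs that is determined by its restrictions to the summands indexed by triples of objects.\<close>

definition internalization :: "('o, 'm) cat \<Rightarrow> ('c, 'o, 'm) vcat \<Rightarrow> ('o, 'm) icat" where
  "internalization V C =
     (let S = VOb C; O0 = (\<lambda>a. terminal V); O1 = (\<lambda>(a, b). VHom C a b);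
          X0 = Coprod V S O0; X1 = Coprod V (S \<times> S) O1;
          s = copair V (S \<times> S) O1 X0 (\<lambda>(a, b). coin V S O0 a \<cdot>\<^bsub>V\<^esub> bang V (VHom C a b));
          t = copair V (S \<times> S) O1 X0 (\<lambda>(a, b). coin V S O0 b \<cdot>\<^bsub>V\<^esub> bang V (VHom C a b))
      in \<lparr>IOb = X0, IAr = X1, ISrc = s, ITgt = t,
          IIdn = copair V S O0 X1 (\<lambda>a. coin V (S \<times> S) O1 (a, a) \<cdot>\<^bsub>V\<^esub> VId C a),
          ICmp = (THE k. k \<in> Hom V (Pb V t s) X1 \<and>
            (\<forall>a \<in> S. \<forall>b \<in> S. \<forall>c \<in> S.
               k \<cdot>\<^bsub>V\<^esub> pb_tuple V t s
                 (coin V (S \<times> S) O1 (a, b) \<cdot>\<^bsub>V\<^esub> pr1 V (VHom C a b) (VHom C b c))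
                 (coin V (S \<times> S) O1 (b, c) \<cdot>\<^bsub>V\<^esub> pr2 V (VHom C a b) (VHom C b c)) =
               coin V (S \<times> S) O1 (a, c) \<cdot>\<^bsub>V\<^esub> VCmp C a b c))\<rparr>)"

abbreviation presheaves where
  "presheaves V C \<equiv> vfun_cat V (vop V C) (vself V)"

abbreviation presheaves_vcat where
  "presheaves_vcat V C \<equiv> vfun_vcat V (vop V C) (vself V)"

text \<open>\<open>psh_act V C F a b : C(a,b) \<times> F b \<rightarrow> F a\<close> is the transpose of
  \<open>VFHom F b a : C(a,b) \<rightarrow> [F b, F a]\<close>.\<close>

definition psh_act :: "('o, 'm) cat \<Rightarrow> ('c, 'o, 'm) vcat \<Rightarrow> ('c, 'o, 'm) vfun \<Rightarrow> 'c \<Rightarrow> 'c \<Rightarrow> 'm" where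
  "psh_act V C F a b =
     eval_ar V (VFOb F b) (VFOb F a) \<cdot>\<^bsub>V\<^esub> cross V (VFHom F b a) (Idn V (VFOb F b))"

text \<open>\<open>psh_map V F G \<alpha> a : F a \<rightarrow> G a\<close> is the map with name \<open>\<alpha> a : 1 \<rightarrow> [F a, G a]\<close>.\<close>

definition psh_map :: "('o, 'm) cat \<Rightarrow> ('c, 'o, 'm) vfun \<Rightarrow> ('c, 'o, 'm) vfun
    \<Rightarrow> ('c \<Rightarrow> 'm) \<Rightarrow> 'c \<Rightarrow> 'm" where
  "psh_map V F G \<alpha> a = eval_ar V (VFOb F a) (VFOb G a)
     \<cdot>\<^bsub>V\<^esub> tuple V (\<alpha> a \<cdot>\<^bsub>V\<^esub> bang V (VFOb F a)) (Idn V (VFOb F a))"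

definition elements ::
  "('o, 'm) cat \<Rightarrow> ('c, 'o, 'm) vcat \<Rightarrow> ('c, 'o, 'm) vfun \<Rightarrow> ('o, 'm) icat" where
  "elements V C F =
     (let S = VOb C; O0 = VFOb F; O1 = (\<lambda>(a, b). Prod V (VHom C a b) (VFOb F b));
          X0 = Coprod V S O0; X1 = Coprod V (S \<times> S) O1;
          s = copair V (S \<times> S) O1 X0 (\<lambda>(a, b). coin V S O0 a \<cdot>\<^bsub>V\<^esub> psh_act V C F a b);
          t = copair V (S \<times> S) O1 X0 (\<lambda>(a, b). coin V S O0 b \<cdot>\<^bsub>V\<^esub> pr2 V (VHom C a b) (VFOb F b))
      in \<lparr>IOb = X0, IAr = X1, ISrc = s, ITgt = t,
          IIdn = copair V S O0 X1 (\<lambda>a. coin V (S \<times> S) O1 (a, a)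
            \<cdot>\<^bsub>V\<^esub> tuple V (VId C a \<cdot>\<^bsub>V\<^esub> bang V (VFOb F a)) (Idn V (VFOb F a))),
          ICmp = (THE k. k \<in> Hom V (Pb V t s) X1 \<and>
            (\<forall>a \<in> S. \<forall>b \<in> S. \<forall>c \<in> S.
               let M = VHom C a b; N = VHom C b c; Z = VFOb F c;
                   f = pr1 V M N \<cdot>\<^bsub>V\<^esub> pr1 V (Prod V M N) Z;
                   g = pr2 V M N \<cdot>\<^bsub>V\<^esub> pr1 V (Prod V M N) Z;
                   z = pr2 V (Prod V M N) Z
               in k \<cdot>\<^bsub>V\<^esub> pb_tuple V t s
                    (coin V (S \<times> S) O1 (a, b) \<cdot>\<^bsub>V\<^esub> tuple V f (psh_act V C F b c \<cdot>\<^bsub>V\<^esub> tuple V g z))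
                    (coin V (S \<times> S) O1 (b, c) \<cdot>\<^bsub>V\<^esub> tuple V g z) =
                  coin V (S \<times> S) O1 (a, c) \<cdot>\<^bsub>V\<^esub> cross V (VCmp C a b c) (Idn V Z)))\<rparr>)"

definition elements_proj ::
  "('o, 'm) cat \<Rightarrow> ('c, 'o, 'm) vcat \<Rightarrow> ('c, 'o, 'm) vfun \<Rightarrow> ('o, 'm) ifun" where
  "elements_proj V C F = \<lparr>IDom = elements V C F, ICod = internalization V C,
     I0 = coprod_map V (VOb C) (VFOb F) (\<lambda>a. terminal V) (\<lambda>a. bang V (VFOb F a)),
     I1 = coprod_map V (VOb C \<times> VOb C)
            (\<lambda>(a, b). Prod V (VHom C a b) (VFOb F b)) (\<lambda>(a, b). VHom C a b)
            (\<lambda>(a, b). pr1 V (VHom C a b) (VFOb F b))\<rparr>"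

definition elements_map :: "('o, 'm) cat \<Rightarrow> ('c, 'o, 'm) vcat \<Rightarrow> ('c, 'o, 'm) vfun
    \<Rightarrow> ('c, 'o, 'm) vfun \<Rightarrow> ('c \<Rightarrow> 'm) \<Rightarrow> ('o, 'm) ifun" where
  "elements_map V C F G \<alpha> = \<lparr>IDom = elements V C F, ICod = elements V C G,
     I0 = coprod_map V (VOb C) (VFOb F) (VFOb G) (psh_map V F G \<alpha>),
     I1 = coprod_map V (VOb C \<times> VOb C)
            (\<lambda>(a, b). Prod V (VHom C a b) (VFOb F b)) (\<lambda>(a, b). Prod V (VHom C a b) (VFOb G b))
            (\<lambda>(a, b). cross V (Idn V (VHom C a b)) (psh_map V F G \<alpha> b))\<rparr>"

definition grothendieck where
  "grothendieck V C = \<lparr>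
     FOb = (\<lambda>F \<in> Ob (presheaves V C). elements_proj V C F),
     FAr = (\<lambda>(F, G, \<alpha>) \<in> Ar (presheaves V C).
              (elements_proj V C F, elements_proj V C G, elements_map V C F G \<alpha>))\<rparr>"

end

theory Submission
  imports Defs
begin

text \<open>
  The proof works with generalized elements.  An object of \<open>V\<close> is studied through the maps into it, and maps and
  equations are given by what they do to these, naturally in the stage.  In these terms an enriched category is a
  category in which only elements at the same stage are composed, an internal category is a presheaf of categories
  on \<open>V\<close>, and the arguments become those for sets, with one exception: an element of a coproduct need not lie in
  a summand.  Extensivity repairs this.  The stage of such an element is a coproduct of parts on which it does lie
  in a summand (\<open>coproduct_cover\<close>), and an element lies in two different summands only at a stage that is initial
  (\<open>coproduct_inclusions\<close>).  Hence equations may be checked, and maps defined, by cases on the summand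
  (\<open>coproduct_cases_eqI\<close>, \<open>glues_single\<close>, \<open>glues_pair\<close>).

  Let \<open>P\<close> be a discrete fibration over the internalization of \<open>C\<close>.  Its object of objects lies over a coproduct of
  terminal objects and so is a coproduct of objects \<open>Z a\<close>.  An arrow \<open>f\<close> from \<open>a\<close> to \<open>b\<close> and an element \<open>x\<close>
  of \<open>Z b\<close> have a unique lift, whose source is an element of \<open>Z a\<close>.  This action makes \<open>Z\<close> a presheaf, and \<open>P\<close> is
  isomorphic to its category of elements (\<open>dfib_elements\<close>): the construction is essentially surjective.

  For full faithfulness, the key fact is that a functor into a discrete fibration, over the base, is a
  map on objects that is compatible with the sources of lifts; the rest of the structure is forced
  (\<open>dfib_extend\<close>).  This also holds for parametrized families of functors.  For categories of elements of presheaves \<open>F\<close>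
  and \<open>G\<close> such a map on objects is a family of maps from \<open>F a\<close> to \<open>G a\<close>, and the source condition is naturality.
  Therefore the hom-object from \<open>F\<close> to \<open>G\<close> over the internalization, together with its components, is an end
  of the internal homs of \<open>F a\<close> and \<open>G a\<close> (\<open>over_end\<close>).  This shows at the same time that the ends in
  the enriched category of presheaves exist and that they are isomorphic to the hom-objects of discrete fibrations, compatibly
  with composition (\<open>elements_vfunctor\<close>, \<open>elements_vequivalence\<close>).  On points it is the bijection
  between natural transformations and functors over the base (\<open>elements_map_bij\<close>), which gives the ordinary equivalence.

  The hom-objects over the base are cut out of the internal homs of the category of internal categories.  That this
  category is cartesian closed is proved by a Yoneda argument: functors and natural transformations that depend
  on a parameter form a presheaf of categories whose objects and arrows are represented, because products,
  exponentials and equalizers of \<open>V\<close> represent them (\<open>represented_internal_category\<close>, \<open>functor_category\<close>).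

  In the text, composition is written \<open>g o f\<close>, pairing \<open><|f, g|>\<close>, and \<open>f : x ~> y\<close> says that
  \<open>f\<close> is a map from \<open>x\<close> to \<open>y\<close> in \<open>V\<close>.
\<close>

no_notation (ASCII) comp (infixl "o" 55)
notation Cmp ("(_ o\<index>/ _)" [70, 71] 70)

section \<open>Categories with products, exponentials and pullbacks\<close>

lemma Hom_iff [simp]: "f : Hom K a b \<longleftrightarrow> f : Ar K \<and> Dom K f = a \<and> Cod K f = b"
 by (auto simp: Hom_def)

context category
begin

lemma Idn_simps [simp]:
 "a : Ob K ==> Idn K a : Ar K" "a : Ob K ==> Dom K (Idn K a) = a" "a : Ob K ==> Cod K (Idn K a) = a"
 using Idn_Hom by auto

lemma Cmp_simps [simp]:
 assumes "f : Ar K" "g : Ar K" "Cod K f = Dom K g"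
 shows "g o f : Ar K" "Dom K (g o f) = Dom K f" "Cod K (g o f) = Cod K g"
 using Cmp_Hom[of f "Dom K f" "Cod K f" g "Cod K g"] assms by auto

lemma Cmp_Cmp [simp]:
 "[|f : Ar K; g : Ar K; h : Ar K; Cod K f = Dom K g; Cod K g = Dom K h|]
  ==> (h o g) o f = h o (g o f)"
 using Cmp_assoc[of f "Dom K f" "Cod K f" g "Cod K g" h "Cod K h"] by auto

lemma Cmp_Idn' [simp]: "f : Ar K ==> Dom K f = a ==> f o Idn K a = f"
 using Cmp_Idn[of f a "Cod K f"] by auto

lemma Idn_Cmp' [simp]: "f : Ar K ==> Cod K f = b ==> Idn K b o f = f"
 using Idn_Cmp[of f "Dom K f" b] by auto

declare Dom_Ob [simp] Cod_Ob [simp]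

lemma is_isoE:
 assumes "is_iso K f" "f : Hom K a b"
 obtains g where "g : Hom K b a" "g o f = Idn K a" "f o g = Idn K b"
 using assms unfolding is_iso_def by auto

lemma is_isoI:
 "[|f : Hom K a b; g : Hom K b a; g o f = Idn K a; f o g = Idn K b|] ==> is_iso K f"
 unfolding is_iso_def by auto

lemma product_pairing:
 assumes "is_product K a b p u v" "f : Hom K x a" "g : Hom K x b"
 shows "pairing K u v f g : Hom K x p" "u o pairing K u v f g = f" "v o pairing K u v f g = g"
proof -
 have "\<exists>!h. h : Hom K x p \<and> u o h = f \<and> v o h = g" using assms unfolding is_product_def by blast
 from theI'[OF this] show "pairing K u v f g : Hom K x p" "u o pairing K u v f g = f"
  "v o pairing K u v f g = g"
  using assms unfolding pairing_def is_product_def by auto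
qed

lemma product_eqI:
 assumes "is_product K a b p u v" "h : Hom K x p" "k : Hom K x p" "u o h = u o k" "v o h = v o k"
 shows "h = k"
proof -
 have "u o k : Hom K x a" "v o k : Hom K x b" using assms unfolding is_product_def by auto
 then have "\<exists>!l. l : Hom K x p \<and> u o l = u o k \<and> v o l = v o k"
  using assms(1) unfolding is_product_def by blast
 then show ?thesis using assms by blast
qed

lemma pullback_pairing:
 assumes "is_pullback K f g p u v" "h : Hom K x (Dom K f)" "k : Hom K x (Dom K g)" "f o h = g o k"
 shows "pairing K u v h k : Hom K x p" "u o pairing K u v h k = h" "v o pairing K u v h k = k"
proof -
 have "\<exists>!w. w : Hom K x p \<and> u o w = h \<and> v o w = k" using assms unfolding is_pullback_def by blast
 from theI'[OF this] show "pairing K u v h k : Hom K x p" "u o pairing K u v h k = h"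
  "v o pairing K u v h k = k"
  using assms unfolding pairing_def is_pullback_def by auto
qed

lemma pullback_eqI:
 assumes "is_pullback K f g p u v" "h : Hom K x p" "k : Hom K x p" "u o h = u o k" "v o h = v o k"
 shows "h = k"
proof -
 have *: "u o k : Hom K x (Dom K f)" "v o k : Hom K x (Dom K g)"
  using assms unfolding is_pullback_def by auto
 have t: "f : Ar K" "g : Ar K" "u : Hom K p (Dom K f)" "v : Hom K p (Dom K g)" "f o u = g o v"
  using assms(1) unfolding is_pullback_def by auto
 have "f o (u o k) = (f o u) o k" using t(1-4) assms(3) by simp
 also have "\<dots> = g o (v o k)" unfolding t(5) using t(1-4) assms(3) by simp
 finally have "\<exists>!l. l : Hom K x p \<and> u o l = u o k \<and> v o l = v o k"
  using assms(1) * unfolding is_pullback_def by blast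
 then show ?thesis using assms by blast
qed

end

lemma is_functorD:
 assumes "is_functor C D F"
 shows "category C" "category D" "a : Ob C ==> FOb F a : Ob D"
  "f : Hom C a b ==> FAr F f : Hom D (FOb F a) (FOb F b)"
  "a : Ob C ==> FAr F (Idn C a) = Idn D (FOb F a)"
  "f : Hom C a b ==> g : Hom C b c ==> FAr F (g o\<^bsub>C\<^esub> f) = FAr F g o\<^bsub>D\<^esub> FAr F f"
 using assms unfolding is_functor_def by (simp_all add: PiE_iff)

lemma equivalence_essentially_surjective:
 assumes "is_equivalence C D F" "d : Ob D"
 shows "\<exists>c\<in>Ob C. \<exists>e. e : Hom D (FOb F c) d \<and> is_iso D e"
proof -
 obtain G \<epsilon> where G: "is_functor D C G"
  and \<epsilon>: "\<forall>a \<in> Ob D. \<epsilon> a : Hom D (FOb (functor_comp D F G) a) (FOb (id_functor D) a) \<and> is_iso D (\<epsilon> a)"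
  using assms(1) unfolding is_equivalence_def naturally_isomorphic_def by blast
 have "FOb G d : Ob C" using is_functorD(3)[OF G assms(2)] .
 moreover have "\<epsilon> d : Hom D (FOb F (FOb G d)) d \<and> is_iso D (\<epsilon> d)"
  using \<epsilon> assms(2) unfolding functor_comp_def id_functor_def by (metis fctr.select_convs(1) restrict_apply')
 ultimately show ?thesis by blast
qed

text \<open>The candidate for a preimage of \<^term>\<open>h\<close> is the image of \<^term>\<open>h\<close> under the quasi-inverse, conjugated by the
 unit; naturality of the counit shows that it is mapped to \<^term>\<open>h\<close>.\<close>

lemma equivalence_full:
 assumes eq: "is_equivalence C D F" and ab: "a : Ob C" "b : Ob C" and h: "h : Hom D (FOb F a) (FOb F b)"
 shows "\<exists>f\<in>Hom C a b. FAr F f = h"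
proof -
 obtain G \<eta> \<epsilon> where F: "is_functor C D F" and G: "is_functor D C G"
  and \<eta>: "!!a. a : Ob C ==> \<eta> a : Hom C (FOb (id_functor C) a) (FOb (functor_comp C G F) a) \<and> is_iso C (\<eta> a)"
   "!!a b f. f : Hom C a b ==> \<eta> b o\<^bsub>C\<^esub> FAr (id_functor C) f = FAr (functor_comp C G F) f o\<^bsub>C\<^esub> \<eta> a"
  and \<epsilon>: "!!a. a : Ob D ==> \<epsilon> a : Hom D (FOb (functor_comp D F G) a) (FOb (id_functor D) a) \<and> is_iso D (\<epsilon> a)"
   "!!a b f. f : Hom D a b ==> \<epsilon> b o\<^bsub>D\<^esub> FAr (functor_comp D F G) f = FAr (id_functor D) f o\<^bsub>D\<^esub> \<epsilon> a"
  using eq unfolding is_equivalence_def naturally_isomorphic_def by blast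
 interpret C: category C by (rule is_functorD(1)[OF F])
 interpret D: category D by (rule is_functorD(2)[OF F])
 note Fs = is_functorD(3-6)[OF F] and Gs = is_functorD(3-6)[OF G]
 have \<eta>1: "\<eta> a : Hom C a (FOb G (FOb F a))" "is_iso C (\<eta> a)" if "a : Ob C" for a
  using \<eta>(1)[OF that] that by (simp_all add: functor_comp_def id_functor_def)
 have \<eta>2: "\<eta> b o\<^bsub>C\<^esub> f = FAr G (FAr F f) o\<^bsub>C\<^esub> \<eta> a" if "f : Hom C a b" for a b f
  using \<eta>(2)[OF that] that by (simp add: functor_comp_def id_functor_def)
 have \<epsilon>1: "\<epsilon> a : Hom D (FOb F (FOb G a)) a" "is_iso D (\<epsilon> a)" if "a : Ob D" for a
  using \<epsilon>(1)[OF that] that by (simp_all add: functor_comp_def id_functor_def)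
 have \<epsilon>2: "\<epsilon> b o\<^bsub>D\<^esub> FAr F (FAr G f) = f o\<^bsub>D\<^esub> \<epsilon> a" if "f : Hom D a b" for a b f
  using \<epsilon>(2)[OF that] that by (simp add: functor_comp_def id_functor_def)
 obtain ia where ia: "ia : Hom C (FOb G (FOb F a)) a" "ia o\<^bsub>C\<^esub> \<eta> a = Idn C a" "\<eta> a o\<^bsub>C\<^esub> ia = Idn C (FOb G (FOb F a))"
  using C.is_isoE[OF \<eta>1(2,1)] ab by blast
 obtain ib where ib: "ib : Hom C (FOb G (FOb F b)) b" "ib o\<^bsub>C\<^esub> \<eta> b = Idn C b" "\<eta> b o\<^bsub>C\<^esub> ib = Idn C (FOb G (FOb F b))"
  using C.is_isoE[OF \<eta>1(2,1)] ab by blast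
 have Gh: "FAr G h : Hom C (FOb G (FOb F a)) (FOb G (FOb F b))" using Gs(2)[OF h] .
 let ?f = "ib o\<^bsub>C\<^esub> (FAr G h o\<^bsub>C\<^esub> \<eta> a)"
 have f: "?f : Hom C a b" using ia(1) ib(1) Gh \<eta>1(1)[OF ab(1)] by simp
 have Ff: "FAr F ?f : Hom D (FOb F a) (FOb F b)" using Fs(2)[OF f] .
 then have GFf: "FAr G (FAr F ?f) : Hom C (FOb G (FOb F a)) (FOb G (FOb F b))" by (rule Gs(2))
 have "FAr G (FAr F ?f) o\<^bsub>C\<^esub> \<eta> a = \<eta> b o\<^bsub>C\<^esub> ?f" using \<eta>2[OF f] by simp
 also have "\<dots> = (\<eta> b o\<^bsub>C\<^esub> ib) o\<^bsub>C\<^esub> (FAr G h o\<^bsub>C\<^esub> \<eta> a)"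
  using ib(1) Gh \<eta>1(1)[OF ab(1)] \<eta>1(1)[OF ab(2)] by simp
 also have "\<dots> = FAr G h o\<^bsub>C\<^esub> \<eta> a" unfolding ib(3) using Gh \<eta>1(1)[OF ab(1)] by simp
 finally have "(FAr G (FAr F ?f) o\<^bsub>C\<^esub> \<eta> a) o\<^bsub>C\<^esub> ia = (FAr G h o\<^bsub>C\<^esub> \<eta> a) o\<^bsub>C\<^esub> ia" by simp
 moreover have "(k o\<^bsub>C\<^esub> \<eta> a) o\<^bsub>C\<^esub> ia = k" if "k : Hom C (FOb G (FOb F a)) (FOb G (FOb F b))" for k
  using that ia(1,3) \<eta>1(1)[OF ab(1)] by simp
 ultimately have GG: "FAr G (FAr F ?f) = FAr G h" using Gh GFf by simp
 have Fa: "FOb F a : Ob D" using Fs(1) ab by simp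
 obtain j where j: "j : Hom D (FOb F a) (FOb F (FOb G (FOb F a)))" "\<epsilon> (FOb F a) o\<^bsub>D\<^esub> j = Idn D (FOb F a)"
  using D.is_isoE[OF \<epsilon>1(2,1)] Fa by blast
 have "(FAr F ?f o\<^bsub>D\<^esub> \<epsilon> (FOb F a)) o\<^bsub>D\<^esub> j = (h o\<^bsub>D\<^esub> \<epsilon> (FOb F a)) o\<^bsub>D\<^esub> j"
  using \<epsilon>2[OF h] \<epsilon>2[OF Ff] GG by simp
 moreover have "(k o\<^bsub>D\<^esub> \<epsilon> (FOb F a)) o\<^bsub>D\<^esub> j = k" if "k : Hom D (FOb F a) (FOb F b)" for k
  using that j \<epsilon>1(1)[OF Fa] by simp
 ultimately have "FAr F ?f = h" using h Ff by simp
 then show ?thesis using f by blast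
qed

text \<open>A quasi-inverse chooses a preimage of every object up to isomorphism, and full faithfulness transports
 arrows along the chosen isomorphisms.\<close>

lemma equivalenceI:
 assumes F: "is_functor C D F"
  and ff: "!!a b. a : Ob C ==> b : Ob C ==> bij_betw (FAr F) (Hom C a b) (Hom D (FOb F a) (FOb F b))"
  and es: "!!d. d : Ob D ==> \<exists>c\<in>Ob C. \<exists>e. e : Hom D (FOb F c) d \<and> is_iso D e"
 shows "is_equivalence C D F"
proof -
 interpret C: category C by (rule is_functorD(1)[OF F])
 interpret D: category D by (rule is_functorD(2)[OF F])
 note Fs = is_functorD(3-6)[OF F]
 have "\<forall>d\<in>Ob D. \<exists>c e e'. c : Ob C \<and> e : Hom D (FOb F c) d \<and> e' : Hom D d (FOb F c) \<and>
   e' o\<^bsub>D\<^esub> e = Idn D (FOb F c) \<and> e o\<^bsub>D\<^esub> e' = Idn D d"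
  by (metis es D.is_isoE)
 then obtain g e e' where g: "!!d. d : Ob D ==> g d : Ob C"
  and e: "!!d. d : Ob D ==> e d : Hom D (FOb F (g d)) d"
  and e': "!!d. d : Ob D ==> e' d : Hom D d (FOb F (g d))"
  and e'e: "!!d. d : Ob D ==> e' d o\<^bsub>D\<^esub> e d = Idn D (FOb F (g d))"
  and ee': "!!d. d : Ob D ==> e d o\<^bsub>D\<^esub> e' d = Idn D d"
  by metis
 have e'e2: "e' d o\<^bsub>D\<^esub> (e d o\<^bsub>D\<^esub> k) = k" if "d : Ob D" "k : Ar D" "Cod D k = FOb F (g d)" for d k
  using e e' e'e[OF that(1)] that D.Cmp_Cmp[of k "e d" "e' d"] by simp
 have ee'2: "e d o\<^bsub>D\<^esub> (e' d o\<^bsub>D\<^esub> k) = k" if "d : Ob D" "k : Ar D" "Cod D k = d" for d k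
  using e e' ee'[OF that(1)] that D.Cmp_Cmp[of k "e' d" "e d"] by simp
 have ty [simp]: "e d : Ar D" "Dom D (e d) = FOb F (g d)" "Cod D (e d) = d"
   "e' d : Ar D" "Dom D (e' d) = d" "Cod D (e' d) = FOb F (g d)" if "d : Ob D" for d
  using e e' that by auto
 have FAr_typ [simp]: "FAr F f : Ar D" "Dom D (FAr F f) = FOb F (Dom C f)" "Cod D (FAr F f) = FOb F (Cod C f)"
  if "f : Ar C" for f using Fs(2)[of f "Dom C f" "Cod C f"] that by auto
 define P where "P a b h = (THE f. f : Hom C a b \<and> FAr F f = h)" for a b h
 have P: "P a b h : Hom C a b" "FAr F (P a b h) = h"
  if "a : Ob C" "b : Ob C" "h : Hom D (FOb F a) (FOb F b)" for a b h
 proof -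
  have "\<exists>!f. f : Hom C a b \<and> FAr F f = h"
   using ff[OF that(1,2)] that(3) unfolding bij_betw_def inj_on_def by (metis (no_types, lifting) imageE)
  from theI'[OF this] show "P a b h : Hom C a b" "FAr F (P a b h) = h" by (auto simp: P_def)
 qed
 have inj: "f = f'" if "f : Hom C a b" "f' : Hom C a b" "FAr F f = FAr F f'" for f f' a b
  using ff[of a b] that C.Dom_Ob C.Cod_Ob unfolding bij_betw_def inj_on_def by auto
 define G where "G = \<lparr>FOb = (\<lambda>d\<in>Ob D. g d),
   FAr = (\<lambda>h\<in>Ar D. P (g (Dom D h)) (g (Cod D h)) (e' (Cod D h) o\<^bsub>D\<^esub> (h o\<^bsub>D\<^esub> e (Dom D h))))\<rparr>"
 have G1: "FOb G d = g d" if "d : Ob D" for d using that by (simp add: G_def)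
 have G2: "FAr G h : Hom C (g (Dom D h)) (g (Cod D h))"
   "FAr F (FAr G h) = e' (Cod D h) o\<^bsub>D\<^esub> (h o\<^bsub>D\<^esub> e (Dom D h))" if "h : Ar D" for h
  using P[of "g (Dom D h)" "g (Cod D h)" "e' (Cod D h) o\<^bsub>D\<^esub> (h o\<^bsub>D\<^esub> e (Dom D h))"] that
  by (simp_all add: G_def g)
 have G: "is_functor D C G"
  unfolding is_functor_def
 proof (intro conjI allI ballI)
  fix a assume a: "a : Ob D"
  show "FAr G (Idn D a) = Idn C (FOb G a)"
   using G2[of "Idn D a"] a G1 g e'e Fs(3)
   by (intro inj[of _ "g a" "g a"]) auto
 next
  fix a b c h k assume h: "h : Hom D a b" and k: "k : Hom D b c"
  have b: "b : Ob D" using k D.Dom_Ob by auto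
  show "FAr G (k o\<^bsub>D\<^esub> h) = FAr G k o\<^bsub>C\<^esub> FAr G h"
   using G2[of h] G2[of k] G2[of "k o\<^bsub>D\<^esub> h"] h k Fs(4)[of "FAr G h" "g a" "g b" "FAr G k" "g c"] b
   by (intro inj[of _ "g a" "g c"]) (auto simp: ee'2)
 qed (use G1 G2 g in \<open>auto simp: C.category_axioms D.category_axioms PiE_iff G_def\<close>)
 have FI: "FAr F (Idn C a) = Idn D (FOb F a)" if "a : Ob C" for a using Fs(3) that .
 have 1: "naturally_isomorphic C C (id_functor C) (functor_comp C G F)"
  unfolding naturally_isomorphic_def
 proof (intro exI conjI ballI allI)
  fix a assume a: "a : Ob C"
  have Fa: "FOb F a : Ob D" "g (FOb F a) : Ob C" using Fs(1) a g by auto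
  note p = P[OF a Fa(2), of "e' (FOb F a)"] P[OF Fa(2) a, of "e (FOb F a)"]
  show "P a (g (FOb F a)) (e' (FOb F a)) : Hom C (FOb (id_functor C) a) (FOb (functor_comp C G F) a)"
   using p a Fa by (simp add: id_functor_def functor_comp_def G1)
  show "is_iso C (P a (g (FOb F a)) (e' (FOb F a)))"
  proof (rule C.is_isoI)
   show "P (g (FOb F a)) a (e (FOb F a)) o\<^bsub>C\<^esub> P a (g (FOb F a)) (e' (FOb F a)) = Idn C a"
    using p a Fa FI ee' Fs(4)[of _ a "g (FOb F a)" _ a] by (intro inj[of _ a a]) auto
   show "P a (g (FOb F a)) (e' (FOb F a)) o\<^bsub>C\<^esub> P (g (FOb F a)) a (e (FOb F a)) = Idn C (g (FOb F a))"
    using p a Fa FI e'e Fs(4)[of _ "g (FOb F a)" a _ "g (FOb F a)"] by (intro inj[of _ "g (FOb F a)" "g (FOb F a)"]) auto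
  qed (use p Fa in auto)
 next
  fix a b f assume f: "f : Hom C a b"
  then have ab: "a : Ob C" "b : Ob C" using C.Dom_Ob C.Cod_Ob by auto
  have Fa: "FOb F a : Ob D" "g (FOb F a) : Ob C" "FOb F b : Ob D" "g (FOb F b) : Ob C" using Fs(1) ab g by auto
  note p = P[OF ab(1) Fa(2), of "e' (FOb F a)"] P[OF ab(2) Fa(4), of "e' (FOb F b)"]
  have q: "FAr G (FAr F f) : Hom C (g (FOb F a)) (g (FOb F b))"
   "FAr F (FAr G (FAr F f)) = e' (FOb F b) o\<^bsub>D\<^esub> (FAr F f o\<^bsub>D\<^esub> e (FOb F a))"
   using G2[of "FAr F f"] f by auto
  have "P b (g (FOb F b)) (e' (FOb F b)) o\<^bsub>C\<^esub> f = FAr G (FAr F f) o\<^bsub>C\<^esub> P a (g (FOb F a)) (e' (FOb F a))"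
   using p q f ab Fa Fs(4)[of _ a b _ "g (FOb F b)"] Fs(4)[of _ a "g (FOb F a)" _ "g (FOb F b)"] ee'
   by (intro inj[of _ a "g (FOb F b)"]) auto
  then show "P b (g (FOb F b)) (e' (FOb F b)) o\<^bsub>C\<^esub> FAr (id_functor C) f
    = FAr (functor_comp C G F) f o\<^bsub>C\<^esub> P a (g (FOb F a)) (e' (FOb F a))"
   using f by (simp add: id_functor_def functor_comp_def)
 qed
 have 2: "naturally_isomorphic D D (functor_comp D F G) (id_functor D)"
  unfolding naturally_isomorphic_def
 proof (intro exI conjI ballI allI)
  fix d assume d: "d : Ob D"
  show "e d : Hom D (FOb (functor_comp D F G) d) (FOb (id_functor D) d)"
   using d by (simp add: id_functor_def functor_comp_def G1)
  show "is_iso D (e d)" using d e e' e'e ee' by (intro D.is_isoI[of _ "FOb F (g d)" d "e' d"]) auto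
 next
  fix a b f assume f: "f : Hom D a b"
  then have ab: "a : Ob D" "b : Ob D" using D.Dom_Ob D.Cod_Ob by auto
  show "e b o\<^bsub>D\<^esub> FAr (functor_comp D F G) f = FAr (id_functor D) f o\<^bsub>D\<^esub> e a"
   using f ab G2[of f] by (simp add: id_functor_def functor_comp_def ee'2)
 qed
 show ?thesis unfolding is_equivalence_def using F G 1 2 by blast
qed

subsection \<open>Cartesian closed categories\<close>

locale cartesian = category V for V :: "('o, 'm) cat" (structure) +
 assumes has_terminal: "\<exists>t. is_terminal V t"
  and has_products: "[|a : Ob V; b : Ob V|] ==> \<exists>p u v. is_product V a b p u v"
begin

abbreviation arrow ("_ : _ ~>/ _" [51, 51, 51] 50) where "f : x ~> y \<equiv> f \<in> Hom V x y"

abbreviation tup ("<|_,/ _|>") where "<|f, g|> \<equiv> tuple V f g"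

lemma terminal: "is_terminal V (terminal V)"
 unfolding terminal_def by (rule someI_ex[OF has_terminal])

lemma terminal_Ob [simp]: "terminal V : Ob V"
 using terminal unfolding is_terminal_def by blast

lemma bang_simps [simp]: assumes "a : Ob V"
 shows "bang V a : Ar V" "Dom V (bang V a) = a" "Cod V (bang V a) = terminal V"
proof -
 have "\<exists>!f. f : a ~> terminal V" using terminal assms unfolding is_terminal_def by blast
 from theI'[OF this] show "bang V a : Ar V" "Dom V (bang V a) = a" "Cod V (bang V a) = terminal V"
  unfolding bang_def by auto
qed

lemma terminal_eqI: "f : x ~> terminal V ==> g : x ~> terminal V ==> f = g"
 using terminal unfolding is_terminal_def by (metis Dom_Ob Hom_iff)

lemma bang_Cmp [simp]: "f : Ar V ==> Cod V f = a ==> bang V a o f = bang V (Dom V f)"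
 by (rule terminal_eqI[of _ "Dom V f"]) auto

lemma bang_terminal [simp]: "bang V (terminal V) = Idn V (terminal V)"
 by (rule terminal_eqI) auto

lemma product: assumes "a : Ob V" "b : Ob V"
 shows "is_product V a b (Prod V a b) (pr1 V a b) (pr2 V a b)"
proof -
 have "\<exists>x. case x of (p, u, v) \<Rightarrow> is_product V a b p u v"
  using has_products[OF assms] by simp
 from someI_ex[OF this] show ?thesis
  unfolding product_def[symmetric] Prod_def pr1_def pr2_def by (simp add: case_prod_beta)
qed

lemma pr_simps [simp]: assumes "a : Ob V" "b : Ob V"
 shows "pr1 V a b : Ar V" "pr2 V a b : Ar V" "Dom V (pr1 V a b) = Prod V a b"
  "Dom V (pr2 V a b) = Prod V a b" "Cod V (pr1 V a b) = a" "Cod V (pr2 V a b) = b"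
 using product[OF assms] unfolding is_product_def by auto

lemma Prod_Ob [simp]: assumes "a : Ob V" "b : Ob V" shows "Prod V a b : Ob V"
 using Dom_Ob[of "pr1 V a b"] assms by simp

lemma tuple_simps [simp]: assumes "f : Ar V" "g : Ar V" "Dom V f = Dom V g"
 shows "<|f, g|> : Ar V" "Dom V <|f, g|> = Dom V f" "Cod V <|f, g|> = Prod V (Cod V f) (Cod V g)"
  "Cod V f = a ==> Cod V g = b ==> pr1 V a b o <|f, g|> = f"
  "Cod V f = a ==> Cod V g = b ==> pr2 V a b o <|f, g|> = g"
 using product_pairing[OF product, of "Cod V f" "Cod V g" f "Dom V f" g] assms unfolding tuple_def by auto

lemma prod_eqI:
 "[|h : x ~> Prod V a b; k : x ~> Prod V a b; pr1 V a b o h = pr1 V a b o k;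
  pr2 V a b o h = pr2 V a b o k; a : Ob V; b : Ob V|] ==> h = k"
 using product_eqI[OF product] by blast

lemma tuple_Cmp [simp]: "[|f : Ar V; g : Ar V; h : Ar V; Dom V f = Cod V h; Dom V g = Cod V h|]
  ==> <|f, g|> o h = <|f o h, g o h|>"
 by (rule prod_eqI[of _ "Dom V h" "Cod V f" "Cod V g"]) (simp_all flip: Cmp_Cmp)

lemma tuple_pr [simp]: "[|a : Ob V; b : Ob V|] ==> <|pr1 V a b, pr2 V a b|> = Idn V (Prod V a b)"
 by (rule prod_eqI[of _ "Prod V a b" a b]) auto

lemma tuple_pr_Cmp [simp]: "[|a : Ob V; b : Ob V; h : Ar V; Cod V h = Prod V a b|]
  ==> <|pr1 V a b o h, pr2 V a b o h|> = h"
 by (rule prod_eqI[of _ "Dom V h" a b]) auto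

declare cross_def [simp]

lemma elements_eqI:
 assumes "f : Prod V x a ~> b" "g : Prod V x a ~> b" "x : Ob V" "a : Ob V"
  and "!!y u z. u : y ~> x ==> z : y ~> a ==> f o <|u, z|> = g o <|u, z|>"
 shows "f = g"
 using assms(5)[of "pr1 V x a" "Prod V x a" "pr2 V x a"] assms(1-4) by simp

end

locale ccc = cartesian V for V :: "('o, 'm) cat" (structure) +
 assumes has_exponentials: "[|a : Ob V; b : Ob V|] ==> \<exists>e w. is_exponential V a b e w"
begin

lemma exponential: assumes "a : Ob V" "b : Ob V"
 shows "is_exponential V a b (Exp V a b) (eval_ar V a b)"
proof -
 have "\<exists>x. case x of (p, u) \<Rightarrow> is_exponential V a b p u"
  using has_exponentials[OF assms] by simp
 from someI_ex[OF this] show ?thesis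
  unfolding exponential_def[symmetric] Exp_def eval_ar_def by (simp add: case_prod_beta)
qed

lemma Exp_simps [simp]: assumes "a : Ob V" "b : Ob V"
 shows "Exp V a b : Ob V" "eval_ar V a b : Ar V" "Dom V (eval_ar V a b) = Prod V (Exp V a b) a"
  "Cod V (eval_ar V a b) = b"
 using exponential[OF assms] unfolding is_exponential_def by auto

lemma transp: assumes "f : Ar V" "Dom V f = Prod V x a" "Cod V f = b" "x : Ob V" "a : Ob V"
 shows "transp V x a b f : x ~> Exp V a b"
  "eval_ar V a b o cross V (transp V x a b f) (Idn V a) = f"
proof -
 have "b : Ob V" using assms Cod_Ob by blast
 then have "\<exists>!h. h : x ~> Exp V a b \<and> eval_ar V a b o cross V h (Idn V a) = f"
  using assms exponential[of a b] unfolding is_exponential_def by (auto simp del: cross_def)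
 from theI'[OF this] show "transp V x a b f : x ~> Exp V a b"
  "eval_ar V a b o cross V (transp V x a b f) (Idn V a) = f"
  unfolding transp_def by blast+
qed

lemma transp_simps [simp]:
 assumes "f : Ar V" "Dom V f = Prod V x a" "Cod V f = b" "x : Ob V" "a : Ob V"
 shows "transp V x a b f : Ar V" "Dom V (transp V x a b f) = x" "Cod V (transp V x a b f) = Exp V a b"
 using transp[OF assms] by auto

lemma eval_transp [simp]:
 assumes "f : Ar V" "Dom V f = Prod V x a" "Cod V f = b" "x : Ob V" "a : Ob V"
  "z : Ar V" "Cod V z = a"
 shows "u : Ar V ==> Cod V u = x ==> Dom V u = Dom V z ==> eval_ar V a b o <|transp V x a b f o u, z|> = f o <|u, z|>"
  "Dom V z = x ==> eval_ar V a b o <|transp V x a b f, z|> = f o <|Idn V x, z|>"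
proof -
 have b: "b : Ob V" using assms Cod_Ob by blast
 have *: "eval_ar V a b o <|transp V x a b f o u, z|> = f o <|u, z|>"
  if "u : Ar V" "Cod V u = x" "Dom V u = Dom V z" for u
 proof -
  have "eval_ar V a b o <|transp V x a b f o u, z|>
    = (eval_ar V a b o cross V (transp V x a b f) (Idn V a)) o <|u, z|>"
   using assms that b by simp
  then show ?thesis using transp(2)[OF assms(1-5)] by simp
 qed
 then show "u : Ar V ==> Cod V u = x ==> Dom V u = Dom V z ==> eval_ar V a b o <|transp V x a b f o u, z|> = f o <|u, z|>" .
 show "eval_ar V a b o <|transp V x a b f, z|> = f o <|Idn V x, z|>" if "Dom V z = x"
  using *[of "Idn V x"] that assms by simp
qed

lemma exp_eqI:
 assumes "f : x ~> Exp V a b" "g : x ~> Exp V a b" "a : Ob V" "b : Ob V"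
  "eval_ar V a b o <|f o pr1 V x a, pr2 V x a|> = eval_ar V a b o <|g o pr1 V x a, pr2 V x a|>"
 shows "f = g"
proof -
 have x: "x : Ob V" using assms Dom_Ob by auto
 let ?e = "\<lambda>h. eval_ar V a b o cross V h (Idn V a)"
 have *: "?e h = eval_ar V a b o <|h o pr1 V x a, pr2 V x a|>" if "h : x ~> Exp V a b" for h
  using that assms(3) x by simp
 have "?e g : Prod V x a ~> b" unfolding *[OF assms(2)] using assms(2-4) x by simp
 then have "\<exists>!h. h : x ~> Exp V a b \<and> ?e h = ?e g"
  using exponential[OF assms(3,4)] x unfolding is_exponential_def by blast
 moreover have "?e f = ?e g" unfolding *[OF assms(1)] *[OF assms(2)] by (rule assms(5))
 ultimately show ?thesis using assms(1,2) by blast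
qed

end

locale ccc_pb = ccc V for V :: "('o, 'm) cat" (structure) +
 assumes pb: "has_pullbacks V"
begin

lemma pullback: assumes "f : Ar V" "g : Ar V" "Cod V f = Cod V g"
 shows "is_pullback V f g (Pb V f g) (pb1 V f g) (pb2 V f g)"
proof -
 have "\<exists>x. case x of (p, u, v) \<Rightarrow> is_pullback V f g p u v"
  using pb assms unfolding has_pullbacks_def by simp
 from someI_ex[OF this] show ?thesis
  unfolding pullback_def[symmetric] Pb_def pb1_def pb2_def by (simp add: case_prod_beta)
qed

lemma pb_simps [simp]: assumes "f : Ar V" "g : Ar V" "Cod V f = Cod V g"
 shows "pb1 V f g : Ar V" "pb2 V f g : Ar V" "Dom V (pb1 V f g) = Pb V f g"
  "Dom V (pb2 V f g) = Pb V f g" "Cod V (pb1 V f g) = Dom V f" "Cod V (pb2 V f g) = Dom V g"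
  "Pb V f g : Ob V"
 using pullback[OF assms] Dom_Ob[of "pb1 V f g"] unfolding is_pullback_def by auto

lemma pb_commute: assumes "f : Ar V" "g : Ar V" "Cod V f = Cod V g"
 shows "f o pb1 V f g = g o pb2 V f g"
 using pullback[OF assms] unfolding is_pullback_def by auto

lemma pb_tuple: assumes "f : Ar V" "g : Ar V" "Cod V f = Cod V g" "h : x ~> Dom V f"
  "k : x ~> Dom V g" "f o h = g o k"
 shows "pb_tuple V f g h k : x ~> Pb V f g" "pb1 V f g o pb_tuple V f g h k = h"
  "pb2 V f g o pb_tuple V f g h k = k"
 using pullback_pairing[OF pullback] assms unfolding pb_tuple_def by blast+

lemma pb_eqI: assumes "f : Ar V" "g : Ar V" "Cod V f = Cod V g" "h : x ~> Pb V f g"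
  "k : x ~> Pb V f g" "pb1 V f g o h = pb1 V f g o k" "pb2 V f g o h = pb2 V f g o k"
 shows "h = k"
 using pullback_eqI[OF pullback] assms by blast

text \<open>The pullback of \<^term>\<open><|f, g|>\<close> and the diagonal.\<close>

lemma equalizer:
 assumes "f : a ~> b" "g : a ~> b"
 obtains e q where "e : q ~> a" "f o e = g o e"
  "!!x h. h : x ~> a ==> f o h = g o h ==> \<exists>!k. k : x ~> q \<and> e o k = h"
proof -
 have ab: "a : Ob V" "b : Ob V" using assms by auto
 let ?f = "<|Idn V a, f|>" and ?g = "<|Idn V a, g|>"
 note s = pb_simps[of ?f ?g] and t = pb_tuple[of ?f ?g]
 have c: "<|pb1 V ?f ?g, f o pb1 V ?f ?g|> = <|pb2 V ?f ?g, g o pb2 V ?f ?g|>"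
  using pb_commute[of ?f ?g] assms ab s by simp
 have 1: "pb1 V ?f ?g = pb2 V ?f ?g"
  using arg_cong[OF c, of "\<lambda>t. pr1 V a b o t"] assms ab s by simp
 show ?thesis
 proof (rule that)
  show "pb1 V ?f ?g : Pb V ?f ?g ~> a" using s assms ab by simp
  show "f o pb1 V ?f ?g = g o pb1 V ?f ?g"
   using arg_cong[OF c, of "\<lambda>t. pr2 V a b o t"] assms ab s 1 by simp
  fix x h assume h: "h : x ~> a" "f o h = g o h"
  show "\<exists>!k. k : x ~> Pb V ?f ?g \<and> pb1 V ?f ?g o k = h"
  proof (rule ex1I)
   show "pb_tuple V ?f ?g h h : x ~> Pb V ?f ?g \<and> pb1 V ?f ?g o pb_tuple V ?f ?g h h = h"
    using t[of h x h] h assms ab by simp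
   show "k = pb_tuple V ?f ?g h h" if "k : x ~> Pb V ?f ?g \<and> pb1 V ?f ?g o k = h" for k
    using t[of h x h] h assms ab that 1 by (intro pb_eqI[of ?f ?g k x]) auto
  qed
 qed
qed

end

section \<open>Enriched categories on generalized elements\<close>

context ccc
begin

lemma vcategoryI:
 assumes "!!a b. a : VOb A ==> b : VOb A ==> VHom A a b : Ob V"
  and "!!a b c. a : VOb A ==> b : VOb A ==> c : VOb A ==>
   VCmp A a b c : Prod V (VHom A a b) (VHom A b c) ~> VHom A a c"
  and "!!a. a : VOb A ==> VId A a : terminal V ~> VHom A a a"
  and "!!a b c d x f g h. [|a : VOb A; b : VOb A; c : VOb A; d : VOb A; f : x ~> VHom A a b;
   g : x ~> VHom A b c; h : x ~> VHom A c d|] ==>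
   VCmp A a c d o <|VCmp A a b c o <|f, g|>, h|> = VCmp A a b d o <|f, VCmp A b c d o <|g, h|>|>"
  and "!!a b x f. [|a : VOb A; b : VOb A; f : x ~> VHom A a b|] ==>
   VCmp A a a b o <|VId A a o bang V x, f|> = f"
  and "!!a b x f. [|a : VOb A; b : VOb A; f : x ~> VHom A a b|] ==>
   VCmp A a b b o <|f, VId A b o bang V x|> = f"
 shows "vcategory V A"
 unfolding vcategory_def
proof (intro conjI ballI)
 fix a b c d assume o: "a : VOb A" "b : VOb A" "c : VOb A" "d : VOb A"
 note t = assms(1)[OF o(1,2)] assms(1)[OF o(2,3)] assms(1)[OF o(3,4)] assms(1)[OF o(1,3)]
   assms(1)[OF o(2,4)] assms(2)[OF o(1,2,3)] assms(2)[OF o(1,2,4)] assms(2)[OF o(1,3,4)] assms(2)[OF o(2,3,4)]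
 show "VCmp A a c d o cross V (VCmp A a b c) (Idn V (VHom A c d)) =
   VCmp A a b d o cross V (Idn V (VHom A a b)) (VCmp A b c d)
     o assoc V (VHom A a b) (VHom A b c) (VHom A c d)"
  using assms(4)[OF o, of "pr1 V (VHom A a b) (VHom A b c) o pr1 V (Prod V (VHom A a b) (VHom A b c)) (VHom A c d)"
   "Prod V (Prod V (VHom A a b) (VHom A b c)) (VHom A c d)"
   "pr2 V (VHom A a b) (VHom A b c) o pr1 V (Prod V (VHom A a b) (VHom A b c)) (VHom A c d)"
   "pr2 V (Prod V (VHom A a b) (VHom A b c)) (VHom A c d)"] t
  by (simp add: assoc_def)
next
 fix a b assume "a : VOb A" "b : VOb A"
 with assms(5,6)[OF this, of "Idn V (VHom A a b)" "VHom A a b"] assms(1)[OF this]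
 show "VCmp A a a b o <|VId A a o bang V (VHom A a b), Idn V (VHom A a b)|> = Idn V (VHom A a b)"
  "VCmp A a b b o <|Idn V (VHom A a b), VId A b o bang V (VHom A a b)|> = Idn V (VHom A a b)"
  by simp_all
qed (use assms(1-3) in blast)+

end

locale vcat = ccc V for V :: "('o, 'm) cat" (structure) +
 fixes A :: "('c, 'o, 'm) vcat"
 assumes vcategory: "vcategory V A"
begin

lemma VHom_simps [simp]:
 "a : VOb A ==> b : VOb A ==> VHom A a b : Ob V"
 "a : VOb A ==> VId A a : Ar V" "a : VOb A ==> Dom V (VId A a) = terminal V"
 "a : VOb A ==> Cod V (VId A a) = VHom A a a"
 "a : VOb A ==> b : VOb A ==> c : VOb A ==> VCmp A a b c : Ar V"
 "a : VOb A ==> b : VOb A ==> c : VOb A ==> Dom V (VCmp A a b c) = Prod V (VHom A a b) (VHom A b c)"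
 "a : VOb A ==> b : VOb A ==> c : VOb A ==> Cod V (VCmp A a b c) = VHom A a c"
 using vcategory unfolding vcategory_def by (meson Hom_iff)+

lemma VCmp_assoc [simp]:
 assumes o: "a : VOb A" "b : VOb A" "c : VOb A" "d : VOb A"
  and t: "f : Ar V" "g : Ar V" "h : Ar V" "Dom V f = Dom V g" "Dom V g = Dom V h"
   "Cod V f = VHom A a b" "Cod V g = VHom A b c" "Cod V h = VHom A c d"
 shows "VCmp A a c d o <|VCmp A a b c o <|f, g|>, h|> = VCmp A a b d o <|f, VCmp A b c d o <|g, h|>|>"
proof -
 have "VCmp A a c d o cross V (VCmp A a b c) (Idn V (VHom A c d)) =
    VCmp A a b d o cross V (Idn V (VHom A a b)) (VCmp A b c d)
     o assoc V (VHom A a b) (VHom A b c) (VHom A c d)"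
  using vcategory o unfolding vcategory_def by blast
 from arg_cong[OF this, of "\<lambda>k. k o <|<|f, g|>, h|>"] show ?thesis
  using o t by (simp add: assoc_def)
qed

lemma VCmp_VId [simp]:
 assumes o: "a : VOb A" "b : VOb A" and t: "f : Ar V" "Dom V f = x" "Cod V f = VHom A a b"
 shows "VCmp A a a b o <|VId A a o bang V x, f|> = f" "VCmp A a b b o <|f, VId A b o bang V x|> = f"
  "x = terminal V ==> VCmp A a a b o <|VId A a, f|> = f"
  "x = terminal V ==> VCmp A a b b o <|f, VId A b|> = f"
proof -
 have x: "x : Ob V" using t Dom_Ob by blast
 have *: "VCmp A a a b o <|VId A a o bang V (VHom A a b), Idn V (VHom A a b)|> = Idn V (VHom A a b)"
  "VCmp A a b b o <|Idn V (VHom A a b), VId A b o bang V (VHom A a b)|> = Idn V (VHom A a b)"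
  using vcategory o unfolding vcategory_def by blast+
 show 1: "VCmp A a a b o <|VId A a o bang V x, f|> = f" 
  using arg_cong[OF *(1), of "\<lambda>k. k o f"] o t x by simp
 show 2: "VCmp A a b b o <|f, VId A b o bang V x|> = f"
  using arg_cong[OF *(2), of "\<lambda>k. k o f"] o t x by simp
 show "x = terminal V ==> VCmp A a a b o <|VId A a, f|> = f" using 1 o by simp
 show "x = terminal V ==> VCmp A a b b o <|f, VId A b|> = f" using 2 o by simp
qed

end

context ccc
begin

lemma vfunctorD:
 assumes "vfunctor V A B F"
 shows "vcategory V A" "vcategory V B" "a : VOb A ==> VFOb F a : VOb B"
  "a : VOb A ==> b : VOb A ==> VFHom F a b : Ar V"
  "a : VOb A ==> b : VOb A ==> Dom V (VFHom F a b) = VHom A a b"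
  "a : VOb A ==> b : VOb A ==> Cod V (VFHom F a b) = VHom B (VFOb F a) (VFOb F b)"
 using assms unfolding vfunctor_def by (auto simp: PiE_iff)

lemma vfunctor_VCmp:
 assumes F: "vfunctor V A B F" and o: "a : VOb A" "b : VOb A" "c : VOb A"
  and t: "f : Ar V" "g : Ar V" "Dom V f = Dom V g" "Cod V f = VHom A a b" "Cod V g = VHom A b c"
 shows "VFHom F a c o (VCmp A a b c o <|f, g|>) =
   VCmp B (VFOb F a) (VFOb F b) (VFOb F c) o <|VFHom F a b o f, VFHom F b c o g|>"
proof -
 interpret A: vcat V A by (unfold_locales) (rule vfunctorD(1)[OF F])
 interpret B: vcat V B by (unfold_locales) (rule vfunctorD(2)[OF F])
 note [simp] = vfunctorD(3-6)[OF F] o t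
 have "VFHom F a c o VCmp A a b c =
    VCmp B (VFOb F a) (VFOb F b) (VFOb F c) o cross V (VFHom F a b) (VFHom F b c)"
  using F o unfolding vfunctor_def by blast
 from arg_cong[OF this, of "\<lambda>k. k o <|f, g|>"] show ?thesis by simp
qed

lemma vfunctor_VId:
 assumes F: "vfunctor V A B F" and o: "a : VOb A"
 shows "VFHom F a a o VId A a = VId B (VFOb F a)"
  "u : Ar V ==> Cod V u = terminal V ==> VFHom F a a o (VId A a o u) = VId B (VFOb F a) o u"
proof -
 interpret A: vcat V A by (unfold_locales) (rule vfunctorD(1)[OF F])
 note [simp] = vfunctorD(3-6)[OF F] o
 show 1: "VFHom F a a o VId A a = VId B (VFOb F a)"
  using F o unfolding vfunctor_def by blast
 show "u : Ar V ==> Cod V u = terminal V ==> VFHom F a a o (VId A a o u) = VId B (VFOb F a) o u"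
  unfolding 1[symmetric] by simp
qed

lemma vfunctorI:
 assumes A: "vcategory V A" and B: "vcategory V B"
  and ext: "VFOb F : extensional (VOb A)"
   "!!a b. \<not> (a : VOb A \<and> b : VOb A) ==> VFHom F a b = undefined"
  and ob: "!!a. a : VOb A ==> VFOb F a : VOb B"
  and hom: "!!a b. a : VOb A ==> b : VOb A ==> VFHom F a b : VHom A a b ~> VHom B (VFOb F a) (VFOb F b)"
  and cmp: "!!a b c x f g. [|a : VOb A; b : VOb A; c : VOb A; f : x ~> VHom A a b; g : x ~> VHom A b c|]
   ==> VFHom F a c o (VCmp A a b c o <|f, g|>) =
     VCmp B (VFOb F a) (VFOb F b) (VFOb F c) o <|VFHom F a b o f, VFHom F b c o g|>"
  and id: "!!a. a : VOb A ==> VFHom F a a o VId A a = VId B (VFOb F a)"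
 shows "vfunctor V A B F"
proof -
 interpret A: vcat V A by (unfold_locales) (rule A)
 interpret B: vcat V B by (unfold_locales) (rule B)
 have "VFHom F a c o VCmp A a b c =
    VCmp B (VFOb F a) (VFOb F b) (VFOb F c) o cross V (VFHom F a b) (VFHom F b c)"
  if o: "a : VOb A" "b : VOb A" "c : VOb A" for a b c
  using cmp[OF o, of "pr1 V (VHom A a b) (VHom A b c)" "Prod V (VHom A a b) (VHom A b c)"
   "pr2 V (VHom A a b) (VHom A b c)"] hom[OF o(1,2)] hom[OF o(2,3)] o ob by simp
 then show ?thesis unfolding vfunctor_def using assms by (auto simp: PiE_iff)
qed

lemma vid_functor: assumes "vcategory V A" shows "vfunctor V A A (vid_functor V A)"
proof -
 interpret A: vcat V A by (unfold_locales) (rule assms)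
 show ?thesis by (rule vfunctorI) (auto simp: vid_functor_def assms)
qed

lemma vfunctor_comp:
 assumes F: "vfunctor V A B F" and G: "vfunctor V B D G"
 shows "vfunctor V A D (vfunctor_comp V A G F)"
proof -
 interpret A: vcat V A by (unfold_locales) (rule vfunctorD(1)[OF F])
 interpret B: vcat V B by (unfold_locales) (rule vfunctorD(2)[OF F])
 interpret D: vcat V D by (unfold_locales) (rule vfunctorD(2)[OF G])
 note [simp] = vfunctorD(3-6)[OF F] vfunctorD(3-6)[OF G] vfunctor_VCmp[OF F] vfunctor_VCmp[OF G]
  vfunctor_VId[OF F] vfunctor_VId[OF G]
 show ?thesis
  by (rule vfunctorI) (auto simp: vfunctor_comp_def A.vcategory D.vcategory)
qed

lemma vnat_iff:
 assumes F: "vfunctor V A B F" and G: "vfunctor V A B G"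
 shows "vnat V A B F G \<alpha> \<longleftrightarrow> \<alpha> : extensional (VOb A) \<and>
   (\<forall>a \<in> VOb A. \<alpha> a : terminal V ~> VHom B (VFOb F a) (VFOb G a)) \<and>
   (\<forall>a \<in> VOb A. \<forall>b \<in> VOb A. \<forall>x. \<forall>f \<in> Hom V x (VHom A a b).
    VCmp B (VFOb F a) (VFOb F b) (VFOb G b) o <|VFHom F a b o f, \<alpha> b o bang V x|> =
    VCmp B (VFOb F a) (VFOb G a) (VFOb G b) o <|\<alpha> a o bang V x, VFHom G a b o f|>)"
  (is "_ \<longleftrightarrow> ?R")
proof -
 interpret A: vcat V A by (unfold_locales) (rule vfunctorD(1)[OF F])
 interpret B: vcat V B by (unfold_locales) (rule vfunctorD(2)[OF F])
 note [simp] = vfunctorD(3-6)[OF F] vfunctorD(3-6)[OF G]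
 have "VCmp B (VFOb F a) (VFOb F b) (VFOb G b) o <|VFHom F a b o f, \<alpha> b o bang V x|> =
    VCmp B (VFOb F a) (VFOb G a) (VFOb G b) o <|\<alpha> a o bang V x, VFHom G a b o f|>"
  if n: "vnat V A B F G \<alpha>" and o: "a : VOb A" "b : VOb A" and f: "f : x ~> VHom A a b" for a b x f
 proof -
  have \<alpha>: "\<alpha> a : terminal V ~> VHom B (VFOb F a) (VFOb G a)"
   "\<alpha> b : terminal V ~> VHom B (VFOb F b) (VFOb G b)"
   using n o unfolding vnat_def by blast+
  have "VCmp B (VFOb F a) (VFOb F b) (VFOb G b)
     o tuple V (VFHom F a b) (\<alpha> b o bang V (VHom A a b)) =
    VCmp B (VFOb F a) (VFOb G a) (VFOb G b)
     o tuple V (\<alpha> a o bang V (VHom A a b)) (VFHom G a b)"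
   using n o unfolding vnat_def by blast
  from arg_cong[OF this, of "\<lambda>k. k o f"] show ?thesis using o f \<alpha> by simp
 qed
 moreover have "vnat V A B F G \<alpha>" if R: ?R
 proof -
  have "VCmp B (VFOb F a) (VFOb F b) (VFOb G b)
     o tuple V (VFHom F a b) (\<alpha> b o bang V (VHom A a b)) =
    VCmp B (VFOb F a) (VFOb G a) (VFOb G b)
     o tuple V (\<alpha> a o bang V (VHom A a b)) (VFHom G a b)" if o: "a : VOb A" "b : VOb A" for a b
  proof -
   have "Idn V (VHom A a b) : VHom A a b ~> VHom A a b" using o by simp
   then have "VCmp B (VFOb F a) (VFOb F b) (VFOb G b) o <|VFHom F a b o Idn V (VHom A a b), \<alpha> b o bang V (VHom A a b)|> =
    VCmp B (VFOb F a) (VFOb G a) (VFOb G b) o <|\<alpha> a o bang V (VHom A a b), VFHom G a b o Idn V (VHom A a b)|>"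
    using R o by blast
   then show ?thesis using o by simp
  qed
  then show ?thesis unfolding vnat_def using F G R by blast
 qed
 ultimately show ?thesis unfolding vnat_def[of V A B F G \<alpha>] by blast
qed

text \<open>Naturality is only asked of a family that is defined on the objects of \<^term>\<open>A\<close>; the
 restriction makes it extensional.\<close>

lemma vnaturally_isomorphicI:
 assumes F: "vfunctor V A B F" and G: "vfunctor V A B G"
  and \<alpha>: "!!a. a : VOb A ==> \<alpha> a : terminal V ~> VHom B (VFOb F a) (VFOb G a)"
   "!!a b x f. [|a : VOb A; b : VOb A; f : x ~> VHom A a b|] ==>
    VCmp B (VFOb F a) (VFOb F b) (VFOb G b) o <|VFHom F a b o f, \<alpha> b o bang V x|> =
    VCmp B (VFOb F a) (VFOb G a) (VFOb G b) o <|\<alpha> a o bang V x, VFHom G a b o f|>"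
  and \<beta>: "!!a. a : VOb A ==> \<beta> a : terminal V ~> VHom B (VFOb G a) (VFOb F a)"
  and \<alpha>\<beta>: "!!a. a : VOb A ==> VCmp B (VFOb F a) (VFOb G a) (VFOb F a) o <|\<alpha> a, \<beta> a|> = VId B (VFOb F a)"
  and \<beta>\<alpha>: "!!a. a : VOb A ==> VCmp B (VFOb G a) (VFOb F a) (VFOb G a) o <|\<beta> a, \<alpha> a|> = VId B (VFOb G a)"
 shows "vnaturally_isomorphic V A B F G"
proof -
 interpret A: vcat V A by (unfold_locales) (rule vfunctorD(1)[OF F])
 interpret B: vcat V B by (unfold_locales) (rule vfunctorD(2)[OF F])
 note [simp] = vfunctorD(3-6)[OF F] vfunctorD(3-6)[OF G]
 have \<alpha>t [simp]: "\<alpha> a : Ar V" "Dom V (\<alpha> a) = terminal V" "Cod V (\<alpha> a) = VHom B (VFOb F a) (VFOb G a)"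
  if "a : VOb A" for a using \<alpha>(1)[OF that] by auto
 have \<beta>t [simp]: "\<beta> a : Ar V" "Dom V (\<beta> a) = terminal V" "Cod V (\<beta> a) = VHom B (VFOb G a) (VFOb F a)"
  if "a : VOb A" for a using \<beta>(1)[OF that] by auto
 have \<alpha>\<beta>': "VCmp B (VFOb F a) (VFOb G a) c o <|\<alpha> a o bang V x, VCmp B (VFOb G a) (VFOb F a) c o <|\<beta> a o bang V x, f|>|> = f"
  if "a : VOb A" "c : VOb B" "f : x ~> VHom B (VFOb F a) c" for a c x f
 proof -
  have x: "x : Ob V" using that by auto
  have "VCmp B (VFOb F a) (VFOb F a) c o <|(VCmp B (VFOb F a) (VFOb G a) (VFOb F a) o <|\<alpha> a, \<beta> a|>) o bang V x, f|> = f"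
   using that unfolding \<alpha>\<beta>[OF that(1)] by simp
  then show ?thesis using that x by (simp del: B.VCmp_VId)
 qed
 have \<beta>\<alpha>': "VCmp B (VFOb G a) (VFOb F a) c o <|\<beta> a o bang V x, VCmp B (VFOb F a) (VFOb G a) c o <|\<alpha> a o bang V x, f|>|> = f"
  if "a : VOb A" "c : VOb B" "f : x ~> VHom B (VFOb G a) c" for a c x f
 proof -
  have x: "x : Ob V" using that by auto
  have "VCmp B (VFOb G a) (VFOb G a) c o <|(VCmp B (VFOb G a) (VFOb F a) (VFOb G a) o <|\<beta> a, \<alpha> a|>) o bang V x, f|> = f"
   using that unfolding \<beta>\<alpha>[OF that(1)] by simp
  then show ?thesis using that x by (simp del: B.VCmp_VId)
 qed
 have \<beta>n: "VCmp B (VFOb G a) (VFOb G b) (VFOb F b) o <|VFHom G a b o f, \<beta> b o bang V x|> =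
    VCmp B (VFOb G a) (VFOb F a) (VFOb F b) o <|\<beta> a o bang V x, VFHom F a b o f|>"
  if o: "a : VOb A" "b : VOb A" and f: "f : x ~> VHom A a b" for a b x f
 proof -
  have x: "x : Ob V" using f by auto
  have \<alpha>\<beta>b: "VCmp B (VFOb F b) (VFOb G b) (VFOb F b) o <|\<alpha> b o bang V x, \<beta> b o bang V x|> = VId B (VFOb F b) o bang V x"
   unfolding \<alpha>\<beta>[OF o(2), symmetric] using o x by simp
  have "VCmp B (VFOb G a) (VFOb G b) (VFOb F b) o <|VFHom G a b o f, \<beta> b o bang V x|> =
   VCmp B (VFOb G a) (VFOb F a) (VFOb F b) o <|\<beta> a o bang V x, VCmp B (VFOb F a) (VFOb G b) (VFOb F b) o
    <|VCmp B (VFOb F a) (VFOb G a) (VFOb G b) o <|\<alpha> a o bang V x, VFHom G a b o f|>, \<beta> b o bang V x|>|>"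
   using o f x by (simp add: \<beta>\<alpha>')
  also have "\<dots> = VCmp B (VFOb G a) (VFOb F a) (VFOb F b) o <|\<beta> a o bang V x, VFHom F a b o f|>"
   unfolding \<alpha>(2)[OF o f, symmetric] using o f x by (simp add: \<alpha>\<beta>b)
  finally show ?thesis .
 qed
 let ?\<alpha> = "restrict \<alpha> (VOb A)" and ?\<beta> = "restrict \<beta> (VOb A)"
 have "vnat V A B F G ?\<alpha>" unfolding vnat_iff[OF F G] using \<alpha> by auto
 moreover have "vnat V A B G F ?\<beta>" unfolding vnat_iff[OF G F] using \<beta> \<beta>n by auto
 ultimately show ?thesis
  unfolding vnaturally_isomorphic_def is_iso_def using \<alpha>\<beta> \<beta>\<alpha>
  by (intro exI[of _ "(F, G, ?\<alpha>)"] conjI bexI[of _ "(G, F, ?\<beta>)"]) (auto simp: vfun_cat_def)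
qed

text \<open>The enriched form of the criterion for ordinary categories.  The hom-maps of the quasi-inverse are
 conjugations by the chosen isomorphisms \<^term>\<open>e\<close> and \<^term>\<open>e'\<close>, followed by the inverses \<^term>\<open>\<psi>\<close> of the hom-maps.\<close>

lemma vequivalenceI:
 assumes F: "vfunctor V A B F"
  and \<psi>: "!!a b. a : VOb A ==> b : VOb A ==> \<psi> a b : VHom B (VFOb F a) (VFOb F b) ~> VHom A a b"
   "!!a b. a : VOb A ==> b : VOb A ==> VFHom F a b o \<psi> a b = Idn V (VHom B (VFOb F a) (VFOb F b))"
   "!!a b. a : VOb A ==> b : VOb A ==> \<psi> a b o VFHom F a b = Idn V (VHom A a b)"
  and es: "!!d. d : VOb B ==> \<exists>c \<in> VOb A. \<exists>e e'. e : terminal V ~> VHom B (VFOb F c) d \<and>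
   e' : terminal V ~> VHom B d (VFOb F c) \<and>
   VCmp B (VFOb F c) d (VFOb F c) o <|e, e'|> = VId B (VFOb F c) \<and>
   VCmp B d (VFOb F c) d o <|e', e|> = VId B d"
 shows "is_vequivalence V A B F"
proof -
 interpret A: vcat V A by (unfold_locales) (rule vfunctorD(1)[OF F])
 interpret B: vcat V B by (unfold_locales) (rule vfunctorD(2)[OF F])
 note Fs [simp] = vfunctorD(3-6)[OF F] vfunctor_VCmp[OF F] vfunctor_VId[OF F]
 obtain g e e' where g [simp]: "!!d. d : VOb B ==> g d : VOb A"
  and e: "!!d. d : VOb B ==> e d : terminal V ~> VHom B (VFOb F (g d)) d"
  and e': "!!d. d : VOb B ==> e' d : terminal V ~> VHom B d (VFOb F (g d))"
  and ee': "!!d. d : VOb B ==> VCmp B (VFOb F (g d)) d (VFOb F (g d)) o <|e d, e' d|> = VId B (VFOb F (g d))"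
  and e'e: "!!d. d : VOb B ==> VCmp B d (VFOb F (g d)) d o <|e' d, e d|> = VId B d"
  using es by metis
 have et [simp]: "e d : Ar V" "Dom V (e d) = terminal V" "Cod V (e d) = VHom B (VFOb F (g d)) d"
  "e' d : Ar V" "Dom V (e' d) = terminal V" "Cod V (e' d) = VHom B d (VFOb F (g d))"
  if "d : VOb B" for d using e[OF that] e'[OF that] by auto
 have \<psi>t [simp]: "\<psi> a b : Ar V" "Dom V (\<psi> a b) = VHom B (VFOb F a) (VFOb F b)" "Cod V (\<psi> a b) = VHom A a b"
  if "a : VOb A" "b : VOb A" for a b using \<psi>(1)[OF that] by auto
 have F\<psi> [simp]: "VFHom F a b o (\<psi> a b o k) = k"
  if "a : VOb A" "b : VOb A" "k : Ar V" "Cod V k = VHom B (VFOb F a) (VFOb F b)" for a b k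
  using arg_cong[OF \<psi>(2)[OF that(1,2)], of "\<lambda>t. t o k"] that by simp
 have inj: "f = f'" if "a : VOb A" "b : VOb A" "f : x ~> VHom A a b" "f' : x ~> VHom A a b"
  "VFHom F a b o f = VFHom F a b o f'" for a b x f f'
 proof -
  have "(\<psi> a b o VFHom F a b) o f = (\<psi> a b o VFHom F a b) o f'" using that by simp
  then show ?thesis unfolding \<psi>(3)[OF that(1,2)] using that by simp
 qed
 have 1 [simp]: "VCmp B (VFOb F (g d)) d c o <|e d o bang V x, VCmp B d (VFOb F (g d)) c o <|e' d o bang V x, f|>|> = f"
  if "d : VOb B" "c : VOb B" "f : Ar V" "Dom V f = x" "Cod V f = VHom B (VFOb F (g d)) c" for d c x f
 proof -
  have x: "x : Ob V" using that by auto
  have "VCmp B (VFOb F (g d)) (VFOb F (g d)) c o <|(VCmp B (VFOb F (g d)) d (VFOb F (g d)) o <|e d, e' d|>) o bang V x, f|> = f"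
   using that unfolding ee'[OF that(1)] by simp
  then show ?thesis using that x by (simp del: B.VCmp_VId)
 qed
 have 2 [simp]: "VCmp B d (VFOb F (g d)) c o <|e' d o bang V x, VCmp B (VFOb F (g d)) d c o <|e d o bang V x, f|>|> = f"
  if "d : VOb B" "c : VOb B" "f : Ar V" "Dom V f = x" "Cod V f = VHom B d c" for d c x f
 proof -
  have x: "x : Ob V" using that by auto
  have "VCmp B d d c o <|(VCmp B d (VFOb F (g d)) d o <|e' d, e d|>) o bang V x, f|> = f"
   using that unfolding e'e[OF that(1)] by simp
  then show ?thesis using that x by (simp del: B.VCmp_VId)
 qed
 have 3 [simp]: "VCmp B d (VFOb F (g d)) d o <|e' d o bang V x, e d o bang V x|> = VId B d o bang V x"
  if "d : VOb B" "x : Ob V" for d x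
  unfolding e'e[OF that(1), symmetric] using that by simp
 define G where "G = \<lparr>VFOb = (\<lambda>d\<in>VOb B. g d), VFHom = (\<lambda>c d. if c : VOb B \<and> d : VOb B
   then \<psi> (g c) (g d) o (VCmp B (VFOb F (g c)) c (VFOb F (g d)) o <|e c o bang V (VHom B c d),
    VCmp B c d (VFOb F (g d)) o <|Idn V (VHom B c d), e' d o bang V (VHom B c d)|>|>) else undefined)\<rparr>"
 have G0 [simp]: "VFOb G d = g d" if "d : VOb B" for d using that by (simp add: G_def)
 have G1 [simp]: "VFHom G c d : Ar V" "Dom V (VFHom G c d) = VHom B c d" "Cod V (VFHom G c d) = VHom A (g c) (g d)"
  if "c : VOb B" "d : VOb B" for c d using that by (simp_all add: G_def)
 have FG [simp]: "VFHom F (g c) (g d) o (VFHom G c d o h) = VCmp B (VFOb F (g c)) c (VFOb F (g d)) o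
   <|e c o bang V x, VCmp B c d (VFOb F (g d)) o <|h, e' d o bang V x|>|>"
  if "c : VOb B" "d : VOb B" "h : Ar V" "Dom V h = x" "Cod V h = VHom B c d" for c d h x
 proof -
  have "x : Ob V" using that by auto
  then show ?thesis using that by (simp add: G_def)
 qed
 have G: "vfunctor V B A G"
 proof (rule vfunctorI)
  fix a b c x f h assume o: "a : VOb B" "b : VOb B" "c : VOb B" "f : x ~> VHom B a b" "h : x ~> VHom B b c"
  then have x: "x : Ob V" by auto
  show "VFHom G a c o (VCmp B a b c o <|f, h|>) = VCmp A (VFOb G a) (VFOb G b) (VFOb G c) o <|VFHom G a b o f, VFHom G b c o h|>"
   by (rule inj[of "g a" "g c" _ x]) (use o x in simp_all)
 next
  fix a assume o: "a : VOb B"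
  show "VFHom G a a o VId B a = VId A (VFOb G a)"
   by (rule inj[of "g a" "g a" _ "terminal V"]) (use o ee' in simp_all)
 qed (auto simp: G_def A.vcategory B.vcategory)
 have GF: "vfunctor V A A (vfunctor_comp V A G F)" by (rule vfunctor_comp[OF F G])
 have FG': "vfunctor V B B (vfunctor_comp V B F G)" by (rule vfunctor_comp[OF G F])
 have comp [simp]: "VFOb (vfunctor_comp V A G F) a = g (VFOb F a)" "VFOb (vfunctor_comp V B F G) d = VFOb F (g d)"
   "VFHom (vfunctor_comp V A G F) a b = VFHom G (VFOb F a) (VFOb F b) o VFHom F a b"
   "VFHom (vfunctor_comp V B F G) d d' = VFHom F (g d) (g d') o VFHom G d d'"
   "VFOb (vid_functor V A) a = a" "VFOb (vid_functor V B) d = d"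
   "VFHom (vid_functor V A) a b = Idn V (VHom A a b)" "VFHom (vid_functor V B) d d' = Idn V (VHom B d d')"
  if "a : VOb A" "b : VOb A" "d : VOb B" "d' : VOb B" for a b d d'
  using that by (simp_all add: vfunctor_comp_def vid_functor_def)
 have "VOb A = {} ==> VOb B = {}" using g by blast
 have comp' [simp]: "VFOb (vfunctor_comp V A G F) a = g (VFOb F a)"
   "VFHom (vfunctor_comp V A G F) a b = VFHom G (VFOb F a) (VFOb F b) o VFHom F a b"
   "VFOb (vid_functor V A) a = a" "VFHom (vid_functor V A) a b = Idn V (VHom A a b)"
  if "a : VOb A" "b : VOb A" for a b
  using that by (simp_all add: vfunctor_comp_def vid_functor_def)
 have comp'' [simp]: "VFOb (vfunctor_comp V A G F) a = g (VFOb F a)" "VFOb (vid_functor V A) a = a"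
  if "a : VOb A" for a using that by (simp_all add: vfunctor_comp_def vid_functor_def)
 have comp''' [simp]: "VFOb (vfunctor_comp V B F G) d = VFOb F (g d)" "VFOb (vid_functor V B) d = d"
  if "d : VOb B" for d using that by (simp_all add: vfunctor_comp_def vid_functor_def)
 have comp4 [simp]: "VFHom (vfunctor_comp V B F G) d d' = VFHom F (g d) (g d') o VFHom G d d'"
   "VFHom (vid_functor V B) d d' = Idn V (VHom B d d')"
  if "d : VOb B" "d' : VOb B" for d d'
  using that by (simp_all add: vfunctor_comp_def vid_functor_def)
 have \<eta>t: "\<psi> a (g (VFOb F a)) o e' (VFOb F a) : terminal V ~> VHom A a (g (VFOb F a))"
   "\<psi> (g (VFOb F a)) a o e (VFOb F a) : terminal V ~> VHom A (g (VFOb F a)) a" if "a : VOb A" for a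
  using that by simp_all
 have "vnaturally_isomorphic V A A (vid_functor V A) (vfunctor_comp V A G F)"
 proof (rule vnaturally_isomorphicI[OF vid_functor[OF A.vcategory] GF,
   where \<alpha> = "\<lambda>a. \<psi> a (g (VFOb F a)) o e' (VFOb F a)" and \<beta> = "\<lambda>a. \<psi> (g (VFOb F a)) a o e (VFOb F a)"])
  fix a assume "a : VOb A"
  note o [simp] = this \<eta>t[OF this]
  show "\<psi> a (g (VFOb F a)) o e' (VFOb F a) : terminal V ~> VHom A (VFOb (vid_functor V A) a) (VFOb (vfunctor_comp V A G F) a)"
   "\<psi> (g (VFOb F a)) a o e (VFOb F a) : terminal V ~> VHom A (VFOb (vfunctor_comp V A G F) a) (VFOb (vid_functor V A) a)"
   by simp_all
  show "VCmp A (VFOb (vid_functor V A) a) (VFOb (vfunctor_comp V A G F) a) (VFOb (vid_functor V A) a) o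
    <|\<psi> a (g (VFOb F a)) o e' (VFOb F a), \<psi> (g (VFOb F a)) a o e (VFOb F a)|> = VId A (VFOb (vid_functor V A) a)"
   by (rule inj[of a a _ "terminal V"]) (use e'e in simp_all)
  show "VCmp A (VFOb (vfunctor_comp V A G F) a) (VFOb (vid_functor V A) a) (VFOb (vfunctor_comp V A G F) a) o
    <|\<psi> (g (VFOb F a)) a o e (VFOb F a), \<psi> a (g (VFOb F a)) o e' (VFOb F a)|> = VId A (VFOb (vfunctor_comp V A G F) a)"
   by (rule inj[of "g (VFOb F a)" "g (VFOb F a)" _ "terminal V"]) (use ee' in simp_all)
 next
  fix a b x f assume o: "a : VOb A" "b : VOb A" "f : x ~> VHom A a b"
  then have x: "x : Ob V" by auto
  show "VCmp A (VFOb (vid_functor V A) a) (VFOb (vid_functor V A) b) (VFOb (vfunctor_comp V A G F) b) o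
    <|VFHom (vid_functor V A) a b o f, (\<psi> b (g (VFOb F b)) o e' (VFOb F b)) o bang V x|> =
    VCmp A (VFOb (vid_functor V A) a) (VFOb (vfunctor_comp V A G F) a) (VFOb (vfunctor_comp V A G F) b) o
    <|(\<psi> a (g (VFOb F a)) o e' (VFOb F a)) o bang V x, VFHom (vfunctor_comp V A G F) a b o f|>"
   by (rule inj[of a "g (VFOb F b)" _ x]) (use o x in simp_all)
 qed
 moreover have "vnaturally_isomorphic V B B (vfunctor_comp V B F G) (vid_functor V B)"
  by (rule vnaturally_isomorphicI[OF FG' vid_functor[OF B.vcategory], where \<alpha> = e and \<beta> = e'])
   (auto simp: ee' e'e)
 ultimately show ?thesis unfolding is_vequivalence_def using F G by blast
qed

subsection \<open>Opposites and the self-enrichment\<close>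

lemma vself_VHom [simp]: "VHom (vself V) = Exp V" "VOb (vself V) = Ob V" by (simp_all add: vself_def)

lemma vself_typing [simp]:
 "[|a : Ob V; b : Ob V; c : Ob V|] ==> VCmp (vself V) a b c : Ar V"
 "[|a : Ob V; b : Ob V; c : Ob V|] ==> Dom V (VCmp (vself V) a b c) = Prod V (Exp V a b) (Exp V b c)"
 "[|a : Ob V; b : Ob V; c : Ob V|] ==> Cod V (VCmp (vself V) a b c) = Exp V a c"
 "a : Ob V ==> VId (vself V) a : Ar V" "a : Ob V ==> Dom V (VId (vself V) a) = terminal V"
 "a : Ob V ==> Cod V (VId (vself V) a) = Exp V a a"
 by (simp_all add: vself_def Let_def)

lemma eval_vself [simp]:
 assumes o: "a : Ob V" "b : Ob V" "c : Ob V" and z: "z : Ar V" "Cod V z = a" "Dom V z = x"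
 shows "[|f : Ar V; Cod V f = Exp V a b; Dom V f = x; g : Ar V; Cod V g = Exp V b c; Dom V g = x|] ==>
   eval_ar V a c o <|VCmp (vself V) a b c o <|f, g|>, z|> = eval_ar V b c o <|g, eval_ar V a b o <|f, z|>|>"
  "[|u : Ar V; Cod V u = terminal V; Dom V u = x|] ==> eval_ar V a a o <|VId (vself V) a o u, z|> = z"
  "x = terminal V ==> eval_ar V a a o <|VId (vself V) a, z|> = z"
 using o z by (simp_all add: vself_def Let_def)

lemma vself_vcategory: "vcategory V (vself V)"
proof (rule vcategoryI)
 fix a b c d x f g h
 assume *: "a : VOb (vself V)" "b : VOb (vself V)" "c : VOb (vself V)" "d : VOb (vself V)"
  "f : x ~> VHom (vself V) a b" "g : x ~> VHom (vself V) b c" "h : x ~> VHom (vself V) c d"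
 then have x: "x : Ob V" by auto
 show "VCmp (vself V) a c d o <|VCmp (vself V) a b c o <|f, g|>, h|> =
   VCmp (vself V) a b d o <|f, VCmp (vself V) b c d o <|g, h|>|>"
  by (rule exp_eqI[of _ x a d]) (use * x in simp_all)
next
 fix a b x f assume *: "a : VOb (vself V)" "b : VOb (vself V)" "f : x ~> VHom (vself V) a b"
 then have x: "x : Ob V" by auto
 show "VCmp (vself V) a a b o <|VId (vself V) a o bang V x, f|> = f"
  "VCmp (vself V) a b b o <|f, VId (vself V) b o bang V x|> = f"
  by (rule exp_eqI[of _ x a b]; use * x in simp)+
qed simp_all

sublocale vself: vcat V "vself V" by unfold_locales (rule vself_vcategory)

end

context vcat
begin

lemma vop_simps [simp]: "VOb (vop V A) = VOb A" "VHom (vop V A) a b = VHom A b a" "VId (vop V A) = VId A"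
 by (simp_all add: vop_def)

lemma vop_typing [simp]:
 assumes "a : VOb A" "b : VOb A" "c : VOb A"
 shows "VCmp (vop V A) a b c : Ar V" "Dom V (VCmp (vop V A) a b c) = Prod V (VHom A b a) (VHom A c b)"
  "Cod V (VCmp (vop V A) a b c) = VHom A c a"
  "[|f : Ar V; Cod V f = VHom A b a; g : Ar V; Cod V g = VHom A c b; Dom V f = Dom V g|] ==>
   VCmp (vop V A) a b c o <|f, g|> = VCmp A c b a o <|g, f|>"
 using assms by (simp_all add: vop_def)

lemma vop_vcategory: "vcategory V (vop V A)"
 by (rule vcategoryI) auto

end

subsection \<open>Ends and the enriched category of enriched functors\<close>

context ccc
begin

text \<open>The definition asks for the equation at the generic element of \<^term>\<open>Prod V x (VHom A a b)\<close>, which gives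
 it at every pair of elements.\<close>

lemma is_wedge_iff:
 assumes F: "vfunctor V A B F" and G: "vfunctor V A B G"
 shows "is_wedge V A B F G x w \<longleftrightarrow> x : Ob V \<and>
   (\<forall>a \<in> VOb A. w a : x ~> VHom B (VFOb F a) (VFOb G a)) \<and>
   (\<forall>a \<in> VOb A. \<forall>b \<in> VOb A. \<forall>y. \<forall>u \<in> Hom V y x. \<forall>f \<in> Hom V y (VHom A a b).
    VCmp B (VFOb F a) (VFOb F b) (VFOb G b) o <|VFHom F a b o f, w b o u|> =
    VCmp B (VFOb F a) (VFOb G a) (VFOb G b) o <|w a o u, VFHom G a b o f|>)"
  (is "_ \<longleftrightarrow> ?R")
proof -
 interpret A: vcat V A by (unfold_locales) (rule vfunctorD(1)[OF F])
 interpret B: vcat V B by (unfold_locales) (rule vfunctorD(2)[OF F])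
 note [simp] = vfunctorD(3-6)[OF F] vfunctorD(3-6)[OF G]
 have "VCmp B (VFOb F a) (VFOb F b) (VFOb G b) o <|VFHom F a b o f, w b o u|> =
    VCmp B (VFOb F a) (VFOb G a) (VFOb G b) o <|w a o u, VFHom G a b o f|>"
  if n: "is_wedge V A B F G x w" and o: "a : VOb A" "b : VOb A" and f: "u : y ~> x" "f : y ~> VHom A a b" for a b y f u
 proof -
  have w: "x : Ob V" "w a : x ~> VHom B (VFOb F a) (VFOb G a)"
   "w b : x ~> VHom B (VFOb F b) (VFOb G b)"
   using n o unfolding is_wedge_def by blast+
  have "VCmp B (VFOb F a) (VFOb F b) (VFOb G b)
     o tuple V (VFHom F a b o pr2 V x (VHom A a b)) (w b o pr1 V x (VHom A a b)) =
    VCmp B (VFOb F a) (VFOb G a) (VFOb G b)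
     o tuple V (w a o pr1 V x (VHom A a b)) (VFHom G a b o pr2 V x (VHom A a b))"
   using n o unfolding is_wedge_def by blast
  from arg_cong[OF this, of "\<lambda>k. k o <|u, f|>"] show ?thesis using o f w by simp
 qed
 moreover have "is_wedge V A B F G x w" if R: ?R
 proof -
  have "VCmp B (VFOb F a) (VFOb F b) (VFOb G b)
     o tuple V (VFHom F a b o pr2 V x (VHom A a b)) (w b o pr1 V x (VHom A a b)) =
    VCmp B (VFOb F a) (VFOb G a) (VFOb G b)
     o tuple V (w a o pr1 V x (VHom A a b)) (VFHom G a b o pr2 V x (VHom A a b))"
   if o: "a : VOb A" "b : VOb A" for a b
  proof -
   have "pr1 V x (VHom A a b) : Prod V x (VHom A a b) ~> x"
    "pr2 V x (VHom A a b) : Prod V x (VHom A a b) ~> VHom A a b" using o R by simp_all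
   then show ?thesis using R o by blast
  qed
  then show ?thesis unfolding is_wedge_def using R by blast
 qed
 ultimately show ?thesis unfolding is_wedge_def[of V A B F G x w] by blast
qed

text \<open>A natural transformation only differs from a wedge at the terminal object in that its values off the
 objects of \<^term>\<open>A\<close> are fixed.\<close>

lemma vnat_iff_wedge:
 assumes F: "vfunctor V A B F" and G: "vfunctor V A B G"
 shows "vnat V A B F G \<alpha> \<longleftrightarrow> \<alpha> : extensional (VOb A) \<and> is_wedge V A B F G (terminal V) \<alpha>"
proof -
 interpret A: vcat V A by (unfold_locales) (rule vfunctorD(1)[OF F])
 have u: "u = bang V x" if "u : x ~> terminal V" for u x
  using that Dom_Ob[of u] by (intro terminal_eqI[of _ x]) auto
 let ?P = "\<lambda>a b y u f. VCmp B (VFOb F a) (VFOb F b) (VFOb G b) o <|VFHom F a b o f, \<alpha> b o u|> =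
    VCmp B (VFOb F a) (VFOb G a) (VFOb G b) o <|\<alpha> a o u, VFHom G a b o f|>"
 have "(\<forall>u \<in> Hom V y (terminal V). \<forall>f \<in> Hom V y (VHom A a b). ?P a b y u f) \<longleftrightarrow>
   (\<forall>f \<in> Hom V y (VHom A a b). ?P a b y (bang V y) f)" for a b y
 proof (intro iffI ballI)
  fix f assume *: "\<forall>u \<in> Hom V y (terminal V). \<forall>f \<in> Hom V y (VHom A a b). ?P a b y u f" "f : y ~> VHom A a b"
  then have "bang V y : y ~> terminal V" by auto
  then show "?P a b y (bang V y) f" using * by blast
 qed (use u in blast)
 then show ?thesis unfolding vnat_iff[OF F G] is_wedge_iff[OF F G] by simp
qed

lemma wedge_cong: "(!!a. a : VOb A ==> w a = w' a) ==> is_wedge V A B F G x w \<longleftrightarrow> is_wedge V A B F G x w'"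
 unfolding is_wedge_def by (simp cong: conj_cong)

lemma wedge_precomp:
 assumes F: "vfunctor V A B F" and G: "vfunctor V A B G"
  and w: "is_wedge V A B F G x w" and k: "k : y ~> x"
 shows "is_wedge V A B F G y (\<lambda>a. w a o k)"
proof -
 interpret A: vcat V A by (unfold_locales) (rule vfunctorD(1)[OF F])
 interpret B: vcat V B by (unfold_locales) (rule vfunctorD(2)[OF F])
 note [simp] = vfunctorD(3-6)[OF F] vfunctorD(3-6)[OF G]
 have w': "w a : Ar V" "Dom V (w a) = x" "Cod V (w a) = VHom B (VFOb F a) (VFOb G a)" if "a : VOb A" for a
  using w that unfolding is_wedge_def by auto
 have w2: "VCmp B (VFOb F a) (VFOb F b) (VFOb G b) o <|VFHom F a b o f, w b o u|> =
    VCmp B (VFOb F a) (VFOb G a) (VFOb G b) o <|w a o u, VFHom G a b o f|>"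
  if "a : VOb A" "b : VOb A" "u : z ~> x" "f : z ~> VHom A a b" for a b z u f
  using w that unfolding is_wedge_iff[OF F G] by blast
 show ?thesis unfolding is_wedge_iff[OF F G]
 proof (intro conjI ballI allI)
  fix a b z u f assume o: "a : VOb A" "b : VOb A" "u : z ~> y" "f : z ~> VHom A a b"
  show "VCmp B (VFOb F a) (VFOb F b) (VFOb G b) o <|VFHom F a b o f, (w b o k) o u|> =
    VCmp B (VFOb F a) (VFOb G a) (VFOb G b) o <|(w a o k) o u, VFHom G a b o f|>"
   using w2[of a b "k o u" z f] w' o k by simp
 qed (use w' k in auto)
qed

text \<open>Existence of the ends is what makes the hom-objects of \<^term>\<open>vfun_vcat V A B\<close> meaningful; it is kept as a
 hypothesis here and established for presheaves by constructing the ends.\<close>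

definition has_ends where
 "has_ends A B \<longleftrightarrow> (\<forall>F G. vfunctor V A B F --> vfunctor V A B G --> (\<exists>e l. is_end V A B F G e l))"

lemma is_end:
 assumes "has_ends A B" "vfunctor V A B F" "vfunctor V A B G"
 shows "is_end V A B F G (End V A B F G) (end_pr V A B F G)"
proof -
 have "\<exists>x. case x of (e, l) \<Rightarrow> is_end V A B F G e l" using assms unfolding has_ends_def by simp
 from someI_ex[OF this] show ?thesis
  unfolding vend_def[symmetric] End_def end_pr_def by (simp add: case_prod_beta)
qed

lemma End_simps:
 assumes "has_ends A B" "vfunctor V A B F" "vfunctor V A B G"
 shows "End V A B F G : Ob V" "a : VOb A ==> end_pr V A B F G a : Ar V"
  "a : VOb A ==> Dom V (end_pr V A B F G a) = End V A B F G"
  "a : VOb A ==> Cod V (end_pr V A B F G a) = VHom B (VFOb F a) (VFOb G a)"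
 using is_end[OF assms] unfolding is_end_def is_wedge_def by auto

lemma end_lift:
 assumes "has_ends A B" "vfunctor V A B F" "vfunctor V A B G" "is_wedge V A B F G x w"
 shows "end_lift V A B F G x w : Ar V" "Dom V (end_lift V A B F G x w) = x"
  "Cod V (end_lift V A B F G x w) = End V A B F G"
  "a : VOb A ==> end_pr V A B F G a o end_lift V A B F G x w = w a"
proof -
 have "\<exists>!h. h : x ~> End V A B F G \<and> (\<forall>a \<in> VOb A. end_pr V A B F G a o h = w a)"
  using is_end[OF assms(1-3)] assms(4) unfolding is_end_def by blast
 from theI'[OF this] show "end_lift V A B F G x w : Ar V" "Dom V (end_lift V A B F G x w) = x"
  "Cod V (end_lift V A B F G x w) = End V A B F G"
  "a : VOb A ==> end_pr V A B F G a o end_lift V A B F G x w = w a"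
  unfolding end_lift_def by auto
qed

lemma end_wedge:
 assumes "has_ends A B" "vfunctor V A B F" "vfunctor V A B G" "h : x ~> End V A B F G"
 shows "is_wedge V A B F G x (\<lambda>a. end_pr V A B F G a o h)"
 using wedge_precomp[OF assms(2,3) _ assms(4)] is_end[OF assms(1-3)] unfolding is_end_def by blast

lemma end_eqI:
 assumes "has_ends A B" "vfunctor V A B F" "vfunctor V A B G"
  "h : x ~> End V A B F G" "k : x ~> End V A B F G"
  "!!a. a : VOb A ==> end_pr V A B F G a o h = end_pr V A B F G a o k"
 shows "h = k"
proof -
 have "\<exists>!l. l : x ~> End V A B F G \<and> (\<forall>a \<in> VOb A. end_pr V A B F G a o l = end_pr V A B F G a o h)"
  using is_end[OF assms(1-3)] end_wedge[OF assms(1-4)] unfolding is_end_def by blast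
 then show ?thesis using assms(4-6) by metis
qed

lemma vfun_vcat_simps [simp]: "VOb (vfun_vcat V A B) = {F. vfunctor V A B F}"
  "VHom (vfun_vcat V A B) = End V A B" by (simp_all add: vfun_vcat_def)

lemma wedge_VCmp:
 assumes F: "vfunctor V A B F" and G: "vfunctor V A B G" and H: "vfunctor V A B H"
  and w: "is_wedge V A B F G x w" and v: "is_wedge V A B G H x v"
 shows "is_wedge V A B F H x (\<lambda>a. VCmp B (VFOb F a) (VFOb G a) (VFOb H a) o <|w a, v a|>)"
proof -
 interpret A: vcat V A by (unfold_locales) (rule vfunctorD(1)[OF F])
 interpret B: vcat V B by (unfold_locales) (rule vfunctorD(2)[OF F])
 note [simp] = vfunctorD(3-6)[OF F] vfunctorD(3-6)[OF G] vfunctorD(3-6)[OF H]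
 have t [simp]: "w a : Ar V" "Dom V (w a) = x" "Cod V (w a) = VHom B (VFOb F a) (VFOb G a)"
  "v a : Ar V" "Dom V (v a) = x" "Cod V (v a) = VHom B (VFOb G a) (VFOb H a)" if "a : VOb A" for a
  using w v that unfolding is_wedge_def by auto
 have w2: "VCmp B (VFOb F a) (VFOb F b) (VFOb G b) o <|VFHom F a b o f, w b o u|> =
    VCmp B (VFOb F a) (VFOb G a) (VFOb G b) o <|w a o u, VFHom G a b o f|>"
  if "a : VOb A" "b : VOb A" "u : z ~> x" "f : z ~> VHom A a b" for a b z u f
  using w that unfolding is_wedge_iff[OF F G] by blast
 have v2: "VCmp B (VFOb G a) (VFOb G b) (VFOb H b) o <|VFHom G a b o f, v b o u|> =
    VCmp B (VFOb G a) (VFOb H a) (VFOb H b) o <|v a o u, VFHom H a b o f|>"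
  if "a : VOb A" "b : VOb A" "u : z ~> x" "f : z ~> VHom A a b" for a b z u f
  using v that unfolding is_wedge_iff[OF G H] by blast
 show ?thesis unfolding is_wedge_iff[OF F H]
 proof (intro conjI ballI allI)
  show "x : Ob V" using w unfolding is_wedge_def by blast
  fix a b z u f assume o: "a : VOb A" "b : VOb A" "u : z ~> x" "f : z ~> VHom A a b"
  have "VCmp B (VFOb F a) (VFOb F b) (VFOb H b) o
     <|VFHom F a b o f, (VCmp B (VFOb F b) (VFOb G b) (VFOb H b) o <|w b, v b|>) o u|> =
    VCmp B (VFOb F a) (VFOb G b) (VFOb H b) o
    <|VCmp B (VFOb F a) (VFOb F b) (VFOb G b) o <|VFHom F a b o f, w b o u|>, v b o u|>"
   using o by simp
  also have "\<dots> = VCmp B (VFOb F a) (VFOb G a) (VFOb H b) o <|w a o u,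
    VCmp B (VFOb G a) (VFOb G b) (VFOb H b) o <|VFHom G a b o f, v b o u|>|>"
   unfolding w2[OF o] using o by simp
  also have "\<dots> = VCmp B (VFOb F a) (VFOb H a) (VFOb H b) o
    <|(VCmp B (VFOb F a) (VFOb G a) (VFOb H a) o <|w a, v a|>) o u, VFHom H a b o f|>"
   unfolding v2[OF o] using o by simp
  finally show "VCmp B (VFOb F a) (VFOb F b) (VFOb H b) o
     <|VFHom F a b o f, (VCmp B (VFOb F b) (VFOb G b) (VFOb H b) o <|w b, v b|>) o u|> =
   VCmp B (VFOb F a) (VFOb H a) (VFOb H b) o
    <|(VCmp B (VFOb F a) (VFOb G a) (VFOb H a) o <|w a, v a|>) o u, VFHom H a b o f|>" .
 qed simp
qed

lemma wedge_VId:
 assumes F: "vfunctor V A B F" shows "is_wedge V A B F F (terminal V) (\<lambda>a. VId B (VFOb F a))"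
proof -
 interpret A: vcat V A by (unfold_locales) (rule vfunctorD(1)[OF F])
 interpret B: vcat V B by (unfold_locales) (rule vfunctorD(2)[OF F])
 note [simp] = vfunctorD(3-6)[OF F]
 have u: "u = bang V x" if "u : x ~> terminal V" for u x
  using that Dom_Ob[of u] by (intro terminal_eqI[of _ x]) auto
 show ?thesis unfolding is_wedge_iff[OF F F]
 proof (intro conjI ballI allI)
  fix a b y u f assume o: "a : VOb A" "b : VOb A" "u : y ~> terminal V" "f : y ~> VHom A a b"
  have "y : Ob V" using o by auto
  then show "VCmp B (VFOb F a) (VFOb F b) (VFOb F b) o <|VFHom F a b o f, VId B (VFOb F b) o u|> =
    VCmp B (VFOb F a) (VFOb F a) (VFOb F b) o <|VId B (VFOb F a) o u, VFHom F a b o f|>"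
   unfolding u[OF o(3)] using o by simp
 qed simp_all
qed

lemma vfun_vcat_VCmp:
 assumes "has_ends A B" "vfunctor V A B F" "vfunctor V A B G" "vfunctor V A B H"
 shows "VCmp (vfun_vcat V A B) F G H : Prod V (End V A B F G) (End V A B G H) ~> End V A B F H"
  "[|a : VOb A; h : Ar V; k : Ar V; Dom V h = Dom V k; Cod V h = End V A B F G; Cod V k = End V A B G H|] ==>
   end_pr V A B F H a o (VCmp (vfun_vcat V A B) F G H o <|h, k|>) =
   VCmp B (VFOb F a) (VFOb G a) (VFOb H a) o <|end_pr V A B F G a o h, end_pr V A B G H a o k|>"
proof -
 interpret A: vcat V A by (unfold_locales) (rule vfunctorD(1)[OF assms(2)])
 interpret B: vcat V B by (unfold_locales) (rule vfunctorD(2)[OF assms(2)])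
 note [simp] = vfunctorD(3-6)[OF assms(2)] vfunctorD(3-6)[OF assms(3)] vfunctorD(3-6)[OF assms(4)]
  End_simps[OF assms(1,2,3)] End_simps[OF assms(1,3,4)] End_simps[OF assms(1,2,4)]
 let ?P = "Prod V (End V A B F G) (End V A B G H)"
 let ?w = "\<lambda>a. VCmp B (VFOb F a) (VFOb G a) (VFOb H a) o cross V (end_pr V A B F G a) (end_pr V A B G H a)"
 let ?w' = "\<lambda>a. VCmp B (VFOb F a) (VFOb G a) (VFOb H a) o <|end_pr V A B F G a o pr1 V (End V A B F G) (End V A B G H),
   end_pr V A B G H a o pr2 V (End V A B F G) (End V A B G H)|>"
 have e: "VCmp (vfun_vcat V A B) F G H = end_lift V A B F H ?P ?w" by (simp add: vfun_vcat_def del: cross_def)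
 have "is_wedge V A B F H ?P ?w'"
  using assms by (intro wedge_VCmp end_wedge) auto
 then have w: "is_wedge V A B F H ?P ?w"
  by (subst wedge_cong[of A ?w ?w']) auto
 note l = end_lift[OF assms(1,2,4) w]
 show "VCmp (vfun_vcat V A B) F G H : ?P ~> End V A B F H" unfolding e using l by simp
 assume t: "a : VOb A" "h : Ar V" "k : Ar V" "Dom V h = Dom V k" "Cod V h = End V A B F G" "Cod V k = End V A B G H"
 show "end_pr V A B F H a o (VCmp (vfun_vcat V A B) F G H o <|h, k|>) =
   VCmp B (VFOb F a) (VFOb G a) (VFOb H a) o <|end_pr V A B F G a o h, end_pr V A B G H a o k|>"
  unfolding e using arg_cong[OF l(4)[OF t(1)], of "\<lambda>t. t o <|h, k|>"] l(1-3) t by simp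
qed

lemma vfun_vcat_VId:
 assumes "has_ends A B" "vfunctor V A B F"
 shows "VId (vfun_vcat V A B) F : terminal V ~> End V A B F F"
  "[|a : VOb A|] ==> end_pr V A B F F a o VId (vfun_vcat V A B) F = VId B (VFOb F a)"
  "[|a : VOb A; u : Ar V; Cod V u = terminal V|] ==>
    end_pr V A B F F a o (VId (vfun_vcat V A B) F o u) = VId B (VFOb F a) o u"
proof -
 note l = end_lift[OF assms(1,2,2) wedge_VId[OF assms(2)]]
 note s = End_simps[OF assms(1,2,2)]
 have e: "VId (vfun_vcat V A B) F = end_lift V A B F F (terminal V) (\<lambda>a. VId B (VFOb F a))" by (simp add: vfun_vcat_def)
 show "VId (vfun_vcat V A B) F : terminal V ~> End V A B F F" unfolding e using l by simp
 show 1: "[|a : VOb A|] ==> end_pr V A B F F a o VId (vfun_vcat V A B) F = VId B (VFOb F a)"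
  unfolding e using l(4)[of a] by simp
 show "[|a : VOb A; u : Ar V; Cod V u = terminal V|] ==>
    end_pr V A B F F a o (VId (vfun_vcat V A B) F o u) = VId B (VFOb F a) o u"
  using 1 l(1-3) s unfolding e by (metis Cmp_Cmp)
qed

lemma vfun_vcat_vcategory:
 assumes e: "has_ends A B" and A: "vcategory V A" and B: "vcategory V B"
 shows "vcategory V (vfun_vcat V A B)"
proof -
 interpret A: vcat V A by (unfold_locales) (rule A)
 interpret B: vcat V B by (unfold_locales) (rule B)
 let ?D = "vfun_vcat V A B"
 have Ct: "VCmp ?D F G H : Ar V" "Dom V (VCmp ?D F G H) = Prod V (End V A B F G) (End V A B G H)"
  "Cod V (VCmp ?D F G H) = End V A B F H" if "vfunctor V A B F" "vfunctor V A B G" "vfunctor V A B H" for F G H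
  using vfun_vcat_VCmp(1)[OF e that] by auto
 have It: "VId ?D F : Ar V" "Dom V (VId ?D F) = terminal V"
  "Cod V (VId ?D F) = End V A B F F" if "vfunctor V A B F" for F
  using vfun_vcat_VId(1)[OF e that] by auto
 note [simp] = End_simps[OF e] vfun_vcat_VCmp(2)[OF e] vfun_vcat_VId(3)[OF e] Ct It vfunctorD(3-6)
 show ?thesis
 proof (rule vcategoryI)
  fix F G H K x f g h assume *: "F : VOb ?D" "G : VOb ?D" "H : VOb ?D" "K : VOb ?D"
   "f : x ~> VHom ?D F G" "g : x ~> VHom ?D G H" "h : x ~> VHom ?D H K"
  show "VCmp ?D F H K o <|VCmp ?D F G H o <|f, g|>, h|> = VCmp ?D F G K o <|f, VCmp ?D G H K o <|g, h|>|>"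
   by (rule end_eqI[OF e, of F K _ x]) (use * in simp_all)
 next
  fix F G x f assume *: "F : VOb ?D" "G : VOb ?D" "f : x ~> VHom ?D F G"
  then have x: "x : Ob V" by auto
  show "VCmp ?D F F G o <|VId ?D F o bang V x, f|> = f" "VCmp ?D F G G o <|f, VId ?D G o bang V x|> = f"
   by (rule end_eqI[OF e, of F G _ x]; use * x in simp)+
 qed simp_all
qed

end

section \<open>Coproducts in extensive categories\<close>

text \<open>Extensivity speaks of families indexed by subsets of the type \<^typ>\<open>'i\<close>.  The arrows of an internal category
 are indexed by pairs, so index sets are only required to embed into that type.\<close>

definition small :: "'i itself \<Rightarrow> 'k set \<Rightarrow> bool" where
 "small _ I \<longleftrightarrow> (\<exists>\<phi> :: 'k \<Rightarrow> 'i. inj_on \<phi> I)"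

context category
begin

lemma Cmp_eq_precomp:
 "[|a o b = c o d; a : Ar K; b : Ar K; c : Ar K; d : Ar K; Cod K b = Dom K a; Cod K d = Dom K c;
  r : Ar K; Cod K r = Dom K b; Cod K r = Dom K d|] ==> a o (b o r) = c o (d o r)"
 by (metis Cmp_Cmp)

lemma Hom_Ob: "f : Hom K a b ==> a : Ob K" "f : Hom K a b ==> b : Ob K"
 by auto

lemma coproductD:
 assumes "is_coproduct K I X q j"
 shows "q : Ob K" "i : I ==> j i : Ar K" "i : I ==> Dom K (j i) = X i" "i : I ==> Cod K (j i) = q"
  "i : I ==> X i : Ob K"
proof -
 have *: "\<forall>i \<in> I. j i : Hom K (X i) q" "q : Ob K" using assms unfolding is_coproduct_def by blast+
 then show "q : Ob K" "i : I ==> j i : Ar K" "i : I ==> Dom K (j i) = X i" "i : I ==> Cod K (j i) = q"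
  by simp_all
 show "i : I ==> X i : Ob K" using * Hom_Ob by blast
qed

lemma coproduct_ex1:
 assumes "is_coproduct K I X q j" "y : Ob K" "!!i. i : I ==> f i : Hom K (X i) y"
 shows "\<exists>!h. h : Hom K q y \<and> (\<forall>i \<in> I. h o j i = f i)"
 using assms unfolding is_coproduct_def by blast

lemma coproduct_ex:
 assumes "is_coproduct K I X q j" "y : Ob K" "!!i. i : I ==> f i : Hom K (X i) y"
 obtains h where "h : Hom K q y" "!!i. i : I ==> h o j i = f i"
 using coproduct_ex1[OF assms] that by blast

lemma coproduct_eqI:
 assumes "is_coproduct K I X q j" "h : Hom K q y" "k : Hom K q y" "!!i. i : I ==> h o j i = k o j i"
 shows "h = k"
proof -
 have y: "y : Ob K" using assms(2) by auto
 let ?P = "\<lambda>l. l : Hom K q y \<and> (\<forall>i \<in> I. l o j i = h o j i)"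
 have "h o j i : Hom K (X i) y" if "i : I" for i using assms(2) coproductD[OF assms(1)] that by simp
 then have "\<exists>!l. ?P l" by (rule coproduct_ex1[OF assms(1) y])
 moreover have "?P h" "?P k" using assms(2-4) by simp_all
 ultimately show ?thesis by blast
qed

lemma coproductI:
 assumes "q : Ob K" "!!i. i : I ==> j i : Hom K (X i) q"
  and "!!y f. y : Ob K ==> (!!i. i : I ==> f i : Hom K (X i) y) ==> \<exists>h. h : Hom K q y \<and> (\<forall>i\<in>I. h o j i = f i)"
  and "!!y h k. h : Hom K q y ==> k : Hom K q y ==> (!!i. i : I ==> h o j i = k o j i) ==> h = k"
 shows "is_coproduct K I X q j"
 unfolding is_coproduct_def
proof (intro conjI allI impI ballI)
 fix y f assume y: "y : Ob K" "\<forall>i\<in>I. f i : Hom K (X i) y"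
 then obtain h where h: "h : Hom K q y \<and> (\<forall>i\<in>I. h o j i = f i)" using assms(3)[of y f] by blast
 show "\<exists>!h. h : Hom K q y \<and> (\<forall>i\<in>I. h o j i = f i)"
  using assms(4)[of _ y h] h by (intro ex1I[of _ h]) auto
qed (use assms in blast)+

lemma coproduct_iso:
 assumes c: "is_coproduct K I X q j" and h: "h : Hom K q y" "k : Hom K y q" "k o h = Idn K q" "h o k = Idn K y"
 shows "is_coproduct K I X y (\<lambda>i. h o j i)"
proof -
 note [simp] = coproductD[OF c]
 have kh: "k o (h o t) = t" if "t : Ar K" "Cod K t = q" for t
  using arg_cong[OF h(3), of "\<lambda>s. s o t"] h(1,2) that by simp
 show ?thesis
 proof (rule coproductI)
  fix w f assume "w : Ob K" "!!i. i : I ==> f i : Hom K (X i) w"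
  then obtain m where m: "m : Hom K q w" "!!i. i : I ==> m o j i = f i" using coproduct_ex[OF c] by metis
  show "\<exists>m. m : Hom K y w \<and> (\<forall>i\<in>I. m o (h o j i) = f i)"
   using m h by (intro exI[of _ "m o k"]) (simp add: kh)
 next
  fix w l m assume *: "l : Hom K y w" "m : Hom K y w" "!!i. i : I ==> l o (h o j i) = m o (h o j i)"
  have "l o h = m o h" by (rule coproduct_eqI[OF c, of _ w]) (use * h in simp_all)
  then have "(l o h) o k = (m o h) o k" by simp
  then show "l = m" using * h by simp
 qed (use h in auto)
qed

lemma coproduct_reindex:
 assumes c: "is_coproduct K (\<phi> ` I) X q j" and \<phi>: "inj_on \<phi> I" "!!i. i : I ==> X (\<phi> i) = Y i"
 shows "is_coproduct K I Y q (\<lambda>i. j (\<phi> i))"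
proof -
 note [simp] = coproductD[OF c]
 show ?thesis
 proof (rule coproductI)
  fix w f assume "w : Ob K" "!!i. i : I ==> f i : Hom K (Y i) w"
  note f = this
  have "f (inv_into I \<phi> i) : Hom K (X i) w" if i: "i : \<phi> ` I" for i
  proof -
   obtain k where k: "k : I" "i = \<phi> k" using i by blast
   then show ?thesis using f(2)[OF k(1)] \<phi> by (simp add: inv_into_f_f)
  qed
  then obtain m where m: "m : Hom K q w" "!!i. i : \<phi> ` I ==> m o j i = f (inv_into I \<phi> i)"
   by (rule coproduct_ex[OF c f(1)]) blast+
  then show "\<exists>m. m : Hom K q w \<and> (\<forall>i\<in>I. m o (j (\<phi> i)) = f i)"
   using \<phi>(1) by (intro exI[of _ m]) simp
 next
  fix w l m assume lm: "l : Hom K q w" "m : Hom K q w" "!!i. i : I ==> l o j (\<phi> i) = m o j (\<phi> i)"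
  show "l = m" by (rule coproduct_eqI[OF c lm(1,2)]) (use lm(3) in blast)
 qed (use \<phi>(2) in simp_all)
qed

lemma coproduct_unique_iso:
 assumes c: "is_coproduct K I X q j" and d: "is_coproduct K I X p k"
 obtains h h' where "h : Hom K q p" "h' : Hom K p q" "h' o h = Idn K q" "h o h' = Idn K p"
  "!!i. i : I ==> h o j i = k i" "!!i. i : I ==> h' o k i = j i"
proof -
 note [simp] = coproductD[OF c] coproductD[OF d]
 obtain h where h: "h : Hom K q p" "!!i. i : I ==> h o j i = k i" using coproduct_ex[OF c, of p k] by auto
 obtain h' where h': "h' : Hom K p q" "!!i. i : I ==> h' o k i = j i" using coproduct_ex[OF d, of q j] by auto
 show ?thesis
  by (rule that[OF h(1) h'(1) coproduct_eqI[OF c, of _ q] coproduct_eqI[OF d, of _ p]]) (use h h' in auto)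
qed

text \<open>Initial objects.  In an extensive category they are the stages where two different summands of a
 coproduct meet.\<close>

definition void where
 "void z \<longleftrightarrow> z : Ob K \<and> (\<forall>w \<in> Ob K. \<exists>!h. h : Hom K z w)"

lemma void_eqI: "void z ==> h : Hom K z w ==> k : Hom K z w ==> h = k"
 unfolding void_def by (metis Cod_Ob Hom_iff)

lemma void_iff: "void z \<longleftrightarrow> is_coproduct K {} X z j"
 unfolding void_def is_coproduct_def by simp

lemma slice_simps [simp]: "Ob (slice K x) = {p \<in> Ar K. Cod K p = x}"
 "Dom (slice K x) (p, q, h) = p" "Cod (slice K x) (p, q, h) = q"
 "Idn (slice K x) p = (p, p, Idn K (Dom K p))"
 "(q', r, k) o\<^bsub>slice K x\<^esub> (p, q, h) = (p, r, k o h)"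
 "(p, q, h) : Ar (slice K x) \<longleftrightarrow> p : Ar K \<and> Cod K p = x \<and> q : Ar K \<and> Cod K q = x \<and>
   h : Hom K (Dom K p) (Dom K q) \<and> q o h = p"
 by (simp_all add: slice_def)

lemma slice_category: "category (slice K x)"
proof
 fix f a b assume f: "f : Hom (slice K x) a b"
 then obtain h where "f = (a, b, h)" "(a, b, h) : Ar (slice K x)" by (cases f) auto
 then show "f o\<^bsub>slice K x\<^esub> Idn (slice K x) a = f" "Idn (slice K x) b o\<^bsub>slice K x\<^esub> f = f" by simp_all
next
 fix f g a b c assume "f : Hom (slice K x) a b" "g : Hom (slice K x) b c"
 then obtain h k where "f = (a, b, h)" "(a, b, h) : Ar (slice K x)" "g = (b, c, k)" "(b, c, k) : Ar (slice K x)"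
  by (cases f; cases g) auto
 then show "g o\<^bsub>slice K x\<^esub> f : Hom (slice K x) a c" by (simp flip: Cmp_Cmp)
next
 fix f g h a b c d assume "f : Hom (slice K x) a b" "g : Hom (slice K x) b c" "h : Hom (slice K x) c d"
 then obtain f' g' h' where "f = (a, b, f')" "(a, b, f') : Ar (slice K x)" "g = (b, c, g')"
  "(b, c, g') : Ar (slice K x)" "h = (c, d, h')" "(c, d, h') : Ar (slice K x)"
  by (cases f; cases g; cases h) auto
 then show "h o\<^bsub>slice K x\<^esub> (g o\<^bsub>slice K x\<^esub> f) = (h o\<^bsub>slice K x\<^esub> g) o\<^bsub>slice K x\<^esub> f" by simp
qed (auto simp: slice_def)

lemma slice_isoE:
 assumes "is_iso (slice K x) (p, q, h)"
 obtains k where "k : Hom K (Dom K q) (Dom K p)" "k o h = Idn K (Dom K p)" "h o k = Idn K (Dom K q)"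
proof -
 obtain g where "g : Hom (slice K x) q p" "g o\<^bsub>slice K x\<^esub> (p, q, h) = Idn (slice K x) p"
  "(p, q, h) o\<^bsub>slice K x\<^esub> g = Idn (slice K x) q"
  using assms unfolding is_iso_def slice_simps by blast
 moreover obtain k where "g = (q, p, k)" using calculation(1) by (cases g) auto
 ultimately show ?thesis using that[of k] by simp
qed

end

locale ext_ccc = ccc_pb V for V :: "('o, 'm) cat" (structure) +
 fixes U :: "'i itself"
 assumes extensive: "extensive U V" and infinite: "infinite (UNIV :: 'i set)"
begin

lemma extensiveD:
 fixes I :: "'i set"
 assumes "!!i. i : I ==> X i : Ob V"
 shows "\<exists>q j. is_coproduct V I X q j"
  "is_equivalence (prod_cat I (\<lambda>i. slice V (X i))) (slice V (Coprod V I X)) (coprod_functor V I X)"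
 using extensive assms unfolding extensive_def by blast+

lemma small_index [simp]: "small U (S :: 'i set)"
 unfolding small_def by (rule exI[of _ id]) simp

text \<open>This is where the infinity of the index type enters: pairs embed into it.\<close>

lemma small_square [simp]: "small U (S \<times> T :: ('i \<times> 'i) set)"
proof -
 have "(card_of (UNIV \<times> UNIV :: ('i \<times> 'i) set), card_of (UNIV :: 'i set)) : ordLeq"
  using card_of_Times_same_infinite[OF infinite] ordIso_imp_ordLeq by blast
 then obtain \<phi> :: "'i \<times> 'i \<Rightarrow> 'i" where "inj_on \<phi> (UNIV \<times> UNIV)"
  unfolding card_of_ordLeq[symmetric] by blast
 then show ?thesis unfolding small_def using inj_on_subset[of \<phi> "UNIV \<times> UNIV" "S \<times> T"] by blast
qed

lemma coproduct_exists:
 assumes "small U I" "!!i. i : I ==> X i : Ob V"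
 shows "\<exists>q j. is_coproduct V I X q j"
proof -
 obtain \<phi> where \<phi>: "inj_on (\<phi> :: _ \<Rightarrow> 'i) I" using assms(1) unfolding small_def by blast
 have "X (inv_into I \<phi> l) : Ob V" if "l : \<phi> ` I" for l using assms(2)[OF inv_into_into[OF that]] .
 from extensiveD(1)[of "\<phi> ` I" "\<lambda>l. X (inv_into I \<phi> l)", OF this]
 obtain q j where "is_coproduct V (\<phi> ` I) (\<lambda>l. X (inv_into I \<phi> l)) q j"
  by blast
 from coproduct_reindex[OF this \<phi>, of X] show ?thesis using \<phi> by (metis inv_into_f_f)
qed

lemma coproduct:
 assumes "small U I" "!!i. i : I ==> X i : Ob V"
 shows "is_coproduct V I X (Coprod V I X) (coin V I X)"
proof -
 have "\<exists>x. case x of (p, u) \<Rightarrow> is_coproduct V I X p u" using coproduct_exists[of I X] assms by simp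
 from someI_ex[OF this] show ?thesis
  unfolding coproduct_def[symmetric] Coprod_def coin_def by (simp add: case_prod_beta)
qed

lemma copair:
 assumes "small U I" "!!i. i : I ==> X i : Ob V" "y : Ob V" "!!i. i : I ==> f i : X i ~> y"
 shows "copair V I X y f : Ar V" "Dom V (copair V I X y f) = Coprod V I X" "Cod V (copair V I X y f) = y"
  "i : I ==> copair V I X y f o coin V I X i = f i"
  "i : I ==> r : Ar V ==> Cod V r = X i ==> copair V I X y f o (coin V I X i o r) = f i o r"
proof -
 note c = coproduct[of I X, OF assms(1,2)]
 have "\<exists>!h. h : Coprod V I X ~> y \<and> (\<forall>i \<in> I. h o coin V I X i = f i)"
  by (rule coproduct_ex1[OF c assms(3,4)])
 from theI'[OF this] show 1: "copair V I X y f : Ar V" "Dom V (copair V I X y f) = Coprod V I X" "Cod V (copair V I X y f) = y"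
  "i : I ==> copair V I X y f o coin V I X i = f i"
  unfolding copair_def by auto
 show "i : I ==> r : Ar V ==> Cod V r = X i ==> copair V I X y f o (coin V I X i o r) = f i o r"
  using 1 coproductD[OF c] Cmp_Cmp[of r "coin V I X i" "copair V I X y f"] by metis
qed

lemma coprod_map:
 assumes "small U I" "!!i. i : I ==> Y i : Ob V" "!!i. i : I ==> f i : X i ~> Y i"
 shows "coprod_map V I X Y f : Ar V" "Dom V (coprod_map V I X Y f) = Coprod V I X"
  "Cod V (coprod_map V I X Y f) = Coprod V I Y"
  "i : I ==> coprod_map V I X Y f o coin V I X i = coin V I Y i o f i"
  "i : I ==> r : Ar V ==> Cod V r = X i ==> coprod_map V I X Y f o (coin V I X i o r) = coin V I Y i o (f i o r)"
proof -
 note c = coproductD[OF coproduct[of I Y, OF assms(1,2)]]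
 have X: "X i : Ob V" if "i : I" for i using assms(3)[OF that] by (rule Hom_Ob)
 note p = copair[of I X "Coprod V I Y" "\<lambda>i. coin V I Y i o f i", OF assms(1) X]
 show "coprod_map V I X Y f : Ar V" "Dom V (coprod_map V I X Y f) = Coprod V I X"
  "Cod V (coprod_map V I X Y f) = Coprod V I Y"
  "i : I ==> coprod_map V I X Y f o coin V I X i = coin V I Y i o f i"
  "i : I ==> r : Ar V ==> Cod V r = X i ==> coprod_map V I X Y f o (coin V I X i o r) = coin V I Y i o (f i o r)"
  unfolding coprod_map_def using p c assms(3) by simp_all
qed

text \<open>Generalized elements of a coproduct lie in summands locally: essential surjectivity of the coproduct
 functor writes the map \<^term>\<open>f\<close>, as an object of the slice, as a coproduct of maps into the summands.\<close>

lemma coproduct_cover: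
 assumes s: "small U I" and c: "is_coproduct V I X q j" and f: "f : y ~> q"
 obtains Z k g where "is_coproduct V I Z y k"
  "!!i. i : I ==> k i : Z i ~> y" "!!i. i : I ==> g i : Z i ~> X i"
  "!!i. i : I ==> f o k i = j i o g i"
proof -
 obtain \<phi> where \<phi>: "inj_on (\<phi> :: _ \<Rightarrow> 'i) I" using s unfolding small_def by blast
 let ?J = "\<phi> ` I" let ?X = "\<lambda>l. X (inv_into I \<phi> l)" let ?S = "\<lambda>l. slice V (?X l)"
 have oX: "!!l. l : ?J ==> ?X l : Ob V" by (rule coproductD(5)[OF c inv_into_into])
 have c1: "is_coproduct V ?J ?X (Coprod V ?J ?X) (coin V ?J ?X)" by (rule coproduct[OF small_index oX])
 have c2: "is_coproduct V I X (Coprod V ?J ?X) (\<lambda>i. coin V ?J ?X (\<phi> i))"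
  by (rule coproduct_reindex[OF c1 \<phi>]) (subst inv_into_f_f[OF \<phi>], assumption, rule refl)
 obtain h h' where h: "h : Coprod V ?J ?X ~> q" "h' : q ~> Coprod V ?J ?X" "h' o h = Idn V (Coprod V ?J ?X)"
   "h o h' = Idn V q" "!!i. i : I ==> h o coin V ?J ?X (\<phi> i) = j i"
  using coproduct_unique_iso[OF c2 c] by metis
 have hf: "h' o f : Ob (slice V (Coprod V ?J ?X))" using h f by simp
 have eq: "is_equivalence (prod_cat ?J ?S) (slice V (Coprod V ?J ?X)) (coprod_functor V ?J ?X)"
  by (rule extensiveD(2)[OF oX])
 obtain p e where p: "p : Ob (prod_cat ?J ?S)"
   and e: "e : Hom (slice V (Coprod V ?J ?X)) (FOb (coprod_functor V ?J ?X) p) (h' o f)"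
    "is_iso (slice V (Coprod V ?J ?X)) e"
  using equivalence_essentially_surjective[OF eq hf] by blast
 let ?Z = "\<lambda>l. Dom V (p l)"
 have pt: "p l : ?Z l ~> ?X l" if "l : ?J" for l
 proof -
  have "p : (\<Pi>\<^sub>E l\<in>?J. Ob (?S l))" using p by (simp only: prod_cat_def cat.select_convs)
  from PiE_mem[OF this that] have "p l : Ob (?S l)" .
  then show ?thesis by simp
 qed
 note m = coprod_map[of ?J ?X p ?Z, OF small_index oX pt]
 have Fp: "FOb (coprod_functor V ?J ?X) p = coprod_map V ?J ?Z ?X p"
  using p by (simp add: coprod_functor_def Let_def)
 obtain e3 where e3: "e = (coprod_map V ?J ?Z ?X p, h' o f, e3)"
   "e3 : Coprod V ?J ?Z ~> y" "(h' o f) o e3 = coprod_map V ?J ?Z ?X p"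
  using e(1) h f m(2) unfolding Fp by (cases e) auto
 obtain k where k: "k : y ~> Coprod V ?J ?Z" "k o e3 = Idn V (Coprod V ?J ?Z)" "e3 o k = Idn V y"
 proof -
  have "Dom V (h' o f) = y" using h f by simp
  then show thesis using slice_isoE[OF e(2)[unfolded e3(1)]] m(2) that by metis
 qed
 have "!!l. l : ?J ==> ?Z l : Ob V" by (rule Hom_Ob(1)[OF pt])
 then have cZ: "is_coproduct V ?J ?Z (Coprod V ?J ?Z) (coin V ?J ?Z)" by (rule coproduct[OF small_index])
 note cy = coproduct_reindex[OF coproduct_iso[OF cZ e3(2) k] \<phi> refl]
 show ?thesis
 proof (rule that[OF cy])
  fix i assume i: "i : I"
  show "e3 o coin V ?J ?Z (\<phi> i) : ?Z (\<phi> i) ~> y" using coproductD[OF cZ] i e3 by simp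
  show "p (\<phi> i) : ?Z (\<phi> i) ~> X i" using pt[of "\<phi> i"] i \<phi> by simp
  have t: "e3 : Ar V" "Dom V e3 = Coprod V ?J ?Z" "Cod V e3 = y" "h : Ar V" "h' : Ar V" "Dom V h' = q"
   "Cod V h' = Dom V h" "Dom V h = Coprod V ?J ?X" "f : Ar V" "Dom V f = y" "Cod V f = q" using e3 h f by auto
  have "f o (e3 o coin V ?J ?Z (\<phi> i)) = (h o h') o (f o (e3 o coin V ?J ?Z (\<phi> i)))"
   unfolding h(4) using t coproductD[OF cZ] i by simp
  also have "\<dots> = h o (((h' o f) o e3) o coin V ?J ?Z (\<phi> i))"
   using t coproductD[OF cZ] i by simp
  also have "\<dots> = h o (coin V ?J ?X (\<phi> i) o p (\<phi> i))" unfolding e3(3) using m(4)[of "\<phi> i"] i by simp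
  also have "\<dots> = (h o coin V ?J ?X (\<phi> i)) o p (\<phi> i)"
   using t coproductD[OF c1] i pt[of "\<phi> i"] by simp
  finally show "f o (e3 o coin V ?J ?Z (\<phi> i)) = j i o p (\<phi> i)" using h(5)[OF i] by simp
 qed
qed

definition zero where "zero = Coprod V ({} :: 'i set) (\<lambda>_. undefined)"

lemma void_zero: "void zero"
 unfolding zero_def by (rule void_iff[THEN iffD2, OF coproduct]) simp_all

text \<open>A map into the empty coproduct exhibits its domain as an empty coproduct too.\<close>

lemma void_if_zero: assumes "f : z ~> zero" shows "void z"
proof -
 have c: "is_coproduct V ({} :: 'i set) (\<lambda>_. undefined) zero undefined" using void_zero void_iff by blast
 obtain Z k where "is_coproduct V ({} :: 'i set) Z z k" using coproduct_cover[OF small_index c assms] by metis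
 then show ?thesis using void_iff by blast
qed

lemma void_strict: assumes "void z" "f : y ~> z" shows "void y"
proof -
 have "zero : Ob V" using void_zero unfolding void_def by blast
 then obtain g where "g : z ~> zero" using assms(1) unfolding void_def by blast
 then show ?thesis using assms(2) void_if_zero[of "g o f"] by simp
qed

text \<open>Disjointness and monicity of the summands, in one statement about elements.  A map into one summand is
 also a map of coproducts, given by that map on the summand and by the empty coproduct elsewhere.  If two such maps
 are equal in the total coproduct, then fullness of the coproduct functor yields a map between their domains in each summand:
 a map into the empty coproduct if the summands differ, and the identity if they agree.\<close>

lemma coproduct_inclusions_chosen:
 fixes I :: "'i set"
 assumes oX: "!!i. i : I ==> X i : Ob V" and i: "i : I" and k: "k : I"
  and r: "r : z ~> X i" and r': "r' : z ~> X k"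
  and eq: "coin V I X i o r = coin V I X k o r'"
 shows "(i = k \<and> r = r') \<or> void z"
proof -
 note cX = coproductD[OF coproduct[of I X, OF small_index oX]]
 have z: "z : Ob V" using r by auto
 have zo: "zero : Ob V" using void_zero unfolding void_def by blast
 define ini where "ini w = (THE h. h : zero ~> w)" for w
 have "ini w : zero ~> w" if "w : Ob V" for w
 proof -
  have "\<exists>!h. h : zero ~> w" using void_zero that unfolding void_def by blast
  from theI'[OF this] show ?thesis unfolding ini_def .
 qed
 then have ini: "ini w : Ar V" "Dom V (ini w) = zero" "Cod V (ini w) = w" if "w : Ob V" for w using that by auto
 define P where "P n s = (\<lambda>l\<in>I. if l = n then s else ini (X l))" for n s
 define Z where "Z n = (\<lambda>l. if l = n then z else zero)" for n :: 'i
 have Z: "Z n l : Ob V" for n l using z zo by (simp add: Z_def)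
 have P: "P n s l : Z n l ~> X l" if "s : z ~> X n" "l : I" for n s l
  using that ini oX by (simp add: P_def Z_def)
 have PO: "P n s : Ob (prod_cat I (\<lambda>i. slice V (X i)))" if "s : z ~> X n" for n s
  using P[OF that] by (auto simp: prod_cat_def P_def simp del: Hom_iff simp: Hom_def)
 have DP: "Coprod V I (\<lambda>l. Dom V (P n s l)) = Coprod V I (Z n)"
   "coprod_map V I (\<lambda>l. Dom V (P n s l)) X (P n s) = coprod_map V I (Z n) X (P n s)"
   "coin V I (\<lambda>l. Dom V (P n s l)) = coin V I (Z n)" if "s : z ~> X n" for n s
 proof -
  have "is_coproduct V I (\<lambda>l. Dom V (P n s l)) = is_coproduct V I (Z n)"
   using P[OF that] unfolding is_coproduct_def by (intro ext) simp
  then show "Coprod V I (\<lambda>l. Dom V (P n s l)) = Coprod V I (Z n)"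
    "coprod_map V I (\<lambda>l. Dom V (P n s l)) X (P n s) = coprod_map V I (Z n) X (P n s)"
    "coin V I (\<lambda>l. Dom V (P n s l)) = coin V I (Z n)"
   by (simp_all add: Coprod_def coin_def coprod_map_def copair_def coproduct_def)
 qed
 note cZ = coproductD[OF coproduct[of I "Z n" for n, OF small_index Z]]
 define c where "c n = copair V I (Z n) z (\<lambda>l. if l = n then Idn V z else ini z)" for n
 have "(if l = n then Idn V z else ini z) : Z n l ~> z" for l n using z ini by (simp add: Z_def)
 note cs = copair[of I "Z n" z "\<lambda>l. if l = n then Idn V z else ini z" for n, OF small_index Z z this, folded c_def]
 have c1: "c n o coin V I (Z n) n = Idn V z" if "n : I" for n using cs(4)[of n n] that by simp
 have S: "coprod_map V I (Z n) X (P n s) = (coin V I X n o s) o c n" if s: "s : z ~> X n" "n : I" for n s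
 proof (rule coproduct_eqI[OF coproduct[of I "Z n", OF small_index Z], of _ "Coprod V I X"])
  note m = coprod_map[of I X "P n s" "Z n", OF small_index oX P[OF s(1)]]
  show "coprod_map V I (Z n) X (P n s) : Coprod V I (Z n) ~> Coprod V I X" using m by simp
  show "(coin V I X n o s) o c n : Coprod V I (Z n) ~> Coprod V I X" using s cs cX by simp
  fix l assume l: "l : I"
  show "coprod_map V I (Z n) X (P n s) o coin V I (Z n) l = ((coin V I X n o s) o c n) o coin V I (Z n) l"
  proof (cases "l = n")
   case True
   then show ?thesis using m(4)[of l] l s c1 cs(1-3) cX cZ l z by (simp add: P_def Z_def)
  next
   case False
   then have "Z n l = zero" by (simp add: Z_def)
   then show ?thesis
    using m(1-3) s cX cs(1-3) cZ l by (intro void_eqI[OF void_zero, of _ "Coprod V I X"]) simp_all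
  qed
 qed
 let ?h = "coin V I (Z k) k o c i"
 let ?D = "prod_cat I (\<lambda>i. slice V (X i))"
 have h: "(coprod_map V I (Z i) X (P i r), coprod_map V I (Z k) X (P k r'), ?h) \<in>
   Hom (slice V (Coprod V I X)) (FOb (coprod_functor V I X) (P i r)) (FOb (coprod_functor V I X) (P k r'))"
 proof -
  note m = coprod_map[of I X "P i r" "Z i", OF small_index oX P[OF r]] coprod_map[of I X "P k r'" "Z k", OF small_index oX P[OF r']]
  have "coprod_map V I (Z k) X (P k r') o ?h = (coin V I X k o r') o ((c k o coin V I (Z k) k) o c i)"
   unfolding S[OF r' k] using r' k i cs(1-3) cZ cX z by (simp add: Z_def)
  also have "\<dots> = coprod_map V I (Z i) X (P i r)"
   unfolding c1[OF k] S[OF r i] eq using r' k i cs(1-3) cZ cX z by (simp add: Z_def)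
  finally show ?thesis
   using PO[OF r] PO[OF r'] m cs(1-3) cZ k DP[OF r] DP[OF r'] by (simp add: coprod_functor_def Let_def Z_def)
 qed
 have e: "is_equivalence ?D (slice V (Coprod V I X)) (coprod_functor V I X)"
  by (rule extensiveD(2)[OF oX])
 from equivalence_full[OF e PO[OF r] PO[OF r'] h] obtain g where g: "g : Hom ?D (P i r) (P k r')"
  "FAr (coprod_functor V I X) g = (coprod_map V I (Z i) X (P i r), coprod_map V I (Z k) X (P k r'), ?h)" by blast
 have gA: "g : Ar ?D" "Dom ?D g = P i r" "Cod ?D g = P k r'" using g by auto
 have gl: "\<exists>m. g l = (P i r l, P k r' l, m) \<and> m : Z i l ~> Z k l \<and> P k r' l o m = P i r l" if l: "l : I" for l
 proof -
  obtain p q m where glm: "g l = (p, q, m)" by (cases "g l") auto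
  have "g l : Ar (slice V (X l))" using gA(1) l by (auto simp: prod_cat_def)
  moreover have "p = P i r l" using fun_cong[OF gA(2), of l] glm l by (simp add: prod_cat_def)
  moreover have "q = P k r' l" using fun_cong[OF gA(3), of l] glm l by (simp add: prod_cat_def)
  ultimately show ?thesis using glm P[OF r l] P[OF r' l] by auto
 qed
 define m where "m l = snd (snd (g l))" for l
 have m: "m l : Z i l ~> Z k l" "P k r' l o m l = P i r l" if "l : I" for l using gl[OF that] by (auto simp: m_def)
 have "coprod_map V I (\<lambda>l. Dom V (P i r l)) (\<lambda>l. Dom V (P k r' l)) m = ?h"
  using g(2) gA unfolding coprod_functor_def m_def by (simp add: Let_def)
 then have mh: "coprod_map V I (Z i) (Z k) m = ?h"
  unfolding coprod_map_def copair_def DP[OF r] DP[OF r'] .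
 show ?thesis
 proof (cases "i = k")
  case False
  then have "m i : z ~> zero" using m(1)[OF i] by (simp add: Z_def)
  then show ?thesis using void_if_zero by blast
 next
  case True
  have t: "m i : z ~> z" using m(1)[OF i] True by (simp add: Z_def)
  have "coprod_map V I (Z i) (Z k) m o coin V I (Z i) i = coin V I (Z k) i o m i"
   by (rule coprod_map(4)[OF small_index Z m(1) i])
  moreover have "?h o coin V I (Z i) i = coin V I (Z k) k"
   using c1[OF i] cs(1-3) cZ i k z by (simp add: Z_def)
  ultimately have "coin V I (Z k) k o m i = coin V I (Z k) k" unfolding mh using True by simp
  then have "c k o (coin V I (Z k) k o m i) = c k o coin V I (Z k) k" by simp
  then have "(c k o coin V I (Z k) k) o m i = c k o coin V I (Z k) k"
   using cs(1-3) cZ k t by (simp add: Z_def)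
  then have "m i = Idn V z" unfolding c1[OF k] using t by simp
  then have "r = r'" using m(2)[OF i] r' True i by (simp add: P_def)
  then show ?thesis using True by blast
 qed
qed

text \<open>An arbitrary small index set is replaced by its image in the index type.\<close>

lemma coproduct_inclusions:
 assumes s: "small U I" and c: "is_coproduct V I X q j" and ik: "i : I" "k : I"
  and r: "r : z ~> X i" "r' : z ~> X k" and eq: "j i o r = j k o r'"
 shows "(i = k \<and> r = r') \<or> void z"
proof -
 obtain \<phi> where \<phi>: "inj_on (\<phi> :: _ \<Rightarrow> 'i) I" using s unfolding small_def by blast
 let ?J = "\<phi> ` I" let ?X = "\<lambda>l. X (inv_into I \<phi> l)"
 have oX: "!!l. l : ?J ==> ?X l : Ob V" by (rule coproductD(5)[OF c inv_into_into])
 have c1: "is_coproduct V ?J ?X (Coprod V ?J ?X) (coin V ?J ?X)" by (rule coproduct[OF small_index oX])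
 have c2: "is_coproduct V I X (Coprod V ?J ?X) (\<lambda>i. coin V ?J ?X (\<phi> i))"
  by (rule coproduct_reindex[OF c1 \<phi>]) (subst inv_into_f_f[OF \<phi>], assumption, rule refl)
 obtain h where h: "h : q ~> Coprod V ?J ?X" "!!i. i : I ==> h o j i = coin V ?J ?X (\<phi> i)"
  using coproduct_unique_iso[OF c c2] by metis
 have "coin V ?J ?X (\<phi> i) o r = h o (j i o r)" 
  unfolding h(2)[OF ik(1), symmetric] using h(1) r ik coproductD[OF c] by simp
 also have "\<dots> = coin V ?J ?X (\<phi> k) o r'"
  unfolding h(2)[OF ik(2), symmetric] eq using h(1) r ik coproductD[OF c] by simp
 finally have e: "coin V ?J ?X (\<phi> i) o r = coin V ?J ?X (\<phi> k) o r'" .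
 have "(\<phi> i = \<phi> k \<and> r = r') \<or> void z"
  by (rule coproduct_inclusions_chosen[OF oX _ _ _ _ e]) (use ik r \<phi> in auto)
 then show ?thesis using \<phi> ik by (auto dest: inj_onD)
qed

lemma coproduct_mono:
 assumes "small U I" "is_coproduct V I X q j" "i : I" "r : z ~> X i" "r' : z ~> X i" "j i o r = j i o r'"
 shows "r = r'"
 using coproduct_inclusions[OF assms(1,2,3,3,4,5,6)] void_eqI assms(4,5) by blast

text \<open>The domain is the coproduct of the parts that \<^term>\<open>f\<close> sends to a summand, so an equation may be checked on
 these.\<close>

lemma coproduct_cases_eqI:
 assumes "small U I" "is_coproduct V I X q j" "f : y ~> q" "h : y ~> w" "k : y ~> w"
  "!!z r i g. i : I ==> r : z ~> y ==> g : z ~> X i ==> f o r = j i o g ==> h o r = k o r"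
 shows "h = k"
proof -
 obtain Z l g where c: "is_coproduct V I Z y l"
  "!!i. i : I ==> l i : Z i ~> y" "!!i. i : I ==> g i : Z i ~> X i"
  "!!i. i : I ==> f o l i = j i o g i" using coproduct_cover[OF assms(1-3)] by metis
 show ?thesis by (rule coproduct_eqI[OF c(1) assms(4,5)]) (rule assms(6)[OF _ c(2-4)])
qed

text \<open>Gluing.  A relation \<^term>\<open>R\<close> between maps into \<^term>\<open>y\<close> and maps into \<^term>\<open>w\<close> is read as a partial
 function on generalized elements of \<^term>\<open>y\<close>.  If it is stable under precomposition and is everywhere defined
 after passing to the pieces of coproduct decompositions, it comes from a map from \<^term>\<open>y\<close> to \<^term>\<open>w\<close>.\<close>

definition stable :: "('m \<Rightarrow> 'm \<Rightarrow> bool) \<Rightarrow> 'o \<Rightarrow> 'o \<Rightarrow> bool" where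
 "stable R y w \<longleftrightarrow> w : Ob V \<and> (\<forall>z r v. r : z ~> y --> R r v --> v : z ~> w \<and>
   (\<forall>x s. s : x ~> z --> R (r o s) (v o s)))"

definition glues :: "('m \<Rightarrow> 'm \<Rightarrow> bool) \<Rightarrow> 'o \<Rightarrow> 'o \<Rightarrow> bool" where
 "glues R y w \<longleftrightarrow> (\<exists>h \<in> Hom V y w. \<forall>z r v. r : z ~> y --> R r v --> h o r = v)"

lemma stable_precomp:
 assumes "stable R y w" "r : z ~> y" shows "stable (\<lambda>s. R (r o s)) z w"
 unfolding stable_def
proof (intro conjI allI impI)
 show "w : Ob V" using assms unfolding stable_def by blast
 fix x s v assume s: "s : x ~> z" "R (r o s) v"
 have rs: "r o s : x ~> y" using assms s by simp
 show "v : x ~> w" using assms(1) rs s(2) unfolding stable_def by blast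
 fix x' s' assume s': "s' : x' ~> x"
 have "R ((r o s) o s') (v o s')" using assms(1) rs s(2) s' unfolding stable_def by blast
 then show "R (r o (s o s')) (v o s')" using assms(2) s s' by simp
qed

lemma glues_defined:
 assumes "stable R y w" "!!z r v v'. r : z ~> y ==> R r v ==> R r v' ==> v = v'" "y : Ob V" "R (Idn V y) v"
 shows "glues R y w"
proof -
 have v: "v : y ~> w" "!!x s. s : x ~> y ==> R (Idn V y o s) (v o s)"
  using assms(1,3,4) Idn_Hom[OF assms(3)] unfolding stable_def by blast+
 have "v o r = v'" if "r : z ~> y" "R r v'" for z r v'
  using assms(2)[of r z] v(2)[OF that(1)] that by simp
 then show ?thesis unfolding glues_def using v(1) by blast
qed

lemma glues_void:
 assumes "stable R y w" "void y"
 shows "glues R y w"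
proof -
 obtain h where h: "h : y ~> w" using assms unfolding stable_def void_def by blast
 have "h o r = v" if r: "r : z ~> y" "R r v" for z r v
 proof (rule void_eqI[of z _ w])
  show "void z" using void_strict[OF assms(2) r(1)] .
  show "v : z ~> w" using assms(1) r unfolding stable_def by blast
 qed (use h r in simp)
 then show ?thesis unfolding glues_def using h by blast
qed

text \<open>Maps on the parts of a decomposition of \<^term>\<open>y\<close> assemble to a map on \<^term>\<open>y\<close>.\<close>

lemma glues_cases:
 assumes s: "small U I" and c: "is_coproduct V I X q j" and f: "f : y ~> q" and R: "stable R y w"
  and pieces: "!!z r i g. i : I ==> r : z ~> y ==> g : z ~> X i ==> f o r = j i o g ==> glues (\<lambda>s. R (r o s)) z w"
 shows "glues R y w"
proof -
 obtain Z l g where c': "is_coproduct V I Z y l"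
  and l: "!!i. i : I ==> l i : Z i ~> y" "!!i. i : I ==> g i : Z i ~> X i"
   "!!i. i : I ==> f o l i = j i o g i" using coproduct_cover[OF s c f] by metis
 have w: "w : Ob V" using R unfolding stable_def by blast
 have "\<forall>i \<in> I. \<exists>h. h : Z i ~> w \<and> (\<forall>z s v. s : z ~> Z i --> R (l i o s) v --> h o s = v)"
  using pieces[OF _ l] unfolding glues_def by blast
 then obtain h where h: "!!i. i : I ==> h i : Z i ~> w"
  "!!i z s v. i : I ==> s : z ~> Z i ==> R (l i o s) v ==> h i o s = v" by metis
 obtain k where k: "k : y ~> w" "!!i. i : I ==> k o l i = h i" using coproduct_ex[OF c' w h(1)] by blast
 have "k o r = v" if r: "r : z ~> y" and v: "R r v" for z r v
 proof -
  have vt: "v : z ~> w" using R r v unfolding stable_def by blast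
  show ?thesis
  proof (rule coproduct_cases_eqI[OF s c' r, of "k o r" w v])
   fix x t i u assume i: "i : I" and t: "t : x ~> z" and u: "u : x ~> Z i" and e: "r o t = l i o u"
   have "R (r o t) (v o t)" using R r v t unfolding stable_def by blast
   then have "h i o u = v o t" using h(2)[OF i u] e by simp
   moreover have "k o (l i o u) = (k o l i) o u" using k l(1)[OF i] u by simp
   ultimately have "k o (r o t) = v o t" unfolding e k(2)[OF i] by simp
   then show "(k o r) o t = v o t" using k r t by simp
  qed (use k r vt in simp_all)
 qed
 then show ?thesis unfolding glues_def using k(1) by blast
qed

text \<open>Two ways to apply gluing: values are prescribed on elements that factor through a summand, in one variable or
 in two.  Where several prescriptions apply, they agree or the stage is void.\<close>

lemma glues_single:
 assumes s: "small U I" and c: "is_coproduct V I X q j" and p: "p : y ~> q" and w: "w : Ob V"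
  and val: "!!z r i f. [|i : I; r : z ~> y; f : z ~> X i; p o r = j i o f|] ==>
   val i r f : z ~> w \<and> (\<forall>x s. s : x ~> z --> val i r f o s = val i (r o s) (f o s))"
 obtains h where "h : y ~> w"
  "!!z r i f. [|i : I; r : z ~> y; f : z ~> X i; p o r = j i o f|] ==> h o r = val i r f"
proof -
 note cs = coproductD[OF c]
 let ?R = "\<lambda>r v. \<exists>i f. i : I \<and> f : Dom V r ~> X i \<and> p o r = j i o f \<and> v = val i r f"
 have st: "stable ?R y w"
  unfolding stable_def
 proof (intro conjI allI impI)
  fix z r v assume r: "r : z ~> y" and "?R r v"
  then obtain i f where *: "i : I" "f : z ~> X i" "p o r = j i o f" "v = val i r f" by auto
  show "v : z ~> w" using val[OF *(1) r *(2,3)] *(4) by blast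
  fix x t assume t: "t : x ~> z"
  have "p o (r o t) = j i o (f o t)"
   using arg_cong[OF *(3), of "\<lambda>k. k o t"] p r t *(1,2) cs by simp
  moreover have "f o t : Dom V (r o t) ~> X i" using r t *(2) by simp
  moreover have "v o t = val i (r o t) (f o t)" using val[OF *(1) r *(2,3)] t *(4) by blast
  ultimately show "?R (r o t) (v o t)" using *(1) by blast
 qed (rule w)
 have fn: "v = v'" if r: "r : z ~> y" and R: "?R r v" "?R r v'" for z r v v'
 proof -
  obtain i f i' f' where *: "i : I" "f : z ~> X i" "p o r = j i o f" "v = val i r f"
   "i' : I" "f' : z ~> X i'" "p o r = j i' o f'" "v' = val i' r f'" using R r by auto
  have "(i = i' \<and> f = f') \<or> void z"
   by (rule coproduct_inclusions[OF s c *(1,5,2,6)]) (use *(3,7) in simp)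
  moreover have "v : z ~> w" "v' : z ~> w"
   using val[OF *(1) r *(2,3)] val[OF *(5) r *(6,7)] *(4,8) by blast+
  ultimately show ?thesis using *(4,8) void_eqI by blast
 qed
 have "glues ?R y w"
 proof (rule glues_cases[OF s c p st])
  fix z r i f assume *: "i : I" "r : z ~> y" "f : z ~> X i" "p o r = j i o f"
  have z: "z : Ob V" using *(2) by (rule Hom_Ob)
  show "glues (\<lambda>s. ?R (r o s)) z w"
  proof (rule glues_defined[OF stable_precomp[OF st *(2)] _ z])
   have e: "r o Idn V z = r" "Dom V r = z" using *(2) by simp_all
   show "?R (r o Idn V z) (val i r f)" unfolding e using * by blast
   fix x t v v' assume t: "t : x ~> z" and R: "?R (r o t) v" "?R (r o t) v'"
   have rt: "r o t : x ~> y" using *(2) t by simp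
   show "v = v'" by (rule fn[OF rt R])
  qed
 qed
 then obtain h where h: "h : y ~> w" "!!z r v. r : z ~> y ==> ?R r v ==> h o r = v" unfolding glues_def by blast
 show ?thesis
 proof (rule that[OF h(1)])
  fix z r i f assume *: "i : I" "r : z ~> y" "f : z ~> X i" "p o r = j i o f"
  have "Dom V r = z" using *(2) by simp
  then have "?R r (val i r f)" using * by blast
  then show "h o r = val i r f" by (rule h(2)[OF *(2)])
 qed
qed

lemma glues_pair:
 assumes s: "small U I" "small U J" and c: "is_coproduct V I X q j" and d: "is_coproduct V J Y q' j'"
  and p: "p : y ~> q" and p': "p' : y ~> q'" and w: "w : Ob V"
  and val: "!!z r i l f g. [|i : I; l : J; r : z ~> y; f : z ~> X i; g : z ~> Y l; p o r = j i o f; p' o r = j' l o g|] ==>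
   (val i l f g : z ~> w \<and> (\<forall>x s. s : x ~> z --> val i l f g o s = val i l (f o s) (g o s))) \<or> void z"
 obtains h where "h : y ~> w"
  "!!z r i l f g. [|i : I; l : J; r : z ~> y; f : z ~> X i; g : z ~> Y l; p o r = j i o f; p' o r = j' l o g;
   val i l f g : z ~> w|] ==> h o r = val i l f g"
proof -
 note cs = coproductD[OF c] coproductD[OF d]
 let ?R = "\<lambda>r v. \<exists>i l f g. i : I \<and> l : J \<and> f : Dom V r ~> X i \<and> g : Dom V r ~> Y l \<and>
   p o r = j i o f \<and> p' o r = j' l o g \<and> v : Dom V r ~> w \<and> (v = val i l f g \<or> void (Dom V r))"
 have st: "stable ?R y w"
  unfolding stable_def
 proof (intro conjI allI impI)
  fix z r v assume r: "r : z ~> y" and "?R r v"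
  then obtain i l f g where *: "i : I" "l : J" "f : z ~> X i" "g : z ~> Y l"
   "p o r = j i o f" "p' o r = j' l o g" "v : z ~> w" "v = val i l f g \<or> void z" by auto
  show "v : z ~> w" by (rule *(7))
  fix x t assume t: "t : x ~> z"
  have "p o (r o t) = j i o (f o t)" "p' o (r o t) = j' l o (g o t)"
   by (rule Cmp_eq_precomp[OF *(5)] Cmp_eq_precomp[OF *(6)]; use p p' r t *(1-4) cs in simp)+
  moreover have "f o t : Dom V (r o t) ~> X i" "g o t : Dom V (r o t) ~> Y l"
   "v o t : Dom V (r o t) ~> w" using r t *(3,4,7) by simp_all
  moreover have "v o t = val i l (f o t) (g o t) \<or> void (Dom V (r o t))"
  proof (cases "void z")
   case True then show ?thesis using void_strict[OF True t] r t by simp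
  next
   case False then show ?thesis using val[OF *(1,2) r *(3-6)] *(8) t by blast
  qed
  ultimately show "?R (r o t) (v o t)" using *(1,2) by blast
 qed (rule w)
 have fn: "v = v'" if r: "r : z ~> y" and R: "?R r v" "?R r v'" for z r v v'
 proof (cases "void z")
  case True
  moreover have "v : z ~> w" "v' : z ~> w" using R r by auto
  ultimately show ?thesis using void_eqI by blast
 next
  case False
  obtain i l f g where *: "i : I" "l : J" "f : z ~> X i" "g : z ~> Y l"
   "p o r = j i o f" "p' o r = j' l o g" "v = val i l f g" using R(1) r False by auto
  obtain i2 l2 f2 g2 where 2: "i2 : I" "l2 : J" "f2 : z ~> X i2" "g2 : z ~> Y l2"
   "p o r = j i2 o f2" "p' o r = j' l2 o g2" "v' = val i2 l2 f2 g2" using R(2) r False by auto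
  have e: "j i o f = j i2 o f2" "j' l o g = j' l2 o g2" using *(5,6) 2(5,6) by simp_all
  show ?thesis
   using coproduct_inclusions[OF s(1) c *(1) 2(1) *(3) 2(3) e(1)]
    coproduct_inclusions[OF s(2) d *(2) 2(2) *(4) 2(4) e(2)] False *(7) 2(7) by blast
 qed
 have "glues ?R y w"
 proof (rule glues_cases[OF s(1) c p st])
  fix z r i f assume *: "i : I" "r : z ~> y" "f : z ~> X i" "p o r = j i o f"
  note st' = stable_precomp[OF st *(2)]
  have pr: "p' o r : z ~> q'" using p' *(2) by simp
  show "glues (\<lambda>s. ?R (r o s)) z w"
  proof (rule glues_cases[OF s(2) d pr st'])
   fix x t l g assume 2: "l : J" "t : x ~> z" "g : x ~> Y l" "(p' o r) o t = j' l o g"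
   note st'' = stable_precomp[OF st' 2(2)]
   have rt: "r o t : x ~> y" and x: "x : Ob V" using *(2) 2(2) by auto
   have e: "p o (r o t) = j i o (f o t)" by (rule Cmp_eq_precomp[OF *(4)]) (use p *(1-3) 2(2) cs in simp_all)
   have e': "p' o (r o t) = j' l o g" unfolding 2(4)[symmetric] using p' *(2) 2(2) by simp
   have ft: "f o t : x ~> X i" using *(3) 2(2) by simp
   show "glues (\<lambda>s. ?R (r o (t o s))) x w"
   proof (cases "void x")
    case True then show ?thesis by (rule glues_void[OF st''])
   next
    case False
    have v: "val i l (f o t) g : x ~> w" using val[OF *(1) 2(1) rt ft 2(3) e e'] False by blast
    show ?thesis
    proof (rule glues_defined[OF st'' _ x])
     have "r o (t o Idn V x) = r o t" "Dom V (r o t) = x" using rt 2(2) by simp_all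
     then show "?R (r o (t o Idn V x)) (val i l (f o t) g)" using *(1) 2(1) ft 2(3) e e' v by metis
     fix x' t' v v' assume t': "t' : x' ~> x" and R: "?R (r o (t o t')) v" "?R (r o (t o t')) v'"
     have rtt: "r o (t o t') : x' ~> y" using *(2) 2(2) t' by simp
     show "v = v'" by (rule fn[OF rtt R])
    qed
   qed
  qed
 qed
 then obtain h where h: "h : y ~> w" "!!z r v. r : z ~> y ==> ?R r v ==> h o r = v" unfolding glues_def by blast
 show ?thesis
 proof (rule that[OF h(1)])
  fix z r i l f g assume *: "i : I" "l : J" "r : z ~> y" "f : z ~> X i" "g : z ~> Y l"
   "p o r = j i o f" "p' o r = j' l o g" "val i l f g : z ~> w"
  have "Dom V r = z" using *(3) by simp
  then have "?R r (val i l f g)" using * by blast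
  then show "h o r = val i l f g" by (rule h(2)[OF *(3)])
 qed
qed

text \<open>The squares formed by a map of coproducts and its components are pullbacks.  An element \<^term>\<open>g\<close> is
 locally in a summand of \<^term>\<open>p\<close>; by disjointness in \<^term>\<open>q\<close> this is the \<^term>\<open>i\<close>-th one unless the stage is void, and the
 local factorizations glue.\<close>

lemma coproduct_factor:
 assumes s: "small U I" and c: "is_coproduct V I X q j" and d: "is_coproduct V I Y p k"
  and m: "m : p ~> q" "!!i. i : I ==> n i : Y i ~> X i" "!!i. i : I ==> m o k i = j i o n i"
  and i: "i : I" and g: "g : z ~> p" and r: "r : z ~> X i" and e: "m o g = j i o r"
 obtains h where "h : z ~> Y i" "g = k i o h" "r = n i o h"
proof -
 note cs = coproductD[OF c] and ds = coproductD[OF d]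
 let ?R = "\<lambda>s v. v : Dom V s ~> Y i \<and> g o s = k i o v"
 have st: "stable ?R z (Y i)" unfolding stable_def using g i ds by (auto simp flip: Cmp_Cmp)
 have over: "i = l \<or> void x" if "l : I" "t : x ~> z" "u : x ~> Y l" "g o t = k l o u" for l x t u
 proof -
  have "j i o (r o t) = (j i o r) o t" using cs i r that by simp
  also have "\<dots> = m o (g o t)" unfolding e[symmetric] using m(1) g that by simp
  also have "\<dots> = (m o k l) o u" unfolding that(4) using m(1) ds that by simp
  also have "\<dots> = j l o (n l o u)" unfolding m(3)[OF that(1)] using cs m(2)[OF that(1)] that by simp
  finally have "j i o (r o t) = j l o (n l o u)" .
  from coproduct_inclusions[OF s c i that(1) _ _ this, of x] show ?thesis
   using r m(2)[OF that(1)] that by auto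
 qed
 have "glues ?R z (Y i)"
 proof (rule glues_cases[OF s d g st])
  fix x t l u assume *: "l : I" "t : x ~> z" "u : x ~> Y l" "g o t = k l o u"
  have st': "stable (\<lambda>s. ?R (t o s)) x (Y i)" by (rule stable_precomp[OF st *(2)])
  show "glues (\<lambda>s. ?R (t o s)) x (Y i)"
  proof (cases "i = l")
   case True
   show ?thesis
   proof (rule glues_defined[OF st'])
    show "x : Ob V" using * by auto
    show "?R (t o Idn V x) u" using * True by simp
    fix x' r' v v' assume "r' : x' ~> x" "?R (t o r') v" "?R (t o r') v'"
    then show "v = v'" using coproduct_mono[OF s d i, of v x' v'] *(2) by simp
   qed
  next
   case False then show ?thesis using over[OF *] glues_void[OF st'] by blast
  qed
 qed
 then obtain h where h: "h : z ~> Y i" "!!x t v. t : x ~> z ==> ?R t v ==> h o t = v"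
  unfolding glues_def by blast
 have "g = k i o h"
 proof (rule coproduct_cases_eqI[OF s d g g])
  show "k i o h : z ~> p" using ds i h by simp
  fix x t l u assume *: "l : I" "t : x ~> z" "u : x ~> Y l" "g o t = k l o u"
  show "g o t = (k i o h) o t"
  proof (cases "i = l")
   case True
   then have "h o t = u" using h(2)[OF *(2), of u] * by simp
   then show ?thesis using h(1) * ds i True by simp
  next
   case False then have "void x" using over[OF *] by blast
   then show ?thesis using void_eqI[of x "g o t" p] g h ds i *(2) by simp
  qed
 qed
 moreover have "r = n i o h"
 proof (rule coproduct_mono[OF s c i r])
  show "n i o h : z ~> X i" using m(2)[OF i] h by simp
  have "j i o r = (m o k i) o h" unfolding e[symmetric] using \<open>g = k i o h\<close> m(1) ds i h by simp
  then show "j i o r = j i o (n i o h)" unfolding m(3)[OF i] using cs i m(2)[OF i] h by simp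
 qed
 ultimately show ?thesis using that h(1) by blast
qed

end

section \<open>Internal categories on generalized elements\<close>

context ccc_pb
begin

lemma pb_tuple_Cmp: assumes "f : Ar V" "g : Ar V" "Cod V f = Cod V g" "h : x ~> Dom V f"
  "k : x ~> Dom V g" "f o h = g o k" "r : y ~> x"
 shows "pb_tuple V f g h k o r = pb_tuple V f g (h o r) (k o r)"
proof -
 note p = pb_tuple[OF assms(1-6)]
 have "f o (h o r) = g o (k o r)" by (rule Cmp_eq_precomp[OF assms(6)]) (use assms in auto)
 note q = pb_tuple[OF assms(1-3) _ _ this, of y]
 have t: "h o r : y ~> Dom V f" "k o r : y ~> Dom V g" using assms by simp_all
 show ?thesis
 proof (rule pb_eqI[OF assms(1-3), of _ y])
  show "pb_tuple V f g h k o r : y ~> Pb V f g" using p(1) assms(7) by simp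
  have "(pb1 V f g o pb_tuple V f g h k) o r = h o r" unfolding p(2) ..
  then show "pb1 V f g o (pb_tuple V f g h k o r) = pb1 V f g o pb_tuple V f g (h o r) (k o r)"
   using q(2)[OF t] p(1) assms(1-3,7) by simp
  have "(pb2 V f g o pb_tuple V f g h k) o r = k o r" unfolding p(3) ..
  then show "pb2 V f g o (pb_tuple V f g h k o r) = pb2 V f g o pb_tuple V f g (h o r) (k o r)"
   using q(3)[OF t] p(1) assms(1-3,7) by simp
 qed (use q(1)[OF t] in auto)
qed

abbreviation W where "W \<equiv> cat_of V"

text \<open>The composite of a composable pair of generalized arrows, in the order of \<^const>\<open>ICmp\<close>.  With it the axioms
 of an internal category become those of a category at each stage.\<close>

definition icmp where "icmp A f g = ICmp A o ipair V A f g"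

lemma W_Ob: "A : Ob W \<longleftrightarrow> internal_category V A"
 by (simp add: cat_of_def)

lemma icat_typing [simp]:
 assumes "A : Ob W"
 shows "IOb A : Ob V" "IAr A : Ob V" "ISrc A : Ar V" "ITgt A : Ar V" "IIdn A : Ar V"
  "Dom V (ISrc A) = IAr A" "Cod V (ISrc A) = IOb A" "Dom V (ITgt A) = IAr A" "Cod V (ITgt A) = IOb A"
  "Dom V (IIdn A) = IOb A" "Cod V (IIdn A) = IAr A"
  "ISrc A o IIdn A = Idn V (IOb A)" "ITgt A o IIdn A = Idn V (IOb A)"
 using assms unfolding W_Ob internal_category_def by auto

lemma icat_idn [simp]:
 assumes "A : Ob W" "a : Ar V" "Cod V a = IOb A"
 shows "ISrc A o (IIdn A o a) = a" "ITgt A o (IIdn A o a) = a"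
 using Cmp_Cmp[of a "IIdn A" "ISrc A"] Cmp_Cmp[of a "IIdn A" "ITgt A"] assms by simp_all

lemma icmp:
 assumes A: "A : Ob W" and t: "f : Ar V" "g : Ar V" "Dom V f = Dom V g" "Cod V f = IAr A" "Cod V g = IAr A"
  "ITgt A o f = ISrc A o g"
 shows "icmp A f g : Ar V" "Dom V (icmp A f g) = Dom V f" "Cod V (icmp A f g) = IAr A"
  "ISrc A o icmp A f g = ISrc A o f" "ITgt A o icmp A f g = ITgt A o g"
  "r : Ar V ==> Cod V r = Dom V f ==> icmp A f g o r = icmp A (f o r) (g o r)"
proof -
 note p = pb_tuple[of "ITgt A" "ISrc A" f "Dom V f" g] pb_simps[of "ITgt A" "ISrc A"]
 have C: "ICmp A : ipairs V A ~> IAr A" "ISrc A o ICmp A = ISrc A o ip1 V A"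
  "ITgt A o ICmp A = ITgt A o ip2 V A" using A unfolding W_Ob internal_category_def by auto
 show "icmp A f g : Ar V" "Dom V (icmp A f g) = Dom V f" "Cod V (icmp A f g) = IAr A"
  unfolding icmp_def using p C A t by simp_all
 have "(ISrc A o ICmp A) o ipair V A f g = ISrc A o f" unfolding C(2) using p A t by simp
 then show "ISrc A o icmp A f g = ISrc A o f"
  unfolding icmp_def using p(1) C(1) A t by simp
 have "(ITgt A o ICmp A) o ipair V A f g = ITgt A o g" unfolding C(3) using p A t by simp
 then show "ITgt A o icmp A f g = ITgt A o g"
  unfolding icmp_def using p(1) C(1) A t by simp
 show "r : Ar V ==> Cod V r = Dom V f ==> icmp A f g o r = icmp A (f o r) (g o r)"
  unfolding icmp_def
  using pb_tuple_Cmp[of "ITgt A" "ISrc A" f "Dom V f" g r "Dom V r"] p(1) C(1) A t by simp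
qed

declare icmp [simp]

lemma icmp_unit [simp]:
 assumes A: "A : Ob W" and t: "f : Ar V" "Cod V f = IAr A"
 shows "ISrc A o f = a ==> icmp A (IIdn A o a) f = f" "ITgt A o f = b ==> icmp A f (IIdn A o b) = f"
proof -
 have "icmp A (IIdn A o ISrc A) (Idn V (IAr A)) = Idn V (IAr A)" "icmp A (Idn V (IAr A)) (IIdn A o ITgt A) = Idn V (IAr A)"
  using A unfolding W_Ob internal_category_def icmp_def by auto
 from this[THEN arg_cong[of _ _ "\<lambda>k. k o f"]]
 show "ISrc A o f = a ==> icmp A (IIdn A o a) f = f" "ITgt A o f = b ==> icmp A f (IIdn A o b) = f"
  using A t by auto
qed

lemma icmp_assoc [simp]:
 assumes A: "A : Ob W" and t: "f : Ar V" "g : Ar V" "h : Ar V" "Dom V f = Dom V g" "Dom V g = Dom V h"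
  "Cod V f = IAr A" "Cod V g = IAr A" "Cod V h = IAr A"
  "ITgt A o f = ISrc A o g" "ITgt A o g = ISrc A o h"
 shows "icmp A (icmp A f g) h = icmp A f (icmp A g h)"
proof -
 let ?s = "ISrc A" and ?t = "ITgt A" and ?p = "ip1 V A" and ?q = "ip2 V A"
 note P = pb_simps[of ?t ?s] pb_commute[of ?t ?s]
 note T = pb_simps[of "?t o ?q" ?s, folded trip1_def trip2_def] pb_commute[of "?t o ?q" ?s, folded trip1_def trip2_def]
 have C: "ICmp A : ipairs V A ~> IAr A" "ITgt A o ICmp A = ITgt A o ip2 V A"
  using A unfolding W_Ob internal_category_def by auto
 note x = pb_tuple[of ?t ?s f "Dom V h" g]
 have "(?t o ?q) o ipair V A f g = ?s o h" using x P A t by simp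
 note y = pb_tuple[of "?t o ?q" ?s, OF _ _ _ _ _ this, of "Dom V h", folded trip1_def trip2_def]
 obtain r where r: "r : Ar V" "Dom V r = Dom V h" "Cod V r = Pb V (?t o ?q) ?s" "trip1 V A o r = ipair V A f g" "trip2 V A o r = h"
  by (rule that[of "pb_tuple V (?t o ?q) ?s (ipair V A f g) h"]) (use y x P A t in simp_all)
 have 1: "?t o (ICmp A o trip1 V A) = ?s o trip2 V A"
 proof -
  have "?t o (ICmp A o trip1 V A) = (?t o ICmp A) o trip1 V A" using C(1) P(1-7) T(1-7) A by simp
  also have "\<dots> = ?s o trip2 V A" unfolding C(2) using P T A by simp
  finally show ?thesis .
 qed
 have tq: "?t o (?q o trip1 V A) = ?s o trip2 V A" using T P A by simp
 have tp: "?t o (?p o trip1 V A) = ?s o (?q o trip1 V A)" by (rule Cmp_eq_precomp[OF P(8)]) (use T P A in simp_all)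
 have "icmp A (ICmp A o trip1 V A) (trip2 V A) = icmp A (?p o trip1 V A) (icmp A (?q o trip1 V A) (trip2 V A))"
  using A unfolding W_Ob internal_category_def icmp_def by blast
 from arg_cong[OF this, of "\<lambda>k. k o r"]
 have "icmp A (ICmp A o (trip1 V A o r)) (trip2 V A o r) = icmp A (?p o (trip1 V A o r)) (icmp A (?q o (trip1 V A o r)) (trip2 V A o r))"
  using 1 tq tp T P A r(1-3) C(1) by simp
 then show ?thesis unfolding r(4,5) using x A t by (simp add: icmp_def)
qed

text \<open>The axioms are only stated on the generic pair and the generic triple; conversely these are instances of the
 laws on elements.\<close>

lemma internal_categoryI:
 assumes A: "IOb A : Ob V" "IAr A : Ob V" "ISrc A : IAr A ~> IOb A" "ITgt A : IAr A ~> IOb A"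
   "IIdn A : IOb A ~> IAr A" "ICmp A : ipairs V A ~> IAr A"
   "ISrc A o IIdn A = Idn V (IOb A)" "ITgt A o IIdn A = Idn V (IOb A)"
  and st: "!!x f g. [|f : x ~> IAr A; g : x ~> IAr A; ITgt A o f = ISrc A o g|] ==>
    ISrc A o icmp A f g = ISrc A o f \<and> ITgt A o icmp A f g = ITgt A o g"
  and unit: "!!x f. f : x ~> IAr A ==>
    icmp A (IIdn A o (ISrc A o f)) f = f \<and> icmp A f (IIdn A o (ITgt A o f)) = f"
  and assoc: "!!x f g h. [|f : x ~> IAr A; g : x ~> IAr A; h : x ~> IAr A;
    ITgt A o f = ISrc A o g; ITgt A o g = ISrc A o h|] ==> icmp A (icmp A f g) h = icmp A f (icmp A g h)"
 shows "A : Ob W"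
proof -
 let ?s = "ISrc A" and ?t = "ITgt A" and ?p = "ip1 V A" and ?q = "ip2 V A"
 note P = pb_simps[of ?t ?s] pb_commute[of ?t ?s]
 note T = pb_simps[of "?t o ?q" ?s, folded trip1_def trip2_def] pb_commute[of "?t o ?q" ?s, folded trip1_def trip2_def]
 note x = pb_tuple[of ?t ?s ?p "ipairs V A" ?q]
 have "ipair V A ?p ?q = Idn V (ipairs V A)"
  by (rule pb_eqI[of ?t ?s _ "ipairs V A"]) (use x P A in simp_all)
 then have c: "icmp A ?p ?q = ICmp A" using A P by (simp add: icmp_def)
 have pair: "icmp A (?p o r) (?q o r) = ICmp A o r" if "r : Ar V" "Cod V r = ipairs V A" for r
 proof -
  have "ipair V A (?p o r) (?q o r) = r"
   by (rule pb_eqI[of ?t ?s _ "Dom V r"])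
    (use pb_tuple[of ?t ?s "?p o r" "Dom V r" "?q o r"] Cmp_eq_precomp[OF P(8), of r] P A that in simp_all)
  then show ?thesis by (simp add: icmp_def)
 qed
 have tp: "?t o (?p o trip1 V A) = ?s o (?q o trip1 V A)" by (rule Cmp_eq_precomp[OF P(8)]) (use T P A in simp_all)
 show ?thesis
  unfolding W_Ob internal_category_def
 proof (intro conjI)
  show "?s o ICmp A = ?s o ?p" "?t o ICmp A = ?t o ?q"
   using st[of ?p "ipairs V A" ?q] P A unfolding c by simp_all
  show "ICmp A o ipair V A (IIdn A o ?s) (Idn V (IAr A)) = Idn V (IAr A)"
   "ICmp A o ipair V A (Idn V (IAr A)) (IIdn A o ?t) = Idn V (IAr A)"
   using unit[of "Idn V (IAr A)" "IAr A"] A by (simp_all add: icmp_def)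
  have "icmp A (icmp A (?p o trip1 V A) (?q o trip1 V A)) (trip2 V A)
    = icmp A (?p o trip1 V A) (icmp A (?q o trip1 V A) (trip2 V A))"
   by (rule assoc) (use tp P T A in simp_all)
  moreover have "icmp A (?p o trip1 V A) (?q o trip1 V A) = ICmp A o trip1 V A"
   by (rule pair) (use P T A in simp_all)
  ultimately show "ICmp A o ipair V A (ICmp A o trip1 V A) (trip2 V A) =
    ICmp A o ipair V A (?p o trip1 V A) (ICmp A o ipair V A (?q o trip1 V A) (trip2 V A))"
   unfolding icmp_def by simp
 qed (use A in simp_all)
qed

lemma icmp_generic:
 assumes "A : Ob W" shows "icmp A (ip1 V A) (ip2 V A) = ICmp A"
proof -
 have C: "ICmp A : ipairs V A ~> IAr A" using assms unfolding W_Ob internal_category_def by auto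
 note x = pb_tuple[of "ITgt A" "ISrc A" "ip1 V A" "ipairs V A" "ip2 V A"] pb_simps[of "ITgt A" "ISrc A"]
  pb_commute[of "ITgt A" "ISrc A"]
 have "ipair V A (ip1 V A) (ip2 V A) = Idn V (ipairs V A)"
  by (rule pb_eqI[of "ITgt A" "ISrc A" _ "ipairs V A"]) (use x assms in simp_all)
 then show ?thesis using C by (simp add: icmp_def)
qed

subsection \<open>Internal functors\<close>

abbreviation mkf where "mkf A B h k \<equiv> \<lparr>IDom = A, ICod = B, I0 = h, I1 = k\<rparr>"

lemma W_simps [simp]: "IDom H = Dom W H" "ICod H = Cod W H"
 "Dom W (mkf A B h k) = A" "Cod W (mkf A B h k) = B"
 by (simp_all add: cat_of_def)

lemma W_Ar: "H : Ar W \<longleftrightarrow> internal_functor V H"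
 by (simp add: cat_of_def del: W_simps)

lemma ifun_typing0:
 assumes "H : Ar W"
 shows "Dom W H : Ob W" "Cod W H : Ob W"
  "I0 H : Ar V" "Dom V (I0 H) = IOb (Dom W H)" "Cod V (I0 H) = IOb (Cod W H)"
  "I1 H : Ar V" "Dom V (I1 H) = IAr (Dom W H)" "Cod V (I1 H) = IAr (Cod W H)"
 using assms unfolding W_Ar internal_functor_def W_Ob by auto

lemma ifunI:
 assumes A: "A : Ob W" and B: "B : Ob W" and h: "h : IOb A ~> IOb B" and k: "k : IAr A ~> IAr B"
  and st: "!!x f. f : x ~> IAr A ==> ISrc B o (k o f) = h o (ISrc A o f) \<and> ITgt B o (k o f) = h o (ITgt A o f)"
  and i: "!!x a. a : x ~> IOb A ==> k o (IIdn A o a) = IIdn B o (h o a)"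
  and c: "!!x f g. [|f : x ~> IAr A; g : x ~> IAr A; ITgt A o f = ISrc A o g|] ==>
    k o icmp A f g = icmp B (k o f) (k o g)"
 shows "mkf A B h k : Hom W A B"
proof -
 note P = pb_simps[of "ITgt A" "ISrc A"] pb_commute[of "ITgt A" "ISrc A"]
 have "k o ICmp A = ICmp B o ipair V B (k o ip1 V A) (k o ip2 V A)"
  using c[of "ip1 V A" "ipairs V A" "ip2 V A"] P A k unfolding icmp_generic[OF A] by (simp add: icmp_def)
 moreover have "ISrc B o k = h o ISrc A" "ITgt B o k = h o ITgt A"
  using st[of "Idn V (IAr A)" "IAr A"] A B h k by simp_all
 moreover have "k o IIdn A = IIdn B o h" using i[of "Idn V (IOb A)" "IOb A"] A B h k by simp
 ultimately have "internal_functor V (mkf A B h k)" unfolding internal_functor_def using A B h k by (simp add: W_Ob del: W_simps)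
 then show ?thesis by (simp add: W_Ar)
qed

lemma ifun:
 assumes H: "H : Ar W"
 shows "Cod W H = B ==> f : Ar V ==> Cod V f = IAr (Dom W H) ==> ISrc B o (I1 H o f) = I0 H o (ISrc (Dom W H) o f)"
  "Cod W H = B ==> f : Ar V ==> Cod V f = IAr (Dom W H) ==> ITgt B o (I1 H o f) = I0 H o (ITgt (Dom W H) o f)"
  "Dom W H = A ==> a : Ar V ==> Cod V a = IOb A ==> I1 H o (IIdn A o a) = IIdn (Cod W H) o (I0 H o a)"
  "[|Dom W H = A; f : Ar V; g : Ar V; Dom V f = Dom V g; Cod V f = IAr A; Cod V g = IAr A; ITgt A o f = ISrc A o g|] ==>
   I1 H o icmp A f g = icmp (Cod W H) (I1 H o f) (I1 H o g)"
proof -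
 have e: "ISrc (Cod W H) o I1 H = I0 H o ISrc (Dom W H)" "ITgt (Cod W H) o I1 H = I0 H o ITgt (Dom W H)"
  "I1 H o IIdn (Dom W H) = IIdn (Cod W H) o I0 H"
  "I1 H o ICmp (Dom W H) = ICmp (Cod W H) o
    ipair V (Cod W H) (I1 H o ip1 V (Dom W H)) (I1 H o ip2 V (Dom W H))"
  using H unfolding W_Ar internal_functor_def by auto
 note [simp] = ifun_typing0[OF H]
 show src: "Cod W H = B ==> f : Ar V ==> Cod V f = IAr (Dom W H) ==> ISrc B o (I1 H o f) = I0 H o (ISrc (Dom W H) o f)" for f B
  using arg_cong[OF e(1), of "\<lambda>k. k o f"] by auto
 show tgt: "Cod W H = B ==> f : Ar V ==> Cod V f = IAr (Dom W H) ==> ITgt B o (I1 H o f) = I0 H o (ITgt (Dom W H) o f)" for f B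
  using arg_cong[OF e(2), of "\<lambda>k. k o f"] by auto
 show "Dom W H = A ==> a : Ar V ==> Cod V a = IOb A ==> I1 H o (IIdn A o a) = IIdn (Cod W H) o (I0 H o a)"
  using arg_cong[OF e(3), of "\<lambda>k. k o a"] by auto
 assume A: "Dom W H = A" "f : Ar V" "g : Ar V" "Dom V f = Dom V g" "Cod V f = IAr A" "Cod V g = IAr A" "ITgt A o f = ISrc A o g"
 have AO [simp]: "A : Ob W" using A(1) by auto
 note [simp] = A
 have C: "ICmp A : ipairs V A ~> IAr A" using AO unfolding W_Ob internal_category_def by auto
 note P = pb_simps[of "ITgt A" "ISrc A"] pb_commute[of "ITgt A" "ISrc A"] pb_tuple[of "ITgt A" "ISrc A" f "Dom V g" g]
 have 1: "I1 H o ICmp A = icmp (Cod W H) (I1 H o ip1 V A) (I1 H o ip2 V A)" using e(4) by (simp add: icmp_def)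
 have "I1 H o icmp A f g = (I1 H o ICmp A) o ipair V A f g" using C P by (simp add: icmp_def)
 also have "\<dots> = icmp (Cod W H) (I1 H o f) (I1 H o g)" unfolding 1 using P by (simp add: src tgt)
 finally show "I1 H o icmp A f g = icmp (Cod W H) (I1 H o f) (I1 H o g)" .
qed

lemma ifun_eqI: "[|F : Hom W A B; G : Hom W A B; I0 F = I0 G; I1 F = I1 G|] ==> F = G"
 by (rule ifun.equality) (simp_all add: cat_of_def del: W_simps)

lemma W_Idn [simp]: "I0 (Idn W A) = Idn V (IOb A)" "I1 (Idn W A) = Idn V (IAr A)"
 by (simp_all add: cat_of_def del: W_simps)

lemma W_Cmp [simp]: "I0 (G o\<^bsub>W\<^esub> F) = I0 G o I0 F" "I1 (G o\<^bsub>W\<^esub> F) = I1 G o I1 F"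
 by (simp_all add: cat_of_def del: W_simps)

lemma W_category: "category W"
proof
 fix H assume "H : Ar W" then show "Dom W H : Ob W" "Cod W H : Ob W" using ifun_typing0 by auto
next
 fix A assume A: "A : Ob W"
 have "mkf A A (Idn V (IOb A)) (Idn V (IAr A)) : Hom W A A" by (rule ifunI) (use A in simp_all)
 then show "Idn W A : Hom W A A" by (simp add: cat_of_def del: W_simps)
next
 fix F A B G C assume F: "F : Hom W A B" and G: "G : Hom W B C"
 have [simp]: "F : Ar W" "G : Ar W" "Dom W F = A" "Cod W F = B" "Dom W G = B" "Cod W G = C" using F G by auto
 note [simp] = ifun_typing0[of F, simplified] ifun_typing0[of G, simplified] ifun[of F, simplified] ifun[of G, simplified]
 have "mkf A C (I0 G o I0 F) (I1 G o I1 F) : Hom W A C" by (rule ifunI) simp_all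
 moreover have "G o\<^bsub>W\<^esub> F = mkf A C (I0 G o I0 F) (I1 G o I1 F)" using F G by (simp add: cat_of_def del: W_simps)
 ultimately show "G o\<^bsub>W\<^esub> F : Hom W A C" by simp
next
 fix F A B assume F: "F : Hom W A B"
 then have "F : Ar W" by simp
 note [simp] = ifun_typing0[OF this]
 have 1: "Dom W F = A" "Cod W F = B" using F by auto
 show "F o\<^bsub>W\<^esub> Idn W A = F" "Idn W B o\<^bsub>W\<^esub> F = F"
  using 1 by (auto intro!: ifun.equality simp: cat_of_def simp del: W_simps)
next
 fix F A B G C H D assume F: "F : Hom W A B" and G: "G : Hom W B C" and H: "H : Hom W C D"
 then have "F : Ar W" "G : Ar W" "H : Ar W" by simp_all
 note t = this[THEN ifun_typing0(3)] this[THEN ifun_typing0(4)] this[THEN ifun_typing0(5)]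
  this[THEN ifun_typing0(6)] this[THEN ifun_typing0(7)] this[THEN ifun_typing0(8)]
 have "I0 H o (I0 G o I0 F) = (I0 H o I0 G) o I0 F" "I1 H o (I1 G o I1 F) = (I1 H o I1 G) o I1 F"
  using t F G H by auto
 then show "H o\<^bsub>W\<^esub> (G o\<^bsub>W\<^esub> F) = H o\<^bsub>W\<^esub> G o\<^bsub>W\<^esub> F" by (simp add: cat_of_def del: W_simps)
qed

sublocale W: category "cat_of V" by (rule W_category)

lemmas [simp] = ifun_typing0(3-8) ifun

end

section \<open>Representable presheaves and products of internal categories\<close>

lemma (in category) Cmp_eq_precomp1:
 "[|a o b = c; a : Ar K; b : Ar K; Cod K b = Dom K a; r : Ar K; Cod K r = Dom K b|] ==> a o (b o r) = c o r"
 by (metis Cmp_Cmp)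

lemma (in category) is_product_iso:
 assumes p: "is_product K a b p u v" and h: "h : Hom K q p" "k : Hom K p q" "k o h = Idn K q" "h o k = Idn K p"
 shows "is_product K a b q (u o h) (v o h)"
proof -
 have t: "u : Hom K p a" "v : Hom K p b" using p unfolding is_product_def by blast+
 show ?thesis unfolding is_product_def
 proof (intro conjI allI ballI)
  fix x f g assume fg: "f : Hom K x a" "g : Hom K x b"
  note w = product_pairing[OF p fg]
  show "\<exists>!l. l : Hom K x q \<and> (u o h) o l = f \<and> (v o h) o l = g"
  proof (rule ex1I[of _ "k o pairing K u v f g"])
   have "h o (k o pairing K u v f g) = (h o k) o pairing K u v f g" using w h(1,2) by simp
   then have "h o (k o pairing K u v f g) = pairing K u v f g" using w h(4) by simp
   then show "k o pairing K u v f g : Hom K x q \<and> (u o h) o (k o pairing K u v f g) = f \<and> (v o h) o (k o pairing K u v f g) = g"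
    using w h(1,2) t by simp
   fix l assume l: "l : Hom K x q \<and> (u o h) o l = f \<and> (v o h) o l = g"
   then have l1: "l : Hom K x q" by blast
   have "(u o h) o l = u o (h o l)" "(v o h) o l = v o (h o l)" using l1 h(1) t by simp_all
   then have "u o (h o l) = f" "v o (h o l) = g" using l by metis+
   then have "h o l = pairing K u v f g"
    by (intro product_eqI[OF p _ w(1)]) (use l w h t in simp_all)
   then have "k o (h o l) = k o pairing K u v f g" by simp
   moreover have "k o (h o l) = (k o h) o l" using l h(1,2) by simp
   ultimately show "l = k o pairing K u v f g" using l h(3) by simp
  qed
 qed (use t h in simp_all)
qed

context ccc_pb
begin

text \<open>\<^term>\<open>P x e\<close> says that \<^term>\<open>e\<close> is an element at stage \<^term>\<open>x\<close> of a presheaf with restriction maps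
 \<^term>\<open>\<rho>\<close>.  Internal categories will be obtained from presheaves of categories whose presheaves of
 objects and of arrows are represented.\<close>

definition represents :: "('o \<Rightarrow> 'e \<Rightarrow> bool) \<Rightarrow> ('e \<Rightarrow> 'm \<Rightarrow> 'e) \<Rightarrow> 'o \<Rightarrow> 'e \<Rightarrow> bool" where
 "represents P \<rho> q u \<longleftrightarrow>
   (\<forall>x y e k. P x e --> k : y ~> x --> P y (\<rho> e k)) \<and>
   (\<forall>x y z e k l. P x e --> k : y ~> x --> l : z ~> y --> \<rho> (\<rho> e k) l = \<rho> e (k o l)) \<and>
   q : Ob V \<and> P q u \<and> (\<forall>x e. P x e --> (\<exists>k \<in> Hom V x q. \<rho> u k = e)) \<and>
   (\<forall>x k l. k : x ~> q --> l : x ~> q --> \<rho> u k = \<rho> u l --> k = l)"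

lemma representsD:
 assumes "represents P \<rho> q u"
 shows "P x e ==> k : y ~> x ==> P y (\<rho> e k)"
  "P x e ==> k : y ~> x ==> l : z ~> y ==> \<rho> (\<rho> e k) l = \<rho> e (k o l)"
  "q : Ob V" "P q u" "P x e ==> \<exists>k \<in> Hom V x q. \<rho> u k = e"
  "k : x ~> q ==> l : x ~> q ==> \<rho> u k = \<rho> u l ==> k = l"
  "k : x ~> q ==> P x (\<rho> u k)"
  "k : x ~> q ==> l : y ~> x ==> \<rho> (\<rho> u k) l = \<rho> u (k o l)"
 using assms unfolding represents_def by blast+

lemma represents_cong:
 assumes "represents P \<rho> q u" "!!x e. P x e \<longleftrightarrow> P' x e" shows "represents P' \<rho> q u"
proof -
 have "P = P'" using assms(2) by blast
 then show ?thesis using assms(1) by simp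
qed

lemma represents_hom: "a : Ob V ==> represents (\<lambda>x f. f : x ~> a) (Cmp V) a (Idn V a)"
 unfolding represents_def by (auto intro!: bexI)

lemma represents_pair:
 assumes P: "represents P \<rho> q u" and Q: "represents Q \<sigma> r v"
 shows "represents (\<lambda>x e. P x (fst e) \<and> Q x (snd e)) (\<lambda>e k. (\<rho> (fst e) k, \<sigma> (snd e) k))
   (Prod V q r) (\<rho> u (pr1 V q r), \<sigma> v (pr2 V q r))"
proof -
 note [simp] = representsD(3)[OF P] representsD(3)[OF Q]
 have t: "pr1 V q r : Prod V q r ~> q" "pr2 V q r : Prod V q r ~> r" by simp_all
 show ?thesis unfolding represents_def
 proof (intro conjI allI impI)
  fix x y e k assume e: "P x (fst e) \<and> Q x (snd e)" and k: "k : y ~> x"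
  show "P y (fst (\<rho> (fst e) k, \<sigma> (snd e) k))" using representsD(1)[OF P conjunct1[OF e] k] by (simp only: fst_conv)
  show "Q y (snd (\<rho> (fst e) k, \<sigma> (snd e) k))" using representsD(1)[OF Q conjunct2[OF e] k] by (simp only: snd_conv)
 next
  fix x y z e k l assume "P x (fst e) \<and> Q x (snd e)" "k : y ~> x" "l : z ~> y"
  then show "(\<rho> (fst (\<rho> (fst e) k, \<sigma> (snd e) k)) l, \<sigma> (snd (\<rho> (fst e) k, \<sigma> (snd e) k)) l) = (\<rho> (fst e) (k o l), \<sigma> (snd e) (k o l))"
   using representsD(2)[OF P, of x "fst e" k y l z] representsD(2)[OF Q, of x "snd e" k y l z] by simp
 next
  show "P (Prod V q r) (fst (\<rho> u (pr1 V q r), \<sigma> v (pr2 V q r)))" "Q (Prod V q r) (snd (\<rho> u (pr1 V q r), \<sigma> v (pr2 V q r)))"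
   using representsD(7)[OF P t(1)] representsD(7)[OF Q t(2)] by simp_all
 next
  fix x e assume e: "P x (fst e) \<and> Q x (snd e)"
  obtain k where k: "k : x ~> q" "\<rho> u k = fst e" using representsD(5)[OF P conjunct1[OF e]] by blast
  obtain l where l: "l : x ~> r" "\<sigma> v l = snd e" using representsD(5)[OF Q conjunct2[OF e]] by blast
  show "\<exists>k\<in>Hom V x (Prod V q r). (\<rho> (fst (\<rho> u (pr1 V q r), \<sigma> v (pr2 V q r))) k, \<sigma> (snd (\<rho> u (pr1 V q r), \<sigma> v (pr2 V q r))) k) = e"
  proof (rule bexI)
   show kl: "<|k, l|> : x ~> Prod V q r" using k l by simp
   show "(\<rho> (fst (\<rho> u (pr1 V q r), \<sigma> v (pr2 V q r))) <|k, l|>, \<sigma> (snd (\<rho> u (pr1 V q r), \<sigma> v (pr2 V q r))) <|k, l|>) = e"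
    using representsD(8)[OF P t(1) kl] representsD(8)[OF Q t(2) kl] k l by simp
  qed
 next
  fix x k l assume k: "k : x ~> Prod V q r" and l: "l : x ~> Prod V q r"
   and "(\<rho> (fst (\<rho> u (pr1 V q r), \<sigma> v (pr2 V q r))) k, \<sigma> (snd (\<rho> u (pr1 V q r), \<sigma> v (pr2 V q r))) k) =
    (\<rho> (fst (\<rho> u (pr1 V q r), \<sigma> v (pr2 V q r))) l, \<sigma> (snd (\<rho> u (pr1 V q r), \<sigma> v (pr2 V q r))) l)"
  then have "\<rho> u (pr1 V q r o k) = \<rho> u (pr1 V q r o l)" "\<sigma> v (pr2 V q r o k) = \<sigma> v (pr2 V q r o l)"
   using representsD(8)[OF P t(1) k] representsD(8)[OF P t(1) l] representsD(8)[OF Q t(2) k] representsD(8)[OF Q t(2) l] by simp_all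
  note uv = this
  have kl: "pr1 V q r o k : x ~> q" "pr1 V q r o l : x ~> q" "pr2 V q r o k : x ~> r" "pr2 V q r o l : x ~> r"
   using k l by simp_all
  have "pr1 V q r o k = pr1 V q r o l" by (rule representsD(6)[OF P kl(1,2) uv(1)])
  moreover have "pr2 V q r o k = pr2 V q r o l" by (rule representsD(6)[OF Q kl(3,4) uv(2)])
  ultimately show "k = l" using prod_eqI[OF k l] by simp
 qed simp
qed

definition restr where "restr a h k = h o <|k o pr1 V (Dom V k) a, pr2 V (Dom V k) a|>"

lemma restr [simp]:
 assumes "a : Ob V" "h : Ar V" "Dom V h = Prod V x a" "k : Ar V" "Cod V k = x"
 shows "restr a h k : Ar V" "Dom V (restr a h k) = Prod V (Dom V k) a" "Cod V (restr a h k) = Cod V h"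
  "[|u : Ar V; z : Ar V; Cod V u = Dom V k; Cod V z = a; Dom V u = Dom V z|] ==> restr a h k o <|u, z|> = h o <|k o u, z|>"
 unfolding restr_def using assms Cod_Ob[of k] by simp_all

lemma restr_restr: assumes "a : Ob V" "h : Ar V" "Dom V h = Prod V x a" "k : y ~> x" "l : z ~> y"
 shows "restr a (restr a h k) l = restr a h (k o l)"
proof (rule elements_eqI[of _ z a "Cod V h"])
 have o: "x : Ob V" "y : Ob V" "z : Ob V" using Hom_Ob assms(4,5) by blast+
 note t = assms(1-3) assms(4,5)[unfolded Hom_iff]
 show "restr a (restr a h k) l : Prod V z a ~> Cod V h" using t o by simp
 show "restr a h (k o l) : Prod V z a ~> Cod V h" using t o by simp
 show "z : Ob V" "a : Ob V" using o t by simp_all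
 fix w u v assume "u : w ~> z" "v : w ~> a"
 then show "restr a (restr a h k) l o <|u, v|> = restr a h (k o l) o <|u, v|>" using t o by simp
qed

text \<open>The universal property of the exponential, with evaluation as the universal element.\<close>

lemma represents_exp:
 assumes "a : Ob V" "b : Ob V"
 shows "represents (\<lambda>x h. x : Ob V \<and> h : Prod V x a ~> b) (restr a) (Exp V a b) (eval_ar V a b)"
 unfolding represents_def
proof (intro conjI allI impI)
 fix x e assume e: "x : Ob V \<and> e : Prod V x a ~> b"
 have "restr a (eval_ar V a b) (transp V x a b e) = e"
  by (rule elements_eqI[of _ x a b]) (use e assms in simp_all)
 moreover have "transp V x a b e : x ~> Exp V a b" using e assms by simp
 ultimately show "\<exists>k\<in>Hom V x (Exp V a b). restr a (eval_ar V a b) k = e" by blast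
next
 fix x k l assume kl: "k : x ~> Exp V a b" "l : x ~> Exp V a b" "restr a (eval_ar V a b) k = restr a (eval_ar V a b) l"
 show "k = l" by (rule exp_eqI[OF kl(1,2) assms]) (use kl in \<open>simp add: restr_def\<close>)
next
 fix x y e k assume e: "x : Ob V \<and> e : Prod V x a ~> b" and k: "k : y ~> x"
 show "y : Ob V" using k by (rule Hom_Ob)
 show "restr a e k : Prod V y a ~> b" using e k assms by simp
next
 fix x y z e k l assume "x : Ob V \<and> e : Prod V x a ~> b" "k : y ~> x" "l : z ~> y"
 then show "restr a (restr a e k) l = restr a e (k o l)" using restr_restr assms by simp
qed (use assms in simp_all)

text \<open>Imposing an equation between two natural maps out of a product with \<^term>\<open>a\<close> preserves
 representability: the equation becomes one between two maps into \<^term>\<open>Exp V a b\<close>, so it is imposed by an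
 equalizer.\<close>

lemma represents_equation:
 assumes P: "represents P \<rho> q u" and ab: "a : Ob V" "b : Ob V"
  and \<phi>: "!!x e. P x e ==> \<phi> x e : Prod V x a ~> b" "!!x e. P x e ==> \<psi> x e : Prod V x a ~> b"
  and nat: "!!x e y k. P x e ==> k : y ~> x ==> \<phi> y (\<rho> e k) = restr a (\<phi> x e) k"
   "!!x e y k. P x e ==> k : y ~> x ==> \<psi> y (\<rho> e k) = restr a (\<psi> x e) k"
 shows "\<exists>q' u'. represents (\<lambda>x e. P x e \<and> \<phi> x e = \<psi> x e) \<rho> q' u'"
proof -
 note q = representsD(3,4)[OF P]
 note t = \<phi>[OF q(2)]
 let ?f = "transp V q a b (\<phi> q u)" and ?g = "transp V q a b (\<psi> q u)"
 have fg: "?f : q ~> Exp V a b" "?g : q ~> Exp V a b" using t ab q by simp_all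
 obtain e r where e: "e : r ~> q" "?f o e = ?g o e"
  "!!x h. h : x ~> q ==> ?f o h = ?g o h ==> \<exists>!k. k : x ~> r \<and> e o k = h"
  by (rule equalizer[OF fg]) blast
 have key: "\<phi> x (\<rho> u k) = \<psi> x (\<rho> u k) \<longleftrightarrow> ?f o k = ?g o k" if k: "k : x ~> q" for x k
 proof -
  have x: "x : Ob V" using k by (rule Hom_Ob)
  have 1: "eval_ar V a b o <|(?f o k) o pr1 V x a, pr2 V x a|> = \<phi> x (\<rho> u k)"
   "eval_ar V a b o <|(?g o k) o pr1 V x a, pr2 V x a|> = \<psi> x (\<rho> u k)"
   unfolding nat[OF q(2) k] restr_def using k x t ab q by simp_all
  have "?f o k = ?g o k" if "\<phi> x (\<rho> u k) = \<psi> x (\<rho> u k)"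
   by (rule exp_eqI[of _ x a b]) (use 1 that k x t ab q fg in simp_all)
  then show ?thesis using 1 by metis
 qed
 have "represents (\<lambda>x e. P x e \<and> \<phi> x e = \<psi> x e) \<rho> r (\<rho> u e)"
  unfolding represents_def
 proof (intro conjI allI impI)
  fix x y e k assume *: "P x e \<and> \<phi> x e = \<psi> x e" "k : y ~> x"
  then show "P y (\<rho> e k)" "\<phi> y (\<rho> e k) = \<psi> y (\<rho> e k)"
   using representsD(1)[OF P] nat by auto
 next
  fix x y z e k l assume *: "P x e \<and> \<phi> x e = \<psi> x e" "k : y ~> x" "l : z ~> y"
  then show "\<rho> (\<rho> e k) l = \<rho> e (k o l)" using representsD(2)[OF P] by blast
 next
  show "r : Ob V" using e(1) by (rule Hom_Ob)
  show "P r (\<rho> u e)" by (rule representsD(7)[OF P e(1)])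
  show "\<phi> r (\<rho> u e) = \<psi> r (\<rho> u e)" using key[OF e(1)] e(2) by blast
 next
  fix x d assume *: "P x d \<and> \<phi> x d = \<psi> x d"
  obtain k where k: "k : x ~> q" "\<rho> u k = d" using representsD(5)[OF P conjunct1[OF *]] by blast
  have "?f o k = ?g o k" using key[OF k(1)] k(2) * by simp
  then obtain l where l: "l : x ~> r" "e o l = k" using e(3)[OF k(1)] by blast
  have "\<rho> (\<rho> u e) l = d" using representsD(8)[OF P e(1) l(1)] l k by simp
  then show "\<exists>k\<in>Hom V x r. \<rho> (\<rho> u e) k = d" using l(1) by blast
 next
  fix x k l assume *: "k : x ~> r" "l : x ~> r" "\<rho> (\<rho> u e) k = \<rho> (\<rho> u e) l"
  then have "\<rho> u (e o k) = \<rho> u (e o l)" using representsD(8)[OF P e(1)] by metis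
  then have 1: "e o k = e o l" by (intro representsD(6)[OF P, of _ x]) (use * e(1) in simp_all)
  have el: "e o l : x ~> q" using *(2) e(1) by simp
  have "?f o (e o l) = ?g o (e o l)" by (rule Cmp_eq_precomp[OF e(2)]) (use * e(1) fg in simp_all)
  then show "k = l" using e(3)[OF el] 1 * by blast
 qed
 then show ?thesis by blast
qed

text \<open>Yoneda for categories: a presheaf of categories with represented objects and arrows comes from an
 internal category.\<close>

lemma represented_internal_category:
 assumes P: "represents P \<rho> q u" and Q: "represents Q \<sigma> r v"
  and st: "!!x f. Q x f ==> P x (sE f)" "!!x f. Q x f ==> P x (tE f)"
   "!!x f y k. Q x f ==> k : y ~> x ==> sE (\<sigma> f k) = \<rho> (sE f) k"
   "!!x f y k. Q x f ==> k : y ~> x ==> tE (\<sigma> f k) = \<rho> (tE f) k"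
  and i: "!!x e. P x e ==> Q x (iE e)" "!!x e y k. P x e ==> k : y ~> x ==> iE (\<rho> e k) = \<sigma> (iE e) k"
   "!!x e. P x e ==> sE (iE e) = e" "!!x e. P x e ==> tE (iE e) = e"
  and c: "!!x f g. Q x f ==> Q x g ==> tE f = sE g ==> Q x (cE f g)"
   "!!x f g y k. Q x f ==> Q x g ==> tE f = sE g ==> k : y ~> x ==> cE (\<sigma> f k) (\<sigma> g k) = \<sigma> (cE f g) k"
   "!!x f g. Q x f ==> Q x g ==> tE f = sE g ==> sE (cE f g) = sE f"
   "!!x f g. Q x f ==> Q x g ==> tE f = sE g ==> tE (cE f g) = tE g"
   "!!x f. Q x f ==> cE (iE (sE f)) f = f" "!!x f. Q x f ==> cE f (iE (tE f)) = f"
   "!!x f g h. Q x f ==> Q x g ==> Q x h ==> tE f = sE g ==> tE g = sE h ==> cE (cE f g) h = cE f (cE g h)"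
 obtains E where "E : Ob W" "IOb E = q" "IAr E = r"
  "!!x k. k : x ~> r ==> \<rho> u (ISrc E o k) = sE (\<sigma> v k)"
  "!!x k. k : x ~> r ==> \<rho> u (ITgt E o k) = tE (\<sigma> v k)"
  "!!x k. k : x ~> q ==> \<sigma> v (IIdn E o k) = iE (\<rho> u k)"
  "!!x k l. k : x ~> r ==> l : x ~> r ==> ITgt E o k = ISrc E o l ==>
    \<sigma> v (icmp E k l) = cE (\<sigma> v k) (\<sigma> v l)"
proof -
 note Pu = representsD(3,4)[OF P] and Qv = representsD(3,4)[OF Q]
 obtain s where s: "s : r ~> q" "\<rho> u s = sE v" using representsD(5)[OF P st(1)[OF Qv(2)]] by blast
 obtain t where t: "t : r ~> q" "\<rho> u t = tE v" using representsD(5)[OF P st(2)[OF Qv(2)]] by blast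
 obtain i where i': "i : q ~> r" "\<sigma> v i = iE u" using representsD(5)[OF Q i(1)[OF Pu(2)]] by blast
 have sk: "\<rho> u (s o k) = sE (\<sigma> v k)" if "k : x ~> r" for x k
  using representsD(8)[OF P s(1) that] st(3)[OF Qv(2) that] s(2) by simp
 have tk: "\<rho> u (t o k) = tE (\<sigma> v k)" if "k : x ~> r" for x k
  using representsD(8)[OF P t(1) that] st(4)[OF Qv(2) that] t(2) by simp
 have ik: "\<sigma> v (i o k) = iE (\<rho> u k)" if "k : x ~> q" for x k
  using representsD(8)[OF Q i'(1) that] i(2)[OF Pu(2) that] i'(2) by simp
 note pb = pb_simps[of t s] pb_commute[of t s]
 let ?p = "pb1 V t s" and ?q = "pb2 V t s"
 have pq: "?p : Pb V t s ~> r" "?q : Pb V t s ~> r" using pb s t by simp_all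
 have e: "tE (\<sigma> v ?p) = sE (\<sigma> v ?q)" using tk[OF pq(1)] sk[OF pq(2)] pb s t by simp
 have Qpq: "Q (Pb V t s) (\<sigma> v ?p)" "Q (Pb V t s) (\<sigma> v ?q)" using representsD(7)[OF Q] pq by blast+
 obtain c' where c': "c' : Pb V t s ~> r" "\<sigma> v c' = cE (\<sigma> v ?p) (\<sigma> v ?q)"
  using representsD(5)[OF Q c(1)[OF Qpq e]] by blast
 let ?E = "\<lparr>IOb = q, IAr = r, ISrc = s, ITgt = t, IIdn = i, ICmp = c'\<rparr>"
 have Qk: "Q x (\<sigma> v k)" if "k : x ~> r" for x k using representsD(7)[OF Q that] .
 have cE: "\<sigma> v (icmp ?E k l) = cE (\<sigma> v k) (\<sigma> v l)" "icmp ?E k l : x ~> r"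
  "tE (\<sigma> v k) = sE (\<sigma> v l)"
  if "k : x ~> r" "l : x ~> r" "t o k = s o l" for x k l
 proof -
  note p = pb_tuple[of t s k x l]
  have w: "pb_tuple V t s k l : x ~> Pb V t s" using p that s t by simp
  show "tE (\<sigma> v k) = sE (\<sigma> v l)" using tk[OF that(1)] sk[OF that(2)] that(3) by simp
  show "icmp ?E k l : x ~> r" using w c'(1) by (simp add: icmp_def)
  have "\<sigma> v (icmp ?E k l) = \<sigma> (cE (\<sigma> v ?p) (\<sigma> v ?q)) (pb_tuple V t s k l)"
   using representsD(8)[OF Q c'(1) w] c'(2) by (simp add: icmp_def)
  also have "\<dots> = cE (\<sigma> v k) (\<sigma> v l)"
   unfolding c(2)[OF Qpq e w, symmetric] representsD(8)[OF Q pq(1) w] representsD(8)[OF Q pq(2) w]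
   using p that s t by simp
  finally show "\<sigma> v (icmp ?E k l) = cE (\<sigma> v k) (\<sigma> v l)" .
 qed
 have ST: "s o icmp ?E k l = s o k" "t o icmp ?E k l = t o l"
  if kl: "k : x ~> r" "l : x ~> r" "t o k = s o l" for x k l
 proof -
  note c' = cE[OF kl] and Qkl = Qk[OF kl(1)] Qk[OF kl(2)]
  have tt: "s o icmp ?E k l : x ~> q" "s o k : x ~> q" "t o icmp ?E k l : x ~> q" "t o l : x ~> q"
   using c'(2) kl(1,2) s(1) t(1) by simp_all
  show "s o icmp ?E k l = s o k"
   by (rule representsD(6)[OF P tt(1,2)]) (simp only: sk[OF c'(2)] sk[OF kl(1)] c'(1) c(3)[OF Qkl c'(3)])
  show "t o icmp ?E k l = t o l"
   by (rule representsD(6)[OF P tt(3,4)]) (simp only: tk[OF c'(2)] tk[OF kl(2)] c'(1) c(4)[OF Qkl c'(3)])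
 qed
 have "?E : Ob W"
 proof (rule internal_categoryI)
  note I = Idn_Hom[OF Pu(1)]
  obtain k where k: "k : q ~> q" "\<rho> u k = u" using representsD(5)[OF P Pu(2)] by blast
  then have u: "\<rho> u (Idn V q) = u" using representsD(8)[OF P k(1) I] by simp
  have si: "s o i : q ~> q" "t o i : q ~> q" using s t i' by simp_all
  have "s o i = Idn V q"
   by (rule representsD(6)[OF P si(1) I]) (simp only: sk[OF i'(1)] i'(2) i(3)[OF Pu(2)] u)
  then show "ISrc ?E o IIdn ?E = Idn V (IOb ?E)" by simp
  have "t o i = Idn V q"
   by (rule representsD(6)[OF P si(2) I]) (simp only: tk[OF i'(1)] i'(2) i(4)[OF Pu(2)] u)
  then show "ITgt ?E o IIdn ?E = Idn V (IOb ?E)" by simp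
 next
  fix x f g assume *: "f : x ~> IAr ?E" "g : x ~> IAr ?E" "ITgt ?E o f = ISrc ?E o g"
  then have fg: "f : x ~> r" "g : x ~> r" "t o f = s o g" by simp_all
  have "s o icmp ?E f g = s o f" "t o icmp ?E f g = t o g" using ST[OF fg] by blast+
  then show "ISrc ?E o icmp ?E f g = ISrc ?E o f \<and> ITgt ?E o icmp ?E f g = ITgt ?E o g" by simp
 next
  fix x f assume "f : x ~> IAr ?E"
  then have f: "f : x ~> r" by simp
  have sf: "s o f : x ~> q" "t o f : x ~> q" using f s t by simp_all
  have isf: "i o (s o f) : x ~> r" "i o (t o f) : x ~> r" using sf i' by simp_all
  note Qf = Qk[OF f] and Ps = st(1)[OF Qk[OF f]] and Pt = st(2)[OF Qk[OF f]]
  have "t o (i o (s o f)) : x ~> q" "s o (i o (t o f)) : x ~> q" using isf s t by simp_all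
  note u = representsD(6)[OF P this(1) sf(1)] representsD(6)[OF P this(2) sf(2)]
  have "t o (i o (s o f)) = s o f"
   by (rule u(1)) (simp only: tk[OF isf(1)] ik[OF sf(1)] sk[OF f] i(4)[OF Ps])
  note c1 = cE[OF isf(1) f this]
  have 1: "icmp ?E (i o (s o f)) f = f"
   by (rule representsD(6)[OF Q c1(2) f]) (simp only: c1(1) ik[OF sf(1)] sk[OF f] c(5)[OF Qf])
  have "s o (i o (t o f)) = t o f"
   by (rule u(2)) (simp only: sk[OF isf(2)] ik[OF sf(2)] tk[OF f] i(3)[OF Pt])
  note c2 = cE[OF f isf(2) this[symmetric]]
  have "icmp ?E f (i o (t o f)) = f"
   by (rule representsD(6)[OF Q c2(2) f]) (simp only: c2(1) ik[OF sf(2)] tk[OF f] c(6)[OF Qf])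
  with 1 show "icmp ?E (IIdn ?E o (ISrc ?E o f)) f = f \<and> icmp ?E f (IIdn ?E o (ITgt ?E o f)) = f" by simp
 next
  fix x f g h assume "f : x ~> IAr ?E" "g : x ~> IAr ?E" "h : x ~> IAr ?E"
   "ITgt ?E o f = ISrc ?E o g" "ITgt ?E o g = ISrc ?E o h"
  then have *: "f : x ~> r" "g : x ~> r" "h : x ~> r" "t o f = s o g" "t o g = s o h" by simp_all
  note fg = cE[OF *(1,2,4)] and gh = cE[OF *(2,3,5)]
  have "t o icmp ?E f g = s o h" using ST(2)[OF *(1,2,4)] *(5) by simp
  from cE[OF fg(2) *(3) this] have 1: "\<sigma> v (icmp ?E (icmp ?E f g) h) = cE (cE (\<sigma> v f) (\<sigma> v g)) (\<sigma> v h)"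
   "icmp ?E (icmp ?E f g) h : x ~> r" using fg by simp_all
  have "t o f = s o icmp ?E g h" using ST(1)[OF *(2,3,5)] *(4) by simp
  from cE[OF *(1) gh(2) this] have 2: "\<sigma> v (icmp ?E f (icmp ?E g h)) = cE (\<sigma> v f) (cE (\<sigma> v g) (\<sigma> v h))"
   "icmp ?E f (icmp ?E g h) : x ~> r" using gh by simp_all
  show "icmp ?E (icmp ?E f g) h = icmp ?E f (icmp ?E g h)"
   by (rule representsD(6)[OF Q 1(2) 2(2)])
    (simp only: 1(1) 2(1) c(7)[OF Qk[OF *(1)] Qk[OF *(2)] Qk[OF *(3)] fg(3) gh(3)])
 qed (use Pu Qv s t i' c' in simp_all)
 from that[OF this] sk tk ik cE(1) show ?thesis by simp
qed

subsection \<open>The terminal internal category, discrete categories and products\<close>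

definition disc where
 "disc x = \<lparr>IOb = x, IAr = x, ISrc = Idn V x, ITgt = Idn V x, IIdn = Idn V x, ICmp = pb1 V (Idn V x) (Idn V x)\<rparr>"

lemma disc_simps [simp]: "IOb (disc x) = x" "IAr (disc x) = x" "ISrc (disc x) = Idn V x"
 "ITgt (disc x) = Idn V x" "IIdn (disc x) = Idn V x"
 by (simp_all add: disc_def)

lemma icmp_disc [simp]: assumes "f : Ar V" "Cod V f = x" shows "icmp (disc x) f f = f"
 using pb_tuple[of "Idn V x" "Idn V x" f "Dom V f" f] assms Cod_Ob[OF assms(1)]
 by (simp add: icmp_def) (simp add: disc_def)

lemma disc_Ob [simp]: assumes "x : Ob V" shows "disc x : Ob W"
proof (rule internal_categoryI)
 show "ICmp (disc x) : ipairs V (disc x) ~> IAr (disc x)"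
  using assms pb_simps[of "Idn V x" "Idn V x"] by (simp add: disc_def)
next
 fix y f g assume "f : y ~> IAr (disc x)" "g : y ~> IAr (disc x)" "ITgt (disc x) o f = ISrc (disc x) o g"
 then have "f = g" by simp
 then show "ISrc (disc x) o icmp (disc x) f g = ISrc (disc x) o f \<and> ITgt (disc x) o icmp (disc x) f g = ITgt (disc x) o g"
  using \<open>f : y ~> IAr (disc x)\<close> by simp
qed (use assms in simp_all)

text \<open>A functor out of \<^term>\<open>disc x\<close> is the same as an element at stage \<^term>\<open>x\<close> of the objects of its target.\<close>

definition from_disc where
 "from_disc B k = mkf (disc (Dom V k)) B k (IIdn B o k)"

lemma from_disc [simp]:
 assumes "B : Ob W" "k : Ar V" "Cod V k = IOb B"
 shows "from_disc B k : Ar W" "Dom W (from_disc B k) = disc (Dom V k)" "Cod W (from_disc B k) = B"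
  "I0 (from_disc B k) = k" "I1 (from_disc B k) = IIdn B o k"
proof -
 have "from_disc B k : Hom W (disc (Dom V k)) B"
  unfolding from_disc_def
 proof (rule ifunI)
  fix x f g assume *: "f : x ~> IAr (disc (Dom V k))" "g : x ~> IAr (disc (Dom V k))"
   "ITgt (disc (Dom V k)) o f = ISrc (disc (Dom V k)) o g"
  then have "f = g" by simp
  then show "(IIdn B o k) o icmp (disc (Dom V k)) f g = icmp B ((IIdn B o k) o f) ((IIdn B o k) o g)"
   using * assms by simp
 qed (use assms in simp_all)
 then show "from_disc B k : Ar W" "Dom W (from_disc B k) = disc (Dom V k)" "Cod W (from_disc B k) = B" by simp_all
qed (simp_all add: from_disc_def)

lemma from_disc_eqI:
 assumes "F : Hom W (disc x) B" "G : Hom W (disc x) B" "I0 F = I0 G"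
 shows "F = G"
proof (rule ifun_eqI[OF assms])
 have x: "x : Ob V" using icat_typing(1)[OF W.Hom_Ob(1)[OF assms(1)]] by simp
 have "I1 H = IIdn B o I0 H" if H: "H : Hom W (disc x) B" for H
  using ifun(3)[of H "disc x" "Idn V x"] ifun_typing0(3-8)[of H] H x by simp
 then show "I1 F = I1 G" using assms by metis
qed

lemma W_terminal: "is_terminal W (disc (terminal V))"
 unfolding is_terminal_def
proof (intro conjI ballI)
 fix A assume A: "A : Ob W"
 let ?H = "mkf A (disc (terminal V)) (bang V (IOb A)) (bang V (IAr A))"
 have H: "?H : Hom W A (disc (terminal V))"
  by (rule ifunI) (use A in simp_all)
 have "F = ?H" if F: "F : Hom W A (disc (terminal V))" for F
 proof (rule ifun_eqI[OF F H])
  show "I0 F = I0 ?H" by (rule terminal_eqI[of _ "IOb A"]) (use F A ifun_typing0(3-8)[of F] in simp_all)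
  show "I1 F = I1 ?H" by (rule terminal_eqI[of _ "IAr A"]) (use F A ifun_typing0(3-8)[of F] in simp_all)
 qed
 with H show "\<exists>!f. f : Hom W A (disc (terminal V))" by blast
qed simp

lemma W_product:
 assumes A: "A : Ob W" and B: "B : Ob W"
 obtains E p q where "is_product W A B E p q" "is_product V (IOb A) (IOb B) (IOb E) (I0 p) (I0 q)"
  "is_product V (IAr A) (IAr B) (IAr E) (I1 p) (I1 q)"
proof -
 have oA: "IOb A : Ob V" "IOb B : Ob V" "IAr A : Ob V" "IAr B : Ob V" using A B by simp_all
 note P = represents_pair[OF represents_hom[OF oA(1)] represents_hom[OF oA(2)]]
 note Q = represents_pair[OF represents_hom[OF oA(3)] represents_hom[OF oA(4)]]
 obtain E where E: "E : Ob W" "IOb E = Prod V (IOb A) (IOb B)" "IAr E = Prod V (IAr A) (IAr B)"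
  and e: "!!x k. k : x ~> Prod V (IAr A) (IAr B) ==>
    (pr1 V (IOb A) (IOb B) o (ISrc E o k), pr2 V (IOb A) (IOb B) o (ISrc E o k))
    = (ISrc A o (pr1 V (IAr A) (IAr B) o k), ISrc B o (pr2 V (IAr A) (IAr B) o k))"
   "!!x k. k : x ~> Prod V (IAr A) (IAr B) ==>
    (pr1 V (IOb A) (IOb B) o (ITgt E o k), pr2 V (IOb A) (IOb B) o (ITgt E o k))
    = (ITgt A o (pr1 V (IAr A) (IAr B) o k), ITgt B o (pr2 V (IAr A) (IAr B) o k))"
   "!!x k. k : x ~> Prod V (IOb A) (IOb B) ==>
    (pr1 V (IAr A) (IAr B) o (IIdn E o k), pr2 V (IAr A) (IAr B) o (IIdn E o k))
    = (IIdn A o (pr1 V (IOb A) (IOb B) o k), IIdn B o (pr2 V (IOb A) (IOb B) o k))"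
   "!!x k l. k : x ~> Prod V (IAr A) (IAr B) ==> l : x ~> Prod V (IAr A) (IAr B) ==> ITgt E o k = ISrc E o l ==>
    (pr1 V (IAr A) (IAr B) o icmp E k l, pr2 V (IAr A) (IAr B) o icmp E k l)
    = (icmp A (pr1 V (IAr A) (IAr B) o k) (pr1 V (IAr A) (IAr B) o l),
     icmp B (pr2 V (IAr A) (IAr B) o k) (pr2 V (IAr A) (IAr B) o l))"
  by (rule represented_internal_category[OF P Q,
    where sE = "\<lambda>e. (ISrc A o fst e, ISrc B o snd e)" and tE = "\<lambda>e. (ITgt A o fst e, ITgt B o snd e)"
     and iE = "\<lambda>e. (IIdn A o fst e, IIdn B o snd e)" and cE = "\<lambda>e e'. (icmp A (fst e) (fst e'), icmp B (snd e) (snd e'))"])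
   (use A B in \<open>simp_all\<close>)
 have e1: "pr1 V (IOb A) (IOb B) o (ISrc E o k) = ISrc A o (pr1 V (IAr A) (IAr B) o k)"
   "pr2 V (IOb A) (IOb B) o (ISrc E o k) = ISrc B o (pr2 V (IAr A) (IAr B) o k)"
   "pr1 V (IOb A) (IOb B) o (ITgt E o k) = ITgt A o (pr1 V (IAr A) (IAr B) o k)"
   "pr2 V (IOb A) (IOb B) o (ITgt E o k) = ITgt B o (pr2 V (IAr A) (IAr B) o k)"
  if "k : Ar V" "Cod V k = Prod V (IAr A) (IAr B)" for k
  using e(1,2)[of k "Dom V k"] that by simp_all
 have e2: "pr1 V (IAr A) (IAr B) o (IIdn E o k) = IIdn A o (pr1 V (IOb A) (IOb B) o k)"
   "pr2 V (IAr A) (IAr B) o (IIdn E o k) = IIdn B o (pr2 V (IOb A) (IOb B) o k)"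
  if "k : Ar V" "Cod V k = Prod V (IOb A) (IOb B)" for k
  using e(3)[of k "Dom V k"] that by simp_all
 have e3: "pr1 V (IAr A) (IAr B) o icmp E k l = icmp A (pr1 V (IAr A) (IAr B) o k) (pr1 V (IAr A) (IAr B) o l)"
   "pr2 V (IAr A) (IAr B) o icmp E k l = icmp B (pr2 V (IAr A) (IAr B) o k) (pr2 V (IAr A) (IAr B) o l)"
  if "k : Ar V" "Cod V k = Prod V (IAr A) (IAr B)" "l : Ar V" "Cod V l = Prod V (IAr A) (IAr B)"
   "Dom V k = Dom V l" "ITgt E o k = ISrc E o l" for k l
  using e(4)[of k "Dom V k" l] that by simp_all
 note oA [simp] note E [simp] note A [simp] note B [simp] note e1 [simp] note e2 [simp] note e3 [simp]
 let ?p = "mkf E A (pr1 V (IOb A) (IOb B)) (pr1 V (IAr A) (IAr B))"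
 let ?q = "mkf E B (pr2 V (IOb A) (IOb B)) (pr2 V (IAr A) (IAr B))"
 have p: "?p : Hom W E A" by (rule ifunI) simp_all
 have q: "?q : Hom W E B" by (rule ifunI) simp_all
 have "is_product W A B E ?p ?q"
  unfolding is_product_def
 proof (intro conjI allI ballI)
  fix X F G assume F: "F : Hom W X A" and G: "G : Hom W X B"
  have X: "X : Ob W" using F by (rule W.Hom_Ob)
  have [simp]: "F : Ar W" "Dom W F = X" "Cod W F = A" "G : Ar W" "Dom W G = X" "Cod W G = B" using F G by simp_all
  have eq: "h = k" if "h : y ~> IAr E" "k : y ~> IAr E" "pr1 V (IAr A) (IAr B) o h = pr1 V (IAr A) (IAr B) o k"
   "pr2 V (IAr A) (IAr B) o h = pr2 V (IAr A) (IAr B) o k" for h k y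
   using prod_eqI[of h y "IAr A" "IAr B" k] that E A B by simp
  have eq0: "h = k" if "h : y ~> IOb E" "k : y ~> IOb E" "pr1 V (IOb A) (IOb B) o h = pr1 V (IOb A) (IOb B) o k"
   "pr2 V (IOb A) (IOb B) o h = pr2 V (IOb A) (IOb B) o k" for h k y
   using prod_eqI[of h y "IOb A" "IOb B" k] that E A B by simp
  let ?H = "mkf X E <|I0 F, I0 G|> <|I1 F, I1 G|>"
  have s: "ISrc E o (<|I1 F, I1 G|> o f) = <|I0 F, I0 G|> o (ISrc X o f)" "ITgt E o (<|I1 F, I1 G|> o f) = <|I0 F, I0 G|> o (ITgt X o f)"
   if f: "f : x ~> IAr X" for x f
   by (rule eq0[of _ x]; use f X in simp)+
  have H: "?H : Hom W X E"
  proof (rule ifunI[OF X E(1)])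
   show "ISrc E o (<|I1 F, I1 G|> o f) = <|I0 F, I0 G|> o (ISrc X o f) \<and> ITgt E o (<|I1 F, I1 G|> o f) = <|I0 F, I0 G|> o (ITgt X o f)"
    if f: "f : x ~> IAr X" for x f using s[OF that] by simp
   show "<|I1 F, I1 G|> o (IIdn X o a) = IIdn E o (<|I0 F, I0 G|> o a)" if "a : x ~> IOb X" for x a
    by (rule eq[of _ x]) (use that X in simp_all)
   fix x f g assume f: "f : x ~> IAr X" and g: "g : x ~> IAr X" and fg: "ITgt X o f = ISrc X o g"
   have "ITgt E o (<|I1 F, I1 G|> o f) = ISrc E o (<|I1 F, I1 G|> o g)" unfolding s(2)[OF f] s(1)[OF g] fg ..
   then have c: "ITgt E o <|I1 F o f, I1 G o f|> = ISrc E o <|I1 F o g, I1 G o g|>" using f g X by simp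
   show "<|I1 F, I1 G|> o icmp X f g = icmp E (<|I1 F, I1 G|> o f) (<|I1 F, I1 G|> o g)"
    by (rule eq[of _ x]) (use f g fg X c in simp_all)
  qed (use X in simp_all)
  show "\<exists>!H. H : Hom W X E \<and> ?p o\<^bsub>W\<^esub> H = F \<and> ?q o\<^bsub>W\<^esub> H = G"
  proof (rule ex1I[of _ ?H])
   show "?H : Hom W X E \<and> ?p o\<^bsub>W\<^esub> ?H = F \<and> ?q o\<^bsub>W\<^esub> ?H = G"
   proof (intro conjI)
    show "?p o\<^bsub>W\<^esub> ?H = F" by (rule ifun_eqI[of _ X A]) (use H p X in simp_all)
    show "?q o\<^bsub>W\<^esub> ?H = G" by (rule ifun_eqI[of _ X B]) (use H q X in simp_all)
   qed (rule H)
   fix K assume K: "K : Hom W X E \<and> ?p o\<^bsub>W\<^esub> K = F \<and> ?q o\<^bsub>W\<^esub> K = G"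
   have k: "K : Hom W X E" "F = ?p o\<^bsub>W\<^esub> K" "G = ?q o\<^bsub>W\<^esub> K" using K by simp_all
   have "I0 F = pr1 V (IOb A) (IOb B) o I0 K" "I0 G = pr2 V (IOb A) (IOb B) o I0 K"
    "I1 F = pr1 V (IAr A) (IAr B) o I1 K" "I1 G = pr2 V (IAr A) (IAr B) o I1 K"
    unfolding k(2,3) by simp_all
   then show "K = ?H" using k(1) by (intro ifun_eqI[OF k(1) H]) simp_all
  qed
 qed (use p q in simp_all)
 then show ?thesis by (rule that) (use product[OF oA(1,2)] product[OF oA(3,4)] E in simp_all)
qed

lemma W_cartesian: "cartesian W"
 by unfold_locales (use W_terminal W_product in blast)+

sublocale W: cartesian "cat_of V" by (rule W_cartesian)

text \<open>The chosen product is isomorphic to the levelwise one, and an isomorphism of internal categories is one at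
 both levels.\<close>

lemma W_product_levels:
 assumes A: "A : Ob W" and B: "B : Ob W"
 shows "is_product V (IOb A) (IOb B) (IOb (Prod W A B)) (I0 (pr1 W A B)) (I0 (pr2 W A B))"
  "is_product V (IAr A) (IAr B) (IAr (Prod W A B)) (I1 (pr1 W A B)) (I1 (pr2 W A B))"
proof -
 obtain E p q where E: "is_product W A B E p q" "is_product V (IOb A) (IOb B) (IOb E) (I0 p) (I0 q)"
  "is_product V (IAr A) (IAr B) (IAr E) (I1 p) (I1 q)" by (rule W_product[OF A B])
 have pq: "p : Hom W E A" "q : Hom W E B" using E(1) unfolding is_product_def by blast+
 note pr = W.pr_simps[OF A B] W.product[OF A B]
 have pr': "pr1 W A B : Hom W (Prod W A B) A" "pr2 W A B : Hom W (Prod W A B) B" using pr by simp_all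
 define h where "h = pairing W p q (pr1 W A B) (pr2 W A B)"
 define k where "k = pairing W (pr1 W A B) (pr2 W A B) p q"
 note h = W.product_pairing[OF E(1) pr', folded h_def]
 note k = W.product_pairing[OF pr(7) pq, folded k_def]
 have PO: "Prod W A B : Ob W" "E : Ob W" using W.Hom_Ob[OF h(1)] by simp_all
 have "h o\<^bsub>W\<^esub> k = Idn W E"
  by (rule W.product_eqI[OF E(1), of _ E]) (use h k pq PO in \<open>simp_all flip: W.Cmp_Cmp\<close>)
 moreover have "k o\<^bsub>W\<^esub> h = Idn W (Prod W A B)"
  by (rule W.product_eqI[OF pr(7), of _ "Prod W A B"]) (use h k pr PO in \<open>simp_all flip: W.Cmp_Cmp\<close>)
 ultimately have hk: "I0 h o I0 k = Idn V (IOb E)" "I0 k o I0 h = Idn V (IOb (Prod W A B))"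
   "I1 h o I1 k = Idn V (IAr E)" "I1 k o I1 h = Idn V (IAr (Prod W A B))"
  by (metis W_Cmp W_Idn)+
 have e: "I0 p o I0 h = I0 (pr1 W A B)" "I0 q o I0 h = I0 (pr2 W A B)"
  "I1 p o I1 h = I1 (pr1 W A B)" "I1 q o I1 h = I1 (pr2 W A B)"
  using h(2,3) by (metis W_Cmp)+
 show "is_product V (IOb A) (IOb B) (IOb (Prod W A B)) (I0 (pr1 W A B)) (I0 (pr2 W A B))"
  using is_product_iso[OF E(2), of "I0 h" "IOb (Prod W A B)" "I0 k"] h(1) k(1) hk e by simp
 show "is_product V (IAr A) (IAr B) (IAr (Prod W A B)) (I1 (pr1 W A B)) (I1 (pr2 W A B))"
  using is_product_iso[OF E(3), of "I1 h" "IAr (Prod W A B)" "I1 k"] h(1) k(1) hk e by simp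
qed

text \<open>The pair of two elements, as an element of the chosen product of internal categories.\<close>

definition pp0 where "pp0 A B = pairing V (I0 (pr1 W A B)) (I0 (pr2 W A B))"
definition pp1 where "pp1 A B = pairing V (I1 (pr1 W A B)) (I1 (pr2 W A B))"

lemma pp0 [simp]:
 assumes "A : Ob W" "B : Ob W" "f : Ar V" "g : Ar V" "Dom V f = Dom V g" "Cod V f = IOb A" "Cod V g = IOb B"
 shows "pp0 A B f g : Ar V" "Dom V (pp0 A B f g) = Dom V f" "Cod V (pp0 A B f g) = IOb (Prod W A B)"
  "I0 (pr1 W A B) o pp0 A B f g = f" "I0 (pr2 W A B) o pp0 A B f g = g"
 using product_pairing[OF W_product_levels(1)[OF assms(1,2)], of f "Dom V f" g] assms unfolding pp0_def by auto

lemma pp1 [simp]: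
 assumes "A : Ob W" "B : Ob W" "f : Ar V" "g : Ar V" "Dom V f = Dom V g" "Cod V f = IAr A" "Cod V g = IAr B"
 shows "pp1 A B f g : Ar V" "Dom V (pp1 A B f g) = Dom V f" "Cod V (pp1 A B f g) = IAr (Prod W A B)"
  "I1 (pr1 W A B) o pp1 A B f g = f" "I1 (pr2 W A B) o pp1 A B f g = g"
 using product_pairing[OF W_product_levels(2)[OF assms(1,2)], of f "Dom V f" g] assms unfolding pp1_def by auto

lemma pp0_eqI:
 "[|h : x ~> IOb (Prod W A B); k : x ~> IOb (Prod W A B); A : Ob W; B : Ob W;
  I0 (pr1 W A B) o h = I0 (pr1 W A B) o k; I0 (pr2 W A B) o h = I0 (pr2 W A B) o k|] ==> h = k"
 using product_eqI[OF W_product_levels(1)] by blast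

lemma pp1_eqI:
 "[|h : x ~> IAr (Prod W A B); k : x ~> IAr (Prod W A B); A : Ob W; B : Ob W;
  I1 (pr1 W A B) o h = I1 (pr1 W A B) o k; I1 (pr2 W A B) o h = I1 (pr2 W A B) o k|] ==> h = k"
 using product_eqI[OF W_product_levels(2)] by blast

lemma pp_Cmp [simp]:
 assumes "A : Ob W" "B : Ob W" "f : Ar V" "g : Ar V" "Dom V f = Dom V g" "r : Ar V" "Cod V r = Dom V f"
 shows "Cod V f = IOb A ==> Cod V g = IOb B ==> pp0 A B f g o r = pp0 A B (f o r) (g o r)"
  "Cod V f = IAr A ==> Cod V g = IAr B ==> pp1 A B f g o r = pp1 A B (f o r) (g o r)"
proof -
 assume t: "Cod V f = IOb A" "Cod V g = IOb B"
 have e: "I0 (pr1 W A B) o (pp0 A B f g o r) = f o r" "I0 (pr2 W A B) o (pp0 A B f g o r) = g o r"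
  by (rule Cmp_eq_precomp1; use assms t in simp)+
 show "pp0 A B f g o r = pp0 A B (f o r) (g o r)"
  by (rule pp0_eqI[of _ "Dom V r" A B]) (use e assms t in simp_all)
next
 assume t: "Cod V f = IAr A" "Cod V g = IAr B"
 have e: "I1 (pr1 W A B) o (pp1 A B f g o r) = f o r" "I1 (pr2 W A B) o (pp1 A B f g o r) = g o r"
  by (rule Cmp_eq_precomp1; use assms t in simp)+
 show "pp1 A B f g o r = pp1 A B (f o r) (g o r)"
  by (rule pp1_eqI[of _ "Dom V r" A B]) (use e assms t in simp_all)
qed

lemma pp_pr [simp]:
 assumes "A : Ob W" "B : Ob W" "h : Ar V"
 shows "Cod V h = IOb (Prod W A B) ==> pp0 A B (I0 (pr1 W A B) o h) (I0 (pr2 W A B) o h) = h"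
  "Cod V h = IAr (Prod W A B) ==> pp1 A B (I1 (pr1 W A B) o h) (I1 (pr2 W A B) o h) = h"
proof -
 assume t: "Cod V h = IOb (Prod W A B)"
 show "pp0 A B (I0 (pr1 W A B) o h) (I0 (pr2 W A B) o h) = h"
  by (rule pp0_eqI[of _ "Dom V h" A B]) (use assms t in simp_all)
next
 assume t: "Cod V h = IAr (Prod W A B)"
 show "pp1 A B (I1 (pr1 W A B) o h) (I1 (pr2 W A B) o h) = h"
  by (rule pp1_eqI[of _ "Dom V h" A B]) (use assms t in simp_all)
qed

lemma pp_icat [simp]:
 assumes AB: "A : Ob W" "B : Ob W" and t: "f : Ar V" "g : Ar V" "Dom V f = Dom V g"
 shows "Cod V f = IAr A ==> Cod V g = IAr B ==> ISrc (Prod W A B) o pp1 A B f g = pp0 A B (ISrc A o f) (ISrc B o g)"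
  "Cod V f = IAr A ==> Cod V g = IAr B ==> ITgt (Prod W A B) o pp1 A B f g = pp0 A B (ITgt A o f) (ITgt B o g)"
  "Cod V f = IOb A ==> Cod V g = IOb B ==> IIdn (Prod W A B) o pp0 A B f g = pp1 A B (IIdn A o f) (IIdn B o g)"
proof -
 let ?p = "pr1 W A B" and ?q = "pr2 W A B"
 assume c: "Cod V f = IAr A" "Cod V g = IAr B"
 note e = ifun(1)[of ?p A "pp1 A B f g", symmetric] ifun(1)[of ?q B "pp1 A B f g", symmetric]
  ifun(2)[of ?p A "pp1 A B f g", symmetric] ifun(2)[of ?q B "pp1 A B f g", symmetric]
 show "ISrc (Prod W A B) o pp1 A B f g = pp0 A B (ISrc A o f) (ISrc B o g)"
  by (rule pp0_eqI[of _ "Dom V f" A B]) (use e AB t c in simp_all)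
 show "ITgt (Prod W A B) o pp1 A B f g = pp0 A B (ITgt A o f) (ITgt B o g)"
  by (rule pp0_eqI[of _ "Dom V f" A B]) (use e AB t c in simp_all)
next
 assume c: "Cod V f = IOb A" "Cod V g = IOb B"
 show "IIdn (Prod W A B) o pp0 A B f g = pp1 A B (IIdn A o f) (IIdn B o g)"
  by (rule pp1_eqI[of _ "Dom V f" A B]) (use AB t c in simp_all)
qed

lemma icmp_pp [simp]:
 assumes AB: "A : Ob W" "B : Ob W" and t: "f : Ar V" "g : Ar V" "f' : Ar V" "g' : Ar V"
  "Dom V f = Dom V g" "Dom V f' = Dom V g'" "Dom V g = Dom V g'" "Cod V f = IAr A" "Cod V g = IAr B"
  "Cod V f' = IAr A" "Cod V g' = IAr B" "ITgt A o f = ISrc A o f'" "ITgt B o g = ISrc B o g'"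
 shows "icmp (Prod W A B) (pp1 A B f g) (pp1 A B f' g') = pp1 A B (icmp A f f') (icmp B g g')"
 by (rule pp1_eqI[of _ "Dom V f" A B]) (use AB t in simp_all)

lemma I_tuple:
 assumes "F : Hom W X A" "G : Hom W X B"
 shows "I0 (tuple W F G) = pp0 A B (I0 F) (I0 G)" "I1 (tuple W F G) = pp1 A B (I1 F) (I1 G)"
proof -
 have o: "A : Ob W" "B : Ob W" using W.Hom_Ob assms by blast+
 have e: "pr1 W A B o\<^bsub>W\<^esub> tuple W F G = F" "pr2 W A B o\<^bsub>W\<^esub> tuple W F G = G" using assms by auto
 have t: "tuple W F G : Hom W X (Prod W A B)" using assms by simp
 have 0: "I0 (pr1 W A B) o I0 (tuple W F G) = I0 F" "I0 (pr2 W A B) o I0 (tuple W F G) = I0 G"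
  "I1 (pr1 W A B) o I1 (tuple W F G) = I1 F" "I1 (pr2 W A B) o I1 (tuple W F G) = I1 G"
  unfolding W_Cmp[symmetric] e by (rule refl)+
 show "I0 (tuple W F G) = pp0 A B (I0 F) (I0 G)"
  by (rule pp0_eqI[of _ "IOb X" A B]) (use o t 0 assms in simp_all)
 show "I1 (tuple W F G) = pp1 A B (I1 F) (I1 G)"
  by (rule pp1_eqI[of _ "IAr X" A B]) (use o t 0 assms in simp_all)
qed

text \<open>The chosen product of internal categories is not known on the nose, so functors out of it are described by
 their values on pairs \<^term>\<open>pp0\<close> and \<^term>\<open>pp1\<close> of elements.\<close>

lemma ifun_prodI:
 assumes X: "X : Ob W" and A: "A : Ob W" and B: "B : Ob W"
  and h: "h : IOb (Prod W X A) ~> IOb B" and k: "k : IAr (Prod W X A) ~> IAr B"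
  and st: "!!x \<xi> f. [|\<xi> : x ~> IAr X; f : x ~> IAr A|] ==>
   ISrc B o (k o pp1 X A \<xi> f) = h o pp0 X A (ISrc X o \<xi>) (ISrc A o f) \<and>
   ITgt B o (k o pp1 X A \<xi> f) = h o pp0 X A (ITgt X o \<xi>) (ITgt A o f)"
  and i: "!!x u a. [|u : x ~> IOb X; a : x ~> IOb A|] ==>
   k o pp1 X A (IIdn X o u) (IIdn A o a) = IIdn B o (h o pp0 X A u a)"
  and c: "!!x \<xi> \<zeta> f g. [|\<xi> : x ~> IAr X; \<zeta> : x ~> IAr X; f : x ~> IAr A; g : x ~> IAr A;
    ITgt X o \<xi> = ISrc X o \<zeta>; ITgt A o f = ISrc A o g|] ==>
   k o pp1 X A (icmp X \<xi> \<zeta>) (icmp A f g) = icmp B (k o pp1 X A \<xi> f) (k o pp1 X A \<zeta> g)"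
 shows "mkf (Prod W X A) B h k : Hom W (Prod W X A) B"
proof -
 have P: "Prod W X A : Ob W" using X A by simp
 have e1: "\<exists>\<xi> f'. \<xi> : x ~> IAr X \<and> f' : x ~> IAr A \<and> f = pp1 X A \<xi> f'" if "f : x ~> IAr (Prod W X A)" for x f
  by (rule exI[of _ "I1 (pr1 W X A) o f"], rule exI[of _ "I1 (pr2 W X A) o f"]) (use that X A in simp)
 have e0: "\<exists>\<xi> f'. \<xi> : x ~> IOb X \<and> f' : x ~> IOb A \<and> f = pp0 X A \<xi> f'" if "f : x ~> IOb (Prod W X A)" for x f
  by (rule exI[of _ "I0 (pr1 W X A) o f"], rule exI[of _ "I0 (pr2 W X A) o f"]) (use that X A in simp)
 show ?thesis
 proof (rule ifunI[OF P B h k])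
  fix x f assume "f : x ~> IAr (Prod W X A)"
  then obtain \<xi> f' where f: "\<xi> : x ~> IAr X" "f' : x ~> IAr A" "f = pp1 X A \<xi> f'" using e1 by blast
  show "ISrc B o (k o f) = h o (ISrc (Prod W X A) o f) \<and> ITgt B o (k o f) = h o (ITgt (Prod W X A) o f)"
   using st[OF f(1,2)] f X A by simp
 next
  fix x a assume "a : x ~> IOb (Prod W X A)"
  then obtain u a' where a: "u : x ~> IOb X" "a' : x ~> IOb A" "a = pp0 X A u a'" using e0 by blast
  show "k o (IIdn (Prod W X A) o a) = IIdn B o (h o a)" using i[OF a(1,2)] a X A by simp
 next
  fix x f g assume fg: "f : x ~> IAr (Prod W X A)" "g : x ~> IAr (Prod W X A)" "ITgt (Prod W X A) o f = ISrc (Prod W X A) o g"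
  obtain \<xi> f' where f: "\<xi> : x ~> IAr X" "f' : x ~> IAr A" "f = pp1 X A \<xi> f'" using e1[OF fg(1)] by blast
  obtain \<zeta> g' where g: "\<zeta> : x ~> IAr X" "g' : x ~> IAr A" "g = pp1 X A \<zeta> g'" using e1[OF fg(2)] by blast
  have q: "pp0 X A (ITgt X o \<xi>) (ITgt A o f') = pp0 X A (ISrc X o \<zeta>) (ISrc A o g')" using fg(3) f g X A by simp
  have "ITgt X o \<xi> = ISrc X o \<zeta>" "ITgt A o f' = ISrc A o g'"
   using arg_cong[OF q, of "\<lambda>k. I0 (pr1 W X A) o k"] arg_cong[OF q, of "\<lambda>k. I0 (pr2 W X A) o k"] f g X A by simp_all
  with c[OF f(1) g(1) f(2) g(2)] show "k o icmp (Prod W X A) f g = icmp B (k o f) (k o g)" using f g X A by simp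
 qed
qed

end

section \<open>Exponentials of internal categories\<close>

context ccc_pb
begin

text \<open>Families of functors that depend on a parameter in \<^term>\<open>x\<close>; the two components of \<^term>\<open>h\<close> act on objects
 and on arrows.  The conditions are stated on elements, which makes them natural in \<^term>\<open>x\<close>.\<close>

definition PF where
 "PF A B x h \<longleftrightarrow> x : Ob V \<and> fst h : Prod V x (IOb A) ~> IOb B \<and> snd h : Prod V x (IAr A) ~> IAr B \<and>
  (\<forall>y u f. u : y ~> x --> f : y ~> IAr A --> ISrc B o (snd h o <|u, f|>) = fst h o <|u, ISrc A o f|>) \<and>
  (\<forall>y u f. u : y ~> x --> f : y ~> IAr A --> ITgt B o (snd h o <|u, f|>) = fst h o <|u, ITgt A o f|>) \<and>
  (\<forall>y u a. u : y ~> x --> a : y ~> IOb A --> snd h o <|u, IIdn A o a|> = IIdn B o (fst h o <|u, a|>)) \<and>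
  (\<forall>y u f g. u : y ~> x --> f : y ~> IAr A --> g : y ~> IAr A --> ITgt A o f = ISrc A o g -->
   snd h o <|u, icmp A f g|> = icmp B (snd h o <|u, f|>) (snd h o <|u, g|>))"

lemma PFD:
 assumes "PF A B x (h0, h1)"
 shows "x : Ob V" "h0 : Ar V" "Dom V h0 = Prod V x (IOb A)" "Cod V h0 = IOb B"
  "h1 : Ar V" "Dom V h1 = Prod V x (IAr A)" "Cod V h1 = IAr B"
  "[|u : Ar V; f : Ar V; Cod V u = x; Cod V f = IAr A; Dom V u = Dom V f|] ==>
   ISrc B o (h1 o <|u, f|>) = h0 o <|u, ISrc A o f|>"
  "[|u : Ar V; f : Ar V; Cod V u = x; Cod V f = IAr A; Dom V u = Dom V f|] ==>
   ITgt B o (h1 o <|u, f|>) = h0 o <|u, ITgt A o f|>"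
  "[|u : Ar V; a : Ar V; Cod V u = x; Cod V a = IOb A; Dom V u = Dom V a|] ==>
   h1 o <|u, IIdn A o a|> = IIdn B o (h0 o <|u, a|>)"
  "[|u : Ar V; f : Ar V; g : Ar V; Cod V u = x; Cod V f = IAr A; Cod V g = IAr A; Dom V u = Dom V f;
    Dom V f = Dom V g; ITgt A o f = ISrc A o g|] ==>
   h1 o <|u, icmp A f g|> = icmp B (h1 o <|u, f|>) (h1 o <|u, g|>)"
 using assms unfolding PF_def fst_conv snd_conv by auto

lemma elements_eq_iff:
 assumes "f : Prod V x a ~> b" "g : Prod V x a ~> b" "x : Ob V" "a : Ob V"
  "!!y u z. u : y ~> x ==> z : y ~> a ==> f o <|u, z|> = F u z"
  "!!y u z. u : y ~> x ==> z : y ~> a ==> g o <|u, z|> = G u z"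
 shows "f = g \<longleftrightarrow> (\<forall>y u z. u : y ~> x --> z : y ~> a --> F u z = G u z)"
proof
 assume "f = g"
 then show "\<forall>y u z. u : y ~> x --> z : y ~> a --> F u z = G u z"
  using assms(5,6) by metis
next
 assume R: "\<forall>y u z. u : y ~> x --> z : y ~> a --> F u z = G u z"
 show "f = g"
 proof (rule elements_eqI[OF assms(1-4)])
  fix y u z assume "u : y ~> x" "z : y ~> a"
  then show "f o <|u, z|> = g o <|u, z|>" using R assms(5,6) by metis
 qed
qed

text \<open>Start from the pairs of arbitrary maps on objects and on arrows, which are represented by a product of two
 exponentials, and impose one after the other the four equations of a functor.\<close>

lemma PF_represented:
 assumes A: "A : Ob W" and B: "B : Ob W"
 shows "\<exists>q u. represents (PF A B) (\<lambda>h k. (restr (IOb A) (fst h) k, restr (IAr A) (snd h) k)) q u"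
proof -
 let ?\<rho> = "\<lambda>h k. (restr (IOb A) (fst h) k, restr (IAr A) (snd h) k)"
 define P0 where "P0 x h \<longleftrightarrow> (x : Ob V \<and> fst h : Prod V x (IOb A) ~> IOb B) \<and>
  (x : Ob V \<and> snd h : Prod V x (IAr A) ~> IAr B)" for x h
 note [simp] = icat_typing[OF A] icat_typing[OF B]
 obtain q u where r0: "represents P0 ?\<rho> q u"
  using represents_pair[OF represents_exp[of "IOb A" "IOb B"] represents_exp[of "IAr A" "IAr B"]]
  unfolding P0_def[abs_def] by auto
 have P0: "x : Ob V" "fst h : Ar V" "Dom V (fst h) = Prod V x (IOb A)" "Cod V (fst h) = IOb B"
   "snd h : Ar V" "Dom V (snd h) = Prod V x (IAr A)" "Cod V (snd h) = IAr B" if "P0 x h" for x h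
  using that unfolding P0_def by simp_all
 let ?s = "\<lambda>x h. ISrc B o snd h" and ?s' = "\<lambda>x h. fst h o <|pr1 V x (IAr A), ISrc A o pr2 V x (IAr A)|>"
 define P1 where "P1 x h \<longleftrightarrow> P0 x h \<and> ?s x h = ?s' x h" for x h
 have restr_simp: "restr a (fst h) k : Ar V" "Dom V (restr a (fst h) k) = Prod V y a" "Cod V (restr a (fst h) k) = Cod V (fst h)"
  "[|v : Ar V; z : Ar V; Cod V v = y; Cod V z = a; Dom V v = Dom V z|] ==> restr a (fst h) k o <|v, z|> = fst h o <|k o v, z|>"
  if "P0 x h" "k : y ~> x" "a = IOb A" for x y h k a v z
  using that P0[OF that(1)] by simp_all
 have "\<exists>q' u'. represents (\<lambda>x e. P0 x e \<and> ?s x e = ?s' x e) ?\<rho> q' u'"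
 proof (rule represents_equation[OF r0, of "IAr A" "IOb B"])
  fix x e y k assume e: "P0 x e" and k: "k : y ~> x"
  note [simp] = P0[OF e] k[unfolded Hom_iff] have [simp]: "y : Ob V" using k by (rule Hom_Ob)
  show "?s y (?\<rho> e k) = restr (IAr A) (?s x e) k" by (simp add: restr_def)
  show "?s' y (?\<rho> e k) = restr (IAr A) (?s' x e) k" by (simp add: restr_def)
 qed (use P0 in simp_all)
 then obtain q u where r1: "represents P1 ?\<rho> q u" unfolding P1_def[abs_def] by blast
 let ?t = "\<lambda>x h. ITgt B o snd h" and ?t' = "\<lambda>x h. fst h o <|pr1 V x (IAr A), ITgt A o pr2 V x (IAr A)|>"
 define P2 where "P2 x h \<longleftrightarrow> P1 x h \<and> ?t x h = ?t' x h" for x h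
 have P1: "P0 x h" if "P1 x h" for x h using that unfolding P1_def by blast
 have "\<exists>q' u'. represents (\<lambda>x e. P1 x e \<and> ?t x e = ?t' x e) ?\<rho> q' u'"
 proof (rule represents_equation[OF r1, of "IAr A" "IOb B"])
  fix x e y k assume "P1 x e" and k: "k : y ~> x"
  note [simp] = P0[OF P1[OF this(1)]] k[unfolded Hom_iff] have [simp]: "y : Ob V" using k by (rule Hom_Ob)
  show "?t y (?\<rho> e k) = restr (IAr A) (?t x e) k" by (simp add: restr_def)
  show "?t' y (?\<rho> e k) = restr (IAr A) (?t' x e) k" by (simp add: restr_def)
 qed (use P0[OF P1] in simp_all)
 then obtain q u where r2: "represents P2 ?\<rho> q u" unfolding P2_def[abs_def] by blast
 have P2: "P0 x h" if "P2 x h" for x h using that P1 unfolding P2_def by blast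
 let ?i = "\<lambda>x h. snd h o <|pr1 V x (IOb A), IIdn A o pr2 V x (IOb A)|>" and ?i' = "\<lambda>x h. IIdn B o fst h"
 define P3 where "P3 x h \<longleftrightarrow> P2 x h \<and> ?i x h = ?i' x h" for x h
 have "\<exists>q' u'. represents (\<lambda>x e. P2 x e \<and> ?i x e = ?i' x e) ?\<rho> q' u'"
 proof (rule represents_equation[OF r2, of "IOb A" "IAr B"])
  fix x e y k assume "P2 x e" and k: "k : y ~> x"
  note [simp] = P0[OF P2[OF this(1)]] k[unfolded Hom_iff] have [simp]: "y : Ob V" using k by (rule Hom_Ob)
  show "?i y (?\<rho> e k) = restr (IOb A) (?i x e) k" by (simp add: restr_def)
  show "?i' y (?\<rho> e k) = restr (IOb A) (?i' x e) k" by (simp add: restr_def)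
 qed (use P0[OF P2] in simp_all)
 then obtain q u where r3: "represents P3 ?\<rho> q u" unfolding P3_def[abs_def] by blast
 have P3: "P0 x h" if "P3 x h" for x h using that P2 unfolding P3_def by blast
 have el: "(\<forall>y u f. u : y ~> x --> f : y ~> IAr A --> ISrc B o (snd h o <|u, f|>) = fst h o <|u, ISrc A o f|>) \<longleftrightarrow> ?s x h = ?s' x h"
   "(\<forall>y u f. u : y ~> x --> f : y ~> IAr A --> ITgt B o (snd h o <|u, f|>) = fst h o <|u, ITgt A o f|>) \<longleftrightarrow> ?t x h = ?t' x h"
   "(\<forall>y u a. u : y ~> x --> a : y ~> IOb A --> snd h o <|u, IIdn A o a|> = IIdn B o (fst h o <|u, a|>)) \<longleftrightarrow> ?i x h = ?i' x h"
   if h: "P0 x h" for x h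
   apply (rule elements_eq_iff[of _ x _ "IOb B", symmetric]; use P0[OF h] in simp)
   apply (rule elements_eq_iff[of _ x _ "IOb B", symmetric]; use P0[OF h] in simp)
  by (rule elements_eq_iff[of _ x _ "IAr B", symmetric]; use P0[OF h] in simp)
 let ?AA = "ipairs V A"
 note AA = pb_simps[of "ITgt A" "ISrc A"] pb_commute[of "ITgt A" "ISrc A"]
 have AAr: "ITgt A o (ip1 V A o r) = ISrc A o (ip2 V A o r)" if "r : Ar V" "Cod V r = ?AA" for r
  by (rule Cmp_eq_precomp) (use AA that in simp_all)
 let ?f = "\<lambda>x h. snd h o <|pr1 V x ?AA, ip1 V A o pr2 V x ?AA|>" and ?g = "\<lambda>x h. snd h o <|pr1 V x ?AA, ip2 V A o pr2 V x ?AA|>"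
 let ?c = "\<lambda>x h. snd h o <|pr1 V x ?AA, icmp A (ip1 V A o pr2 V x ?AA) (ip2 V A o pr2 V x ?AA)|>"
 let ?c' = "\<lambda>x h. icmp B (?f x h) (?g x h)"
 have P3s: "ISrc B o (snd h o <|u, f|>) = fst h o <|u, ISrc A o f|>" "ITgt B o (snd h o <|u, f|>) = fst h o <|u, ITgt A o f|>"
  if "P3 x h" "u : Ar V" "f : Ar V" "Cod V u = x" "Cod V f = IAr A" "Dom V u = Dom V f" for x h u f
  using el(1,2)[OF P3[OF that(1)]] that unfolding P3_def P2_def P1_def by auto
 have "\<exists>q' u'. represents (\<lambda>x e. P3 x e \<and> ?c x e = ?c' x e) ?\<rho> q' u'"
 proof (rule represents_equation[OF r3, of ?AA "IAr B"])
  fix x e assume e: "P3 x e"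
  note [simp] = P0[OF P3[OF e]] P3s[OF e] AA AAr
  show "?c x e : Prod V x ?AA ~> IAr B" using A by simp
  show "?c' x e : Prod V x ?AA ~> IAr B" using A B by simp
  fix y k assume k: "k : y ~> x"
  note [simp] = k[unfolded Hom_iff] have [simp]: "y : Ob V" using k by (rule Hom_Ob)
  show "?c y (?\<rho> e k) = restr ?AA (?c x e) k" using A by (simp add: restr_def)
  show "?c' y (?\<rho> e k) = restr ?AA (?c' x e) k" using A B by (simp add: restr_def)
 qed (use AA in simp_all)
 then obtain q u where r4: "represents (\<lambda>x e. P3 x e \<and> ?c x e = ?c' x e) ?\<rho> q u" by blast
 have "P3 x h \<and> ?c x h = ?c' x h \<longleftrightarrow> PF A B x h" for x h
 proof (cases "P3 x h")
  case True
  note [simp] = P0[OF P3[OF True]] P3s[OF True] AA AAr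
  have "(\<forall>y u f g. u : y ~> x --> f : y ~> IAr A --> g : y ~> IAr A --> ITgt A o f = ISrc A o g -->
   snd h o <|u, icmp A f g|> = icmp B (snd h o <|u, f|>) (snd h o <|u, g|>)) \<longleftrightarrow> ?c x h = ?c' x h" (is "?L \<longleftrightarrow> ?R")
  proof
   assume L: ?L
   have t: "pr1 V x ?AA : Prod V x ?AA ~> x" "ip1 V A o pr2 V x ?AA : Prod V x ?AA ~> IAr A"
    "ip2 V A o pr2 V x ?AA : Prod V x ?AA ~> IAr A"
    "ITgt A o (ip1 V A o pr2 V x ?AA) = ISrc A o (ip2 V A o pr2 V x ?AA)" by simp_all
   show ?R using L t by blast
  next
   assume R: ?R
   show ?L
   proof (intro allI impI)
    fix y u f g assume t: "u : y ~> x" "f : y ~> IAr A" "g : y ~> IAr A" "ITgt A o f = ISrc A o g"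
    note p = pb_tuple[of "ITgt A" "ISrc A" f y g]
    have "?c x h o <|u, ipair V A f g|> = ?c' x h o <|u, ipair V A f g|>" unfolding R ..
    then show "snd h o <|u, icmp A f g|> = icmp B (snd h o <|u, f|>) (snd h o <|u, g|>)"
     using t p A B by simp
   qed
  qed
  then show ?thesis using True el[OF P3[OF True]] P3[OF True]
   unfolding PF_def P3_def P2_def P1_def P0_def by blast
 next
  case False
  have "P3 x h" if PF: "PF A B x h"
  proof -
   have p: "P0 x h" using PF unfolding PF_def P0_def by blast
   show ?thesis using p el[OF p] PF unfolding PF_def P3_def P2_def P1_def by blast
  qed
  then show ?thesis using False by blast
 qed
 then show ?thesis using represents_cong[OF r4] by blast
qed

text \<open>The internal category of functors and natural transformations.  Its objects represent the
 parametrized functors; an arrow at stage \<^term>\<open>x\<close> is a triple of two objects and a transformation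
 \<^term>\<open>\<phi>\<close>, given by its components.\<close>

lemma functor_category:
 assumes A: "A : Ob W" and B: "B : Ob W"
 obtains E h0 h1 \<theta> where "E : Ob W" "PF A B (IOb E) (h0, h1)"
  "\<theta> : Prod V (IAr E) (IOb A) ~> IAr B"
  "!!y \<xi> a. [|\<xi> : y ~> IAr E; a : y ~> IOb A|] ==>
   ISrc B o (\<theta> o <|\<xi>, a|>) = h0 o <|ISrc E o \<xi>, a|> \<and> ITgt B o (\<theta> o <|\<xi>, a|>) = h0 o <|ITgt E o \<xi>, a|>"
  "!!y \<xi> f. [|\<xi> : y ~> IAr E; f : y ~> IAr A|] ==>
   icmp B (\<theta> o <|\<xi>, ISrc A o f|>) (h1 o <|ITgt E o \<xi>, f|>) = icmp B (h1 o <|ISrc E o \<xi>, f|>) (\<theta> o <|\<xi>, ITgt A o f|>)"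
  "!!y u a. [|u : y ~> IOb E; a : y ~> IOb A|] ==> \<theta> o <|IIdn E o u, a|> = IIdn B o (h0 o <|u, a|>)"
  "!!y \<xi> \<zeta> a. [|\<xi> : y ~> IAr E; \<zeta> : y ~> IAr E; ITgt E o \<xi> = ISrc E o \<zeta>; a : y ~> IOb A|] ==>
   \<theta> o <|icmp E \<xi> \<zeta>, a|> = icmp B (\<theta> o <|\<xi>, a|>) (\<theta> o <|\<zeta>, a|>)"
  "!!x k0 k1. PF A B x (k0, k1) ==> \<exists>k \<in> Hom V x (IOb E). restr (IOb A) h0 k = k0 \<and> restr (IAr A) h1 k = k1"
  "!!x k l. [|k : x ~> IOb E; l : x ~> IOb E; restr (IOb A) h0 k = restr (IOb A) h0 l;
    restr (IAr A) h1 k = restr (IAr A) h1 l|] ==> k = l"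
  "!!x k l \<phi>. [|k : x ~> IOb E; l : x ~> IOb E; \<phi> : Prod V x (IOb A) ~> IAr B;
    ISrc B o \<phi> = restr (IOb A) h0 k; ITgt B o \<phi> = restr (IOb A) h0 l;
    !!y u f. [|u : y ~> x; f : y ~> IAr A|] ==>
     icmp B (\<phi> o <|u, ISrc A o f|>) (h1 o <|l o u, f|>) = icmp B (h1 o <|k o u, f|>) (\<phi> o <|u, ITgt A o f|>)|] ==>
    \<exists>\<xi> \<in> Hom V x (IAr E). ISrc E o \<xi> = k \<and> ITgt E o \<xi> = l \<and> restr (IOb A) \<theta> \<xi> = \<phi>"
  "!!x \<xi> \<zeta>. [|\<xi> : x ~> IAr E; \<zeta> : x ~> IAr E; ISrc E o \<xi> = ISrc E o \<zeta>; ITgt E o \<xi> = ITgt E o \<zeta>;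
    restr (IOb A) \<theta> \<xi> = restr (IOb A) \<theta> \<zeta>|] ==> \<xi> = \<zeta>"
proof -
 note [simp] = icat_typing[OF A] icat_typing[OF B]
 obtain q u where "represents (PF A B) (\<lambda>h k. (restr (IOb A) (fst h) k, restr (IAr A) (snd h) k)) q u"
  using PF_represented[OF A B] by blast
 moreover obtain h0 h1 where u: "u = (h0, h1)" by (cases u)
 ultimately have r: "represents (PF A B) (\<lambda>h k. (restr (IOb A) (fst h) k, restr (IAr A) (snd h) k)) q (h0, h1)" by simp
 have q [simp]: "q : Ob V" and h: "PF A B q (h0, h1)" using representsD(3,4)[OF r] by auto
 note [simp] = PFD(2-7)[OF h] and hs [simp] = PFD(8-10)[OF h] PFD(11)[OF h]
 let ?\<sigma> = "\<lambda>e m. ((fst (fst e) o m, snd (fst e) o m), restr (IOb A) (snd e) m)"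
 \<comment> \<open>Triples of two functors and a family of arrows; the source, the target and the naturality condition follow.\<close>
 define Q0 where "Q0 x e \<longleftrightarrow> (fst (fst e) : x ~> q \<and> snd (fst e) : x ~> q) \<and>
   x : Ob V \<and> snd e : Prod V x (IOb A) ~> IAr B" for x e
 obtain r0 u0 where R0: "represents Q0 ?\<sigma> r0 u0"
  using represents_pair[OF represents_pair[OF represents_hom[OF q] represents_hom[OF q]] represents_exp[of "IOb A" "IAr B"]]
  unfolding Q0_def[abs_def] by auto
 have Q0: "x : Ob V" "fst (fst e) : Ar V" "Dom V (fst (fst e)) = x" "Cod V (fst (fst e)) = q"
   "snd (fst e) : Ar V" "Dom V (snd (fst e)) = x" "Cod V (snd (fst e)) = q"
   "snd e : Ar V" "Dom V (snd e) = Prod V x (IOb A)" "Cod V (snd e) = IAr B" if "Q0 x e" for x e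
  using that unfolding Q0_def by simp_all
 define Q1 where "Q1 x e \<longleftrightarrow> Q0 x e \<and> ISrc B o snd e = restr (IOb A) h0 (fst (fst e))" for x e
 have "\<exists>q' u'. represents (\<lambda>x e. Q0 x e \<and> ISrc B o snd e = restr (IOb A) h0 (fst (fst e))) ?\<sigma> q' u'"
 proof (rule represents_equation[OF R0, of "IOb A" "IOb B"])
  fix x e y k assume e: "Q0 x e" and k: "k : y ~> x"
  note [simp] = Q0[OF e] k[unfolded Hom_iff] have [simp]: "y : Ob V" using k by (rule Hom_Ob)
  show "ISrc B o snd (?\<sigma> e k) = restr (IOb A) (ISrc B o snd e) k" by (simp add: restr_def)
  show "restr (IOb A) h0 (fst (fst (?\<sigma> e k))) = restr (IOb A) (restr (IOb A) h0 (fst (fst e))) k"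
   by (simp add: restr_restr[of _ _ q _ x _ y])
 qed (use Q0 in simp_all)
 then obtain r1 u1 where R1: "represents Q1 ?\<sigma> r1 u1" unfolding Q1_def[abs_def] by blast
 define Q2 where "Q2 x e \<longleftrightarrow> Q1 x e \<and> ITgt B o snd e = restr (IOb A) h0 (snd (fst e))" for x e
 have Q1: "Q0 x e" "ISrc B o snd e = restr (IOb A) h0 (fst (fst e))" if "Q1 x e" for x e using that unfolding Q1_def by auto
 have "\<exists>q' u'. represents (\<lambda>x e. Q1 x e \<and> ITgt B o snd e = restr (IOb A) h0 (snd (fst e))) ?\<sigma> q' u'"
 proof (rule represents_equation[OF R1, of "IOb A" "IOb B"])
  fix x e y k assume e: "Q1 x e" and k: "k : y ~> x"
  note [simp] = Q0[OF Q1(1)[OF e]] k[unfolded Hom_iff] have [simp]: "y : Ob V" using k by (rule Hom_Ob)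
  show "ITgt B o snd (?\<sigma> e k) = restr (IOb A) (ITgt B o snd e) k" by (simp add: restr_def)
  show "restr (IOb A) h0 (snd (fst (?\<sigma> e k))) = restr (IOb A) (restr (IOb A) h0 (snd (fst e))) k"
   by (simp add: restr_restr[of _ _ q _ x _ y])
 qed (use Q0[OF Q1(1)] in simp_all)
 then obtain r2 u2 where R2: "represents Q2 ?\<sigma> r2 u2" unfolding Q2_def[abs_def] by blast
 have Q2: "Q0 x e" "ISrc B o snd e = restr (IOb A) h0 (fst (fst e))" "ITgt B o snd e = restr (IOb A) h0 (snd (fst e))"
  if "Q2 x e" for x e using that Q1[of x e] unfolding Q2_def by blast+
 have Q2s: "ISrc B o (snd e o <|v, a|>) = h0 o <|fst (fst e) o v, a|>" "ITgt B o (snd e o <|v, a|>) = h0 o <|snd (fst e) o v, a|>"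
  if e: "Q2 x e" and t: "v : Ar V" "a : Ar V" "Cod V v = x" "Cod V a = IOb A" "Dom V v = Dom V a" for x e v a
  using Cmp_eq_precomp1[OF Q2(2)[OF e], of "<|v, a|>"] Cmp_eq_precomp1[OF Q2(3)[OF e], of "<|v, a|>"] t Q0[OF Q2(1)[OF e]]
  by simp_all
 let ?n = "\<lambda>x e. icmp B (snd e o <|pr1 V x (IAr A), ISrc A o pr2 V x (IAr A)|>) (restr (IAr A) h1 (snd (fst e)))"
 let ?n' = "\<lambda>x e. icmp B (restr (IAr A) h1 (fst (fst e))) (snd e o <|pr1 V x (IAr A), ITgt A o pr2 V x (IAr A)|>)"
 have nt: "?n x e : Prod V x (IAr A) ~> IAr B" "?n' x e : Prod V x (IAr A) ~> IAr B"
  "!!y u f. u : y ~> x ==> f : y ~> IAr A ==>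
    ?n x e o <|u, f|> = icmp B (snd e o <|u, ISrc A o f|>) (h1 o <|snd (fst e) o u, f|>)"
  "!!y u f. u : y ~> x ==> f : y ~> IAr A ==>
    ?n' x e o <|u, f|> = icmp B (h1 o <|fst (fst e) o u, f|>) (snd e o <|u, ITgt A o f|>)"
  if e: "Q2 x e" for x e
  using Q0[OF Q2(1)[OF e]] Q2s[OF e] A B by (simp_all add: restr_def)
 define Q where "Q x e \<longleftrightarrow> Q2 x e \<and> ?n x e = ?n' x e" for x e
 have "\<exists>q' u'. represents (\<lambda>x e. Q2 x e \<and> ?n x e = ?n' x e) ?\<sigma> q' u'"
 proof (rule represents_equation[OF R2, of "IAr A" "IAr B"])
  fix x e assume e: "Q2 x e"
  show "?n x e : Prod V x (IAr A) ~> IAr B" "?n' x e : Prod V x (IAr A) ~> IAr B"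
   using nt[OF e] by simp_all
  fix y k assume k: "k : y ~> x"
  have ek: "Q2 y (?\<sigma> e k)" by (rule representsD(1)[OF R2 e k])
  note [simp] = Q0[OF Q2(1)[OF e]] k[unfolded Hom_iff] have [simp]: "y : Ob V" using k by (rule Hom_Ob)
  show "?n y (?\<sigma> e k) = restr (IAr A) (?n x e) k"
   by (rule elements_eqI[OF nt(1)[OF ek]]) (use nt[OF e] nt(3)[OF ek] in simp_all)
  show "?n' y (?\<sigma> e k) = restr (IAr A) (?n' x e) k"
   by (rule elements_eqI[OF nt(2)[OF ek]]) (use nt[OF e] nt(4)[OF ek] in simp_all)
 qed simp_all
 then obtain r w where R: "represents Q ?\<sigma> r w" unfolding Q_def[abs_def] by blast
 have QD: "Q2 x e" "Q0 x e" if "Q x e" for x e using that Q2 unfolding Q_def by auto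
 have Qn: "icmp B (snd e o <|v, ISrc A o f|>) (h1 o <|snd (fst e) o v, f|>) = icmp B (h1 o <|fst (fst e) o v, f|>) (snd e o <|v, ITgt A o f|>)"
  if e: "Q x e" and t: "v : y ~> x" "f : y ~> IAr A" for x e y v f
  using nt(3,4)[OF QD(1)[OF e] t] e unfolding Q_def by metis
 have QI: "Q x e" if e: "Q0 x e" "ISrc B o snd e = restr (IOb A) h0 (fst (fst e))" "ITgt B o snd e = restr (IOb A) h0 (snd (fst e))"
   "!!y v f. v : y ~> x ==> f : y ~> IAr A ==>
    icmp B (snd e o <|v, ISrc A o f|>) (h1 o <|snd (fst e) o v, f|>) = icmp B (h1 o <|fst (fst e) o v, f|>) (snd e o <|v, ITgt A o f|>)" for x e
 proof -
  have e2: "Q2 x e" using e(1-3) unfolding Q2_def Q1_def by blast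
  have "?n x e = ?n' x e"
   by (rule elements_eqI[OF nt(1,2)[OF e2]]) (use nt(3,4)[OF e2] e(4) Q0[OF e(1)] in simp_all)
  then show ?thesis using e2 unfolding Q_def by blast
 qed
 have comp: "ITgt B o snd e = ISrc B o snd e'" if "Q x e" "Q x e'" "snd (fst e) = fst (fst e')" for x e e'
  using Q2[OF QD(1)[OF that(1)]] Q2[OF QD(1)[OF that(2)]] that(3) by simp
 obtain E where E: "E : Ob W" "IOb E = q" "IAr E = r"
  "!!x k. k : x ~> r ==> Idn V q o (ISrc E o k) = fst (fst (?\<sigma> w k))"
  "!!x k. k : x ~> r ==> Idn V q o (ITgt E o k) = snd (fst (?\<sigma> w k))"
  "!!x k. k : x ~> q ==> ?\<sigma> w (IIdn E o k) = ((Idn V q o k, Idn V q o k), IIdn B o restr (IOb A) h0 (Idn V q o k))"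
  "!!x k l. k : x ~> r ==> l : x ~> r ==> ITgt E o k = ISrc E o l ==>
    ?\<sigma> w (icmp E k l) = ((fst (fst (?\<sigma> w k)), snd (fst (?\<sigma> w l))), icmp B (snd (?\<sigma> w k)) (snd (?\<sigma> w l)))"
 proof (rule represented_internal_category[OF represents_hom[OF q] R,
    where sE = "\<lambda>e. fst (fst e)" and tE = "\<lambda>e. snd (fst e)" and iE = "\<lambda>k. ((k, k), IIdn B o restr (IOb A) h0 k)"
    and cE = "\<lambda>e e'. ((fst (fst e), snd (fst e')), icmp B (snd e) (snd e'))"])
  show "fst (fst f) : x ~> q" "snd (fst f) : x ~> q" if "Q x f" for x f using Q0[OF QD(2)[OF that]] by simp_all
  show "Q x ((e, e), IIdn B o restr (IOb A) h0 e)" if e: "e : x ~> q" for x e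
  proof (rule QI)
   have x: "x : Ob V" using e by (rule Hom_Ob)
   show "Q0 x ((e, e), IIdn B o restr (IOb A) h0 e)" using e x by (simp add: Q0_def)
  qed (use e A B Hom_Ob(1)[OF e] in \<open>simp_all add: restr_def\<close>)
  show "((e o k, e o k), IIdn B o restr (IOb A) h0 (e o k)) = ?\<sigma> ((e, e), IIdn B o restr (IOb A) h0 e) k"
   if "e : x ~> q" "k : y ~> x" for x e y k
   using that Hom_Ob[OF that(2)] by (simp add: restr_def)
  fix x f g assume fg: "Q x f" "Q x g" "snd (fst f) = fst (fst g)"
  note [simp] = Q0[OF QD(2)[OF fg(1)]] Q0[OF QD(2)[OF fg(2)]] Q2s[OF QD(1)[OF fg(1)]] Q2s[OF QD(1)[OF fg(2)]] fg(3)
  note c = comp[OF fg]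
  show "Q x ((fst (fst f), snd (fst g)), icmp B (snd f) (snd g))"
  proof (rule QI)
   show "Q0 x ((fst (fst f), snd (fst g)), icmp B (snd f) (snd g))" using c B by (simp add: Q0_def)
   show "ISrc B o snd ((fst (fst f), snd (fst g)), icmp B (snd f) (snd g)) =
     restr (IOb A) h0 (fst (fst ((fst (fst f), snd (fst g)), icmp B (snd f) (snd g))))"
    "ITgt B o snd ((fst (fst f), snd (fst g)), icmp B (snd f) (snd g)) =
     restr (IOb A) h0 (snd (fst ((fst (fst f), snd (fst g)), icmp B (snd f) (snd g))))"
    using c B Q2[OF QD(1)[OF fg(1)]] Q2[OF QD(1)[OF fg(2)]] by simp_all
   fix y v l assume v: "v : y ~> x" and l: "l : y ~> IAr A"
   note [simp] = v[unfolded Hom_iff] l[unfolded Hom_iff]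
   have 1: "icmp B (snd f o <|v, ISrc A o l|>) (h1 o <|fst (fst g) o v, l|>) = icmp B (h1 o <|fst (fst f) o v, l|>) (snd f o <|v, ITgt A o l|>)"
    using Qn[OF fg(1) v l] by simp
   have 2: "icmp B (snd g o <|v, ISrc A o l|>) (h1 o <|snd (fst g) o v, l|>) = icmp B (h1 o <|fst (fst g) o v, l|>) (snd g o <|v, ITgt A o l|>)"
    using Qn[OF fg(2) v l] by simp
   have "icmp B (icmp B (snd f) (snd g) o <|v, ISrc A o l|>) (h1 o <|snd (fst g) o v, l|>) =
     icmp B (snd f o <|v, ISrc A o l|>) (icmp B (snd g o <|v, ISrc A o l|>) (h1 o <|snd (fst g) o v, l|>))"
    using A B c by simp
   also have "\<dots> = icmp B (icmp B (snd f o <|v, ISrc A o l|>) (h1 o <|fst (fst g) o v, l|>)) (snd g o <|v, ITgt A o l|>)"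
    unfolding 2 using A B c by simp
   also have "\<dots> = icmp B (h1 o <|fst (fst f) o v, l|>) (icmp B (snd f) (snd g) o <|v, ITgt A o l|>)"
    unfolding 1 using A B c by simp
   finally show "icmp B (snd ((fst (fst f), snd (fst g)), icmp B (snd f) (snd g)) o <|v, ISrc A o l|>)
     (h1 o <|snd (fst ((fst (fst f), snd (fst g)), icmp B (snd f) (snd g))) o v, l|>) =
    icmp B (h1 o <|fst (fst ((fst (fst f), snd (fst g)), icmp B (snd f) (snd g))) o v, l|>)
     (snd ((fst (fst f), snd (fst g)), icmp B (snd f) (snd g)) o <|v, ITgt A o l|>)" by simp
  qed
  show "((fst (fst (?\<sigma> f k)), snd (fst (?\<sigma> g k))), icmp B (snd (?\<sigma> f k)) (snd (?\<sigma> g k))) =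
    ?\<sigma> ((fst (fst f), snd (fst g)), icmp B (snd f) (snd g)) k" if k: "k : y ~> x" for y k
   using k Hom_Ob[OF k] c B by (simp add: restr_def)
 next
  fix x f assume f: "Q x f"
  note [simp] = Q0[OF QD(2)[OF f]]
  show "((fst (fst ((fst (fst f), fst (fst f)), IIdn B o restr (IOb A) h0 (fst (fst f)))), snd (fst f)),
     icmp B (snd ((fst (fst f), fst (fst f)), IIdn B o restr (IOb A) h0 (fst (fst f)))) (snd f)) = f"
   using Q2[OF QD(1)[OF f]] B by (simp add: prod_eq_iff)
  show "((fst (fst f), snd (fst ((snd (fst f), snd (fst f)), IIdn B o restr (IOb A) h0 (snd (fst f))))),
     icmp B (snd f) (snd ((snd (fst f), snd (fst f)), IIdn B o restr (IOb A) h0 (snd (fst f))))) = f"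
   using Q2[OF QD(1)[OF f]] B by (simp add: prod_eq_iff)
 next
  fix x f g l assume *: "Q x f" "Q x g" "Q x l" "snd (fst f) = fst (fst g)" "snd (fst g) = fst (fst l)"
  note c = comp[OF *(1,2,4)] comp[OF *(2,3,5)]
  show "((fst (fst ((fst (fst f), snd (fst g)), icmp B (snd f) (snd g))), snd (fst l)),
     icmp B (snd ((fst (fst f), snd (fst g)), icmp B (snd f) (snd g))) (snd l)) =
    ((fst (fst f), snd (fst ((fst (fst g), snd (fst l)), icmp B (snd g) (snd l)))),
     icmp B (snd f) (snd ((fst (fst g), snd (fst l)), icmp B (snd g) (snd l))))"
   using Q0[OF QD(2)[OF *(1)]] Q0[OF QD(2)[OF *(2)]] Q0[OF QD(2)[OF *(3)]] c B by simp
 qed simp_all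
 obtain k' l' \<theta> where w: "w = ((k', l'), \<theta>)" by (cases w; cases "fst w") auto
 have wQ: "Q r w" by (rule representsD(4)[OF R])
 have ro [simp]: "r : Ob V" by (rule representsD(3)[OF R])
 have \<theta> [simp]: "\<theta> : Ar V" "Dom V \<theta> = Prod V r (IOb A)" "Cod V \<theta> = IAr B" "k' : Ar V" "Dom V k' = r" "Cod V k' = q"
  "l' : Ar V" "Dom V l' = r" "Cod V l' = q"
  using Q0[OF QD(2)[OF wQ]] unfolding w by simp_all
 have st: "ISrc E o k = k' o k" "ITgt E o k = l' o k" if "k : Ar V" "Cod V k = r" for k
  using E(4,5)[of k "Dom V k"] that icat_typing[OF E(1)] unfolding w E(2,3) by simp_all
 show ?thesis
 proof (rule that[OF E(1), unfolded E(2,3), OF h, of \<theta>])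
  show "\<theta> : Prod V r (IOb A) ~> IAr B" by simp
  show "ISrc B o (\<theta> o <|\<xi>, a|>) = h0 o <|ISrc E o \<xi>, a|> \<and> ITgt B o (\<theta> o <|\<xi>, a|>) = h0 o <|ITgt E o \<xi>, a|>"
   if "\<xi> : y ~> r" "a : y ~> IOb A" for y \<xi> a
   using Q2s[OF QD(1)[OF wQ], of \<xi> a] that st[of \<xi>] unfolding w by simp
  show "icmp B (\<theta> o <|\<xi>, ISrc A o f|>) (h1 o <|ITgt E o \<xi>, f|>) = icmp B (h1 o <|ISrc E o \<xi>, f|>) (\<theta> o <|\<xi>, ITgt A o f|>)"
   if "\<xi> : y ~> r" "f : y ~> IAr A" for y \<xi> f
   using Qn[OF wQ that] that st[of \<xi>] unfolding w by simp
  show "\<theta> o <|IIdn E o u, a|> = IIdn B o (h0 o <|u, a|>)" if "u : y ~> q" "a : y ~> IOb A" for y u a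
  proof -
   have "restr (IOb A) \<theta> (IIdn E o u) = IIdn B o restr (IOb A) h0 u"
    using E(6)[OF that(1)] that unfolding w by simp
   from arg_cong[OF this, of "\<lambda>k. k o <|Idn V y, a|>"] show ?thesis
    using that Hom_Ob[OF that(1)] icat_typing[OF E(1)] unfolding E(2,3) by simp
  qed
  show "\<theta> o <|icmp E \<xi> \<zeta>, a|> = icmp B (\<theta> o <|\<xi>, a|>) (\<theta> o <|\<zeta>, a|>)"
   if t: "\<xi> : y ~> r" "\<zeta> : y ~> r" "ITgt E o \<xi> = ISrc E o \<zeta>" "a : y ~> IOb A" for y \<xi> \<zeta> a
  proof -
   have y: "y : Ob V" using t(1) by (rule Hom_Ob)
   have "restr (IOb A) \<theta> (icmp E \<xi> \<zeta>) = icmp B (restr (IOb A) \<theta> \<xi>) (restr (IOb A) \<theta> \<zeta>)"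
    using E(7)[OF t(1-3)] unfolding w by simp
   from arg_cong[OF this, of "\<lambda>k. k o <|Idn V y, a|>"]
   have "\<theta> o <|icmp E \<xi> \<zeta>, a|> = icmp B (restr (IOb A) \<theta> \<xi>) (restr (IOb A) \<theta> \<zeta>) o <|Idn V y, a|>"
    using t y icmp[OF E(1), of \<xi> \<zeta>] unfolding E(2,3) by simp
   moreover have "ITgt B o restr (IOb A) \<theta> \<xi> = ISrc B o restr (IOb A) \<theta> \<zeta>"
   proof (rule elements_eqI[of _ y "IOb A" "IOb B"])
    fix z v b assume vb: "v : z ~> y" "b : z ~> IOb A"
    have "l' o (\<xi> o v) = k' o (\<zeta> o v)"
     by (rule Cmp_eq_precomp) (use t vb st[of \<xi>] st[of \<zeta>] in simp_all)
    then show "(ITgt B o restr (IOb A) \<theta> \<xi>) o <|v, b|> = (ISrc B o restr (IOb A) \<theta> \<zeta>) o <|v, b|>"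
     using Q2s[OF QD(1)[OF wQ], of "\<xi> o v" b] Q2s[OF QD(1)[OF wQ], of "\<zeta> o v" b] t vb y unfolding w by simp
   qed (use t y in simp_all)
   ultimately show ?thesis using t y B by simp
  qed
  show "\<exists>k \<in> Hom V x q. restr (IOb A) h0 k = k0 \<and> restr (IAr A) h1 k = k1" if "PF A B x (k0, k1)" for x k0 k1
   using representsD(5)[OF r that] by simp
  show "k = l" if "k : x ~> q" "l : x ~> q" "restr (IOb A) h0 k = restr (IOb A) h0 l"
    "restr (IAr A) h1 k = restr (IAr A) h1 l" for x k l
   by (rule representsD(6)[OF r that(1,2)]) (simp add: that)
  show "\<exists>\<xi> \<in> Hom V x r. ISrc E o \<xi> = k \<and> ITgt E o \<xi> = l \<and> restr (IOb A) \<theta> \<xi> = \<phi>"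
   if t: "k : x ~> q" "l : x ~> q" "\<phi> : Prod V x (IOb A) ~> IAr B"
    "ISrc B o \<phi> = restr (IOb A) h0 k" "ITgt B o \<phi> = restr (IOb A) h0 l"
    "!!y u f. [|u : y ~> x; f : y ~> IAr A|] ==>
     icmp B (\<phi> o <|u, ISrc A o f|>) (h1 o <|l o u, f|>) = icmp B (h1 o <|k o u, f|>) (\<phi> o <|u, ITgt A o f|>)" for x k l \<phi>
  proof -
   have "Q x ((k, l), \<phi>)"
    by (rule QI) (use t Hom_Ob[OF t(1)] in \<open>simp_all add: Q0_def\<close>)
   from representsD(5)[OF R this] obtain \<xi> where \<xi>: "\<xi> : x ~> r" "?\<sigma> w \<xi> = ((k, l), \<phi>)" by blast
   then show ?thesis using st[of \<xi>] unfolding w by auto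
  qed
  show "\<xi> = \<zeta>" if t: "\<xi> : x ~> r" "\<zeta> : x ~> r" "ISrc E o \<xi> = ISrc E o \<zeta>" "ITgt E o \<xi> = ITgt E o \<zeta>"
    "restr (IOb A) \<theta> \<xi> = restr (IOb A) \<theta> \<zeta>" for x \<xi> \<zeta>
   by (rule representsD(6)[OF R t(1,2)]) (use t st[of \<xi>] st[of \<zeta>] in \<open>simp add: w\<close>)
 qed
qed

lemma ifun_prod_eqI:
 assumes F: "F : Hom W (Prod W X A) B" and G: "G : Hom W (Prod W X A) B" and X: "X : Ob W" and A: "A : Ob W"
  and 0: "!!x u a. u : x ~> IOb X ==> a : x ~> IOb A ==> I0 F o pp0 X A u a = I0 G o pp0 X A u a"
  and 1: "!!x u a. u : x ~> IAr X ==> a : x ~> IAr A ==> I1 F o pp1 X A u a = I1 G o pp1 X A u a"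
 shows "F = G"
proof (rule ifun_eqI[OF F G])
 note [simp] = F[unfolded Hom_iff] G[unfolded Hom_iff] X A
 have "pp0 X A (I0 (pr1 W X A)) (I0 (pr2 W X A)) = Idn V (IOb (Prod W X A))"
  "pp1 X A (I1 (pr1 W X A)) (I1 (pr2 W X A)) = Idn V (IAr (Prod W X A))"
  using pp_pr(1)[of X A "Idn V (IOb (Prod W X A))"] pp_pr(2)[of X A "Idn V (IAr (Prod W X A))"] by simp_all
 then show "I0 F = I0 G" "I1 F = I1 G"
  using 0[of "I0 (pr1 W X A)" "IOb (Prod W X A)" "I0 (pr2 W X A)"] 1[of "I1 (pr1 W X A)" "IAr (Prod W X A)" "I1 (pr2 W X A)"]
  by simp_all
qed

lemma W_exponential:
 assumes A: "A : Ob W" and B: "B : Ob W"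
 shows "\<exists>E w. is_exponential W A B E w"
proof -
 obtain E h0 h1 \<theta> where E [simp]: "E : Ob W" and h: "PF A B (IOb E) (h0, h1)"
  and \<theta>: "\<theta> : Prod V (IAr E) (IOb A) ~> IAr B"
  and \<theta>st: "!!y \<xi> a. [|\<xi> : y ~> IAr E; a : y ~> IOb A|] ==>
   ISrc B o (\<theta> o <|\<xi>, a|>) = h0 o <|ISrc E o \<xi>, a|> \<and> ITgt B o (\<theta> o <|\<xi>, a|>) = h0 o <|ITgt E o \<xi>, a|>"
  and \<theta>n: "!!y \<xi> f. [|\<xi> : y ~> IAr E; f : y ~> IAr A|] ==>
   icmp B (\<theta> o <|\<xi>, ISrc A o f|>) (h1 o <|ITgt E o \<xi>, f|>) = icmp B (h1 o <|ISrc E o \<xi>, f|>) (\<theta> o <|\<xi>, ITgt A o f|>)"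
  and \<theta>i: "!!y u a. [|u : y ~> IOb E; a : y ~> IOb A|] ==> \<theta> o <|IIdn E o u, a|> = IIdn B o (h0 o <|u, a|>)"
  and \<theta>c: "!!y \<xi> \<zeta> a. [|\<xi> : y ~> IAr E; \<zeta> : y ~> IAr E; ITgt E o \<xi> = ISrc E o \<zeta>; a : y ~> IOb A|] ==>
   \<theta> o <|icmp E \<xi> \<zeta>, a|> = icmp B (\<theta> o <|\<xi>, a|>) (\<theta> o <|\<zeta>, a|>)"
  and ex0: "!!x k0 k1. PF A B x (k0, k1) ==> \<exists>k \<in> Hom V x (IOb E). restr (IOb A) h0 k = k0 \<and> restr (IAr A) h1 k = k1"
  and un0: "!!x k l. [|k : x ~> IOb E; l : x ~> IOb E; restr (IOb A) h0 k = restr (IOb A) h0 l;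
    restr (IAr A) h1 k = restr (IAr A) h1 l|] ==> k = l"
  and ex1: "!!x k l \<phi>. [|k : x ~> IOb E; l : x ~> IOb E; \<phi> : Prod V x (IOb A) ~> IAr B;
    ISrc B o \<phi> = restr (IOb A) h0 k; ITgt B o \<phi> = restr (IOb A) h0 l;
    !!y u f. [|u : y ~> x; f : y ~> IAr A|] ==>
     icmp B (\<phi> o <|u, ISrc A o f|>) (h1 o <|l o u, f|>) = icmp B (h1 o <|k o u, f|>) (\<phi> o <|u, ITgt A o f|>)|] ==>
    \<exists>\<xi> \<in> Hom V x (IAr E). ISrc E o \<xi> = k \<and> ITgt E o \<xi> = l \<and> restr (IOb A) \<theta> \<xi> = \<phi>"
  and un1: "!!x \<xi> \<zeta>. [|\<xi> : x ~> IAr E; \<zeta> : x ~> IAr E; ISrc E o \<xi> = ISrc E o \<zeta>; ITgt E o \<xi> = ITgt E o \<zeta>;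
    restr (IOb A) \<theta> \<xi> = restr (IOb A) \<theta> \<zeta>|] ==> \<xi> = \<zeta>"
  by (rule functor_category[OF A B]) blast
 note [simp] = A B PFD(2-7)[OF h] PFD(8-10)[OF h] PFD(11)[OF h] \<theta>[unfolded Hom_iff]
 have \<theta>s [simp]: "ISrc B o (\<theta> o <|\<xi>, a|>) = h0 o <|ISrc E o \<xi>, a|>" "ITgt B o (\<theta> o <|\<xi>, a|>) = h0 o <|ITgt E o \<xi>, a|>"
  if "\<xi> : Ar V" "a : Ar V" "Cod V \<xi> = IAr E" "Cod V a = IOb A" "Dom V \<xi> = Dom V a" for \<xi> a
  using \<theta>st[of \<xi> "Dom V a" a] that by simp_all
 have \<theta>i' [simp]: "\<theta> o <|IIdn E o u, a|> = IIdn B o (h0 o <|u, a|>)"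
  if "u : Ar V" "a : Ar V" "Cod V u = IOb E" "Cod V a = IOb A" "Dom V u = Dom V a" for u a
  using \<theta>i[of u "Dom V a" a] that by simp
 let ?P = "Prod W E A"
 \<comment> \<open>On objects evaluation is the universal functor; on arrows it is a component followed by the image under
  the target functor.\<close>
 let ?ea = "h0 o <|I0 (pr1 W E A), I0 (pr2 W E A)|>"
 let ?eb = "icmp B (\<theta> o <|I1 (pr1 W E A), ISrc A o I1 (pr2 W E A)|>) (h1 o <|ITgt E o I1 (pr1 W E A), I1 (pr2 W E A)|>)"
 let ?w = "mkf ?P B ?ea ?eb"
 have w0: "?ea o pp0 E A u a = h0 o <|u, a|>" if "u : Ar V" "a : Ar V" "Cod V u = IOb E" "Cod V a = IOb A" "Dom V u = Dom V a" for u a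
  using that by simp
 have w1: "?eb o pp1 E A \<xi> f = icmp B (\<theta> o <|\<xi>, ISrc A o f|>) (h1 o <|ITgt E o \<xi>, f|>)"
  if "\<xi> : Ar V" "f : Ar V" "Cod V \<xi> = IAr E" "Cod V f = IAr A" "Dom V \<xi> = Dom V f" for \<xi> f
  using that by simp
 have w: "?w : Hom W ?P B"
 proof (rule ifun_prodI)
  show "?ea : IOb ?P ~> IOb B" "?eb : IAr ?P ~> IAr B" by simp_all
  fix x \<xi> f assume "\<xi> : x ~> IAr E" "f : x ~> IAr A"
  then show "ISrc B o (?eb o pp1 E A \<xi> f) = ?ea o pp0 E A (ISrc E o \<xi>) (ISrc A o f) \<and>
   ITgt B o (?eb o pp1 E A \<xi> f) = ?ea o pp0 E A (ITgt E o \<xi>) (ITgt A o f)" by simp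
 next
  fix x u a assume "u : x ~> IOb E" "a : x ~> IOb A"
  then show "?eb o pp1 E A (IIdn E o u) (IIdn A o a) = IIdn B o (?ea o pp0 E A u a)" by simp
 next
  fix x \<xi> \<zeta> f g assume t: "\<xi> : x ~> IAr E" "\<zeta> : x ~> IAr E" "f : x ~> IAr A" "g : x ~> IAr A"
    "ITgt E o \<xi> = ISrc E o \<zeta>" "ITgt A o f = ISrc A o g"
  note [simp] = t[unfolded Hom_iff]
  have "?eb o pp1 E A (icmp E \<xi> \<zeta>) (icmp A f g) =
    icmp B (\<theta> o <|\<xi>, ISrc A o f|>) (icmp B (icmp B (\<theta> o <|\<zeta>, ISrc A o f|>) (h1 o <|ITgt E o \<zeta>, f|>)) (h1 o <|ITgt E o \<zeta>, g|>))"
   using \<theta>c[OF t(1,2,5), of "ISrc A o f"] by (subst w1) simp_all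
  also have "\<dots> = icmp B (icmp B (\<theta> o <|\<xi>, ISrc A o f|>) (h1 o <|ITgt E o \<xi>, f|>)) (icmp B (\<theta> o <|\<zeta>, ISrc A o g|>) (h1 o <|ITgt E o \<zeta>, g|>))"
   unfolding \<theta>n[OF t(2,3)] by simp
  also have "\<dots> = icmp B (?eb o pp1 E A \<xi> f) (?eb o pp1 E A \<zeta> g)"
   by (subst (1 2) w1) simp_all
  finally show "?eb o pp1 E A (icmp E \<xi> \<zeta>) (icmp A f g) = icmp B (?eb o pp1 E A \<xi> f) (?eb o pp1 E A \<zeta> g)" .
 qed simp_all
 have wcr: "I0 (?w o\<^bsub>W\<^esub> cross W k (Idn W A)) o pp0 X A u a = h0 o <|I0 k o u, a|>"
   "I1 (?w o\<^bsub>W\<^esub> cross W k (Idn W A)) o pp1 X A \<xi> f = icmp B (\<theta> o <|I1 k o \<xi>, ISrc A o f|>) (h1 o <|I0 k o (ITgt X o \<xi>), f|>)"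
  if k: "k : Hom W X E" and t: "u : Ar V" "a : Ar V" "Dom V u = Dom V a" "Cod V u = IOb X" "Cod V a = IOb A"
   "\<xi> : Ar V" "f : Ar V" "Dom V \<xi> = Dom V f" "Cod V \<xi> = IAr X" "Cod V f = IAr A" for k X u a \<xi> f
 proof -
  have X: "X : Ob W" using k by (rule W.Hom_Ob)
  have l: "k o\<^bsub>W\<^esub> pr1 W X A : Hom W (Prod W X A) E" "Idn W A o\<^bsub>W\<^esub> pr2 W X A : Hom W (Prod W X A) A"
   using k X by simp_all
  have c: "cross W k (Idn W A) = tuple W (k o\<^bsub>W\<^esub> pr1 W X A) (Idn W A o\<^bsub>W\<^esub> pr2 W X A)" using k X by simp
  have "I0 (cross W k (Idn W A)) o pp0 X A u a = pp0 E A (I0 k o u) a"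
   unfolding c I_tuple[OF l] using k t X by simp
  moreover have "I0 (?w o\<^bsub>W\<^esub> cross W k (Idn W A)) o pp0 X A u a = ?ea o (I0 (cross W k (Idn W A)) o pp0 X A u a)"
   unfolding c I_tuple[OF l] W_Cmp using k t X by simp
  ultimately show "I0 (?w o\<^bsub>W\<^esub> cross W k (Idn W A)) o pp0 X A u a = h0 o <|I0 k o u, a|>" using k t X by simp
  have "I1 (cross W k (Idn W A)) o pp1 X A \<xi> f = pp1 E A (I1 k o \<xi>) f"
   unfolding c I_tuple[OF l] using k t X by simp
  moreover have "I1 (?w o\<^bsub>W\<^esub> cross W k (Idn W A)) o pp1 X A \<xi> f = ?eb o (I1 (cross W k (Idn W A)) o pp1 X A \<xi> f)"
   unfolding c I_tuple[OF l] W_Cmp using k t X by simp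
  ultimately show "I1 (?w o\<^bsub>W\<^esub> cross W k (Idn W A)) o pp1 X A \<xi> f = icmp B (\<theta> o <|I1 k o \<xi>, ISrc A o f|>) (h1 o <|I0 k o (ITgt X o \<xi>), f|>)"
   using k t X by simp
 qed
 have wt: "?w o\<^bsub>W\<^esub> cross W H (Idn W A) : Hom W (Prod W X A) B" if "H : Hom W X E" for H X
  using w that W.Hom_Ob[OF that] by simp
 have "is_exponential W A B E ?w"
  unfolding is_exponential_def
 proof (intro conjI ballI)
  fix X G assume X [simp]: "X : Ob W" and G: "G : Hom W (Prod W X A) B"
  have [simp]: "G : Ar W" "Dom W G = Prod W X A" "Cod W G = B" using G by simp_all
  have Gs: "ISrc B o (I1 G o pp1 X A \<xi> f) = I0 G o pp0 X A (ISrc X o \<xi>) (ISrc A o f)"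
   "ITgt B o (I1 G o pp1 X A \<xi> f) = I0 G o pp0 X A (ITgt X o \<xi>) (ITgt A o f)"
   if "\<xi> : x ~> IAr X" "f : x ~> IAr A" for x \<xi> f using that by simp_all
  have Gi: "I1 G o pp1 X A (IIdn X o u) (IIdn A o a) = IIdn B o (I0 G o pp0 X A u a)"
   if "u : x ~> IOb X" "a : x ~> IOb A" for x u a
  proof -
   have "I1 G o (IIdn (Prod W X A) o pp0 X A u a) = IIdn B o (I0 G o pp0 X A u a)" using that by (simp del: pp_icat)
   moreover have "IIdn (Prod W X A) o pp0 X A u a = pp1 X A (IIdn X o u) (IIdn A o a)" using that by simp
   ultimately show ?thesis by metis
  qed
  have Gc: "icmp B (I1 G o pp1 X A \<xi> f) (I1 G o pp1 X A \<zeta> g) = I1 G o pp1 X A (icmp X \<xi> \<zeta>) (icmp A f g)"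
   if "\<xi> : x ~> IAr X" "f : x ~> IAr A" "\<zeta> : x ~> IAr X" "g : x ~> IAr A"
    "ITgt X o \<xi> = ISrc X o \<zeta>" "ITgt A o f = ISrc A o g" for x \<xi> f \<zeta> g
  proof -
   have "I1 G o icmp (Prod W X A) (pp1 X A \<xi> f) (pp1 X A \<zeta> g) = icmp B (I1 G o pp1 X A \<xi> f) (I1 G o pp1 X A \<zeta> g)"
    using that by (simp del: icmp_pp)
   moreover have "icmp (Prod W X A) (pp1 X A \<xi> f) (pp1 X A \<zeta> g) = pp1 X A (icmp X \<xi> \<zeta>) (icmp A f g)" using that by simp
   ultimately show ?thesis by metis
  qed
  \<comment> \<open>Fixing an object of \<^term>\<open>X\<close> gives a functor on \<^term>\<open>A\<close>, by inserting its identity; fixing an arrow of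
   \<^term>\<open>X\<close> gives the natural transformation \<open>?\<phi>\<close> between two such functors.\<close>
  let ?ka = "I0 G o pp0 X A (pr1 V (IOb X) (IOb A)) (pr2 V (IOb X) (IOb A))"
  let ?kb = "I1 G o pp1 X A (IIdn X o pr1 V (IOb X) (IAr A)) (pr2 V (IOb X) (IAr A))"
  have idc: "icmp X (IIdn X o u) (IIdn X o u) = IIdn X o u" if "u : Ar V" "Cod V u = IOb X" for u
   using that by simp
  have "PF A B (IOb X) (?ka, ?kb)"
   unfolding PF_def fst_conv snd_conv
  proof (intro conjI allI impI)
   fix y u f assume t: "u : y ~> IOb X" "f : y ~> IAr A"
   then show "ISrc B o (?kb o <|u, f|>) = ?ka o <|u, ISrc A o f|>" "ITgt B o (?kb o <|u, f|>) = ?ka o <|u, ITgt A o f|>" by simp_all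
   fix g assume "g : y ~> IAr A" "ITgt A o f = ISrc A o g"
   then show "?kb o <|u, icmp A f g|> = icmp B (?kb o <|u, f|>) (?kb o <|u, g|>)"
    using t Gc[of "IIdn X o u" y f "IIdn X o u" g] idc[of u] by simp
  next
   fix y u a assume "u : y ~> IOb X" "a : y ~> IOb A"
   then show "?kb o <|u, IIdn A o a|> = IIdn B o (?ka o <|u, a|>)" using Gi[of u y a] by simp
  qed simp_all
  from ex0[OF this] obtain k where k: "k : IOb X ~> IOb E" "restr (IOb A) h0 k = ?ka" "restr (IAr A) h1 k = ?kb" by blast
  note [simp] = k(1)[unfolded Hom_iff]
  have k0: "h0 o <|k o u, a|> = I0 G o pp0 X A u a" if "u : Ar V" "a : Ar V" "Cod V u = IOb X" "Cod V a = IOb A" "Dom V u = Dom V a" for u a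
   using arg_cong[OF k(2), of "\<lambda>t. t o <|u, a|>"] that by simp
  have k1: "h1 o <|k o u, f|> = I1 G o pp1 X A (IIdn X o u) f" if "u : Ar V" "f : Ar V" "Cod V u = IOb X" "Cod V f = IAr A" "Dom V u = Dom V f" for u f
   using arg_cong[OF k(3), of "\<lambda>t. t o <|u, f|>"] that by simp
  let ?\<phi> = "I1 G o pp1 X A (pr1 V (IAr X) (IOb A)) (IIdn A o pr2 V (IAr X) (IOb A))"
  have "\<exists>\<xi> \<in> Hom V (IAr X) (IAr E). ISrc E o \<xi> = k o ISrc X \<and> ITgt E o \<xi> = k o ITgt X \<and> restr (IOb A) \<theta> \<xi> = ?\<phi>"
  proof (rule ex1)
   show "ISrc B o ?\<phi> = restr (IOb A) h0 (k o ISrc X)" by (simp add: restr_def k0)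
   show "ITgt B o ?\<phi> = restr (IOb A) h0 (k o ITgt X)" by (simp add: restr_def k0)
   fix y u f assume t: "u : y ~> IAr X" "f : y ~> IAr A"
   then show "icmp B (?\<phi> o <|u, ISrc A o f|>) (h1 o <|(k o ITgt X) o u, f|>) = icmp B (h1 o <|(k o ISrc X) o u, f|>) (?\<phi> o <|u, ITgt A o f|>)"
    using Gc[of u y "IIdn A o (ISrc A o f)" "IIdn X o (ITgt X o u)" f] Gc[of "IIdn X o (ISrc X o u)" y f u "IIdn A o (ITgt A o f)"]
    by (simp add: k1)
  qed simp_all
  then obtain \<xi> where \<xi>: "\<xi> : IAr X ~> IAr E" "ISrc E o \<xi> = k o ISrc X" "ITgt E o \<xi> = k o ITgt X" "restr (IOb A) \<theta> \<xi> = ?\<phi>" by blast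
  note [simp] = \<xi>(1)[unfolded Hom_iff]
  have \<xi>0: "\<theta> o <|\<xi> o v, a|> = I1 G o pp1 X A v (IIdn A o a)" if "v : Ar V" "a : Ar V" "Cod V v = IAr X" "Cod V a = IOb A" "Dom V v = Dom V a" for v a
   using arg_cong[OF \<xi>(4), of "\<lambda>t. t o <|v, a|>"] that by simp
  have \<xi>st: "ISrc E o (\<xi> o v) = k o (ISrc X o v)" "ITgt E o (\<xi> o v) = k o (ITgt X o v)" if "v : Ar V" "Cod V v = IAr X" for v
   by (rule Cmp_eq_precomp[OF \<xi>(2)] Cmp_eq_precomp[OF \<xi>(3)]; use that in simp)+
  have K: "mkf X E k \<xi> : Hom W X E"
  proof (rule ifunI)
   fix x f assume "f : x ~> IAr X"
   then show "ISrc E o (\<xi> o f) = k o (ISrc X o f) \<and> ITgt E o (\<xi> o f) = k o (ITgt X o f)" using \<xi>st by simp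
  next
   fix x a assume t: "a : x ~> IOb X"
   have x: "x : Ob V" using t by (rule Hom_Ob)
   show "\<xi> o (IIdn X o a) = IIdn E o (k o a)"
   proof (rule un1[of _ x])
    show "restr (IOb A) \<theta> (\<xi> o (IIdn X o a)) = restr (IOb A) \<theta> (IIdn E o (k o a))"
     by (rule elements_eqI[of _ x "IOb A" "IAr B"]) (use t x in \<open>simp_all add: \<xi>0 k0 Gi[of _ "Dom V z" z for z]\<close>)
   qed (use t \<xi>st in simp_all)
  next
   fix x f g assume t: "f : x ~> IAr X" "g : x ~> IAr X" "ITgt X o f = ISrc X o g"
   have x: "x : Ob V" using t(1) by (rule Hom_Ob)
   note [simp] = t[unfolded Hom_iff] x
   have c: "ITgt E o (\<xi> o f) = ISrc E o (\<xi> o g)" using \<xi>st[of f] \<xi>st[of g] by simp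
   show "\<xi> o icmp X f g = icmp E (\<xi> o f) (\<xi> o g)"
   proof (rule un1[of _ x])
    show "ISrc E o (\<xi> o icmp X f g) = ISrc E o icmp E (\<xi> o f) (\<xi> o g)" "ITgt E o (\<xi> o icmp X f g) = ITgt E o icmp E (\<xi> o f) (\<xi> o g)"
     using c \<xi>st by simp_all
    show "restr (IOb A) \<theta> (\<xi> o icmp X f g) = restr (IOb A) \<theta> (icmp E (\<xi> o f) (\<xi> o g))"
    proof (rule elements_eqI[of _ x "IOb A" "IAr B"])
     fix y u a assume u: "u : y ~> x" "a : y ~> IOb A"
     have cu: "ITgt E o (\<xi> o (f o u)) = ISrc E o (\<xi> o (g o u))" "ITgt X o (f o u) = ISrc X o (g o u)"
      using Cmp_eq_precomp[OF t(3), of u] u \<xi>st by simp_all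
     have "restr (IOb A) \<theta> (icmp E (\<xi> o f) (\<xi> o g)) o <|u, a|> = \<theta> o <|icmp E (\<xi> o (f o u)) (\<xi> o (g o u)), a|>"
      using u c cu by simp
     also have "\<dots> = icmp B (\<theta> o <|\<xi> o (f o u), a|>) (\<theta> o <|\<xi> o (g o u), a|>)"
      by (rule \<theta>c[of _ y]) (use u cu in simp_all)
     also have "\<dots> = I1 G o pp1 X A (icmp X (f o u) (g o u)) (IIdn A o a)"
      using u cu Gc[of "f o u" y "IIdn A o a" "g o u" "IIdn A o a"] by (simp add: \<xi>0)
     also have "\<dots> = restr (IOb A) \<theta> (\<xi> o icmp X f g) o <|u, a|>" using u cu by (simp add: \<xi>0)
     finally show "restr (IOb A) \<theta> (\<xi> o icmp X f g) o <|u, a|> = restr (IOb A) \<theta> (icmp E (\<xi> o f) (\<xi> o g)) o <|u, a|>" ..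
    qed (use c in simp_all)
   qed (use c in simp_all)
  qed simp_all
  have "?w o\<^bsub>W\<^esub> cross W (mkf X E k \<xi>) (Idn W A) = G"
  proof (rule ifun_prod_eqI[OF wt[OF K] G X A])
   fix x u a assume t: "u : x ~> IOb X" "a : x ~> IOb A"
   have "I0 (?w o\<^bsub>W\<^esub> cross W (mkf X E k \<xi>) (Idn W A)) o pp0 X A u a = h0 o <|I0 (mkf X E k \<xi>) o u, a|>"
    by (rule wcr(1)[OF K, of u a "IIdn X o u" "IIdn A o a"]) (use t in simp_all)
   also have "\<dots> = I0 G o pp0 X A u a" using t by (simp add: k0)
   finally show "I0 (?w o\<^bsub>W\<^esub> cross W (mkf X E k \<xi>) (Idn W A)) o pp0 X A u a = I0 G o pp0 X A u a" .
  next
   fix x v f assume t: "v : x ~> IAr X" "f : x ~> IAr A"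
   have "I1 (?w o\<^bsub>W\<^esub> cross W (mkf X E k \<xi>) (Idn W A)) o pp1 X A v f =
     icmp B (\<theta> o <|I1 (mkf X E k \<xi>) o v, ISrc A o f|>) (h1 o <|I0 (mkf X E k \<xi>) o (ITgt X o v), f|>)"
    by (rule wcr(2)[OF K, of "ISrc X o v" "ISrc A o f" v f]) (use t in simp_all)
   also have "\<dots> = I1 G o pp1 X A v f"
    using Gc[of v x "IIdn A o (ISrc A o f)" "IIdn X o (ITgt X o v)" f] t by (simp add: k1 \<xi>0)
   finally show "I1 (?w o\<^bsub>W\<^esub> cross W (mkf X E k \<xi>) (Idn W A)) o pp1 X A v f = I1 G o pp1 X A v f" .
  qed
  moreover have "H = mkf X E k \<xi>" if H: "H : Hom W X E" and HG: "?w o\<^bsub>W\<^esub> cross W H (Idn W A) = G" for H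
  proof (rule ifun_eqI[OF H K])
   note [simp] = H[unfolded Hom_iff]
   have 0: "I0 G o pp0 X A u a = h0 o <|I0 H o u, a|>" if "u : Ar V" "a : Ar V" "Dom V u = Dom V a" "Cod V u = IOb X" "Cod V a = IOb A" for u a
    by (rule wcr(1)[OF H, of u a "IIdn X o u" "IIdn A o a", unfolded HG]) (use that in simp_all)
   have 1: "I1 G o pp1 X A v f = icmp B (\<theta> o <|I1 H o v, ISrc A o f|>) (h1 o <|I0 H o (ITgt X o v), f|>)"
    if "v : Ar V" "f : Ar V" "Dom V v = Dom V f" "Cod V v = IAr X" "Cod V f = IAr A" for v f
    by (rule wcr(2)[OF H, of "ISrc X o v" "ISrc A o f" v f, unfolded HG]) (use that in simp_all)
   have "I0 H = k"
   proof (rule un0[of _ "IOb X"])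
    show "restr (IOb A) h0 (I0 H) = restr (IOb A) h0 k"
     by (rule elements_eqI[of _ "IOb X" "IOb A" "IOb B"]) (simp_all add: 0 k0)
    show "restr (IAr A) h1 (I0 H) = restr (IAr A) h1 k"
     by (rule elements_eqI[of _ "IOb X" "IAr A" "IAr B"]) (simp_all add: 1 k1)
   qed simp_all
   then show "I0 H = I0 (mkf X E k \<xi>)" by simp
   have "I1 H = \<xi>"
   proof (rule un1[of _ "IAr X"])
    have e: "ISrc E o I1 H = I0 H o ISrc X" "ITgt E o I1 H = I0 H o ITgt X"
     using ifun(1,2)[of H E "Idn V (IAr X)"] by simp_all
    show "ISrc E o I1 H = ISrc E o \<xi>" "ITgt E o I1 H = ITgt E o \<xi>" unfolding e \<xi>(2,3) \<open>I0 H = k\<close> by (rule refl)+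
    show "restr (IOb A) \<theta> (I1 H) = restr (IOb A) \<theta> \<xi>"
     by (rule elements_eqI[of _ "IAr X" "IOb A" "IAr B"]) (simp_all add: 1 \<xi>0)
   qed simp_all
   then show "I1 H = I1 (mkf X E k \<xi>)" by simp
  qed
  ultimately show "\<exists>!H. H : Hom W X E \<and> ?w o\<^bsub>W\<^esub> cross W H (Idn W A) = G" using K by blast
 qed (use w in simp_all)
 then show ?thesis by blast
qed

lemma W_ccc: "ccc W"
 by unfold_locales (use W_exponential in blast)

sublocale W: ccc "cat_of V" by (rule W_ccc)

end

section \<open>Slices of the category of internal categories\<close>

context ccc_pb
begin

text \<open>Application of an element of \<^term>\<open>IOb (Exp W A B)\<close>, read as a family of functors, to objects and to
 arrows of \<^term>\<open>A\<close>.\<close>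

definition ap0 where "ap0 A B k a = I0 (eval_ar W A B) o pp0 (Exp W A B) A k a"
definition ap1 where "ap1 A B k f = I1 (eval_ar W A B) o pp1 (Exp W A B) A (IIdn (Exp W A B) o k) f"

lemma ap_simps [simp]:
 assumes "A : Ob W" "B : Ob W" "k : Ar V" "Cod V k = IOb (Exp W A B)" "a : Ar V" "Dom V k = Dom V a"
 shows "Cod V a = IOb A ==> ap0 A B k a : Ar V" "Cod V a = IOb A ==> Dom V (ap0 A B k a) = Dom V a"
  "Cod V a = IOb A ==> Cod V (ap0 A B k a) = IOb B"
  "Cod V a = IOb A ==> r : Ar V ==> Cod V r = Dom V a ==> ap0 A B k a o r = ap0 A B (k o r) (a o r)"
  "Cod V a = IAr A ==> ap1 A B k a : Ar V" "Cod V a = IAr A ==> Dom V (ap1 A B k a) = Dom V a"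
  "Cod V a = IAr A ==> Cod V (ap1 A B k a) = IAr B"
  "Cod V a = IAr A ==> r : Ar V ==> Cod V r = Dom V a ==> ap1 A B k a o r = ap1 A B (k o r) (a o r)"
  "Cod V a = IAr A ==> ISrc B o ap1 A B k a = ap0 A B k (ISrc A o a)"
  "Cod V a = IAr A ==> ITgt B o ap1 A B k a = ap0 A B k (ITgt A o a)"
  "Cod V a = IOb A ==> ap1 A B k (IIdn A o a) = IIdn B o ap0 A B k a"
 using assms ifun(3)[of "eval_ar W A B" "Prod W (Exp W A B) A" "pp0 (Exp W A B) A k a"]
 by (simp_all add: ap0_def ap1_def)

lemma eval_elements:
 assumes "F : Hom W X (Exp W A B)" "G : Hom W X A" "A : Ob W" "B : Ob W"
 shows "[|u : Ar V; Cod V u = IOb X|] ==> I0 (eval_ar W A B o\<^bsub>W\<^esub> tuple W F G) o u = ap0 A B (I0 F o u) (I0 G o u)"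
  "[|v : Ar V; Cod V v = IAr X|] ==> I1 (eval_ar W A B o\<^bsub>W\<^esub> tuple W F G) o v =
    I1 (eval_ar W A B) o pp1 (Exp W A B) A (I1 F o v) (I1 G o v)"
  "[|v : Ar V; Cod V v = IOb X|] ==> I1 (eval_ar W A B o\<^bsub>W\<^esub> tuple W F G) o (IIdn X o v) =
    ap1 A B (I0 F o v) (IIdn A o (I0 G o v))"
 using assms W.Hom_Ob[OF assms(1)] by (simp_all add: ap0_def ap1_def I_tuple[OF assms(1,2)] del: pp_icat ifun(3)) simp

text \<open>An element of the objects of the exponential is a functor on a discrete category, which transposes to a
 functor on the product of this category with \<^term>\<open>A\<close>.\<close>

lemma ap_ext:
 assumes A: "A : Ob W" and B: "B : Ob W" and kl: "k : x ~> IOb (Exp W A B)" "l : x ~> IOb (Exp W A B)"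
  and 0: "!!y u a. u : y ~> x ==> a : y ~> IOb A ==> ap0 A B (k o u) a = ap0 A B (l o u) a"
  and 1: "!!y u a. u : y ~> x ==> a : y ~> IAr A ==> ap1 A B (k o u) a = ap1 A B (l o u) a"
 shows "k = l"
proof -
 let ?E = "Exp W A B"
 note [simp] = A B kl[unfolded Hom_iff] have x [simp]: "x : Ob V" using kl(1) by (rule Hom_Ob)
 let ?K = "from_disc ?E k" and ?L = "from_disc ?E l"
 have "?K = ?L"
 proof (rule W.exp_eqI[of _ "disc x" A B])
  have t: "?K o\<^bsub>W\<^esub> pr1 W (disc x) A : Hom W (Prod W (disc x) A) ?E" "?L o\<^bsub>W\<^esub> pr1 W (disc x) A : Hom W (Prod W (disc x) A) ?E"
   "pr2 W (disc x) A : Hom W (Prod W (disc x) A) A" by simp_all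
  show "eval_ar W A B o\<^bsub>W\<^esub> tuple W (?K o\<^bsub>W\<^esub> pr1 W (disc x) A) (pr2 W (disc x) A) =
   eval_ar W A B o\<^bsub>W\<^esub> tuple W (?L o\<^bsub>W\<^esub> pr1 W (disc x) A) (pr2 W (disc x) A)"
  proof (rule ifun_prod_eqI[of _ "disc x" A B])
   fix y u a assume "u : y ~> IOb (disc x)" "a : y ~> IOb A"
   then show "I0 (eval_ar W A B o\<^bsub>W\<^esub> tuple W (?K o\<^bsub>W\<^esub> pr1 W (disc x) A) (pr2 W (disc x) A)) o pp0 (disc x) A u a =
     I0 (eval_ar W A B o\<^bsub>W\<^esub> tuple W (?L o\<^bsub>W\<^esub> pr1 W (disc x) A) (pr2 W (disc x) A)) o pp0 (disc x) A u a"
    using eval_elements(1)[OF t(1,3)] eval_elements(1)[OF t(2,3)] 0[of u y a] by (simp del: W_Cmp) simp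
  next
   fix y u a assume "u : y ~> IAr (disc x)" "a : y ~> IAr A"
   then show "I1 (eval_ar W A B o\<^bsub>W\<^esub> tuple W (?K o\<^bsub>W\<^esub> pr1 W (disc x) A) (pr2 W (disc x) A)) o pp1 (disc x) A u a =
     I1 (eval_ar W A B o\<^bsub>W\<^esub> tuple W (?L o\<^bsub>W\<^esub> pr1 W (disc x) A) (pr2 W (disc x) A)) o pp1 (disc x) A u a"
    using eval_elements(2)[OF t(1,3)] eval_elements(2)[OF t(2,3)] 1[of u y a] by (simp del: W_Cmp) (simp add: ap1_def)
  qed simp_all
 qed simp_all
 then have "I0 ?K = I0 ?L" by simp
 then show ?thesis by simp
qed

lemma ap_ex:
 assumes A: "A : Ob W" and B: "B : Ob W" and h: "PF A B x (h0, h1)"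
 obtains k where "k : x ~> IOb (Exp W A B)"
  "!!y u a. u : y ~> x ==> a : y ~> IOb A ==> ap0 A B (k o u) a = h0 o <|u, a|>"
  "!!y u a. u : y ~> x ==> a : y ~> IAr A ==> ap1 A B (k o u) a = h1 o <|u, a|>"
proof -
 let ?E = "Exp W A B" and ?X = "disc x"
 note [simp] = A B PFD(1-7)[OF h] PFD(8-10)[OF h] PFD(11)[OF h]
 let ?H = "mkf (Prod W ?X A) B (h0 o <|I0 (pr1 W ?X A), I0 (pr2 W ?X A)|>) (h1 o <|I1 (pr1 W ?X A), I1 (pr2 W ?X A)|>)"
 have H: "?H : Hom W (Prod W ?X A) B"
 proof (rule ifun_prodI)
  fix y u v f g assume t: "u : y ~> IAr ?X" "v : y ~> IAr ?X" "f : y ~> IAr A" "g : y ~> IAr A"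
   "ITgt ?X o u = ISrc ?X o v" "ITgt A o f = ISrc A o g"
  then have "v = u" by simp
  with t show "(h1 o <|I1 (pr1 W ?X A), I1 (pr2 W ?X A)|>) o pp1 ?X A (icmp ?X u v) (icmp A f g) =
   icmp B ((h1 o <|I1 (pr1 W ?X A), I1 (pr2 W ?X A)|>) o pp1 ?X A u f) ((h1 o <|I1 (pr1 W ?X A), I1 (pr2 W ?X A)|>) o pp1 ?X A v g)"
   by simp
 qed simp_all
 note Ht = H[unfolded Hom_iff]
 let ?T = "transp W ?X A B ?H"
 have T: "?T : Hom W ?X ?E" using H by simp
 have t: "?T o\<^bsub>W\<^esub> pr1 W ?X A : Hom W (Prod W ?X A) ?E" "pr2 W ?X A : Hom W (Prod W ?X A) A" using T by simp_all
 have e: "eval_ar W A B o\<^bsub>W\<^esub> tuple W (?T o\<^bsub>W\<^esub> pr1 W ?X A) (pr2 W ?X A) = ?H" using Ht by simp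
 have k: "I0 ?T : x ~> IOb ?E" using T ifun_typing0(3-5)[of ?T] by simp
 have T1: "I1 ?T = IIdn ?E o I0 ?T"
  using arg_cong[OF from_disc_eqI[of ?T x ?E "from_disc ?E (I0 ?T)"], of I1] T k by simp
 show ?thesis
 proof (rule that[OF k])
  fix y u a assume "u : y ~> x" "a : y ~> IOb A"
  then show "ap0 A B (I0 ?T o u) a = h0 o <|u, a|>"
   using eval_elements(1)[OF t, of "pp0 ?X A u a"] k unfolding e by simp
 next
  fix y u a assume "u : y ~> x" "a : y ~> IAr A"
  then show "ap1 A B (I0 ?T o u) a = h1 o <|u, a|>"
   using eval_elements(2)[OF t, of "pp1 ?X A u a"] k unfolding e by (simp add: T1 ap1_def)
 qed
qed

text \<open>Composition of functors, which was defined by transposing twice, is composition of the actions on elements.\<close>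

lemma icomp0:
 assumes o: "A : Ob W" "B : Ob W" "D : Ob W"
 shows "icomp0 V A B D : Prod V (IOb (Exp W A B)) (IOb (Exp W B D)) ~> IOb (Exp W A D)"
  "[|k : x ~> IOb (Exp W A B); l : x ~> IOb (Exp W B D); a : x ~> IOb A|] ==>
   ap0 A D (icomp0 V A B D o <|k, l|>) a = ap0 B D l (ap0 A B k a)"
  "[|k : x ~> IOb (Exp W A B); l : x ~> IOb (Exp W B D); f : x ~> IAr A|] ==>
   ap1 A D (icomp0 V A B D o <|k, l|>) f = ap1 B D l (ap1 A B k f)"
proof -
 let ?E = "Exp W A B" and ?E' = "Exp W B D" and ?F = "Exp W A D" and ?C = "VCmp (vself W) A B D"
 have e: "icomp0 V A B D = I0 ?C o pp0 ?E ?E' (pr1 V (IOb ?E) (IOb ?E')) (pr2 V (IOb ?E) (IOb ?E'))"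
  unfolding icomp0_def Let_def pp0_def ..
 note [simp] = o
 show "icomp0 V A B D : Prod V (IOb ?E) (IOb ?E') ~> IOb ?F" unfolding e by simp
 let ?P = "Prod W ?E ?E'" let ?Y = "Prod W ?P A"
 let ?p = "pr1 W ?P A" and ?q = "pr2 W ?P A"
 have t: "?C o\<^bsub>W\<^esub> tuple W (pr1 W ?E ?E' o\<^bsub>W\<^esub> ?p) (pr2 W ?E ?E' o\<^bsub>W\<^esub> ?p) : Hom W ?Y ?F" "?q : Hom W ?Y A"
  "pr1 W ?E ?E' o\<^bsub>W\<^esub> ?p : Hom W ?Y ?E" "pr2 W ?E ?E' o\<^bsub>W\<^esub> ?p : Hom W ?Y ?E'"
  "eval_ar W A B o\<^bsub>W\<^esub> tuple W (pr1 W ?E ?E' o\<^bsub>W\<^esub> ?p) ?q : Hom W ?Y B" by simp_all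
 have M: "eval_ar W A D o\<^bsub>W\<^esub> tuple W (?C o\<^bsub>W\<^esub> tuple W (pr1 W ?E ?E' o\<^bsub>W\<^esub> ?p) (pr2 W ?E ?E' o\<^bsub>W\<^esub> ?p)) ?q =
   eval_ar W B D o\<^bsub>W\<^esub> tuple W (pr2 W ?E ?E' o\<^bsub>W\<^esub> ?p) (eval_ar W A B o\<^bsub>W\<^esub> tuple W (pr1 W ?E ?E' o\<^bsub>W\<^esub> ?p) ?q)"
  by (rule W.eval_vself(1)) simp_all
 show "ap0 A D (icomp0 V A B D o <|k, l|>) a = ap0 B D l (ap0 A B k a)"
  if s: "k : x ~> IOb ?E" "l : x ~> IOb ?E'" "a : x ~> IOb A"
 proof -
  let ?u = "pp0 ?P A (pp0 ?E ?E' k l) a"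
  have u: "?u : Ar V" "Cod V ?u = IOb ?Y" using s by simp_all
  have "I0 (eval_ar W A D o\<^bsub>W\<^esub> tuple W (?C o\<^bsub>W\<^esub> tuple W (pr1 W ?E ?E' o\<^bsub>W\<^esub> ?p) (pr2 W ?E ?E' o\<^bsub>W\<^esub> ?p)) ?q) o ?u
   = ap0 A D (icomp0 V A B D o <|k, l|>) a"
   unfolding eval_elements(1)[OF t(1,2) o(1,3) u] e using s by (simp add: I_tuple[OF t(3,4)])
  moreover have "I0 (eval_ar W B D o\<^bsub>W\<^esub> tuple W (pr2 W ?E ?E' o\<^bsub>W\<^esub> ?p) (eval_ar W A B o\<^bsub>W\<^esub> tuple W (pr1 W ?E ?E' o\<^bsub>W\<^esub> ?p) ?q)) o ?u
   = ap0 B D l (ap0 A B k a)"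
   unfolding eval_elements(1)[OF t(4,5) o(2,3) u] eval_elements(1)[OF t(3,2) o(1,2) u] using s by simp
  ultimately show ?thesis unfolding M by simp
 qed
 show "ap1 A D (icomp0 V A B D o <|k, l|>) f = ap1 B D l (ap1 A B k f)"
  if s: "k : x ~> IOb ?E" "l : x ~> IOb ?E'" "f : x ~> IAr A"
 proof -
  let ?u = "pp1 ?P A (IIdn ?P o pp0 ?E ?E' k l) f"
  have u: "?u : Ar V" "Cod V ?u = IAr ?Y" using s by simp_all
  have C: "I1 ?C o pp1 ?E ?E' (IIdn ?E o k) (IIdn ?E' o l) = IIdn ?F o (I0 ?C o pp0 ?E ?E' k l)"
  proof -
   have "I1 ?C o (IIdn ?P o pp0 ?E ?E' k l) = IIdn ?F o (I0 ?C o pp0 ?E ?E' k l)"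
    using s by (simp del: pp_icat)
   moreover have "IIdn ?P o pp0 ?E ?E' k l = pp1 ?E ?E' (IIdn ?E o k) (IIdn ?E' o l)" using s by simp
   ultimately show ?thesis by metis
  qed
  have "I1 (eval_ar W A D o\<^bsub>W\<^esub> tuple W (?C o\<^bsub>W\<^esub> tuple W (pr1 W ?E ?E' o\<^bsub>W\<^esub> ?p) (pr2 W ?E ?E' o\<^bsub>W\<^esub> ?p)) ?q) o ?u
   = ap1 A D (icomp0 V A B D o <|k, l|>) f"
   unfolding eval_elements(2)[OF t(1,2) o(1,3) u] e using s C by (simp add: I_tuple[OF t(3,4)] ap1_def)
  moreover have "I1 (eval_ar W B D o\<^bsub>W\<^esub> tuple W (pr2 W ?E ?E' o\<^bsub>W\<^esub> ?p) (eval_ar W A B o\<^bsub>W\<^esub> tuple W (pr1 W ?E ?E' o\<^bsub>W\<^esub> ?p) ?q)) o ?u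
   = ap1 B D l (ap1 A B k f)"
   unfolding eval_elements(2)[OF t(4,5) o(2,3) u] eval_elements(2)[OF t(3,2) o(1,2) u] using s by (simp add: ap1_def)
  ultimately show ?thesis unfolding M by simp
 qed
qed

lemma ap_transp:
 assumes o: "X : Ob W" "A : Ob W" "B : Ob W" and H: "H : Hom W (Prod W X A) B"
 shows "[|k : Ar V; a : Ar V; Dom V k = Dom V a; Cod V k = IOb X; Cod V a = IOb A|] ==>
   ap0 A B (I0 (transp W X A B H) o k) a = I0 H o pp0 X A k a"
  "[|k : Ar V; f : Ar V; Dom V k = Dom V f; Cod V k = IOb X; Cod V f = IAr A|] ==>
   ap1 A B (I0 (transp W X A B H) o k) f = I1 H o pp1 X A (IIdn X o k) f"
proof -
 note [simp] = o H[unfolded Hom_iff]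
 let ?T = "transp W X A B H"
 have t: "?T o\<^bsub>W\<^esub> pr1 W X A : Hom W (Prod W X A) (Exp W A B)" "pr2 W X A : Hom W (Prod W X A) A" by simp_all
 have e: "eval_ar W A B o\<^bsub>W\<^esub> tuple W (?T o\<^bsub>W\<^esub> pr1 W X A) (pr2 W X A) = H" by simp
 show "[|k : Ar V; a : Ar V; Dom V k = Dom V a; Cod V k = IOb X; Cod V a = IOb A|] ==>
   ap0 A B (I0 ?T o k) a = I0 H o pp0 X A k a"
  using eval_elements(1)[OF t o(2,3), of "pp0 X A k a"] unfolding e by simp
 show "[|k : Ar V; f : Ar V; Dom V k = Dom V f; Cod V k = IOb X; Cod V f = IAr A|] ==>
   ap1 A B (I0 ?T o k) f = I1 H o pp1 X A (IIdn X o k) f"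
  using eval_elements(2)[OF t o(2,3), of "pp1 X A (IIdn X o k) f"] unfolding e by (simp add: ap1_def)
qed

lemma iname:
 assumes H: "H : Hom W A B"
 shows "iname V H : terminal V ~> IOb (Exp W A B)"
  "[|u : Ar V; a : Ar V; Cod V u = terminal V; Dom V u = Dom V a; Cod V a = IOb A|] ==> ap0 A B (iname V H o u) a = I0 H o a"
  "[|u : Ar V; f : Ar V; Cod V u = terminal V; Dom V u = Dom V f; Cod V f = IAr A|] ==> ap1 A B (iname V H o u) f = I1 H o f"
proof -
 let ?T = "terminal W"
 have o: "A : Ob W" "B : Ob W" using W.Hom_Ob[OF H] by simp_all
 note [simp] = o H[unfolded Hom_iff]
 define \<tau> where "\<tau> = (THE u. u : terminal V ~> IOb ?T)"
 let ?\<tau> = "I0 (bang W (disc (terminal V)))"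
 have "?\<tau> : terminal V ~> IOb ?T" by simp
 moreover have "v = ?\<tau>" if v: "v : terminal V ~> IOb ?T" for v
 proof -
  have "from_disc ?T v = bang W (disc (terminal V))"
   by (rule W.terminal_eqI[of _ "disc (terminal V)"]) (use v in simp_all)
  from arg_cong[OF this, of I0] show ?thesis using v by simp
 qed
 ultimately have "\<tau> : terminal V ~> IOb ?T" unfolding \<tau>_def by (rule theI)
 then have \<tau> [simp]: "\<tau> : Ar V" "Dom V \<tau> = terminal V" "Cod V \<tau> = IOb ?T" by simp_all
 have e: "iname V H = I0 (transp W ?T A B (H o\<^bsub>W\<^esub> pr2 W ?T A)) o \<tau>"
  unfolding iname_def Let_def \<tau>_def by simp
 show "iname V H : terminal V ~> IOb (Exp W A B)" unfolding e by simp
 have t: "H o\<^bsub>W\<^esub> pr2 W ?T A : Hom W (Prod W ?T A) B" by simp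
 note ap = ap_transp[OF W.terminal_Ob o t]
 show "[|u : Ar V; a : Ar V; Cod V u = terminal V; Dom V u = Dom V a; Cod V a = IOb A|] ==> ap0 A B (iname V H o u) a = I0 H o a"
  unfolding e using ap(1)[of "\<tau> o u" a] by simp
 show "[|u : Ar V; f : Ar V; Cod V u = terminal V; Dom V u = Dom V f; Cod V f = IAr A|] ==> ap1 A B (iname V H o u) f = I1 H o f"
  unfolding e using ap(2)[of "\<tau> o u" f] by simp
qed

lemma slice_post:
 assumes P: "P : Hom W A X" and Q: "Q : Hom W B X"
 shows "slice_post V P Q : IOb (Exp W A B) ~> IOb (Exp W A X)"
  "[|k : Ar V; a : Ar V; Dom V k = Dom V a; Cod V k = IOb (Exp W A B); Cod V a = IOb A|] ==>
   ap0 A X (slice_post V P Q o k) a = I0 Q o ap0 A B k a"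
  "[|k : Ar V; f : Ar V; Dom V k = Dom V f; Cod V k = IOb (Exp W A B); Cod V f = IAr A|] ==>
   ap1 A X (slice_post V P Q o k) f = I1 Q o ap1 A B k f"
proof -
 have o: "A : Ob W" "B : Ob W" "X : Ob W" using W.Hom_Ob[OF P] W.Hom_Ob[OF Q] by simp_all
 note [simp] = o P[unfolded Hom_iff] Q[unfolded Hom_iff]
 have e: "slice_post V P Q = I0 (transp W (Exp W A B) A X (Q o\<^bsub>W\<^esub> eval_ar W A B))"
  unfolding slice_post_def ipostcomp_def Let_def by simp
 show "slice_post V P Q : IOb (Exp W A B) ~> IOb (Exp W A X)" unfolding e by simp
 have t: "Q o\<^bsub>W\<^esub> eval_ar W A B : Hom W (Prod W (Exp W A B) A) X" by simp
 have E: "Exp W A B : Ob W" by simp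
 note ap = ap_transp[OF E o(1,3) t, folded e]
 show "[|k : Ar V; a : Ar V; Dom V k = Dom V a; Cod V k = IOb (Exp W A B); Cod V a = IOb A|] ==>
   ap0 A X (slice_post V P Q o k) a = I0 Q o ap0 A B k a"
  using ap(1)[of k a] by (simp add: ap0_def)
 show "[|k : Ar V; f : Ar V; Dom V k = Dom V f; Cod V k = IOb (Exp W A B); Cod V f = IAr A|] ==>
   ap1 A X (slice_post V P Q o k) f = I1 Q o ap1 A B k f"
  using ap(2)[of k f] by (simp add: ap1_def)
qed

text \<open>An element \<^term>\<open>h\<close> of the hom-object \<^term>\<open>slice_hom V P Q\<close> acts on objects and arrows of the domain
 of \<^term>\<open>P\<close>, compatibly with \<^term>\<open>P\<close> and \<^term>\<open>Q\<close>; it is determined by this action.\<close>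

definition sl0 where "sl0 P Q h a = ap0 (Dom W P) (Dom W Q) (slice_hom_pr V P Q o h) a"
definition sl1 where "sl1 P Q h f = ap1 (Dom W P) (Dom W Q) (slice_hom_pr V P Q o h) f"

context
 fixes A B X P Q
 assumes P: "P : Hom W A X" and Q: "Q : Hom W B X"
begin

private lemma o [simp]: "A : Ob W" "B : Ob W" "X : Ob W" "P : Ar W" "Dom W P = A" "Cod W P = X"
 "Q : Ar W" "Dom W Q = B" "Cod W Q = X"
 using W.Hom_Ob[OF P] W.Hom_Ob[OF Q] P Q by simp_all

private lemma pbs: "slice_post V P Q : Ar V" "iname V P : Ar V" "Cod V (slice_post V P Q) = Cod V (iname V P)"
 "Dom V (slice_post V P Q) = IOb (Exp W A B)" "Dom V (iname V P) = terminal V" "Cod V (iname V P) = IOb (Exp W A X)"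
 using slice_post(1)[OF P Q] iname(1)[OF P] by simp_all

lemma slice_hom_typing:
 "slice_hom V P Q : Ob V" "slice_hom_pr V P Q : Ar V" "Dom V (slice_hom_pr V P Q) = slice_hom V P Q"
 "Cod V (slice_hom_pr V P Q) = IOb (Exp W A B)"
 using pb_simps[OF pbs(1-3)] pbs unfolding slice_hom_def slice_hom_pr_def by simp_all

private lemma t [simp]:
 "slice_hom V P Q : Ob V" "slice_hom_pr V P Q : Ar V" "Dom V (slice_hom_pr V P Q) = slice_hom V P Q"
 "Cod V (slice_hom_pr V P Q) = IOb (Exp W A B)"
 by (fact slice_hom_typing)+

lemma sl:
 assumes "h : Ar V" "Cod V h = slice_hom V P Q" "a : Ar V" "Dom V h = Dom V a"
 shows "Cod V a = IOb A ==> sl0 P Q h a : Ar V" "Cod V a = IOb A ==> Dom V (sl0 P Q h a) = Dom V a"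
  "Cod V a = IOb A ==> Cod V (sl0 P Q h a) = IOb B"
  "Cod V a = IOb A ==> r : Ar V ==> Cod V r = Dom V a ==> sl0 P Q h a o r = sl0 P Q (h o r) (a o r)"
  "Cod V a = IAr A ==> sl1 P Q h a : Ar V" "Cod V a = IAr A ==> Dom V (sl1 P Q h a) = Dom V a"
  "Cod V a = IAr A ==> Cod V (sl1 P Q h a) = IAr B"
  "Cod V a = IAr A ==> ISrc B o sl1 P Q h a = sl0 P Q h (ISrc A o a)"
  "Cod V a = IAr A ==> ITgt B o sl1 P Q h a = sl0 P Q h (ITgt A o a)"
  "Cod V a = IOb A ==> I0 Q o sl0 P Q h a = I0 P o a"
  "Cod V a = IAr A ==> I1 Q o sl1 P Q h a = I1 P o a"
proof -
 have c: "slice_post V P Q o (slice_hom_pr V P Q o h) = iname V P o (pb2 V (slice_post V P Q) (iname V P) o h)"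
  unfolding slice_hom_pr_def
  by (rule Cmp_eq_precomp[OF pb_commute[OF pbs(1-3)]]) (use pbs pb_simps[OF pbs(1-3)] assms in \<open>simp_all add: slice_hom_def\<close>)
 have k: "slice_hom_pr V P Q o h : Ar V" "Cod V (slice_hom_pr V P Q o h) = IOb (Exp W A B)" "Dom V (slice_hom_pr V P Q o h) = Dom V a"
  "pb2 V (slice_post V P Q) (iname V P) o h : Ar V" "Dom V (pb2 V (slice_post V P Q) (iname V P) o h) = Dom V a"
  "Cod V (pb2 V (slice_post V P Q) (iname V P) o h) = terminal V"
  using assms pbs pb_simps[OF pbs(1-3)] by (simp_all add: slice_hom_def)
 show "Cod V a = IOb A ==> I0 Q o sl0 P Q h a = I0 P o a"
  using slice_post(2)[OF P Q k(1), of a] iname(2)[OF P k(4), of a] assms k c by (simp add: sl0_def)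
 show "Cod V a = IAr A ==> I1 Q o sl1 P Q h a = I1 P o a"
  using slice_post(3)[OF P Q k(1), of a] iname(3)[OF P k(4), of a] assms k c by (simp add: sl1_def)
qed (use assms in \<open>simp_all add: sl0_def sl1_def\<close>)

lemma slice_lift:
 assumes f: "f : x ~> IOb (Exp W A B)" and c: "slice_post V P Q o f = iname V P o bang V x"
 shows "slice_lift V P Q f : x ~> slice_hom V P Q" "slice_hom_pr V P Q o slice_lift V P Q f = f"
proof -
 have "x : Ob V" using f by (rule Hom_Ob)
 then have t: "f : x ~> Dom V (slice_post V P Q)" "bang V (Dom V f) : x ~> Dom V (iname V P)"
  "slice_post V P Q o f = iname V P o bang V (Dom V f)" using f c pbs by simp_all
 show "slice_lift V P Q f : x ~> slice_hom V P Q" "slice_hom_pr V P Q o slice_lift V P Q f = f"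
  unfolding slice_lift_def slice_hom_def slice_hom_pr_def using pb_tuple[OF pbs(1-3) t] by simp_all
qed

lemma slice_lift_elements:
 assumes f: "f : x ~> IOb (Exp W A B)"
  and 0: "!!y u a. u : y ~> x ==> a : y ~> IOb A ==> I0 Q o ap0 A B (f o u) a = I0 P o a"
  and 1: "!!y u a. u : y ~> x ==> a : y ~> IAr A ==> I1 Q o ap1 A B (f o u) a = I1 P o a"
 shows "slice_lift V P Q f : x ~> slice_hom V P Q" "slice_hom_pr V P Q o slice_lift V P Q f = f"
proof -
 have x [simp]: "x : Ob V" using f by (rule Hom_Ob)
 note [simp] = f[unfolded Hom_iff] pbs
 have "slice_post V P Q o f = iname V P o bang V x"
 proof (rule ap_ext[of A X _ x])
  fix y u a assume t: "u : y ~> x" "a : y ~> IOb A"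
  then show "ap0 A X ((slice_post V P Q o f) o u) a = ap0 A X ((iname V P o bang V x) o u) a"
   using slice_post(2)[OF P Q, of "f o u" a] iname(2)[OF P, of "bang V y" a] 0[OF t] Hom_Ob[OF t(1)] by simp
 next
  fix y u a assume t: "u : y ~> x" "a : y ~> IAr A"
  then show "ap1 A X ((slice_post V P Q o f) o u) a = ap1 A X ((iname V P o bang V x) o u) a"
   using slice_post(3)[OF P Q, of "f o u" a] iname(3)[OF P, of "bang V y" a] 1[OF t] Hom_Ob[OF t(1)] by simp
 qed simp_all
 from slice_lift[OF f this] show "slice_lift V P Q f : x ~> slice_hom V P Q" "slice_hom_pr V P Q o slice_lift V P Q f = f" .
qed

lemma sl_ext:
 assumes hk: "h : x ~> slice_hom V P Q" "k : x ~> slice_hom V P Q"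
  and 0: "!!y u a. u : y ~> x ==> a : y ~> IOb A ==> sl0 P Q (h o u) a = sl0 P Q (k o u) a"
  and 1: "!!y u a. u : y ~> x ==> a : y ~> IAr A ==> sl1 P Q (h o u) a = sl1 P Q (k o u) a"
 shows "h = k"
proof -
 note [simp] = hk[unfolded Hom_iff]
 have "slice_hom_pr V P Q o h = slice_hom_pr V P Q o k"
 proof (rule ap_ext[of A B _ x])
  fix y u a assume t: "u : y ~> x" "a : y ~> IOb A"
  then show "ap0 A B ((slice_hom_pr V P Q o h) o u) a = ap0 A B ((slice_hom_pr V P Q o k) o u) a"
   using 0[OF t] by (simp add: sl0_def)
 next
  fix y u a assume t: "u : y ~> x" "a : y ~> IAr A"
  then show "ap1 A B ((slice_hom_pr V P Q o h) o u) a = ap1 A B ((slice_hom_pr V P Q o k) o u) a"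
   using 1[OF t] by (simp add: sl1_def)
 qed simp_all
 moreover have "pb2 V (slice_post V P Q) (iname V P) o h = pb2 V (slice_post V P Q) (iname V P) o k"
  by (rule terminal_eqI[of _ x]) (use hk pbs pb_simps[OF pbs(1-3)] in \<open>simp_all add: slice_hom_def\<close>)
 ultimately show ?thesis
  using pb_eqI[OF pbs(1-3), of h x k] hk unfolding slice_hom_def slice_hom_pr_def by blast
qed

lemma sl_ex:
 assumes h: "PF A B x (h0, h1)"
  and 0: "!!y u a. u : y ~> x ==> a : y ~> IOb A ==> I0 Q o (h0 o <|u, a|>) = I0 P o a"
  and 1: "!!y u a. u : y ~> x ==> a : y ~> IAr A ==> I1 Q o (h1 o <|u, a|>) = I1 P o a"
 obtains h where "h : x ~> slice_hom V P Q"
  "!!y u a. u : y ~> x ==> a : y ~> IOb A ==> sl0 P Q (h o u) a = h0 o <|u, a|>"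
proof -
 obtain k where k: "k : x ~> IOb (Exp W A B)"
  "!!y u a. u : y ~> x ==> a : y ~> IOb A ==> ap0 A B (k o u) a = h0 o <|u, a|>"
  "!!y u a. u : y ~> x ==> a : y ~> IAr A ==> ap1 A B (k o u) a = h1 o <|u, a|>"
  by (rule ap_ex[OF o(1,2) h]) blast
 note l = slice_lift_elements[OF k(1)]
 have l: "slice_lift V P Q k : x ~> slice_hom V P Q" "slice_hom_pr V P Q o slice_lift V P Q k = k"
  by (rule l; use k 0 1 in simp)+
 show ?thesis
 proof (rule that[OF l(1)])
  fix y u a assume t: "u : y ~> x" "a : y ~> IOb A"
  have "slice_hom_pr V P Q o (slice_lift V P Q k o u) = k o u"
   by (rule Cmp_eq_precomp1[OF l(2)]) (use l(1) t in simp_all)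
  then show "sl0 P Q (slice_lift V P Q k o u) a = h0 o <|u, a|>" using k(2)[OF t] by (simp add: sl0_def)
 qed
qed

lemma slice_name:
 assumes H: "H : Hom W A B" "Q o\<^bsub>W\<^esub> H = P"
 shows "slice_lift V P Q (iname V H) : terminal V ~> slice_hom V P Q"
  "[|u : Ar V; a : Ar V; Cod V u = terminal V; Dom V u = Dom V a; Cod V a = IOb A|] ==>
   sl0 P Q (slice_lift V P Q (iname V H) o u) a = I0 H o a"
  "[|u : Ar V; a : Ar V; Cod V u = terminal V; Dom V u = Dom V a; Cod V a = IAr A|] ==>
   sl1 P Q (slice_lift V P Q (iname V H) o u) a = I1 H o a"
proof -
 note [simp] = H(1)[unfolded Hom_iff]
 have e: "I0 Q o (I0 H o a) = I0 P o a" if "a : Ar V" "Cod V a = IOb A" for a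
  using Cmp_eq_precomp1[of "I0 Q" "I0 H" "I0 P" a] arg_cong[OF H(2), of I0] that by simp
 have e1: "I1 Q o (I1 H o a) = I1 P o a" if "a : Ar V" "Cod V a = IAr A" for a
  using Cmp_eq_precomp1[of "I1 Q" "I1 H" "I1 P" a] arg_cong[OF H(2), of I1] that by simp
 have l: "slice_lift V P Q (iname V H) : terminal V ~> slice_hom V P Q"
  "slice_hom_pr V P Q o slice_lift V P Q (iname V H) = iname V H"
  by (rule slice_lift_elements[OF iname(1)[OF H(1)]]; use iname(2,3)[OF H(1)] e e1 in simp)+
 show "slice_lift V P Q (iname V H) : terminal V ~> slice_hom V P Q" by (rule l)
 have "slice_hom_pr V P Q o (slice_lift V P Q (iname V H) o u) = iname V H o u" if "u : Ar V" "Cod V u = terminal V" for u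
  by (rule Cmp_eq_precomp1[OF l(2)]) (use l(1) that in simp_all)
 then show "[|u : Ar V; a : Ar V; Cod V u = terminal V; Dom V u = Dom V a; Cod V a = IOb A|] ==>
   sl0 P Q (slice_lift V P Q (iname V H) o u) a = I0 H o a"
   "[|u : Ar V; a : Ar V; Cod V u = terminal V; Dom V u = Dom V a; Cod V a = IAr A|] ==>
   sl1 P Q (slice_lift V P Q (iname V H) o u) a = I1 H o a"
  using iname(2,3)[OF H(1)] by (simp_all add: sl0_def sl1_def)
qed

declare o [simp del] t [simp del]

end

lemma slice_VCmp:
 assumes P: "P : Hom W A X" and Q: "Q : Hom W B X" and R: "R : Hom W D X"
 shows "VCmp (slice_vcat V X) P Q R : Prod V (slice_hom V P Q) (slice_hom V Q R) ~> slice_hom V P R"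
  "[|h : x ~> slice_hom V P Q; k : x ~> slice_hom V Q R; a : x ~> IOb A|] ==>
   sl0 P R (VCmp (slice_vcat V X) P Q R o <|h, k|>) a = sl0 Q R k (sl0 P Q h a)"
  "[|h : x ~> slice_hom V P Q; k : x ~> slice_hom V Q R; f : x ~> IAr A|] ==>
   sl1 P R (VCmp (slice_vcat V X) P Q R o <|h, k|>) f = sl1 Q R k (sl1 P Q h f)"
proof -
 have o [simp]: "A : Ob W" "B : Ob W" "X : Ob W" "D : Ob W" using W.Hom_Ob[OF P] W.Hom_Ob[OF Q] W.Hom_Ob[OF R] by simp_all
 note [simp] = P[unfolded Hom_iff] Q[unfolded Hom_iff] R[unfolded Hom_iff]
  slice_hom_typing[OF P Q] slice_hom_typing[OF Q R] slice_hom_typing[OF P R] icomp0(1)[OF o(1,2,4), unfolded Hom_iff]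
 let ?S = "Prod V (slice_hom V P Q) (slice_hom V Q R)"
 let ?f = "icomp0 V A B D o cross V (slice_hom_pr V P Q) (slice_hom_pr V Q R)"
 have e: "VCmp (slice_vcat V X) P Q R = slice_lift V P R ?f"
  by (simp add: slice_vcat_def del: cross_def)
 have ft: "?f : ?S ~> IOb (Exp W A D)" by simp
 have f0: "ap0 A D (?f o u) a = sl0 Q R (pr2 V (slice_hom V P Q) (slice_hom V Q R) o u) (sl0 P Q (pr1 V (slice_hom V P Q) (slice_hom V Q R) o u) a)"
  if "u : y ~> ?S" "a : y ~> IOb A" for y u a
  using icomp0(2)[OF o(1,2,4), of "slice_hom_pr V P Q o (pr1 V (slice_hom V P Q) (slice_hom V Q R) o u)" y
   "slice_hom_pr V Q R o (pr2 V (slice_hom V P Q) (slice_hom V Q R) o u)" a] that by (simp add: sl0_def)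
 have f1: "ap1 A D (?f o u) a = sl1 Q R (pr2 V (slice_hom V P Q) (slice_hom V Q R) o u) (sl1 P Q (pr1 V (slice_hom V P Q) (slice_hom V Q R) o u) a)"
  if "u : y ~> ?S" "a : y ~> IAr A" for y u a
  using icomp0(3)[OF o(1,2,4), of "slice_hom_pr V P Q o (pr1 V (slice_hom V P Q) (slice_hom V Q R) o u)" y
   "slice_hom_pr V Q R o (pr2 V (slice_hom V P Q) (slice_hom V Q R) o u)" a] that by (simp add: sl1_def)
 note s = sl[OF P Q] sl[OF Q R]
 have g0: "I0 R o ap0 A D (?f o u) a = I0 P o a" if "u : y ~> ?S" "a : y ~> IOb A" for y u a
  unfolding f0[OF that] using that s by simp
 have g1: "I1 R o ap1 A D (?f o u) a = I1 P o a" if "u : y ~> ?S" "a : y ~> IAr A" for y u a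
  unfolding f1[OF that] using that s by simp
 note l = slice_lift_elements[OF P R ft g0 g1, folded e]
 show 1: "VCmp (slice_vcat V X) P Q R : ?S ~> slice_hom V P R" by (rule l(1))
 have l2: "slice_hom_pr V P R o (VCmp (slice_vcat V X) P Q R o u) = ?f o u" if "u : y ~> ?S" for y u
  by (rule Cmp_eq_precomp1[OF l(2)]) (use 1 that in simp_all)
 show "sl0 P R (VCmp (slice_vcat V X) P Q R o <|h, k|>) a = sl0 Q R k (sl0 P Q h a)"
  if "h : x ~> slice_hom V P Q" "k : x ~> slice_hom V Q R" "a : x ~> IOb A"
  using l2[of "<|h, k|>" x] f0[of "<|h, k|>" x a] that by (simp add: sl0_def[of P R] del: cross_def)
 show "sl1 P R (VCmp (slice_vcat V X) P Q R o <|h, k|>) f = sl1 Q R k (sl1 P Q h f)"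
  if "h : x ~> slice_hom V P Q" "k : x ~> slice_hom V Q R" "f : x ~> IAr A"
  using l2[of "<|h, k|>" x] f1[of "<|h, k|>" x f] that by (simp add: sl1_def[of P R] del: cross_def)
qed

lemma slice_VId:
 assumes P: "P : Hom W A X"
 shows "VId (slice_vcat V X) P : terminal V ~> slice_hom V P P"
  "[|u : Ar V; a : Ar V; Cod V u = terminal V; Dom V u = Dom V a; Cod V a = IOb A|] ==>
   sl0 P P (VId (slice_vcat V X) P o u) a = a"
  "[|u : Ar V; a : Ar V; Cod V u = terminal V; Dom V u = Dom V a; Cod V a = IAr A|] ==>
   sl1 P P (VId (slice_vcat V X) P o u) a = a"
proof -
 have o: "A : Ob W" using W.Hom_Ob[OF P] by simp
 have e: "VId (slice_vcat V X) P = slice_lift V P P (iname V (Idn W A))" using P by (simp add: slice_vcat_def)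
 have H: "Idn W A : Hom W A A" "P o\<^bsub>W\<^esub> Idn W A = P" using P o by simp_all
 note s = slice_name[OF P P H, folded e]
 show "VId (slice_vcat V X) P : terminal V ~> slice_hom V P P"
  "[|u : Ar V; a : Ar V; Cod V u = terminal V; Dom V u = Dom V a; Cod V a = IOb A|] ==>
   sl0 P P (VId (slice_vcat V X) P o u) a = a"
  "[|u : Ar V; a : Ar V; Cod V u = terminal V; Dom V u = Dom V a; Cod V a = IAr A|] ==>
   sl1 P P (VId (slice_vcat V X) P o u) a = a"
  using s o by simp_all
qed

lemma slice_vcat_simps [simp]: "VOb (slice_vcat V X) = {P \<in> Ar W. Cod W P = X}" "VHom (slice_vcat V X) = slice_hom V"
 using W.slice_simps(1)[of X] by (simp_all add: slice_vcat_def)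

lemma slice_vcategory: assumes "X : Ob W" shows "vcategory V (slice_vcat V X)"
proof (rule vcategoryI)
 fix P Q assume "P : VOb (slice_vcat V X)" "Q : VOb (slice_vcat V X)"
 then have PQ: "P : Hom W (Dom W P) X" "Q : Hom W (Dom W Q) X" by simp_all
 show "VHom (slice_vcat V X) P Q : Ob V" using slice_hom_typing[OF PQ] by simp
 show "VId (slice_vcat V X) P : terminal V ~> VHom (slice_vcat V X) P P"
  using slice_VId(1)[OF PQ(1)] by simp
 fix x h assume "h : x ~> VHom (slice_vcat V X) P Q"
 then have h: "h : x ~> slice_hom V P Q" by simp
 have x: "x : Ob V" using h by (rule Hom_Ob)
 note [simp] = h[unfolded Hom_iff] x slice_VId(1)[OF PQ(1), unfolded Hom_iff] slice_VId(1)[OF PQ(2), unfolded Hom_iff]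
  slice_VCmp(1)[OF PQ(1,1,2), unfolded Hom_iff] slice_VCmp(1)[OF PQ(1,2,2), unfolded Hom_iff]
  slice_VId(2,3)[OF PQ(1)] slice_VId(2,3)[OF PQ(2)] sl[OF PQ]
  slice_hom_typing[OF PQ] slice_hom_typing[OF PQ(1,1)] slice_hom_typing[OF PQ(2,2)]
 show "VCmp (slice_vcat V X) P P Q o <|VId (slice_vcat V X) P o bang V x, h|> = h"
 proof (rule sl_ext[OF PQ, of _ x])
  fix y u a assume "u : y ~> x" "a : y ~> IOb (Dom W P)"
  then show "sl0 P Q ((VCmp (slice_vcat V X) P P Q o <|VId (slice_vcat V X) P o bang V x, h|>) o u) a = sl0 P Q (h o u) a"
   using slice_VCmp(2)[OF PQ(1,1,2), of "VId (slice_vcat V X) P o bang V y" y "h o u" a] Hom_Ob[of u y x] by simp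
 next
  fix y u a assume "u : y ~> x" "a : y ~> IAr (Dom W P)"
  then show "sl1 P Q ((VCmp (slice_vcat V X) P P Q o <|VId (slice_vcat V X) P o bang V x, h|>) o u) a = sl1 P Q (h o u) a"
   using slice_VCmp(3)[OF PQ(1,1,2), of "VId (slice_vcat V X) P o bang V y" y "h o u" a] Hom_Ob[of u y x] by simp
 qed simp_all
 show "VCmp (slice_vcat V X) P Q Q o <|h, VId (slice_vcat V X) Q o bang V x|> = h"
 proof (rule sl_ext[OF PQ, of _ x])
  fix y u a assume "u : y ~> x" "a : y ~> IOb (Dom W P)"
  then show "sl0 P Q ((VCmp (slice_vcat V X) P Q Q o <|h, VId (slice_vcat V X) Q o bang V x|>) o u) a = sl0 P Q (h o u) a"
   using slice_VCmp(2)[OF PQ(1,2,2), of "h o u" y "VId (slice_vcat V X) Q o bang V y" a] Hom_Ob[of u y x] by simp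
 next
  fix y u a assume "u : y ~> x" "a : y ~> IAr (Dom W P)"
  then show "sl1 P Q ((VCmp (slice_vcat V X) P Q Q o <|h, VId (slice_vcat V X) Q o bang V x|>) o u) a = sl1 P Q (h o u) a"
   using slice_VCmp(3)[OF PQ(1,2,2), of "h o u" y "VId (slice_vcat V X) Q o bang V y" a] Hom_Ob[of u y x] by simp
 qed simp_all
next
 fix P Q R assume "P : VOb (slice_vcat V X)" "Q : VOb (slice_vcat V X)" "R : VOb (slice_vcat V X)"
 then have PQR: "P : Hom W (Dom W P) X" "Q : Hom W (Dom W Q) X" "R : Hom W (Dom W R) X" by simp_all
 show "VCmp (slice_vcat V X) P Q R : Prod V (VHom (slice_vcat V X) P Q) (VHom (slice_vcat V X) Q R) ~> VHom (slice_vcat V X) P R"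
  using slice_VCmp(1)[OF PQR] by simp
 fix S x f g h assume "S : VOb (slice_vcat V X)" "f : x ~> VHom (slice_vcat V X) P Q"
  "g : x ~> VHom (slice_vcat V X) Q R" "h : x ~> VHom (slice_vcat V X) R S"
 then have S: "S : Hom W (Dom W S) X" and fgh: "f : x ~> slice_hom V P Q" "g : x ~> slice_hom V Q R" "h : x ~> slice_hom V R S" by simp_all
 have x: "x : Ob V" using fgh(1) by (rule Hom_Ob)
 note [simp] = fgh[unfolded Hom_iff] x slice_VCmp(1)[OF PQR, unfolded Hom_iff] slice_VCmp(1)[OF PQR(1,3) S, unfolded Hom_iff]
  slice_VCmp(1)[OF PQR(2,3) S, unfolded Hom_iff] slice_VCmp(1)[OF PQR(1,2) S, unfolded Hom_iff]
  sl[OF PQR(1,2)] sl[OF PQR(2,3)] sl[OF PQR(3) S] sl[OF PQR(1,3)]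
  slice_hom_typing[OF PQR(1,2)] slice_hom_typing[OF PQR(2,3)] slice_hom_typing[OF PQR(3) S] slice_hom_typing[OF PQR(1,3)]
  slice_hom_typing[OF PQR(1) S] slice_hom_typing[OF PQR(2) S]
 show "VCmp (slice_vcat V X) P R S o <|VCmp (slice_vcat V X) P Q R o <|f, g|>, h|> =
    VCmp (slice_vcat V X) P Q S o <|f, VCmp (slice_vcat V X) Q R S o <|g, h|>|>"
 proof (rule sl_ext[OF PQR(1) S, of _ x])
  fix y u a assume "u : y ~> x" "a : y ~> IOb (Dom W P)"
  then show "sl0 P S ((VCmp (slice_vcat V X) P R S o <|VCmp (slice_vcat V X) P Q R o <|f, g|>, h|>) o u) a =
    sl0 P S ((VCmp (slice_vcat V X) P Q S o <|f, VCmp (slice_vcat V X) Q R S o <|g, h|>|>) o u) a"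
   using slice_VCmp(2)[OF PQR(1,3) S, of "VCmp (slice_vcat V X) P Q R o <|f o u, g o u|>" y "h o u" a]
    slice_VCmp(2)[OF PQR(1,2,3), of "f o u" y "g o u" a] slice_VCmp(2)[OF PQR(1,2) S, of "f o u" y "VCmp (slice_vcat V X) Q R S o <|g o u, h o u|>" a]
    slice_VCmp(2)[OF PQR(2,3) S, of "g o u" y "h o u" "sl0 P Q (f o u) a"] by simp
 next
  fix y u a assume "u : y ~> x" "a : y ~> IAr (Dom W P)"
  then show "sl1 P S ((VCmp (slice_vcat V X) P R S o <|VCmp (slice_vcat V X) P Q R o <|f, g|>, h|>) o u) a =
    sl1 P S ((VCmp (slice_vcat V X) P Q S o <|f, VCmp (slice_vcat V X) Q R S o <|g, h|>|>) o u) a"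
   using slice_VCmp(3)[OF PQR(1,3) S, of "VCmp (slice_vcat V X) P Q R o <|f o u, g o u|>" y "h o u" a]
    slice_VCmp(3)[OF PQR(1,2,3), of "f o u" y "g o u" a] slice_VCmp(3)[OF PQR(1,2) S, of "f o u" y "VCmp (slice_vcat V X) Q R S o <|g o u, h o u|>" a]
    slice_VCmp(3)[OF PQR(2,3) S, of "g o u" y "h o u" "sl1 P Q (f o u) a"] by simp
 qed simp_all
qed

lemma vfull_simps [simp]: "VOb (vfull A S) = VOb A \<inter> S" "VHom (vfull A S) = VHom A" "VCmp (vfull A S) = VCmp A" "VId (vfull A S) = VId A"
 by (simp_all add: vfull_def)

lemma vfull_vcategory: "vcategory V A ==> vcategory V (vfull A S)"
 unfolding vcategory_def vfull_simps by blast

end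

section \<open>Internal discrete fibrations\<close>

context ccc_pb
begin

lemma dfib_lift:
 assumes Q: "discrete_fibration V Q" "Q : Hom W B X" and z: "z : y ~> IOb B" and \<phi>: "\<phi> : y ~> IAr X"
  and e: "I0 Q o z = ITgt X o \<phi>"
 obtains m where "m : y ~> IAr B" "ITgt B o m = z" "I1 Q o m = \<phi>"
proof -
 have pb: "is_pullback V (I0 Q) (ITgt X) (IAr B) (ITgt B) (I1 Q)"
  using Q unfolding discrete_fibration_def by simp
 show ?thesis using pullback_pairing[OF pb, of z y \<phi>] that Q(2) z \<phi> e W.Hom_Ob[OF Q(2)] by simp
qed

lemma dfib_unique:
 assumes Q: "discrete_fibration V Q" "Q : Hom W B X" and m: "m : y ~> IAr B" "n : y ~> IAr B"
  and e: "ITgt B o m = ITgt B o n" "I1 Q o m = I1 Q o n"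
 shows "m = n"
proof -
 have pb: "is_pullback V (I0 Q) (ITgt X) (IAr B) (ITgt B) (I1 Q)"
  using Q unfolding discrete_fibration_def by simp
 show ?thesis by (rule pullback_eqI[OF pb m e])
qed

lemma dfibI:
 assumes Q: "Q : Hom W B X"
  and ex: "!!y z \<phi>. [|z : y ~> IOb B; \<phi> : y ~> IAr X; I0 Q o z = ITgt X o \<phi>|] ==>
   \<exists>m. m : y ~> IAr B \<and> ITgt B o m = z \<and> I1 Q o m = \<phi>"
  and un: "!!y m n. [|m : y ~> IAr B; n : y ~> IAr B; ITgt B o m = ITgt B o n; I1 Q o m = I1 Q o n|] ==> m = n"
 shows "discrete_fibration V Q"
proof -
 note [simp] = W.Hom_Ob[OF Q] Q[unfolded Hom_iff]
 have c: "I0 Q o ITgt B = ITgt X o I1 Q" using ifun(2)[of Q X "Idn V (IAr B)"] by simp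
 have un': "\<exists>!w. w : y ~> IAr B \<and> ITgt B o w = h \<and> I1 Q o w = k"
  if hk: "h : y ~> IOb B" "k : y ~> IAr X" "I0 Q o h = ITgt X o k" for y h k
 proof -
  obtain m where m: "m : y ~> IAr B \<and> ITgt B o m = h \<and> I1 Q o m = k" using ex[OF hk] by blast
  show ?thesis
  proof (rule ex1I[where a = m])
   fix w assume w: "w : y ~> IAr B \<and> ITgt B o w = h \<and> I1 Q o w = k"
   show "w = m" by (rule un[of _ y]) (use w m in simp_all)
  qed (rule m)
 qed
 have "is_pullback V (I0 Q) (ITgt X) (IAr B) (ITgt B) (I1 Q)"
  unfolding is_pullback_def
 proof (intro conjI allI ballI impI)
  fix x h k assume "h : x ~> Dom V (I0 Q)" "k : x ~> Dom V (ITgt X)" "I0 Q o h = ITgt X o k"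
  then show "\<exists>!w. w : x ~> IAr B \<and> ITgt B o w = h \<and> I1 Q o w = k"
   by (intro un') simp_all
 qed (use c in simp_all)
 then show ?thesis using Q unfolding discrete_fibration_def W_Ar[symmetric] by simp
qed

text \<open>Over a fixed base, a functor into a discrete fibration is determined by its action on objects: the
 action on arrows is given by unique lifts, and functoriality follows from uniqueness.  The only condition on
 the action on objects is that it is compatible with the sources of lifts.\<close>

lemma dfib_extend:
 assumes Q: "discrete_fibration V Q" and P: "P : Hom W A X" and QB: "Q : Hom W B X"
  and x: "x : Ob V" and h0: "h0 : Prod V x (IOb A) ~> IOb B"
  and ov: "!!y u a. u : y ~> x ==> a : y ~> IOb A ==> I0 Q o (h0 o <|u, a|>) = I0 P o a"
  and src: "!!y u f m. [|u : y ~> x; f : y ~> IAr A; m : y ~> IAr B; ITgt B o m = h0 o <|u, ITgt A o f|>;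
   I1 Q o m = I1 P o f|] ==> ISrc B o m = h0 o <|u, ISrc A o f|>"
 shows "\<exists>h1. PF A B x (h0, h1) \<and> (\<forall>y u f. u : y ~> x --> f : y ~> IAr A --> I1 Q o (h1 o <|u, f|>) = I1 P o f)"
proof -
 note [simp] = x W.Hom_Ob[OF P] W.Hom_Ob[OF QB] P[unfolded Hom_iff] QB[unfolded Hom_iff] h0[unfolded Hom_iff]
 let ?z = "h0 o <|pr1 V x (IAr A), ITgt A o pr2 V x (IAr A)|>" and ?\<phi> = "I1 P o pr2 V x (IAr A)"
 have "I0 Q o ?z = ITgt X o ?\<phi>"
  using ov[of "pr1 V x (IAr A)" "Prod V x (IAr A)" "ITgt A o pr2 V x (IAr A)"] by simp
 then obtain h1 where h1: "h1 : Prod V x (IAr A) ~> IAr B" "ITgt B o h1 = ?z" "I1 Q o h1 = ?\<phi>"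
  using dfib_lift[OF Q QB, of ?z "Prod V x (IAr A)" ?\<phi>] by auto
 note [simp] = h1(1)[unfolded Hom_iff]
 have t: "ITgt B o (h1 o <|u, f|>) = h0 o <|u, ITgt A o f|>" "I1 Q o (h1 o <|u, f|>) = I1 P o f"
  if "u : y ~> x" "f : y ~> IAr A" for y u f
  using Cmp_eq_precomp1[OF h1(2), of "<|u, f|>"] Cmp_eq_precomp1[OF h1(3), of "<|u, f|>"] that by simp_all
 have s: "ISrc B o (h1 o <|u, f|>) = h0 o <|u, ISrc A o f|>"
  if "u : y ~> x" "f : y ~> IAr A" for y u f
  by (rule src[OF that]) (use t[OF that] that in simp_all)
 have "PF A B x (h0, h1)"
  unfolding PF_def fst_conv snd_conv
 proof (intro conjI allI impI)
  fix y u a assume ua: "u : y ~> x" "a : y ~> IOb A"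
  show "h1 o <|u, IIdn A o a|> = IIdn B o (h0 o <|u, a|>)"
   by (rule dfib_unique[OF Q QB, of _ y]) (use t[of u y "IIdn A o a"] ov[OF ua] ua in simp_all)
 next
  fix y u f g assume tt: "u : y ~> x" "f : y ~> IAr A" "g : y ~> IAr A" "ITgt A o f = ISrc A o g"
  show "h1 o <|u, icmp A f g|> = icmp B (h1 o <|u, f|>) (h1 o <|u, g|>)"
   by (rule dfib_unique[OF Q QB, of _ y])
    (use t[of u y "icmp A f g"] t[OF tt(1,2)] t[OF tt(1,3)] s[OF tt(1,2)] s[OF tt(1,3)] tt in simp_all)
 qed (use s t in simp_all)
 then show ?thesis using t(2) by blast
qed

context
 fixes P Q A B X
 assumes Q: "discrete_fibration V Q" and P: "P : Hom W A X" and QB: "Q : Hom W B X"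
begin

text \<open>The hom-object of two objects of the slice represents parametrized functors over the base, and by the
 previous lemma those into a discrete fibration are given on objects.\<close>

lemma dfib_slice_ex:
 assumes "x : Ob V" "h0 : Prod V x (IOb A) ~> IOb B"
  "!!y u a. u : y ~> x ==> a : y ~> IOb A ==> I0 Q o (h0 o <|u, a|>) = I0 P o a"
  "!!y u f m. [|u : y ~> x; f : y ~> IAr A; m : y ~> IAr B; ITgt B o m = h0 o <|u, ITgt A o f|>;
   I1 Q o m = I1 P o f|] ==> ISrc B o m = h0 o <|u, ISrc A o f|>"
 obtains h where "h : x ~> slice_hom V P Q"
  "!!y u a. u : y ~> x ==> a : y ~> IOb A ==> sl0 P Q (h o u) a = h0 o <|u, a|>"
proof -
 have "\<exists>h1. PF A B x (h0, h1) \<and> (\<forall>y u f. u : y ~> x --> f : y ~> IAr A --> I1 Q o (h1 o <|u, f|>) = I1 P o f)"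
  by (rule dfib_extend[OF Q P QB assms(1,2)]) (rule assms(3,4); assumption)+
 then obtain h1 where h1: "PF A B x (h0, h1)"
  "!!y u f. u : y ~> x ==> f : y ~> IAr A ==> I1 Q o (h1 o <|u, f|>) = I1 P o f" by blast
 show ?thesis by (rule sl_ex[OF P QB h1(1) assms(3) h1(2)]) (use that in blast)+
qed

lemma dfib_slice_ext:
 assumes hk: "h : x ~> slice_hom V P Q" "k : x ~> slice_hom V P Q"
  and 0: "!!y u a. u : y ~> x ==> a : y ~> IOb A ==> sl0 P Q (h o u) a = sl0 P Q (k o u) a"
 shows "h = k"
proof (rule sl_ext[OF P QB hk 0])
 fix y u f assume t: "u : y ~> x" "f : y ~> IAr A"
 note s = sl[OF P QB, of "h o u" f] sl[OF P QB, of "k o u" f]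
 show "sl1 P Q (h o u) f = sl1 P Q (k o u) f"
  by (rule dfib_unique[OF Q QB, of _ y]) (use s t hk 0[OF t(1), of "ITgt A o f"] W.Hom_Ob[OF P] in simp_all)
qed

text \<open>The converse of the source condition: the element acts on arrows by taking the lifts.\<close>

lemma dfib_slice_source:
 assumes h: "h : y ~> slice_hom V P Q" "f : y ~> IAr A" "m : y ~> IAr B"
  "ITgt B o m = sl0 P Q h (ITgt A o f)" "I1 Q o m = I1 P o f"
 shows "ISrc B o m = sl0 P Q h (ISrc A o f)"
proof -
 note s = sl[OF P QB, of h f]
 have "m = sl1 P Q h f" by (rule dfib_unique[OF Q QB h(3)]) (use s h in simp_all)
 then show ?thesis using s h by simp
qed

text \<open>The case where the parameter ranges over the terminal object.\<close>

lemma dfib_functor: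
 assumes h0: "h0 : IOb A ~> IOb B" "I0 Q o h0 = I0 P"
  and src: "!!y f m. [|f : y ~> IAr A; m : y ~> IAr B; ITgt B o m = h0 o (ITgt A o f);
   I1 Q o m = I1 P o f|] ==> ISrc B o m = h0 o (ISrc A o f)"
 obtains H where "H : Hom W A B" "I0 H = h0" "Q o\<^bsub>W\<^esub> H = P"
proof -
 note [simp] = W.Hom_Ob[OF P] W.Hom_Ob[OF QB] P[unfolded Hom_iff] QB[unfolded Hom_iff] h0(1)[unfolded Hom_iff]
 let ?T = "terminal V" let ?h = "h0 o pr2 V ?T (IOb A)"
 have ov: "I0 Q o (h0 o a) = I0 P o a" if "a : Ar V" "Cod V a = IOb A" for a
  by (rule Cmp_eq_precomp1[OF h0(2)]) (use that in simp_all)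
 have "\<exists>h1. PF A B ?T (?h, h1) \<and> (\<forall>y u f. u : y ~> ?T --> f : y ~> IAr A --> I1 Q o (h1 o <|u, f|>) = I1 P o f)"
 proof (rule dfib_extend[OF Q P QB, of ?T ?h])
  show "ISrc B o m = ?h o <|u, ISrc A o f|>"
   if "u : y ~> ?T" "f : y ~> IAr A" "m : y ~> IAr B" "ITgt B o m = ?h o <|u, ITgt A o f|>" "I1 Q o m = I1 P o f" for y u f m
   using src[of f y m] that by simp
 qed (use ov in simp_all)
 then obtain h1 where h1: "PF A B ?T (?h, h1)" "!!y u f. u : y ~> ?T ==> f : y ~> IAr A ==> I1 Q o (h1 o <|u, f|>) = I1 P o f"
  by blast
 note [simp] = PFD(2-7)[OF h1(1)] PFD(8-10)[OF h1(1)] PFD(11)[OF h1(1)]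
 let ?b = "bang V (IAr A)" let ?k = "h1 o <|?b, Idn V (IAr A)|>"
 have H: "mkf A B h0 ?k : Hom W A B"
  by (rule ifunI) simp_all
 moreover have "Q o\<^bsub>W\<^esub> mkf A B h0 ?k = P"
 proof (rule ifun_eqI[OF _ P])
  show "Q o\<^bsub>W\<^esub> mkf A B h0 ?k : Hom W A X" using H by simp
  show "I0 (Q o\<^bsub>W\<^esub> mkf A B h0 ?k) = I0 P" using h0 by simp
  show "I1 (Q o\<^bsub>W\<^esub> mkf A B h0 ?k) = I1 P" using h1(2)[of ?b "IAr A" "Idn V (IAr A)"] by simp
 qed
 ultimately show ?thesis by (intro that[of "mkf A B h0 ?k"]) simp_all
qed

lemma dfib_functor_ext:
 assumes H: "H : Hom W A B" "K : Hom W A B" "Q o\<^bsub>W\<^esub> H = P" "Q o\<^bsub>W\<^esub> K = P" "I0 H = I0 K"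
 shows "H = K"
proof (rule ifun_eqI[OF H(1,2,5)])
 note [simp] = W.Hom_Ob[OF P] W.Hom_Ob[OF QB] P[unfolded Hom_iff] QB[unfolded Hom_iff] H(1,2)[unfolded Hom_iff]
 have "ITgt B o I1 H = ITgt B o I1 K"
  using ifun(2)[of H B "Idn V (IAr A)"] ifun(2)[of K B "Idn V (IAr A)"] H(5) by simp
 moreover have "I1 Q o I1 H = I1 Q o I1 K" unfolding W_Cmp(2)[symmetric] H(3,4) ..
 moreover have "I1 H : IAr A ~> IAr B" "I1 K : IAr A ~> IAr B" by simp_all
 ultimately show "I1 H = I1 K" by (metis dfib_unique[OF Q QB])
qed

end

lemma icmp_pre:
 assumes A: "ITgt A : Ar V" "ISrc A : Ar V" "Cod V (ITgt A) = Cod V (ISrc A)" "Dom V (ITgt A) = IAr A" "Dom V (ISrc A) = IAr A"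
  "ICmp A : ipairs V A ~> IAr A"
  and t: "f : x ~> IAr A" "g : x ~> IAr A" "ITgt A o f = ISrc A o g"
 shows "icmp A f g : x ~> IAr A" "r : y ~> x ==> icmp A f g o r = icmp A (f o r) (g o r)"
proof -
 have t': "f : x ~> Dom V (ITgt A)" "g : x ~> Dom V (ISrc A)" using A t by simp_all
 note p = pb_tuple[OF A(1-3) t' t(3)] pb_tuple_Cmp[OF A(1-3) t' t(3)]
 show "icmp A f g : x ~> IAr A" unfolding icmp_def using p(1) A(6) by simp
 show "r : y ~> x ==> icmp A f g o r = icmp A (f o r) (g o r)"
  unfolding icmp_def p(4)[symmetric] using p(1) A(6) by simp
qed

end

section \<open>Internal categories glued from families\<close>

text \<open>An internal category whose objects of objects and of arrows are coproducts is given by structure on the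
 summands.  Composition is stated on generalized elements, because a composable pair from the summands
 \<^term>\<open>(a, b)\<close> and \<^term>\<open>(b, c)\<close> need not be a pair of independent elements.\<close>

locale glued = ext_ccc V U for V :: "('o, 'm) cat" (structure) and U :: "'i itself" +
 fixes S :: "'i set" and X :: "'i \<Rightarrow> 'o" and Y :: "'i \<times> 'i \<Rightarrow> 'o" and s t :: "'i \<Rightarrow> 'i \<Rightarrow> 'm" and i :: "'i \<Rightarrow> 'm"
  and cc :: "'i \<Rightarrow> 'i \<Rightarrow> 'i \<Rightarrow> 'm \<Rightarrow> 'm \<Rightarrow> 'm"
 assumes X_Ob: "a : S ==> X a : Ob V" and Y_Ob: "a : S ==> b : S ==> Y (a, b) : Ob V"
  and s: "a : S ==> b : S ==> s a b : Y (a, b) ~> X a" and t: "a : S ==> b : S ==> t a b : Y (a, b) ~> X b"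
  and i: "a : S ==> i a : X a ~> Y (a, a)" and si: "a : S ==> s a a o i a = Idn V (X a)" and ti: "a : S ==> t a a o i a = Idn V (X a)"
  and cc: "[|a : S; b : S; c : S; f : z ~> Y (a, b); g : z ~> Y (b, c); t a b o f = s b c o g|] ==>
   cc a b c f g : z ~> Y (a, c) \<and> s a c o cc a b c f g = s a b o f \<and> t a c o cc a b c f g = t b c o g"
  and cc_nat: "[|a : S; b : S; c : S; f : z ~> Y (a, b); g : z ~> Y (b, c); t a b o f = s b c o g; r : y ~> z|] ==>
   cc a b c f g o r = cc a b c (f o r) (g o r)"
  and cc_unit: "[|a : S; b : S; f : z ~> Y (a, b)|] ==>
   cc a a b (i a o (s a b o f)) f = f \<and> cc a b b f (i b o (t a b o f)) = f"
  and cc_assoc: "[|a : S; b : S; c : S; d : S; f : z ~> Y (a, b); g : z ~> Y (b, c); h : z ~> Y (c, d);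
   t a b o f = s b c o g; t b c o g = s c d o h|] ==> cc a c d (cc a b c f g) h = cc a b d f (cc b c d g h)"
begin

abbreviation "X0 \<equiv> Coprod V S X"
abbreviation "X1 \<equiv> Coprod V (S \<times> S) Y"
abbreviation "jX \<equiv> coin V S X"
abbreviation "jY \<equiv> coin V (S \<times> S) Y"
definition "src = copair V (S \<times> S) Y X0 (\<lambda>(a, b). jX a o s a b)"
definition "tgt = copair V (S \<times> S) Y X0 (\<lambda>(a, b). jX b o t a b)"
definition "idn = copair V S X X1 (\<lambda>a. jY (a, a) o i a)"

lemma cX: "is_coproduct V S X X0 jX" by (rule coproduct) (simp_all add: X_Ob)
lemma cY: "is_coproduct V (S \<times> S) Y X1 jY" by (rule coproduct) (auto simp: Y_Ob)

lemma st_typing [simp]: "a : S ==> b : S ==> s a b : Ar V" "a : S ==> b : S ==> Dom V (s a b) = Y (a, b)"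
 "a : S ==> b : S ==> Cod V (s a b) = X a" "a : S ==> b : S ==> t a b : Ar V" "a : S ==> b : S ==> Dom V (t a b) = Y (a, b)"
 "a : S ==> b : S ==> Cod V (t a b) = X b" "a : S ==> i a : Ar V" "a : S ==> Dom V (i a) = X a" "a : S ==> Cod V (i a) = Y (a, a)"
 using s t i by simp_all

lemma X_typing [simp]: "X0 : Ob V" "a : S ==> jX a : Ar V" "a : S ==> Dom V (jX a) = X a" "a : S ==> Cod V (jX a) = X0" "a : S ==> X a : Ob V"
 using coproductD[OF cX] by simp_all

lemma Y_typing [simp]: "X1 : Ob V" "a : S ==> b : S ==> jY (a, b) : Ar V" "a : S ==> b : S ==> Dom V (jY (a, b)) = Y (a, b)"
 "a : S ==> b : S ==> Cod V (jY (a, b)) = X1" "a : S ==> b : S ==> Y (a, b) : Ob V"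
 using coproductD[OF cY] by simp_all

lemma str [simp]: "src : Ar V" "Dom V src = X1" "Cod V src = X0" "tgt : Ar V" "Dom V tgt = X1" "Cod V tgt = X0"
 "idn : Ar V" "Dom V idn = X0" "Cod V idn = X1"
 "a : S ==> b : S ==> r : Ar V ==> Cod V r = Y (a, b) ==> src o (jY (a, b) o r) = jX a o (s a b o r)"
 "a : S ==> b : S ==> r : Ar V ==> Cod V r = Y (a, b) ==> tgt o (jY (a, b) o r) = jX b o (t a b o r)"
 "a : S ==> r : Ar V ==> Cod V r = X a ==> idn o (jX a o r) = jY (a, a) o (i a o r)"
proof -
 have Y: "p : S \<times> S ==> Y p : Ob V" for p by (cases p) simp
 have 1: "p : S \<times> S ==> (\<lambda>(a, b). jX a o s a b) p : Y p ~> X0" "p : S \<times> S ==> (\<lambda>(a, b). jX b o t a b) p : Y p ~> X0" for p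
  by (cases p; simp)+
 note S = copair[where I="S \<times> S" and X=Y and y=X0 and f="\<lambda>(a, b). jX a o s a b", OF small_square Y X_typing(1) 1(1), folded src_def]
 note T = copair[where I="S \<times> S" and X=Y and y=X0 and f="\<lambda>(a, b). jX b o t a b", OF small_square Y X_typing(1) 1(2), folded tgt_def]
 have 2: "a : S ==> jY (a, a) o i a : X a ~> X1" for a by simp
 note I = copair[where I=S and X=X and y=X1 and f="\<lambda>a. jY (a, a) o i a", OF small_index X_typing(5) Y_typing(1) 2, folded idn_def]
 show "src : Ar V" "Dom V src = X1" "Cod V src = X0" "tgt : Ar V" "Dom V tgt = X1" "Cod V tgt = X0"
  "idn : Ar V" "Dom V idn = X0" "Cod V idn = X1"
  "a : S ==> b : S ==> r : Ar V ==> Cod V r = Y (a, b) ==> src o (jY (a, b) o r) = jX a o (s a b o r)"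
  "a : S ==> b : S ==> r : Ar V ==> Cod V r = Y (a, b) ==> tgt o (jY (a, b) o r) = jX b o (t a b o r)"
  "a : S ==> r : Ar V ==> Cod V r = X a ==> idn o (jX a o r) = jY (a, a) o (i a o r)"
  using S(1-3) T(1-3) I(1-3) S(5)[where i="(a, b)"] T(5)[where i="(a, b)"] I(5)[where i=a] by simp_all
qed

text \<open>Case analysis on the summand of a generalized arrow, given the summand of its source or target.\<close>

lemma cases_eqI:
 assumes q: "q : y ~> X1" and hk: "h : y ~> w" "k : y ~> w"
  and cs: "!!z r a b g. [|r : z ~> y; a : S; b : S; g : z ~> Y (a, b); q o r = jY (a, b) o g|] ==> h o r = k o r"
 shows "h = k"
proof (rule coproduct_cases_eqI[OF small_square cY q hk])
 fix z r p g assume "p : S \<times> S" "r : z ~> y" "g : z ~> Y p" "q o r = jY p o g"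
 then show "h o r = k o r" using cs by (cases p) blast
qed

lemma X_disjoint: "[|jX a o u = jX b o v; a : S; b : S; u : z ~> X a; v : z ~> X b|] ==> (a = b \<and> u = v) \<or> void z"
 using coproduct_inclusions[OF small_index cX] by blast

lemma Y_disjoint: "[|jY (a, b) o u = jY (a', b') o v; a : S; b : S; a' : S; b' : S; u : z ~> Y (a, b); v : z ~> Y (a', b')|]
  ==> (a = a' \<and> b = b' \<and> u = v) \<or> void z"
 using coproduct_inclusions[OF small_square cY, where i="(a, b)" and k="(a', b')"] by blast

lemma X_mono: "[|jX a o u = jX a o v; a : S; u : z ~> X a; v : z ~> X a|] ==> u = v"
 using coproduct_mono[OF small_index cX] by blast

lemma src_cases_eqI:
 assumes q: "q : y ~> X1" and b: "b : S" "u : y ~> X b" "jX b o u = src o q" and hk: "h : y ~> w" "k : y ~> w"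
  and cs: "!!z r c g. [|r : z ~> y; c : S; g : z ~> Y (b, c); q o r = jY (b, c) o g; u o r = s b c o g|] ==> h o r = k o r"
 shows "h = k"
proof (rule cases_eqI[OF q hk])
 fix z r a c g assume *: "r : z ~> y" "a : S" "c : S" "g : z ~> Y (a, c)" "q o r = jY (a, c) o g"
 have "jX b o (u o r) = src o (q o r)" by (rule Cmp_eq_precomp[OF b(3)]) (use q b * in simp_all)
 also have "\<dots> = jX a o (s a c o g)" unfolding *(5) using * by simp
 finally have "(b = a \<and> u o r = s a c o g) \<or> void z"
  by (rule X_disjoint) (use b * in simp_all)
 then show "h o r = k o r" using cs[of r z c g] * void_eqI[of z "h o r" w] hk by auto
qed

lemma pair_cases_eqI:
 assumes fg: "f : x ~> X1" "g : x ~> X1" "tgt o f = src o g" and hk: "h : x ~> w" "k : x ~> w"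
  and e: "!!z r a b c f' g'. [|r : z ~> x; a : S; b : S; c : S; f' : z ~> Y (a, b); g' : z ~> Y (b, c);
   f o r = jY (a, b) o f'; g o r = jY (b, c) o g'; t a b o f' = s b c o g'|] ==> h o r = k o r"
 shows "h = k"
proof (rule cases_eqI[OF fg(1) hk])
 fix z r a b f' assume r: "r : z ~> x" and S: "a : S" "b : S" and f': "f' : z ~> Y (a, b)" "f o r = jY (a, b) o f'"
 have "src o (g o r) = tgt o (f o r)" by (rule Cmp_eq_precomp[OF fg(3)[symmetric]]) (use fg r in simp_all)
 then have b: "jX b o (t a b o f') = src o (g o r)" unfolding f'(2) using f' S by simp
 show "h o r = k o r"
 proof (rule src_cases_eqI[OF _ S(2) _ b])
  fix y q c g' assume q: "q : y ~> z" and c: "c : S" and g': "g' : y ~> Y (b, c)" "(g o r) o q = jY (b, c) o g'"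
   "(t a b o f') o q = s b c o g'"
  have f2: "f o (r o q) = jY (a, b) o (f' o q)" by (rule Cmp_eq_precomp[OF f'(2)]) (use fg r f' S q in simp_all)
  have "h o (r o q) = k o (r o q)"
   by (rule e[OF _ S c _ g'(1) f2]) (use q r S c f' g' fg in simp_all)
  then show "(h o r) o q = (k o r) o q" using hk r q by simp
 qed (use fg r f' S hk in simp_all)
qed

text \<open>A composable pair lies locally in two summands, whose middle indices agree unless the stage is void; the
 local composites glue.\<close>

lemma composition_exists:
 obtains k where "k : Pb V tgt src ~> X1"
  "!!a b c z f g. [|a : S; b : S; c : S; f : z ~> Y (a, b); g : z ~> Y (b, c); t a b o f = s b c o g|] ==>
   k o pb_tuple V tgt src (jY (a, b) o f) (jY (b, c) o g) = jY (a, c) o cc a b c f g"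
proof -
 let ?y = "Pb V tgt src" and ?p = "pb1 V tgt src" and ?q = "pb2 V tgt src"
 note pb = pb_simps[of tgt src] pb_commute[of tgt src]
 note [simp] = pb(1-7)
 let ?val = "\<lambda>ab bc f g. jY (fst ab, snd bc) o cc (fst ab) (fst bc) (snd bc) f g"
 have pq: "?p : ?y ~> X1" "?q : ?y ~> X1" by simp_all
 obtain k where k: "k : ?y ~> X1"
  "!!z r ab bc f g. [|ab : S \<times> S; bc : S \<times> S; r : z ~> ?y; f : z ~> Y ab; g : z ~> Y bc;
   ?p o r = jY ab o f; ?q o r = jY bc o g; ?val ab bc f g : z ~> X1|] ==> k o r = ?val ab bc f g"
 proof (rule glues_pair[OF small_square small_square cY cY pq Y_typing(1), of ?val])
  fix z r ab bc f g assume ab: "ab : S \<times> S" and bc: "bc : S \<times> S" and r: "r : z ~> ?y"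
   and f: "f : z ~> Y ab" "?p o r = jY ab o f" and g: "g : z ~> Y bc" "?q o r = jY bc o g"
  obtain a b where [simp]: "ab = (a, b)" by (cases ab)
  obtain b' c where [simp]: "bc = (b', c)" by (cases bc)
  have S [simp]: "a : S" "b : S" "b' : S" "c : S" using ab bc by simp_all
  have "tgt o (?p o r) = src o (?q o r)" by (rule Cmp_eq_precomp[OF pb(8)]) (use r in simp_all)
  then have "jX b o (t a b o f) = jX b' o (s b' c o g)" unfolding f(2) g(2) using f g by simp
  then have d: "(b = b' \<and> t a b o f = s b' c o g) \<or> void z"
   by (rule X_disjoint) (use f g in simp_all)
  show "(?val ab bc f g : z ~> X1 \<and> (\<forall>x s. s : x ~> z --> ?val ab bc f g o s = ?val ab bc (f o s) (g o s))) \<or> void z"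
  proof (cases "void z")
   case False
   then have b: "b' = b" and e: "t a b o f = s b c o g" using d by blast+
   have fg: "f : z ~> Y (a, b)" "g : z ~> Y (b, c)" using f g b by simp_all
   note c1 = cc[OF S(1,2,4) fg e]
   have "(jY (a, c) o cc a b c f g) o u = jY (a, c) o cc a b c (f o u) (g o u)" if u: "u : x ~> z" for x u
    using cc_nat[OF S(1,2,4) fg e u] c1 u by simp
   then show ?thesis using c1 b by simp
  qed blast
 qed blast
 show ?thesis
 proof (rule that[OF k(1)])
  fix a b c z f g assume *: "a : S" "b : S" "c : S" "f : z ~> Y (a, b)" "g : z ~> Y (b, c)" "t a b o f = s b c o g"
  note p = pb_tuple[of tgt src "jY (a, b) o f" z "jY (b, c) o g"]
  show "k o pb_tuple V tgt src (jY (a, b) o f) (jY (b, c) o g) = jY (a, c) o cc a b c f g"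
   using k(2)[of "(a, b)" "(b, c)" "pb_tuple V tgt src (jY (a, b) o f) (jY (b, c) o g)" z f g] p * cc[OF *] by simp
 qed
qed

lemma composition_unique:
 assumes kk: "k : Pb V tgt src ~> w" "k' : Pb V tgt src ~> w"
  and e: "!!a b c z f g. [|a : S; b : S; c : S; f : z ~> Y (a, b); g : z ~> Y (b, c); t a b o f = s b c o g|] ==>
   k o pb_tuple V tgt src (jY (a, b) o f) (jY (b, c) o g) = k' o pb_tuple V tgt src (jY (a, b) o f) (jY (b, c) o g)"
 shows "k = k'"
proof -
 let ?y = "Pb V tgt src" and ?p = "pb1 V tgt src" and ?q = "pb2 V tgt src"
 note pb = pb_simps[of tgt src] pb_commute[of tgt src]
 note [simp] = pb(1-7)
 show ?thesis
 proof (rule cases_eqI[of ?p ?y, OF _ kk])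
  fix z r a b f assume r: "r : z ~> ?y" and S: "a : S" "b : S" and f: "f : z ~> Y (a, b)" "?p o r = jY (a, b) o f"
  have "tgt o (?p o r) = src o (?q o r)" by (rule Cmp_eq_precomp[OF pb(8)]) (use r in simp_all)
  then have b: "jX b o (t a b o f) = src o (?q o r)" unfolding f(2) using f S by simp
  show "k o r = k' o r"
  proof (rule src_cases_eqI[OF _ S(2) _ b])
   fix x q c g assume q: "q : x ~> z" and c: "c : S" and g: "g : x ~> Y (b, c)" "(?q o r) o q = jY (b, c) o g"
    "(t a b o f) o q = s b c o g"
   have e': "t a b o (f o q) = s b c o g" using g(3) f S q by simp
   note p = pb_tuple[of tgt src "jY (a, b) o (f o q)" x "jY (b, c) o g"]
   have "r o q = pb_tuple V tgt src (jY (a, b) o (f o q)) (jY (b, c) o g)"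
   proof (rule pb_eqI[of tgt src _ x])
    have "?p o (r o q) = jY (a, b) o (f o q)" by (rule Cmp_eq_precomp[OF f(2)]) (use r q f S in simp_all)
    then show "?p o (r o q) = ?p o pb_tuple V tgt src (jY (a, b) o (f o q)) (jY (b, c) o g)"
     using p f g c S q e' by simp
    show "?q o (r o q) = ?q o pb_tuple V tgt src (jY (a, b) o (f o q)) (jY (b, c) o g)"
     using p f g c S q r e' by simp
    show "pb_tuple V tgt src (jY (a, b) o (f o q)) (jY (b, c) o g) : x ~> ?y" using p f g c S q e' by simp
   qed (use r q in simp_all)
   then show "(k o r) o q = (k' o r) o q" using e[OF S c _ g(1) e'] f q r kk by simp
  qed (use r kk f S in simp_all)
 qed simp
qed

text \<open>Composition is often given by a definite description that prescribes it on one pair for each triple of indices.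
 This determines the map if the pairs are generic, that is, if every composable pair is an instance of one of them.\<close>

lemma composition_generic:
 assumes \<gamma>: "!!a b c. [|a : S; b : S; c : S|] ==> \<gamma> a b c : T a b c ~> Y (a, b)"
  and \<delta>: "!!a b c. [|a : S; b : S; c : S|] ==> \<delta> a b c : T a b c ~> Y (b, c)"
  and e: "!!a b c. [|a : S; b : S; c : S|] ==> t a b o \<gamma> a b c = s b c o \<delta> a b c"
  and g: "!!a b c z f g. [|a : S; b : S; c : S; f : z ~> Y (a, b); g : z ~> Y (b, c); t a b o f = s b c o g|] ==>
   \<exists>r \<in> Hom V z (T a b c). f = \<gamma> a b c o r \<and> g = \<delta> a b c o r"
  and m: "!!a b c. [|a : S; b : S; c : S|] ==> m a b c = cc a b c (\<gamma> a b c) (\<delta> a b c)"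
  and K: "K = (THE k. k : Pb V tgt src ~> X1 \<and> (\<forall>a \<in> S. \<forall>b \<in> S. \<forall>c \<in> S.
    k o pb_tuple V tgt src (jY (a, b) o \<gamma> a b c) (jY (b, c) o \<delta> a b c) = jY (a, c) o m a b c))"
 shows "K : Pb V tgt src ~> X1"
  "[|a : S; b : S; c : S; f : z ~> Y (a, b); g : z ~> Y (b, c); t a b o f = s b c o g|] ==>
   K o pb_tuple V tgt src (jY (a, b) o f) (jY (b, c) o g) = jY (a, c) o cc a b c f g"
proof -
 let ?\<Phi> = "\<lambda>k. k : Pb V tgt src ~> X1 \<and> (\<forall>a \<in> S. \<forall>b \<in> S. \<forall>c \<in> S.
    k o pb_tuple V tgt src (jY (a, b) o \<gamma> a b c) (jY (b, c) o \<delta> a b c) = jY (a, c) o m a b c)"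
 obtain k where k: "k : Pb V tgt src ~> X1"
  "!!a b c z f g. [|a : S; b : S; c : S; f : z ~> Y (a, b); g : z ~> Y (b, c); t a b o f = s b c o g|] ==>
   k o pb_tuple V tgt src (jY (a, b) o f) (jY (b, c) o g) = jY (a, c) o cc a b c f g"
  by (rule composition_exists) blast
 have k': "?\<Phi> k" using k \<gamma> \<delta> e m by simp
 have un: "l = k" if l: "?\<Phi> l" for l
 proof (rule composition_unique[OF conjunct1[OF l] k(1)])
  fix a b c z f g' assume *: "a : S" "b : S" "c : S" "f : z ~> Y (a, b)" "g' : z ~> Y (b, c)" "t a b o f = s b c o g'"
  then obtain r where r: "r : z ~> T a b c" "f = \<gamma> a b c o r" "g' = \<delta> a b c o r" using g by blast
  let ?\<kappa> = "pb_tuple V tgt src (jY (a, b) o \<gamma> a b c) (jY (b, c) o \<delta> a b c)"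
  note \<gamma>\<delta> = \<gamma>[OF *(1-3)] \<delta>[OF *(1-3)] e[OF *(1-3)]
  have \<kappa>: "?\<kappa> : T a b c ~> Pb V tgt src" "pb_tuple V tgt src (jY (a, b) o f) (jY (b, c) o g') = ?\<kappa> o r"
   using pb_tuple[of tgt src "jY (a, b) o \<gamma> a b c" "T a b c" "jY (b, c) o \<delta> a b c"]
    pb_tuple_Cmp[of tgt src "jY (a, b) o \<gamma> a b c" "T a b c" "jY (b, c) o \<delta> a b c" r z] \<gamma>\<delta> r * by simp_all
  have "l o ?\<kappa> = k o ?\<kappa>" using l k' *(1-3) by metis
  then have "l o (?\<kappa> o r) = k o (?\<kappa> o r)"
   by (rule Cmp_eq_precomp) (use l k(1) \<kappa>(1) r in simp_all)
  then show "l o pb_tuple V tgt src (jY (a, b) o f) (jY (b, c) o g') = k o pb_tuple V tgt src (jY (a, b) o f) (jY (b, c) o g')"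
   unfolding \<kappa>(2) .
 qed
 have "K = k" unfolding K by (rule the_equality[of ?\<Phi>, OF k' un])
 then show "K : Pb V tgt src ~> X1"
  "[|a : S; b : S; c : S; f : z ~> Y (a, b); g : z ~> Y (b, c); t a b o f = s b c o g|] ==>
   K o pb_tuple V tgt src (jY (a, b) o f) (jY (b, c) o g) = jY (a, c) o cc a b c f g"
  using k by simp_all
qed

text \<open>All laws are checked after passing to the summands, where they are the assumed ones.\<close>

lemma glued_category:
 assumes A: "IOb A = X0" "IAr A = X1" "ISrc A = src" "ITgt A = tgt" "IIdn A = idn" "ICmp A : Pb V tgt src ~> X1"
  and c: "!!a b c z f g. [|a : S; b : S; c : S; f : z ~> Y (a, b); g : z ~> Y (b, c); t a b o f = s b c o g|] ==>
   ICmp A o pb_tuple V tgt src (jY (a, b) o f) (jY (b, c) o g) = jY (a, c) o cc a b c f g"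
 shows "A : Ob W"
  "[|a : S; b : S; c : S; f : z ~> Y (a, b); g : z ~> Y (b, c); t a b o f = s b c o g|] ==>
   icmp A (jY (a, b) o f) (jY (b, c) o g) = jY (a, c) o cc a b c f g"
proof -
 show ic: "icmp A (jY (a, b) o f) (jY (b, c) o g) = jY (a, c) o cc a b c f g"
  if "a : S" "b : S" "c : S" "f : z ~> Y (a, b)" "g : z ~> Y (b, c)" "t a b o f = s b c o g" for a b c z f g
  using c[OF that] unfolding icmp_def A .
 have pre: "icmp A f g : x ~> X1" "r : y ~> x ==> icmp A f g o r = icmp A (f o r) (g o r)"
  if "f : x ~> X1" "g : x ~> X1" "tgt o f = src o g" for f g x r y
  using icmp_pre[of A f x g] A that by simp_all
 show "A : Ob W"
 proof (rule internal_categoryI, unfold A(1-5))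
  have si': "s a a o (i a o r) = r" "t a a o (i a o r) = r" if "a : S" "r : Ar V" "Cod V r = X a" for a r
   using Cmp_eq_precomp1[OF si[OF that(1)], of r] Cmp_eq_precomp1[OF ti[OF that(1)], of r] that by simp_all
  have idn: "src o idn = Idn V X0 \<and> tgt o idn = Idn V X0"
  proof -
   have I: "idn o jX a = jY (a, a) o i a" if "a : S" for a using str(12)[OF that, of "Idn V (X a)"] that by simp
   have "src o idn = Idn V X0"
    by (rule coproduct_eqI[OF cX, of _ X0]) (use I si in simp_all)
   moreover have "tgt o idn = Idn V X0"
    by (rule coproduct_eqI[OF cX, of _ X0]) (use I ti in simp_all)
   ultimately show ?thesis ..
  qed
  then show "src o idn = Idn V X0" "tgt o idn = Idn V X0" by simp_all
  have id_r: "src o (idn o u) = u" "tgt o (idn o u) = u" if "u : Ar V" "Cod V u = X0" for u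
   using Cmp_eq_precomp1[OF conjunct1[OF idn], of u] Cmp_eq_precomp1[OF conjunct2[OF idn], of u] that by simp_all
  have st: "src o icmp A f g = src o f" "tgt o icmp A f g = tgt o g"
   if fg: "f : x ~> X1" "g : x ~> X1" "tgt o f = src o g" for x f g
  proof -
   note p = pre[OF fg]
   have key: "src o (icmp A f g o r) = src o (f o r)" "tgt o (icmp A f g o r) = tgt o (g o r)"
    if "r : z ~> x" "a : S" "b : S" "c : S" "f' : z ~> Y (a, b)" "g' : z ~> Y (b, c)" "f o r = jY (a, b) o f'"
     "g o r = jY (b, c) o g'" "t a b o f' = s b c o g'" for z r a b c f' g'
    unfolding p(2)[OF that(1)] that(7,8) ic[OF that(2-6,9)] using cc[OF that(2-6,9)] that(1-6) by simp_all
   have t: "src o icmp A f g : x ~> X0" "src o f : x ~> X0" "tgt o icmp A f g : x ~> X0" "tgt o g : x ~> X0"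
    using p(1) fg by simp_all
   show "src o icmp A f g = src o f"
   proof (rule pair_cases_eqI[OF fg t(1,2)])
    fix z r a b c f' g' assume *: "r : z ~> x" "a : S" "b : S" "c : S" "f' : z ~> Y (a, b)" "g' : z ~> Y (b, c)"
     "f o r = jY (a, b) o f'" "g o r = jY (b, c) o g'" "t a b o f' = s b c o g'"
    show "(src o icmp A f g) o r = (src o f) o r" using key(1)[OF *] p(1) *(1) fg(1) by simp
   qed
   show "tgt o icmp A f g = tgt o g"
   proof (rule pair_cases_eqI[OF fg t(3,4)])
    fix z r a b c f' g' assume *: "r : z ~> x" "a : S" "b : S" "c : S" "f' : z ~> Y (a, b)" "g' : z ~> Y (b, c)"
     "f o r = jY (a, b) o f'" "g o r = jY (b, c) o g'" "t a b o f' = s b c o g'"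
    show "(tgt o icmp A f g) o r = (tgt o g) o r" using key(2)[OF *] p(1) *(1) fg(2) by simp
   qed
  qed
  show "icmp A (icmp A f g) h = icmp A f (icmp A g h)"
   if fgh: "f : x ~> X1" "g : x ~> X1" "h : x ~> X1" "tgt o f = src o g" "tgt o g = src o h" for x f g h
  proof -
   note p = pre[OF fgh(1,2,4)] and p' = pre[OF fgh(2,3,5)]
   have st': "tgt o icmp A f g = src o h" "tgt o f = src o icmp A g h"
    using st[OF fgh(1,2,4)] st[OF fgh(2,3,5)] fgh(4,5) by simp_all
   note q = pre[OF p(1) fgh(3) st'(1)] and q' = pre[OF fgh(1) p'(1) st'(2)]
   show ?thesis
   proof (rule pair_cases_eqI[OF fgh(1,2,4) q(1) q'(1)])
    fix z r a b c f' g' assume *: "r : z ~> x" "a : S" "b : S" "c : S" "f' : z ~> Y (a, b)" "g' : z ~> Y (b, c)"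
     "f o r = jY (a, b) o f'" "g o r = jY (b, c) o g'" "t a b o f' = s b c o g'"
    have "tgt o (g o r) = src o (h o r)" by (rule Cmp_eq_precomp[OF fgh(5)]) (use fgh * in simp_all)
    then have e: "jX c o (t b c o g') = src o (h o r)" unfolding *(8) using * by simp
    show "icmp A (icmp A f g) h o r = icmp A f (icmp A g h) o r"
    proof (rule src_cases_eqI[OF _ *(4) _ e])
     fix y v d h' assume v: "v : y ~> z" and d: "d : S" and h': "h' : y ~> Y (c, d)" "(h o r) o v = jY (c, d) o h'" "(t b c o g') o v = s c d o h'"
     have rv: "r o v : y ~> x" using *(1) v by simp
     have f2: "f o (r o v) = jY (a, b) o (f' o v)" by (rule Cmp_eq_precomp[OF *(7)]) (use fgh * v in simp_all)
     have g2: "g o (r o v) = jY (b, c) o (g' o v)" by (rule Cmp_eq_precomp[OF *(8)]) (use fgh * v in simp_all)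
     have h2: "h o (r o v) = jY (c, d) o h'" using h'(2) fgh(3) *(1) v by simp
     have fv: "f' o v : y ~> Y (a, b)" "g' o v : y ~> Y (b, c)" using * v by simp_all
     have e1: "t a b o (f' o v) = s b c o (g' o v)" by (rule Cmp_eq_precomp[OF *(9)]) (use * v in simp_all)
     have e2: "t b c o (g' o v) = s c d o h'" using h'(3) * v by simp
     note c1 = cc[OF *(2-4) fv e1] and c2 = cc[OF *(3,4) d fv(2) h'(1) e2]
     have e3: "t a c o cc a b c (f' o v) (g' o v) = s c d o h'" "t a b o (f' o v) = s b d o cc b c d (g' o v) h'"
      using c1 c2 e1 e2 by simp_all
     have "icmp A (icmp A f g) h o (r o v) = icmp A f (icmp A g h) o (r o v)"
      unfolding q(2)[OF rv] q'(2)[OF rv] p(2)[OF rv] p'(2)[OF rv] f2 g2 h2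
       ic[OF *(2-4) fv e1] ic[OF *(3,4) d fv(2) h'(1) e2]
       ic[OF *(2,4) d conjunct1[OF c1] h'(1) e3(1)] ic[OF *(2,3) d fv(1) conjunct1[OF c2] e3(2)]
       cc_assoc[OF *(2-4) d fv h'(1) e1 e2] ..
     then show "(icmp A (icmp A f g) h o r) o v = (icmp A f (icmp A g h) o r) o v"
      using q(1) q'(1) *(1) v by simp
    qed (use fgh q(1) q'(1) * in simp_all)
   qed
  qed
  show "src o icmp A f g = src o f \<and> tgt o icmp A f g = tgt o g"
   if "f : x ~> X1" "g : x ~> X1" "tgt o f = src o g" for x f g using st[OF that] ..
  fix x f
  assume f: "f : x ~> X1"
  have ft: "idn o (src o f) : x ~> X1" "idn o (tgt o f) : x ~> X1" "tgt o (idn o (src o f)) = src o f" "tgt o f = src o (idn o (tgt o f))"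
   using f id_r by simp_all
  note p1 = pre[OF ft(1) f ft(3)] and p2 = pre[OF f ft(2,4)]
  have u: "icmp A (idn o (src o f)) f o r = f o r \<and> icmp A f (idn o (tgt o f)) o r = f o r"
   if "r : z ~> x" "a : S" "b : S" "g : z ~> Y (a, b)" "f o r = jY (a, b) o g" for z r a b g
   using p1(2)[OF that(1)] p2(2)[OF that(1)] cc_unit[OF that(2-4)] ic[OF that(2,2,3), of "i a o (s a b o g)" z g]
    ic[OF that(2,3,3), of g z "i b o (t a b o g)"] that f si'[of a "s a b o g"] si'[of b "t a b o g"] by simp
  have "icmp A (idn o (src o f)) f = f" by (rule cases_eqI[OF f p1(1) f]) (use u in blast)
  moreover have "icmp A f (idn o (tgt o f)) = f" by (rule cases_eqI[OF f p2(1) f]) (use u in blast)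
  ultimately show "icmp A (idn o (src o f)) f = f \<and> icmp A f (idn o (tgt o f)) = f" ..
 qed (use A in simp_all)
qed

end

section \<open>The internal category of elements\<close>

lemma (in ccc) eval_VId [simp]:
 "[|z : Ar V; Cod V z = a; u : Ar V; Cod V u = terminal V; Dom V u = Dom V z|] ==> eval_ar V a a o <|VId (vself V) a o u, z|> = z"
 "[|z : Ar V; Cod V z = a; Dom V z = terminal V|] ==> eval_ar V a a o <|VId (vself V) a, z|> = z"
 by (metis eval_vself(2) Cod_Ob) (metis eval_vself(3) Cod_Ob)

locale vext = ext_ccc V U + vcat V C
 for V :: "('o, 'm) cat" (structure) and U :: "'i itself" and C :: "('i, 'o, 'm) vcat"
begin

abbreviation "S \<equiv> VOb C"
abbreviation "H \<equiv> VHom C"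
abbreviation "IntC \<equiv> internalization V C"
abbreviation "psh \<equiv> vfunctor V (vop V C) (vself V)"
abbreviation "psh_nat \<equiv> vnat V (vop V C) (vself V)"
abbreviation "psh_wedge \<equiv> is_wedge V (vop V C) (vself V)"
abbreviation "psh_End \<equiv> End V (vop V C) (vself V)"
abbreviation "psh_pr \<equiv> end_pr V (vop V C) (vself V)"
abbreviation "psh_lift \<equiv> end_lift V (vop V C) (vself V)"
abbreviation "emap \<equiv> elements_map V C"

sublocale Int: glued V U S "\<lambda>a. terminal V" "\<lambda>(a, b). H a b" "\<lambda>a b. bang V (H a b)" "\<lambda>a b. bang V (H a b)" "VId C"
 "\<lambda>a b c f g. VCmp C a b c o <|f, g|>"
 by unfold_locales simp_all

lemma IntC_simps [simp]: "IOb IntC = Int.X0" "IAr IntC = Int.X1" "ISrc IntC = Int.src" "ITgt IntC = Int.tgt"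
 "IIdn IntC = Int.idn"
 by (simp_all add: internalization_def Let_def Int.src_def Int.tgt_def Int.idn_def)

lemma IntC:
 shows IntC_Ob [simp]: "IntC : Ob W"
  and IntC_icmp: "[|a : S; b : S; c : S; f : z ~> H a b; g : z ~> H b c|] ==>
   icmp IntC (Int.jY (a, b) o f) (Int.jY (b, c) o g) = Int.jY (a, c) o (VCmp C a b c o <|f, g|>)"
proof -
 have K: "ICmp IntC = (THE k. k : Pb V Int.tgt Int.src ~> Int.X1 \<and> (\<forall>a \<in> S. \<forall>b \<in> S. \<forall>c \<in> S.
    k o pb_tuple V Int.tgt Int.src (Int.jY (a, b) o pr1 V (H a b) (H b c)) (Int.jY (b, c) o pr2 V (H a b) (H b c)) =
    Int.jY (a, c) o VCmp C a b c))"
  by (simp add: internalization_def Let_def Int.src_def Int.tgt_def)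
 have bb: "bang V (H a b) o f = bang V (H b c) o g"
  if "a : S" "b : S" "c : S" "f : z ~> H a b" "g : z ~> H b c" for a b c z f g using that by simp
 have *: "ICmp IntC : Pb V Int.tgt Int.src ~> Int.X1"
  "[|a : S; b : S; c : S; f : z ~> H a b; g : z ~> H b c|] ==>
   ICmp IntC o pb_tuple V Int.tgt Int.src (Int.jY (a, b) o f) (Int.jY (b, c) o g) = Int.jY (a, c) o (VCmp C a b c o <|f, g|>)"
  for a b c z f g
 proof -
  note G = Int.composition_generic[where \<gamma> = "\<lambda>a b c. pr1 V (H a b) (H b c)" and \<delta> = "\<lambda>a b c. pr2 V (H a b) (H b c)"
    and T = "\<lambda>a b c. Prod V (H a b) (H b c)" and m = "VCmp C" and K = "ICmp IntC", OF _ _ _ _ _ K]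
  have ex: "\<exists>r \<in> Hom V z (Prod V (H a b) (H b c)). f = pr1 V (H a b) (H b c) o r \<and> g = pr2 V (H a b) (H b c) o r"
   if "a : S" "b : S" "c : S" "f : z ~> H a b" "g : z ~> H b c" for a b c z f g
   by (rule bexI[of _ "<|f, g|>"]) (use that in simp_all)
  show "ICmp IntC : Pb V Int.tgt Int.src ~> Int.X1" by (rule G(1)) (use ex in simp_all)
  assume t: "a : S" "b : S" "c : S" "f : z ~> H a b" "g : z ~> H b c"
  show "ICmp IntC o pb_tuple V Int.tgt Int.src (Int.jY (a, b) o f) (Int.jY (b, c) o g) = Int.jY (a, c) o (VCmp C a b c o <|f, g|>)"
   by (rule G(2)[OF _ _ _ _ _ t(1-3), of f z g]) (use ex t in simp_all)
 qed
 have c: "ICmp IntC o pb_tuple V Int.tgt Int.src (Int.jY (a, b) o f) (Int.jY (b, c) o g) = Int.jY (a, c) o (VCmp C a b c o <|f, g|>)"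
  if "a : S" "b : S" "c : S" "f : z ~> (\<lambda>(a, b). H a b) (a, b)" "g : z ~> (\<lambda>(a, b). H a b) (b, c)"
   "bang V (H a b) o f = bang V (H b c) o g" for a b c z f g
  using *(2) that by simp
 note G = Int.glued_category[OF IntC_simps *(1) c]
 show "IntC : Ob W" by (rule G(1))
 show "icmp IntC (Int.jY (a, b) o f) (Int.jY (b, c) o g) = Int.jY (a, c) o (VCmp C a b c o <|f, g|>)"
  if "a : S" "b : S" "c : S" "f : z ~> H a b" "g : z ~> H b c"
  by (rule G(2)) (use that in simp_all)
qed

text \<open>A \<open>V\<close>-functor into \<open>V\<close> amounts to an action on generalized elements.\<close>

lemma psh_act:
 assumes F: "psh F"
 shows "a : S ==> VFOb F a : Ob V"
  "[|a : S; b : S|] ==> psh_act V C F a b : Prod V (H a b) (VFOb F b) ~> VFOb F a"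
  "[|a : S; b : S; f : z ~> H a b; x : z ~> VFOb F b|] ==>
    psh_act V C F a b o <|f, x|> = eval_ar V (VFOb F b) (VFOb F a) o <|VFHom F b a o f, x|>"
  "[|a : S; u : z ~> terminal V; x : z ~> VFOb F a|] ==> psh_act V C F a a o <|VId C a o u, x|> = x"
  "[|a : S; b : S; c : S; f : z ~> H a b; g : z ~> H b c; x : z ~> VFOb F c|] ==>
    psh_act V C F a c o <|VCmp C a b c o <|f, g|>, x|> = psh_act V C F a b o <|f, psh_act V C F b c o <|g, x|>|>"
proof -
 note FD = vfunctorD(3-6)[OF F, simplified]
 show 0: "a : S ==> VFOb F a : Ob V" for a by (rule FD)
 note [simp] = FD
 show 1: "[|a : S; b : S|] ==> psh_act V C F a b : Prod V (H a b) (VFOb F b) ~> VFOb F a" for a b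
  by (simp add: psh_act_def)
 show 2: "[|a : S; b : S; f : z ~> H a b; x : z ~> VFOb F b|] ==>
    psh_act V C F a b o <|f, x|> = eval_ar V (VFOb F b) (VFOb F a) o <|VFHom F b a o f, x|>" for a b f x z
  by (simp add: psh_act_def)
 show "[|a : S; u : z ~> terminal V; x : z ~> VFOb F a|] ==> psh_act V C F a a o <|VId C a o u, x|> = x"
  using 2[of a a "VId C a o u" z x] vfunctor_VId(2)[OF F, of a u] by simp
 assume t: "a : S" "b : S" "c : S" "f : z ~> H a b" "g : z ~> H b c" "x : z ~> VFOb F c"
 have z: "z : Ob V" using t(4) by (rule Hom_Ob)
 have A: "psh_act V C F b c o <|g, x|> : z ~> VFOb F b" using 1[of b c] t by simp
 show "psh_act V C F a c o <|VCmp C a b c o <|f, g|>, x|> = psh_act V C F a b o <|f, psh_act V C F b c o <|g, x|>|>"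
  unfolding 2[OF t(1,2,4) A] unfolding 2[OF t(2,3,5,6)]
  using 2[of a c "VCmp C a b c o <|f, g|>" z x] vfunctor_VCmp[OF F, of c b a g f] t by simp
qed

text \<open>The converse: the hom-maps are the transposes of the action.\<close>

lemma presheafI:
 assumes Z: "!!a. a : S ==> Z a : Ob V"
  and act: "!!a b. [|a : S; b : S|] ==> act a b : Prod V (H a b) (Z b) ~> Z a"
  and unit: "!!a z u x. [|a : S; u : z ~> terminal V; x : z ~> Z a|] ==> act a a o <|VId C a o u, x|> = x"
  and cmp: "!!a b c z f g x. [|a : S; b : S; c : S; f : z ~> H a b; g : z ~> H b c; x : z ~> Z c|] ==>
    act a c o <|VCmp C a b c o <|f, g|>, x|> = act a b o <|f, act b c o <|g, x|>|>"
 obtains F where "psh F" "!!a. a : S ==> VFOb F a = Z a"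
  "!!a b. [|a : S; b : S|] ==> psh_act V C F a b = act a b"
proof -
 let ?F = "\<lparr>VFOb = restrict Z S, VFHom = (\<lambda>b a. if a : S \<and> b : S then transp V (H a b) (Z b) (Z a) (act a b) else undefined)\<rparr>"
 have at: "act a b : Ar V" "Dom V (act a b) = Prod V (H a b) (Z b)" "Cod V (act a b) = Z a" if "a : S" "b : S" for a b
  using act[OF that] by simp_all
 note [simp] = Z at
 have "psh ?F"
 proof (rule vfunctorI[OF vop_vcategory vself_vcategory])
  fix a b c x f g assume t: "a : VOb (vop V C)" "b : VOb (vop V C)" "c : VOb (vop V C)"
   "f : x ~> VHom (vop V C) a b" "g : x ~> VHom (vop V C) b c"
  have x: "x : Ob V" using t(4) by (rule Hom_Ob)
  show "VFHom ?F a c o (VCmp (vop V C) a b c o <|f, g|>) =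
     VCmp (vself V) (VFOb ?F a) (VFOb ?F b) (VFOb ?F c) o <|VFHom ?F a b o f, VFHom ?F b c o g|>"
   by (rule exp_eqI[of _ x "Z a" "Z c"]) (use t x cmp[of c b a "g o pr1 V x (Z a)" "Prod V x (Z a)" "f o pr1 V x (Z a)" "pr2 V x (Z a)"] in simp_all)
 next
  fix a assume a: "a : VOb (vop V C)"
  show "VFHom ?F a a o VId (vop V C) a = VId (vself V) (VFOb ?F a)"
   by (rule exp_eqI[of _ "terminal V" "Z a" "Z a"])
    (use a unit[of a "pr1 V (terminal V) (Z a)" "Prod V (terminal V) (Z a)" "pr2 V (terminal V) (Z a)"] in simp_all)
 qed auto
 then show ?thesis
  by (rule that) (simp_all add: psh_act_def)
qed

end

locale presheaf = vext V U C
 for V :: "('o, 'm) cat" (structure) and U :: "'i itself" and C :: "('i, 'o, 'm) vcat" +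
 fixes F assumes F: "psh F"
begin

abbreviation "FO \<equiv> VFOb F"
abbreviation "act \<equiv> psh_act V C F"
abbreviation "El \<equiv> elements V C F"
abbreviation "\<pi> \<equiv> elements_proj V C F"

lemma act_simps [simp]: "a : S ==> FO a : Ob V" "a : S ==> b : S ==> act a b : Ar V"
 "a : S ==> b : S ==> Dom V (act a b) = Prod V (H a b) (FO b)" "a : S ==> b : S ==> Cod V (act a b) = FO a"
 "[|a : S; u : Ar V; x : Ar V; Dom V u = Dom V x; Cod V u = terminal V; Cod V x = FO a|] ==> act a a o <|VId C a o u, x|> = x"
 "[|a : S; b : S; c : S; f : Ar V; g : Ar V; x : Ar V; Dom V f = Dom V g; Dom V g = Dom V x; Cod V f = H a b; Cod V g = H b c; Cod V x = FO c|] ==>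
   act a c o <|VCmp C a b c o <|f, g|>, x|> = act a b o <|f, act b c o <|g, x|>|>"
 using psh_act(1)[OF F] psh_act(2)[OF F, of a b] psh_act(4)[OF F, of a u "Dom V x" x] psh_act(5)[OF F, of a b c f "Dom V x" g x] by simp_all

sublocale E: glued V U S FO "\<lambda>(a, b). Prod V (H a b) (FO b)" act "\<lambda>a b. pr2 V (H a b) (FO b)"
 "\<lambda>a. <|VId C a o bang V (FO a), Idn V (FO a)|>"
 "\<lambda>a b c f g. <|VCmp C a b c o <|pr1 V (H a b) (FO b) o f, pr1 V (H b c) (FO c) o g|>, pr2 V (H b c) (FO c) o g|>"
proof (unfold_locales, goal_cases)
 case (8 a b c f z g)
 then have e: "act b c o g = pr2 V (H a b) (FO b) o f" by simp
 show ?case using 8(1-5) e by simp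
next
 case (10 a b f z)
 then show ?case using Hom_Ob(1)[OF 10(3)] by simp
qed simp_all

lemma El_simps [simp]: "IOb El = E.X0" "IAr El = E.X1" "ISrc El = E.src" "ITgt El = E.tgt" "IIdn El = E.idn"
 by (simp_all add: elements_def Let_def E.src_def E.tgt_def E.idn_def)

text \<open>In a composable pair of arrows the first one is determined by the second and by its image in
 \<^term>\<open>H a b\<close>, because its target is the source of the second.  So composable pairs correspond to
 two arrows of \<^term>\<open>C\<close> and an element at the last object.\<close>

lemma El:
 shows El_Ob [simp]: "El : Ob W"
  and El_icmp: "[|a : S; b : S; c : S; f : z ~> H a b; g : z ~> H b c; x : z ~> FO c|] ==>
   icmp El (E.jY (a, b) o <|f, act b c o <|g, x|>|>) (E.jY (b, c) o <|g, x|>) = E.jY (a, c) o <|VCmp C a b c o <|f, g|>, x|>"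
proof -
 let ?T = "\<lambda>a b c. Prod V (Prod V (H a b) (H b c)) (FO c)"
 let ?f = "\<lambda>a b c. pr1 V (H a b) (H b c) o pr1 V (Prod V (H a b) (H b c)) (FO c)"
 let ?g = "\<lambda>a b c. pr2 V (H a b) (H b c) o pr1 V (Prod V (H a b) (H b c)) (FO c)"
 let ?x = "\<lambda>a b c. pr2 V (Prod V (H a b) (H b c)) (FO c)"
 let ?cc = "\<lambda>a b c f g. <|VCmp C a b c o <|pr1 V (H a b) (FO b) o f, pr1 V (H b c) (FO c) o g|>, pr2 V (H b c) (FO c) o g|>"
 have K: "ICmp El = (THE k. k : Pb V E.tgt E.src ~> E.X1 \<and> (\<forall>a \<in> S. \<forall>b \<in> S. \<forall>c \<in> S.
    k o pb_tuple V E.tgt E.src (E.jY (a, b) o <|?f a b c, act b c o <|?g a b c, ?x a b c|>|>) (E.jY (b, c) o <|?g a b c, ?x a b c|>) =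
    E.jY (a, c) o cross V (VCmp C a b c) (Idn V (FO c))))"
  unfolding E.src_def E.tgt_def by (simp only: elements_def Let_def icat.select_convs)
 note G = E.composition_generic[where \<gamma> = "\<lambda>a b c. <|?f a b c, act b c o <|?g a b c, ?x a b c|>|>" and \<delta> = "\<lambda>a b c. <|?g a b c, ?x a b c|>"
   and T = ?T and m = "\<lambda>a b c. cross V (VCmp C a b c) (Idn V (FO c))" and K = "ICmp El", OF _ _ _ _ _ K]
 have ex: "\<exists>r \<in> Hom V z (?T a b c). f = <|?f a b c, act b c o <|?g a b c, ?x a b c|>|> o r \<and> g = <|?g a b c, ?x a b c|> o r"
  if t: "a : S" "b : S" "c : S" "f : z ~> Prod V (H a b) (FO b)" "g : z ~> Prod V (H b c) (FO c)"
   "pr2 V (H a b) (FO b) o f = act b c o g" for a b c z f g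
 proof (rule bexI)
  let ?r = "<|<|pr1 V (H a b) (FO b) o f, pr1 V (H b c) (FO c) o g|>, pr2 V (H b c) (FO c) o g|>"
  show "?r : z ~> ?T a b c" using t by simp
  have "f = <|pr1 V (H a b) (FO b) o f, act b c o g|>" unfolding t(6)[symmetric] using t(1-5) by simp
  then show "f = <|?f a b c, act b c o <|?g a b c, ?x a b c|>|> o ?r \<and> g = <|?g a b c, ?x a b c|> o ?r"
   using t(1-5) by simp
 qed
 have 1: "ICmp El : Pb V E.tgt E.src ~> E.X1"
  by (rule G(1)) (use ex in simp_all)
 have 2: "ICmp El o pb_tuple V E.tgt E.src (E.jY (a, b) o f) (E.jY (b, c) o g) = E.jY (a, c) o ?cc a b c f g"
  if "a : S" "b : S" "c : S" "f : z ~> (\<lambda>(a, b). Prod V (H a b) (FO b)) (a, b)"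
   "g : z ~> (\<lambda>(a, b). Prod V (H a b) (FO b)) (b, c)"
   "pr2 V (H a b) (FO b) o f = act b c o g" for a b c z f g
  by (rule G(2)[OF _ _ _ _ _ that(1-5)]) (use ex that in simp_all)
 note G = E.glued_category[OF El_simps 1 2]
 show "El : Ob W" by (rule G(1))
 show "icmp El (E.jY (a, b) o <|f, act b c o <|g, x|>|>) (E.jY (b, c) o <|g, x|>) = E.jY (a, c) o <|VCmp C a b c o <|f, g|>, x|>"
  if t: "a : S" "b : S" "c : S" "f : z ~> H a b" "g : z ~> H b c" "x : z ~> FO c"
 proof -
  have "icmp El (E.jY (a, b) o <|f, act b c o <|g, x|>|>) (E.jY (b, c) o <|g, x|>) =
    E.jY (a, c) o ?cc a b c <|f, act b c o <|g, x|>|> <|g, x|>"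
   by (rule G(2)) (use t in simp_all)
  then show ?thesis using t by simp
 qed
qed

lemma \<pi>_simps [simp]: "I0 \<pi> : Ar V" "Dom V (I0 \<pi>) = E.X0" "Cod V (I0 \<pi>) = Int.X0"
 "I1 \<pi> : Ar V" "Dom V (I1 \<pi>) = E.X1" "Cod V (I1 \<pi>) = Int.X1"
 "[|a : S; x : Ar V; Cod V x = FO a|] ==> I0 \<pi> o (E.jX a o x) = Int.jX a o bang V (Dom V x)"
 "[|a : S; b : S; f : Ar V; Cod V f = Prod V (H a b) (FO b)|] ==> I1 \<pi> o (E.jY (a, b) o f) = Int.jY (a, b) o (pr1 V (H a b) (FO b) o f)"
proof -
 have p: "I0 \<pi> = coprod_map V S FO (\<lambda>a. terminal V) (\<lambda>a. bang V (FO a))"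
  "I1 \<pi> = coprod_map V (S \<times> S) (\<lambda>(a, b). Prod V (H a b) (FO b)) (\<lambda>(a, b). H a b) (\<lambda>(a, b). pr1 V (H a b) (FO b))"
  by (simp_all add: elements_proj_def)
 have m: "bang V (FO a) : FO a ~> terminal V" if "a : S" for a using that by simp
 have n: "(case q of (a, b) \<Rightarrow> H a b) : Ob V" "(case q of (a, b) \<Rightarrow> pr1 V (H a b) (FO b)) : (case q of (a, b) \<Rightarrow> Prod V (H a b) (FO b)) ~> (case q of (a, b) \<Rightarrow> H a b)"
  if "q : S \<times> S" for q using that by (cases q; simp)+
 note M = coprod_map[OF small_index terminal_Ob m] and N = coprod_map[OF small_square n]
 show "I0 \<pi> : Ar V" "Dom V (I0 \<pi>) = E.X0" "Cod V (I0 \<pi>) = Int.X0" "I1 \<pi> : Ar V" "Dom V (I1 \<pi>) = E.X1" "Cod V (I1 \<pi>) = Int.X1"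
  unfolding p by (rule M(1-3) N(1-3); assumption)+
 show "[|a : S; x : Ar V; Cod V x = FO a|] ==> I0 \<pi> o (E.jX a o x) = Int.jX a o bang V (Dom V x)"
  unfolding p using M(5)[where i=a and r=x] by simp
 show "[|a : S; b : S; f : Ar V; Cod V f = Prod V (H a b) (FO b)|] ==> I1 \<pi> o (E.jY (a, b) o f) = Int.jY (a, b) o (pr1 V (H a b) (FO b) o f)"
  unfolding p using N(5)[where i="(a, b)" and r=f] by simp
qed

lemma \<pi>_typing: "\<pi> : Hom W El IntC"
proof -
 have st: "Int.src o (I1 \<pi> o f) = I0 \<pi> o (E.src o f)" "Int.tgt o (I1 \<pi> o f) = I0 \<pi> o (E.tgt o f)" if f: "f : x ~> IAr El" for x f
 proof -
  have e: "Int.src o (I1 \<pi> o (f o r)) = I0 \<pi> o (E.src o (f o r)) \<and> Int.tgt o (I1 \<pi> o (f o r)) = I0 \<pi> o (E.tgt o (f o r))"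
   if *: "r : z ~> x" "a : S" "b : S" "g : z ~> (case (a, b) of (a, b) \<Rightarrow> Prod V (H a b) (FO b))" "f o r = E.jY (a, b) o g"
   for z r a b g
   unfolding *(5) using *(1-4) by simp
  show "Int.src o (I1 \<pi> o f) = I0 \<pi> o (E.src o f)"
   by (rule E.cases_eqI[of f x]) (use f e in simp_all)
  show "Int.tgt o (I1 \<pi> o f) = I0 \<pi> o (E.tgt o f)"
   by (rule E.cases_eqI[of f x]) (use f e in simp_all)
 qed
 have "mkf El IntC (I0 \<pi>) (I1 \<pi>) : Hom W El IntC"
 proof (rule ifunI)
  fix x f assume f: "f : x ~> IAr El"
  then show "ISrc IntC o (I1 \<pi> o f) = I0 \<pi> o (ISrc El o f) \<and> ITgt IntC o (I1 \<pi> o f) = I0 \<pi> o (ITgt El o f)"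
   using st[OF f] by simp
 next
  fix x a assume a: "a : x ~> IOb El"
  show "I1 \<pi> o (IIdn El o a) = IIdn IntC o (I0 \<pi> o a)"
  proof (rule coproduct_cases_eqI[OF small_index E.cX, of a x])
   fix z r b g assume *: "b : S" "r : z ~> x" "g : z ~> FO b" "a o r = E.jX b o g"
   have "I1 \<pi> o (E.idn o (a o r)) = Int.idn o (I0 \<pi> o (a o r))" unfolding *(4) using *(1-3) Hom_Ob(1)[OF *(3)] by simp
   then show "(I1 \<pi> o (IIdn El o a)) o r = (IIdn IntC o (I0 \<pi> o a)) o r" using *(2) a by simp
  qed (use a in simp_all)
 next
  fix x f g assume fg: "f : x ~> IAr El" "g : x ~> IAr El" "ITgt El o f = ISrc El o g"
  show "I1 \<pi> o icmp El f g = icmp IntC (I1 \<pi> o f) (I1 \<pi> o g)"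
  proof (rule E.pair_cases_eqI)
   show "f : x ~> E.X1" "g : x ~> E.X1" "E.tgt o f = E.src o g" using fg by simp_all
   have st: "Int.tgt o (I1 \<pi> o f) = Int.src o (I1 \<pi> o g)"
    using st(2)[OF fg(1)] st(1)[OF fg(2)] fg(3) by simp
   show "I1 \<pi> o icmp El f g : x ~> Int.X1" "icmp IntC (I1 \<pi> o f) (I1 \<pi> o g) : x ~> Int.X1"
    using fg st by simp_all
   fix z r a b c f' g' assume *: "r : z ~> x" "a : S" "b : S" "c : S"
    "f' : z ~> (case (a, b) of (a, b) \<Rightarrow> Prod V (H a b) (FO b))" "g' : z ~> (case (b, c) of (a, b) \<Rightarrow> Prod V (H a b) (FO b))"
    "f o r = E.jY (a, b) o f'" "g o r = E.jY (b, c) o g'" "pr2 V (H a b) (FO b) o f' = act b c o g'"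
   let ?f = "pr1 V (H a b) (FO b) o f'" and ?g = "pr1 V (H b c) (FO c) o g'" and ?x = "pr2 V (H b c) (FO c) o g'"
   have p: "?f : z ~> H a b" "?g : z ~> H b c" "?x : z ~> FO c" using *(2-6) by simp_all
   have g': "g' = <|?g, ?x|>" using *(3,4,6) by simp
   have f': "f' = <|?f, act b c o <|?g, ?x|>|>" unfolding g'[symmetric] *(9)[symmetric] using *(2,3,5) by simp
   have E1: "f o r = E.jY (a, b) o <|?f, act b c o <|?g, ?x|>|>" "g o r = E.jY (b, c) o <|?g, ?x|>" using *(7,8) f' g' by simp_all
   have E2: "I1 \<pi> o (f o r) = Int.jY (a, b) o ?f" "I1 \<pi> o (g o r) = Int.jY (b, c) o ?g"
    unfolding *(7,8) using *(2-6) by simp_all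
   have "I1 \<pi> o icmp El (f o r) (g o r) = icmp IntC (I1 \<pi> o (f o r)) (I1 \<pi> o (g o r))"
    unfolding E2 IntC_icmp[OF *(2-4) p(1,2)] unfolding E1 El_icmp[OF *(2-4) p] using *(2-4) p by simp
   then show "(I1 \<pi> o icmp El f g) o r = icmp IntC (I1 \<pi> o f) (I1 \<pi> o g) o r"
    using *(1) fg st by simp
  qed
 qed simp_all
 then show ?thesis by (simp add: elements_proj_def)
qed

text \<open>An arrow of the category of elements is a pair of an arrow of \<^term>\<open>C\<close> and an element at its target, that
 is, an arrow of \<^term>\<open>IntC\<close> and an object over its target.\<close>

lemma \<pi>_discrete: "discrete_fibration V \<pi>"
proof (rule dfibI[OF \<pi>_typing])
 fix y z \<phi> assume z: "z : y ~> IOb El" and \<phi>: "\<phi> : y ~> IAr IntC" and e: "I0 \<pi> o z = ITgt IntC o \<phi>"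
 let ?val = "\<lambda>b ab x f. E.jY ab o <|f, x|>"
 have val: "b = snd ab \<or> void v"
  if *: "b : S" "ab : S \<times> S" "r : v ~> y" "x : v ~> FO b" "f : v ~> (case ab of (a, b) \<Rightarrow> H a b)"
   "z o r = E.jX b o x" "\<phi> o r = Int.jY ab o f" for b ab r v x f
 proof -
  obtain a b' where ab: "ab = (a, b')" "a : S" "b' : S" using *(2) by blast
  have "I0 \<pi> o (z o r) = Int.tgt o (\<phi> o r)" by (rule Cmp_eq_precomp) (use e z \<phi> *(3) in simp_all)
  then have "Int.jX b o bang V v = Int.jX b' o bang V v" unfolding *(6,7) ab(1) using *(1,4,5) ab by simp
  then show ?thesis using Int.X_disjoint[of b "bang V v" b' "bang V v" v] *(1,4) ab Hom_Ob[OF *(4)] by simp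
 qed
 obtain m where m: "m : y ~> E.X1" "!!v r b ab x f. [|b : S; ab : S \<times> S; r : v ~> y; x : v ~> FO b;
   f : v ~> (case ab of (a, b) \<Rightarrow> H a b); z o r = E.jX b o x; \<phi> o r = Int.jY ab o f; ?val b ab x f : v ~> E.X1|] ==> m o r = ?val b ab x f"
 proof (rule glues_pair[OF small_index small_square E.cX Int.cY, of z y \<phi> E.X1 ?val])
  show "z : y ~> E.X0" "\<phi> : y ~> Int.X1" "E.X1 : Ob V" using z \<phi> by simp_all
  fix v r b ab x f assume *: "b : S" "ab : S \<times> S" "r : v ~> y" "x : v ~> FO b" "f : v ~> (case ab of (a, b) \<Rightarrow> H a b)"
   "z o r = E.jX b o x" "\<phi> o r = Int.jY ab o f"
  from val[OF *] *(1-5) show "(?val b ab x f : v ~> E.X1 \<and> (\<forall>w s. s : w ~> v --> ?val b ab x f o s = ?val b ab (x o s) (f o s))) \<or> void v"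
   by (cases ab) auto
 qed blast
 have key: "E.tgt o (m o r) = z o r \<and> I1 \<pi> o (m o r) = \<phi> o r"
  if *: "r : v ~> y" "b : S" "x : v ~> FO b" "a : S" "b' : S" "f : v ~> H a b'" "z o r = E.jX b o x" "\<phi> o r = Int.jY (a, b') o f"
  for v r b x a b' f
 proof (cases "void v")
  case True
  have "E.tgt o (m o r) : v ~> E.X0" "z o r : v ~> E.X0" "I1 \<pi> o (m o r) : v ~> Int.X1" "\<phi> o r : v ~> Int.X1"
   using m(1) z \<phi> *(1) by simp_all
  then show ?thesis using void_eqI[OF True] by blast
 next
  case False
  then have b: "b' = b" using val[of b "(a, b')" r v x f] * by auto
  have "m o r = E.jY (a, b) o <|f, x|>" using m(2)[of b "(a, b')" r v x f] * b by simp
  then show ?thesis unfolding *(7,8) b using *(2-6) b by simp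
 qed
 have "E.tgt o m = z \<and> I1 \<pi> o m = \<phi>"
 proof
  have t: "E.tgt o m : y ~> E.X0" "z : y ~> E.X0" "I1 \<pi> o m : y ~> Int.X1" "\<phi> : y ~> Int.X1" using m(1) z \<phi> by simp_all
  have loc: "(E.tgt o m) o r = z o r \<and> (I1 \<pi> o m) o r = \<phi> o r" if r: "r : v ~> y" and b: "b : S" "x : v ~> FO b" "z o r = E.jX b o x" for r v b x
  proof -
   have k: "((E.tgt o m) o r) o u = (z o r) o u \<and> ((I1 \<pi> o m) o r) o u = (\<phi> o r) o u"
    if "u : w ~> v" "a : S" "b' : S" "f : w ~> H a b'" "(\<phi> o r) o u = Int.jY (a, b') o f" for u w a b' f
   proof -
    have "z o (r o u) = E.jX b o (x o u)" by (rule Cmp_eq_precomp[OF b(3)]) (use z r b(1,2) that(1) in simp_all)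
    moreover have "\<phi> o (r o u) = Int.jY (a, b') o f" using that(1,5) \<phi> r by simp
    ultimately show ?thesis using key[of "r o u" w b "x o u" a b' f] r b(1,2) that(1-4) m(1) z \<phi> by simp
   qed
   have "\<phi> o r : v ~> Int.X1" using \<phi> r by simp
   note cs = Int.cases_eqI[OF this, of _ _ _, unfolded split]
   show ?thesis
   proof
    show "(E.tgt o m) o r = z o r" by (rule cs[of _ E.X0]) (use k t r in simp_all)
    show "(I1 \<pi> o m) o r = \<phi> o r" by (rule cs[of _ Int.X1]) (use k t r in simp_all)
   qed
  qed
  show "E.tgt o m = z" by (rule coproduct_cases_eqI[OF small_index E.cX t(2,1,2)]) (use loc in blast)
  show "I1 \<pi> o m = \<phi>" by (rule coproduct_cases_eqI[OF small_index E.cX t(2,3,4)]) (use loc in blast)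
 qed
 then show "\<exists>m. m : y ~> IAr El \<and> ITgt El o m = z \<and> I1 \<pi> o m = \<phi>" using m(1) by (intro exI[of _ m]) simp
next
 fix y m n assume mn: "m : y ~> IAr El" "n : y ~> IAr El" "ITgt El o m = ITgt El o n" "I1 \<pi> o m = I1 \<pi> o n"
 show "m = n"
 proof (rule E.cases_eqI[of m y _ E.X1])
  show "m : y ~> E.X1" "m : y ~> E.X1" "n : y ~> E.X1" using mn(1,2) by simp_all
  fix z r a b f assume *: "r : z ~> y" "a : S" "b : S" "f : z ~> (case (a, b) of (a, b) \<Rightarrow> Prod V (H a b) (FO b))" "m o r = E.jY (a, b) o f"
  show "m o r = n o r"
  proof (rule E.cases_eqI[of "n o r" z _ E.X1])
   show "n o r : z ~> E.X1" "m o r : z ~> E.X1" "n o r : z ~> E.X1" using mn(1,2) * by simp_all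
   fix x s a' b' g assume s: "s : x ~> z" "a' : S" "b' : S" "g : x ~> (case (a', b') of (a, b) \<Rightarrow> Prod V (H a b) (FO b))" "(n o r) o s = E.jY (a', b') o g"
   have ms: "m o (r o s) = E.jY (a, b) o (f o s)" by (rule Cmp_eq_precomp[OF *(5)]) (use mn(1) * s in simp_all)
   have ns: "n o (r o s) = E.jY (a', b') o g" using s(1,5) mn(2) *(1) by simp
   have "E.tgt o (m o (r o s)) = E.tgt o (n o (r o s))" "I1 \<pi> o (m o (r o s)) = I1 \<pi> o (n o (r o s))"
    using Cmp_eq_precomp[OF mn(3), of "r o s"] Cmp_eq_precomp[OF mn(4), of "r o s"] mn(1,2) *(1) s(1) by simp_all
   then have "E.jX b o (pr2 V (H a b) (FO b) o (f o s)) = E.jX b' o (pr2 V (H a' b') (FO b') o g)"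
    "Int.jY (a, b) o (pr1 V (H a b) (FO b) o (f o s)) = Int.jY (a', b') o (pr1 V (H a' b') (FO b') o g)"
    unfolding ms ns using *(1-4) s(1-4) by simp_all
   from E.X_disjoint[OF this(1), of x] Int.Y_disjoint[OF this(2), of x]
   have c: "(a = a' \<and> b = b' \<and> pr1 V (H a b) (FO b) o (f o s) = pr1 V (H a' b') (FO b') o g \<and> pr2 V (H a b) (FO b) o (f o s) = pr2 V (H a' b') (FO b') o g) \<or> void x"
    using *(1-4) s(1-4) by auto
   have "m o (r o s) = n o (r o s)"
   proof (cases "void x")
    case True
    then show ?thesis using void_eqI[OF True, of "m o (r o s)" E.X1 "n o (r o s)"] mn(1,2) *(1) s(1) by simp
   next
    case False
    with c have c: "a = a'" "b = b'" "pr1 V (H a b) (FO b) o (f o s) = pr1 V (H a' b') (FO b') o g" "pr2 V (H a b) (FO b) o (f o s) = pr2 V (H a' b') (FO b') o g" by blast+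
    have "f o s = g" by (rule prod_eqI[of _ x "H a b" "FO b"]) (use c *(2-4) s(1-4) in simp_all)
    then show ?thesis unfolding ms ns c(1,2) by simp
   qed
   then show "(m o r) o s = (n o r) o s" using mn(1,2) *(1) s(1) by simp
  qed
 qed
qed

end

section \<open>The internal Grothendieck construction on objects and arrows\<close>

context vext
begin

lemma presheafD: assumes "psh F" shows "presheaf V U C F"
 by unfold_locales (rule assms)

text \<open>Since \<^term>\<open>Int.X0\<close> is a coproduct of terminal objects, a functor \<^term>\<open>P\<close> to \<^term>\<open>IntC\<close> splits the objects of
 \<^term>\<open>A\<close> into parts indexed by the objects of \<^term>\<open>C\<close>.  An arrow of \<^term>\<open>C\<close> acts on these parts by the source of its
 lift; uniqueness of lifts makes this an action, whose category of elements is \<^term>\<open>A\<close>.\<close>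

lemma dfib_elements:
 assumes P: "discrete_fibration V P" "P : Hom W A IntC"
 obtains F H' K where "psh F" "H' : Hom W (elements V C F) A" "K : Hom W A (elements V C F)"
  "P o\<^bsub>W\<^esub> H' = elements_proj V C F" "elements_proj V C F o\<^bsub>W\<^esub> K = P"
  "H' o\<^bsub>W\<^esub> K = Idn W A" "K o\<^bsub>W\<^esub> H' = Idn W (elements V C F)"
proof -
 note [simp] = W.Hom_Ob[OF P(2)] P(2)[unfolded Hom_iff]
 have P0: "I0 P : IOb A ~> Int.X0" by simp
 obtain Z k g where Z: "is_coproduct V S Z (IOb A) k" and k: "!!a. a : S ==> k a : Z a ~> IOb A"
  and g: "!!a. a : S ==> g a : Z a ~> terminal V" and kg: "!!a. a : S ==> I0 P o k a = Int.jX a o g a"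
  by (rule coproduct_cover[OF small_index Int.cX P0]) blast
 have kt [simp]: "k a : Ar V" "Dom V (k a) = Z a" "Cod V (k a) = IOb A" "g a : Ar V" "Dom V (g a) = Z a" "Cod V (g a) = terminal V" "Z a : Ob V"
  if "a : S" for a using k[OF that] g[OF that] Hom_Ob[OF k[OF that]] by simp_all
 have Pk [simp]: "I0 P o (k a o x) = Int.jX a o bang V (Dom V x)" if "a : S" "x : Ar V" "Cod V x = Z a" for a x
 proof -
  have "I0 P o (k a o x) = Int.jX a o (g a o x)" by (rule Cmp_eq_precomp[OF kg]) (use that in simp_all)
  moreover have "g a o x = bang V (Dom V x)" by (rule terminal_eqI[of _ "Dom V x"]) (use that Dom_Ob in simp_all)
  ultimately show ?thesis by simp
 qed
 have lift: "\<exists>n. n : v ~> IAr A \<and> ITgt A o n = k b o x \<and> I1 P o n = Int.jY (a, b) o f"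
  if "a : S" "b : S" "f : v ~> H a b" "x : v ~> Z b" for a b f v x
 proof -
  have "I0 P o (k b o x) = ITgt IntC o (Int.jY (a, b) o f)" using that Hom_Ob[OF that(3)] by simp
  then show ?thesis using dfib_lift[OF P, of "k b o x" v "Int.jY (a, b) o f"] that by simp blast
 qed
 \<comment> \<open>The action: the source of the generic lift lies over the summand of \<^term>\<open>a\<close> and so factors through
  \<^term>\<open>Z a\<close>.  By uniqueness it then computes the source of every lift.\<close>
 define Q where "Q a b m \<longleftrightarrow> m : Prod V (H a b) (Z b) ~> Z a \<and> (\<forall>v f x n. f : v ~> H a b --> x : v ~> Z b -->
   n : v ~> IAr A --> ITgt A o n = k b o x --> I1 P o n = Int.jY (a, b) o f --> ISrc A o n = k a o (m o <|f, x|>))" for a b m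
 have "\<exists>m. Q a b m" if ab: "a : S" "b : S" for a b
 proof -
  let ?T = "Prod V (H a b) (Z b)" and ?f = "pr1 V (H a b) (Z b)" and ?x = "pr2 V (H a b) (Z b)"
  obtain n where n: "n : ?T ~> IAr A" "ITgt A o n = k b o ?x" "I1 P o n = Int.jY (a, b) o ?f"
   using lift[of a b ?f ?T ?x] ab by auto
  have "I0 P o (ISrc A o n) = ISrc IntC o (I1 P o n)" using ifun(1)[of P IntC n] n(1) by simp
  also have "\<dots> = Int.jX a o bang V ?T" unfolding n(3) using ab by simp
  finally have e: "I0 P o (ISrc A o n) = Int.jX a o bang V ?T" .
  obtain m where m: "m : ?T ~> Z a" "ISrc A o n = k a o m"
  proof (rule coproduct_factor[OF small_index Int.cX Z P0 g kg ab(1) _ _ e])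
   show "ISrc A o n : ?T ~> IOb A" "bang V ?T : ?T ~> terminal V" using n(1) ab by simp_all
  qed blast
  have "ISrc A o n' = k a o (m o <|f, x|>)"
   if t: "f : v ~> H a b" "x : v ~> Z b" "n' : v ~> IAr A" "ITgt A o n' = k b o x" "I1 P o n' = Int.jY (a, b) o f" for v f x n'
  proof -
   have r: "<|f, x|> : v ~> ?T" using t(1,2) ab by simp
   have "ITgt A o (n o <|f, x|>) = k b o (?x o <|f, x|>)" by (rule Cmp_eq_precomp[OF n(2)]) (use n(1) r t(1,2) ab in simp_all)
   moreover have "I1 P o (n o <|f, x|>) = Int.jY (a, b) o (?f o <|f, x|>)" by (rule Cmp_eq_precomp[OF n(3)]) (use n(1) r t(1,2) ab in simp_all)
   moreover have "n o <|f, x|> : v ~> IAr A" using n(1) r by simp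
   moreover have "?x o <|f, x|> = x" "?f o <|f, x|> = f" using t(1,2) ab by simp_all
   ultimately have n': "n' = n o <|f, x|>" by (intro dfib_unique[OF P t(3)]) (simp_all add: t(4,5))
   show ?thesis unfolding n' by (rule Cmp_eq_precomp[OF m(2)]) (use n(1) m(1) r t(1,2) ab in simp_all)
  qed
  then show ?thesis using m(1) unfolding Q_def by blast
 qed
 then obtain m where Q: "!!a b. a : S ==> b : S ==> Q a b (m a b)" by metis
 have m: "m a b : Prod V (H a b) (Z b) ~> Z a" if "a : S" "b : S" for a b
  using Q[OF that] unfolding Q_def by blast
 have src: "ISrc A o n = k a o (m a b o <|f, x|>)" if "a : S" "b : S" "f : v ~> H a b" "x : v ~> Z b" "n : v ~> IAr A"
   "ITgt A o n = k b o x" "I1 P o n = Int.jY (a, b) o f" for a b v f x n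
  using Q[OF that(1,2)] that(3-) unfolding Q_def by blast
 have mt [simp]: "m a b : Ar V" "Dom V (m a b) = Prod V (H a b) (Z b)" "Cod V (m a b) = Z a" if "a : S" "b : S" for a b
  using m[OF that] by simp_all
 have unit: "m a a o <|VId C a o u, x|> = x" if "a : S" "u : v ~> terminal V" "x : v ~> Z a" for a v u x
 proof (rule coproduct_mono[OF small_index Z that(1), of _ v])
  have v: "v : Ob V" using that(2) by (rule Hom_Ob)
  have u: "u = bang V v" by (rule terminal_eqI[of _ v]) (use that(2) v in simp_all)
  have "I1 P o (IIdn A o (k a o x)) = Int.jY (a, a) o (VId C a o u)"
   unfolding u using ifun(3)[of P IntC "k a o x"] that v by simp
  then have "ISrc A o (IIdn A o (k a o x)) = k a o (m a a o <|VId C a o u, x|>)"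
   by (intro src[of a a _ v]) (use that in simp_all)
  then show "k a o (m a a o <|VId C a o u, x|>) = k a o x" using that by simp
 qed (use that in simp_all)
 have cmp: "m a c o <|VCmp C a b c o <|f, g|>, x|> = m a b o <|f, m b c o <|g, x|>|>"
  if t: "a : S" "b : S" "c : S" "f : v ~> H a b" "g : v ~> H b c" "x : v ~> Z c" for a b c v f g x
 proof (rule coproduct_mono[OF small_index Z t(1), of _ v])
  obtain q where q: "q : v ~> IAr A" "ITgt A o q = k c o x" "I1 P o q = Int.jY (b, c) o g" using lift[OF t(2,3,5,6)] by blast
  note sq = src[OF t(2,3,5,6) q]
  have y: "m b c o <|g, x|> : v ~> Z b" using t by simp
  obtain p where p: "p : v ~> IAr A" "ITgt A o p = k b o (m b c o <|g, x|>)" "I1 P o p = Int.jY (a, b) o f" using lift[OF t(1,2,4) y] by blast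
  note sp = src[OF t(1,2,4) y p]
  have pq: "ITgt A o p = ISrc A o q" unfolding p(2) sq ..
  have "I1 P o icmp A p q = icmp IntC (I1 P o p) (I1 P o q)" using ifun(4)[of P IntC p q] p(1) q(1) pq by simp
  also have "\<dots> = Int.jY (a, c) o (VCmp C a b c o <|f, g|>)" unfolding p(3) q(3) by (rule IntC_icmp[OF t(1-5)])
  finally have 1: "I1 P o icmp A p q = Int.jY (a, c) o (VCmp C a b c o <|f, g|>)" .
  have 2: "icmp A p q : v ~> IAr A" "ISrc A o icmp A p q = ISrc A o p" "ITgt A o icmp A p q = ITgt A o q"
   using p(1) q(1) pq by simp_all
  have 3: "VCmp C a b c o <|f, g|> : v ~> H a c" using t by simp
  show "k a o (m a c o <|VCmp C a b c o <|f, g|>, x|>) = k a o (m a b o <|f, m b c o <|g, x|>|>)"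
   unfolding src[OF t(1,3) 3 t(6) 2(1) trans[OF 2(3) q(2)] 1, symmetric] 2(2) sp ..
 qed (use t in simp_all)
 obtain F where F: "psh F" "!!a. a : S ==> VFOb F a = Z a"
  "!!a b. [|a : S; b : S|] ==> psh_act V C F a b = m a b"
  by (rule presheafI[where Z=Z and act=m]) (use unit cmp in simp_all)
 interpret F: presheaf V U C F by (rule presheafD[OF F(1)])
 have Z': "is_coproduct V S F.FO (IOb A) k" using Z F(2) unfolding is_coproduct_def by simp
 obtain h h' where h: "h : F.E.X0 ~> IOb A" "h' : IOb A ~> F.E.X0" "h' o h = Idn V F.E.X0" "h o h' = Idn V (IOb A)"
  "!!a. a : S ==> h o F.E.jX a = k a"
  by (rule coproduct_unique_iso[OF F.E.cX Z']) blast
 note [simp] = h(1,2)[unfolded Hom_iff]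
 have hj: "h o (F.E.jX a o x) = k a o x" if "a : S" "x : Ar V" "Cod V x = Z a" for a x
  by (rule Cmp_eq_precomp1[OF h(5)]) (use that F(2) in simp_all)
 have 0: "I0 P o h = I0 F.\<pi>"
 proof (rule coproduct_eqI[OF F.E.cX])
  show "I0 P o h : F.E.X0 ~> Int.X0" "I0 F.\<pi> : F.E.X0 ~> Int.X0" by simp_all
  fix a assume a: "a : S"
  show "(I0 P o h) o F.E.jX a = I0 F.\<pi> o F.E.jX a"
   using hj[of a "Idn V (Z a)"] F.\<pi>_simps(7)[of a "Idn V (Z a)"] a F(2)[OF a] Pk[of a "Idn V (Z a)"] by simp
 qed
 obtain H' where H': "H' : Hom W F.El A" "I0 H' = h" "P o\<^bsub>W\<^esub> H' = F.\<pi>"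
 proof (rule dfib_functor[OF P(1) F.\<pi>_typing P(2), of h])
  show "h : IOb F.El ~> IOb A" "I0 P o h = I0 F.\<pi>" using 0 by simp_all
  fix y f n assume f: "f : y ~> IAr F.El" and n: "n : y ~> IAr A" "ITgt A o n = h o (ITgt F.El o f)" "I1 P o n = I1 F.\<pi> o f"
  show "ISrc A o n = h o (ISrc F.El o f)"
  proof (rule F.E.cases_eqI[of f y])
   fix z r a b q assume *: "r : z ~> y" "a : S" "b : S" "q : z ~> (case (a, b) of (a, b) \<Rightarrow> Prod V (H a b) (F.FO b))" "f o r = F.E.jY (a, b) o q"
   note Fab = F(2)[OF *(2)] F(2)[OF *(3)]
   have "ITgt A o (n o r) = h o (F.E.tgt o (f o r))" using Cmp_eq_precomp[OF n(2), of r] f n(1) *(1) by simp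
   then have 1: "ITgt A o (n o r) = k b o (pr2 V (H a b) (Z b) o q)"
    unfolding *(5) using *(2-4) Fab hj[of b "pr2 V (H a b) (Z b) o q"] by simp
   have "I1 P o (n o r) = I1 F.\<pi> o (f o r)" by (rule Cmp_eq_precomp[OF n(3)]) (use f n(1) *(1) in simp_all)
   then have 2: "I1 P o (n o r) = Int.jY (a, b) o (pr1 V (H a b) (Z b) o q)" unfolding *(5) using *(2-4) Fab by simp
   have "ISrc A o (n o r) = k a o (m a b o q)"
    using src[OF *(2,3) _ _ _ 1 2, of z] *(1-4) n(1) Fab by simp
   also have "\<dots> = h o (F.E.src o (f o r))" unfolding *(5) using *(2-4) Fab F(3)[OF *(2,3)] hj[of a "m a b o q"] by simp
   finally show "(ISrc A o n) o r = (h o (ISrc F.El o f)) o r" using *(1) f n(1) by simp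
  qed (use f n(1) in simp_all)
 qed blast
 note [simp] = H'(1)[unfolded Hom_iff]
 have 0: "I0 F.\<pi> o h' = I0 P" unfolding 0[symmetric] using h(4) by simp
 obtain K where K: "K : Hom W A F.El" "I0 K = h'" "F.\<pi> o\<^bsub>W\<^esub> K = P"
 proof (rule dfib_functor[OF F.\<pi>_discrete P(2) F.\<pi>_typing, of h'])
  show "h' : IOb A ~> IOb F.El" "I0 F.\<pi> o h' = I0 P" using 0 by simp_all
  fix y f n assume f: "f : y ~> IAr A" and n: "n : y ~> IAr F.El" "ITgt F.El o n = h' o (ITgt A o f)" "I1 F.\<pi> o n = I1 P o f"
  have st: "ISrc A o (I1 H' o n) = h o (ISrc F.El o n)" "ITgt A o (I1 H' o n) = h o (ITgt F.El o n)"
   using ifun(1,2)[of H' A n] n(1) H'(2) by simp_all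
  have p: "I1 P o (I1 H' o n) = I1 F.\<pi> o n"
   unfolding H'(3)[symmetric] using n(1) by simp
  have "I1 H' o n = f"
  proof (rule dfib_unique[OF P, of _ y])
   show "ITgt A o (I1 H' o n) = ITgt A o f" unfolding st(2) n(2) using Cmp_eq_precomp1[OF h(4), of "ITgt A o f"] f by simp
   show "I1 P o (I1 H' o n) = I1 P o f" unfolding p n(3) ..
  qed (use f n(1) in simp_all)
  then have "h' o (ISrc A o f) = h' o (h o (ISrc F.El o n))" using st(1) by simp
  then show "ISrc F.El o n = h' o (ISrc A o f)" using Cmp_eq_precomp1[OF h(3), of "ISrc F.El o n"] n(1) by simp
 qed blast
 note [simp] = K(1)[unfolded Hom_iff] F.\<pi>_typing[unfolded Hom_iff]
 have "H' o\<^bsub>W\<^esub> K = Idn W A"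
  by (rule dfib_functor_ext[OF P(1) P(2) P(2)])
   (use H' K h(4) W.Cmp_eq_precomp1[OF H'(3), of K] in simp_all)
 moreover have "K o\<^bsub>W\<^esub> H' = Idn W F.El"
  by (rule dfib_functor_ext[OF F.\<pi>_discrete F.\<pi>_typing F.\<pi>_typing])
   (use H' K h(3) W.Cmp_eq_precomp1[OF K(3), of H'] in simp_all)
 ultimately show ?thesis using that F(1) H' K by blast
qed

text \<open>Naturality in the form that will be compared with the source condition for functors between discrete
 fibrations.\<close>

lemma psh_wedge_iff:
 assumes F: "psh F" and G: "psh G"
 shows "psh_wedge F G x w \<longleftrightarrow> x : Ob V \<and> (\<forall>a \<in> S. w a : x ~> Exp V (VFOb F a) (VFOb G a)) \<and>
   (\<forall>a \<in> S. \<forall>b \<in> S. \<forall>y. \<forall>u \<in> Hom V y x. \<forall>f \<in> Hom V y (H a b). \<forall>z \<in> Hom V y (VFOb F b).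
    eval_ar V (VFOb F a) (VFOb G a) o <|w a o u, psh_act V C F a b o <|f, z|>|> =
    psh_act V C G a b o <|f, eval_ar V (VFOb F b) (VFOb G b) o <|w b o u, z|>|>)" (is "?L \<longleftrightarrow> ?R")
proof -
 interpret F: presheaf V U C F by (rule presheafD[OF F])
 interpret G: presheaf V U C G by (rule presheafD[OF G])
 note [simp] = vfunctorD(3-6)[OF F, simplified] vfunctorD(3-6)[OF G, simplified]
 let ?l = "\<lambda>a b u f. VCmp (vself V) (VFOb F b) (VFOb F a) (VFOb G a) o <|VFHom F b a o f, w a o u|>"
 let ?r = "\<lambda>a b u f. VCmp (vself V) (VFOb F b) (VFOb G b) (VFOb G a) o <|w b o u, VFHom G b a o f|>"
 let ?e = "\<lambda>a b u f z. eval_ar V (VFOb F a) (VFOb G a) o <|w a o u, psh_act V C F a b o <|f, z|>|> =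
    psh_act V C G a b o <|f, eval_ar V (VFOb F b) (VFOb G b) o <|w b o u, z|>|>"
 have L: "?L \<longleftrightarrow> x : Ob V \<and> (\<forall>a \<in> S. w a : x ~> Exp V (VFOb F a) (VFOb G a)) \<and>
   (\<forall>b \<in> S. \<forall>a \<in> S. \<forall>y. \<forall>u \<in> Hom V y x. \<forall>f \<in> Hom V y (H a b). ?l a b u f = ?r a b u f)"
  using is_wedge_iff[OF F G, of x w] by simp
 have ev: "?e a b u f z \<longleftrightarrow> eval_ar V (VFOb F b) (VFOb G a) o <|?l a b u f, z|> = eval_ar V (VFOb F b) (VFOb G a) o <|?r a b u f, z|>"
  if w: "\<forall>a \<in> S. w a : x ~> Exp V (VFOb F a) (VFOb G a)" and *: "a : S" "b : S" "u : y ~> x" "f : y ~> H a b" "z : y ~> VFOb F b"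
  for a b y u f z
 proof -
  have wt: "w a : x ~> Exp V (VFOb F a) (VFOb G a)" "w b : x ~> Exp V (VFOb F b) (VFOb G b)" using w * by blast+
  have 1: "eval_ar V (VFOb F b) (VFOb G b) o <|w b o u, z|> : y ~> VFOb G b" using wt * by simp
  show ?thesis
   unfolding psh_act(3)[OF F *(1,2,4,5)] psh_act(3)[OF G *(1,2,4) 1] using wt * by simp
 qed
 have 1: "\<forall>u \<in> Hom V y x. \<forall>f \<in> Hom V y (H a b). ?l a b u f = ?r a b u f"
  if w: "\<forall>a \<in> S. w a : x ~> Exp V (VFOb F a) (VFOb G a)" and ab: "a : S" "b : S" and
   e: "\<forall>y. \<forall>u \<in> Hom V y x. \<forall>f \<in> Hom V y (H a b). \<forall>z \<in> Hom V y (VFOb F b). ?e a b u f z" for a b y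
 proof (intro ballI)
  fix u f assume uf: "u : y ~> x" "f : y ~> H a b"
  have wt: "w a : x ~> Exp V (VFOb F a) (VFOb G a)" "w b : x ~> Exp V (VFOb F b) (VFOb G b)" using w ab by blast+
  have y: "y : Ob V" using uf(1) by (rule Hom_Ob)
  let ?p = "pr1 V y (VFOb F b)" and ?q = "pr2 V y (VFOb F b)"
  have t: "u o ?p : Prod V y (VFOb F b) ~> x" "f o ?p : Prod V y (VFOb F b) ~> H a b" "?q : Prod V y (VFOb F b) ~> VFOb F b"
   using uf ab y by simp_all
  have "?e a b (u o ?p) (f o ?p) ?q" using e t by blast
  note e' = this[unfolded ev[OF w ab t]]
  show "?l a b u f = ?r a b u f"
   by (rule exp_eqI[of _ y "VFOb F b" "VFOb G a"]) (use e' wt ab uf y in simp_all)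
 qed
 have 2: "?e a b u f z" if "?L" "a : S" "b : S" "u : y ~> x" "f : y ~> H a b" "z : y ~> VFOb F b" for a b y u f z
  unfolding ev[OF conjunct1[OF conjunct2[OF that(1)[unfolded L]]] that(2-)] using that unfolding L by metis
 show ?thesis
 proof
  assume L': ?L
  show ?R using 2[OF L'] L' unfolding L by (intro conjI ballI allI) blast+
 next
  assume R: ?R
  have "\<forall>u \<in> Hom V y x. \<forall>f \<in> Hom V y (H a b). ?l a b u f = ?r a b u f" if "a : S" "b : S" for a b y
   using R that by (intro 1) blast+
  then show ?L unfolding L using R by blast
 qed
qed

text \<open>Functoriality is an instance of the extension of maps on objects to functors into a discrete fibration:
 the source condition is naturality, and the prescribed map on arrows is the one given by lifts.\<close>

lemma elements_map:
 assumes "psh_nat F G \<alpha>"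
 shows elements_map_typing: "emap F G \<alpha> : Hom W (elements V C F) (elements V C G)"
  and elements_map_over: "elements_proj V C G o\<^bsub>W\<^esub> emap F G \<alpha> = elements_proj V C F"
  and elements_map_component: "[|a : S; z : Ar V; Cod V z = VFOb F a|] ==>
   I0 (emap F G \<alpha>) o (coin V S (VFOb F) a o z) = coin V S (VFOb G) a o (eval_ar V (VFOb F a) (VFOb G a) o <|\<alpha> a o bang V (Dom V z), z|>)"
proof -
 have F: "psh F" and G: "psh G" using assms unfolding vnat_def by blast+
 interpret F: presheaf V U C F by (rule presheafD[OF F])
 interpret G: presheaf V U C G by (rule presheafD[OF G])
 have w: "psh_wedge F G (terminal V) \<alpha>" using assms unfolding vnat_iff_wedge[OF F G] by blast
 note w = w[unfolded psh_wedge_iff[OF F G]]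
 have \<alpha>t [simp]: "\<alpha> a : Ar V" "Dom V (\<alpha> a) = terminal V" "Cod V (\<alpha> a) = Exp V (F.FO a) (G.FO a)" if "a : S" for a
  using w that by simp_all
 let ?m = "psh_map V F G \<alpha>"
 have mt [simp]: "?m a : Ar V" "Dom V (?m a) = F.FO a" "Cod V (?m a) = G.FO a" if "a : S" for a
  using that by (simp_all add: psh_map_def)
 have ml: "?m a o z = eval_ar V (F.FO a) (G.FO a) o <|\<alpha> a o bang V (Dom V z), z|>" if "a : S" "z : Ar V" "Cod V z = F.FO a" for a z
  using that by (simp add: psh_map_def)
 have nat: "?m a o (F.act a b o q) = G.act a b o <|pr1 V (H a b) (F.FO b) o q, ?m b o (pr2 V (H a b) (F.FO b) o q)|>"
  if t: "a : S" "b : S" "q : z ~> Prod V (H a b) (F.FO b)" for a b q z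
 proof -
  have z: "z : Ob V" using t(3) by (rule Hom_Ob)
  let ?f = "pr1 V (H a b) (F.FO b) o q" and ?x = "pr2 V (H a b) (F.FO b) o q"
  have "bang V z : z ~> terminal V" "?f : z ~> H a b" "?x : z ~> F.FO b" using t z by simp_all
  with w t(1,2) have "eval_ar V (F.FO a) (G.FO a) o <|\<alpha> a o bang V z, F.act a b o <|?f, ?x|>|> =
    G.act a b o <|?f, eval_ar V (F.FO b) (G.FO b) o <|\<alpha> b o bang V z, ?x|>|>" by blast
  then show ?thesis using t ml[of a "F.act a b o q"] ml[of b ?x] by simp
 qed
 let ?h = "coprod_map V S F.FO G.FO ?m"
 have mH: "?m a : F.FO a ~> G.FO a" if "a : S" for a using that by simp
 note M = coprod_map[OF small_index G.act_simps(1) mH]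
 have M [simp]: "?h : Ar V" "Dom V ?h = F.E.X0" "Cod V ?h = G.E.X0"
  "!!a r. [|a : S; r : Ar V; Cod V r = F.FO a|] ==> ?h o (F.E.jX a o r) = G.E.jX a o (?m a o r)"
  using M(1-3) M(5) by simp_all
 have 0: "I0 G.\<pi> o ?h = I0 F.\<pi>"
 proof (rule coproduct_eqI[OF F.E.cX])
  show "I0 G.\<pi> o ?h : F.E.X0 ~> Int.X0" "I0 F.\<pi> : F.E.X0 ~> Int.X0" by simp_all
  fix a assume a: "a : S"
  show "(I0 G.\<pi> o ?h) o F.E.jX a = I0 F.\<pi> o F.E.jX a"
   using M(4)[of a "Idn V (F.FO a)"] F.\<pi>_simps(7)[of a "Idn V (F.FO a)"] a by simp
 qed
 obtain T where T: "T : Hom W F.El G.El" "I0 T = ?h" "G.\<pi> o\<^bsub>W\<^esub> T = F.\<pi>"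
 proof (rule dfib_functor[OF G.\<pi>_discrete F.\<pi>_typing G.\<pi>_typing, of ?h])
  show "?h : IOb F.El ~> IOb G.El" "I0 G.\<pi> o ?h = I0 F.\<pi>" using 0 by simp_all
  fix y f n assume f: "f : y ~> IAr F.El" and n: "n : y ~> IAr G.El" "ITgt G.El o n = ?h o (ITgt F.El o f)" "I1 G.\<pi> o n = I1 F.\<pi> o f"
  show "ISrc G.El o n = ?h o (ISrc F.El o f)"
  proof (rule F.E.cases_eqI[of f y])
   fix z r a b q assume *: "r : z ~> y" "a : S" "b : S" "q : z ~> (case (a, b) of (a, b) \<Rightarrow> Prod V (H a b) (F.FO b))" "f o r = F.E.jY (a, b) o q"
   have q: "q : z ~> Prod V (H a b) (F.FO b)" using *(4) by simp
   let ?n = "G.E.jY (a, b) o <|pr1 V (H a b) (F.FO b) o q, ?m b o (pr2 V (H a b) (F.FO b) o q)|>"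
   have "G.E.tgt o (n o r) = ?h o (F.E.tgt o (f o r))" using Cmp_eq_precomp[OF n(2), of r] f n(1) *(1) by simp
   then have 1: "G.E.tgt o (n o r) = G.E.tgt o ?n" unfolding *(5) using *(2,3) q by simp
   have "I1 G.\<pi> o (n o r) = I1 F.\<pi> o (f o r)" by (rule Cmp_eq_precomp[OF n(3)]) (use f n(1) *(1) in simp_all)
   then have 2: "I1 G.\<pi> o (n o r) = I1 G.\<pi> o ?n" unfolding *(5) using *(2,3) q by simp
   have nr: "n o r = ?n"
    by (rule dfib_unique[OF G.\<pi>_discrete G.\<pi>_typing, of _ z]) (use 1 2 *(1-3) q n(1) in simp_all)
   have "G.E.src o (n o r) = ?h o (F.E.src o (f o r))" unfolding nr *(5) using *(2,3) q nat[OF *(2,3) q] by simp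
   then show "(ISrc G.El o n) o r = (?h o (ISrc F.El o f)) o r" using *(1) f n(1) by simp
  qed (use f n(1) in simp_all)
 qed blast
 note [simp] = T(1)[unfolded Hom_iff]
 let ?k = "coprod_map V (S \<times> S) (\<lambda>(a, b). Prod V (H a b) (F.FO b)) (\<lambda>(a, b). Prod V (H a b) (G.FO b)) (\<lambda>(a, b). cross V (Idn V (H a b)) (?m b))"
 have n: "(case q of (a, b) \<Rightarrow> Prod V (H a b) (G.FO b)) : Ob V"
  "(case q of (a, b) \<Rightarrow> cross V (Idn V (H a b)) (?m b)) : (case q of (a, b) \<Rightarrow> Prod V (H a b) (F.FO b)) ~> (case q of (a, b) \<Rightarrow> Prod V (H a b) (G.FO b))"
  if "q : S \<times> S" for q using that by (cases q; simp)+
 note N = coprod_map[OF small_square n]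
 have N [simp]: "?k : Ar V" "Dom V ?k = F.E.X1" "Cod V ?k = G.E.X1" by (rule N(1-3); assumption)+
 have N4: "?k o F.E.jY (a, b) = G.E.jY (a, b) o cross V (Idn V (H a b)) (?m b)" if "a : S" "b : S" for a b
  using coprod_map(4)[OF small_square n, where i="(a, b)"] that by simp
 have "I1 T = ?k"
 proof (rule coproduct_eqI[OF F.E.cY])
  show "I1 T : F.E.X1 ~> G.E.X1" "?k : F.E.X1 ~> G.E.X1" by (simp_all del: cross_def)
  fix p assume "p : S \<times> S"
  then obtain a b where p: "p = (a, b)" "a : S" "b : S" by blast
  have "G.E.tgt o (I1 T o F.E.jY (a, b)) = ?h o (F.E.tgt o F.E.jY (a, b))"
   using ifun(2)[of T G.El "F.E.jY (a, b)"] p T(2) by simp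
  then have 1: "G.E.tgt o (I1 T o F.E.jY (a, b)) = G.E.jX b o (?m b o pr2 V (H a b) (F.FO b))"
   using F.E.str(11)[of a b "Idn V (Prod V (H a b) (F.FO b))"] p by simp
  have "I1 G.\<pi> o (I1 T o F.E.jY (a, b)) = I1 F.\<pi> o F.E.jY (a, b)"
   unfolding T(3)[symmetric] using p by simp
  then have 2: "I1 G.\<pi> o (I1 T o F.E.jY (a, b)) = Int.jY (a, b) o pr1 V (H a b) (F.FO b)"
   using F.\<pi>_simps(8)[of a b "Idn V (Prod V (H a b) (F.FO b))"] p by simp
  show "I1 T o F.E.jY p = ?k o F.E.jY p"
   unfolding p(1) N4[OF p(2,3)]
   by (rule dfib_unique[OF G.\<pi>_discrete G.\<pi>_typing, of _ "Prod V (H a b) (F.FO b)"]) (use p 1 2 in simp_all)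
 qed
 then have e: "emap F G \<alpha> = T"
  by (intro ifun.equality) (use T(1,2) in \<open>simp_all add: elements_map_def cat_of_def del: W_simps cross_def\<close>)
 show "emap F G \<alpha> : Hom W F.El G.El" "G.\<pi> o\<^bsub>W\<^esub> emap F G \<alpha> = F.\<pi>" unfolding e by (rule T)+
 show "[|a : S; z : Ar V; Cod V z = VFOb F a|] ==>
   I0 (emap F G \<alpha>) o (coin V S (VFOb F) a o z) = coin V S (VFOb G) a o (eval_ar V (VFOb F a) (VFOb G a) o <|\<alpha> a o bang V (Dom V z), z|>)"
  unfolding e T(2) using ml by simp
qed

end

section \<open>The hom-objects of discrete fibrations as ends\<close>

context vext
begin

abbreviation "proj \<equiv> elements_proj V C"
abbreviation "over F G \<equiv> slice_hom V (proj F) (proj G)"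

lemma proj:
 assumes "psh F"
 shows "proj F : Hom W (elements V C F) IntC" "discrete_fibration V (proj F)"
proof -
 interpret presheaf V U C F by (rule presheafD[OF assms])
 show "proj F : Hom W (elements V C F) IntC" "discrete_fibration V (proj F)" by (rule \<pi>_typing \<pi>_discrete)+
qed

text \<open>Being compatible with the projections to \<^term>\<open>IntC\<close>, a generalized element of the hom-object preserves the summands
 of the objects of objects, and so has a component at each object.\<close>

definition "component F G a = (SOME l. l : over F G ~> Exp V (VFOb F a) (VFOb G a) \<and>
  (\<forall>y. \<forall>h \<in> Hom V y (over F G). \<forall>z \<in> Hom V y (VFOb F a). sl0 (proj F) (proj G) h (coin V S (VFOb F) a o z) =
   coin V S (VFOb G) a o (eval_ar V (VFOb F a) (VFOb G a) o <|l o h, z|>)))"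

context
 fixes F G assumes F: "psh F" and G: "psh G"
begin

interpretation F: presheaf V U C F by (rule presheafD[OF F])
interpretation G: presheaf V U C G by (rule presheafD[OF G])

lemma component:
 assumes a: "a : S"
 shows "component F G a : over F G ~> Exp V (F.FO a) (G.FO a)"
  "[|h : y ~> over F G; z : y ~> F.FO a|] ==> sl0 F.\<pi> G.\<pi> h (F.E.jX a o z) =
   G.E.jX a o (eval_ar V (F.FO a) (G.FO a) o <|component F G a o h, z|>)"
proof -
 note [simp] = slice_hom_typing(1)[OF F.\<pi>_typing G.\<pi>_typing]
 let ?M = "over F G" let ?T = "Prod V ?M (F.FO a)" let ?h = "pr1 V ?M (F.FO a)" and ?z = "pr2 V ?M (F.FO a)"
 note S = sl[OF F.\<pi>_typing G.\<pi>_typing]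
 let ?s = "sl0 F.\<pi> G.\<pi> ?h (F.E.jX a o ?z)"
 have s: "?s : ?T ~> G.E.X0" using S(1-3)[of ?h "F.E.jX a o ?z"] a by simp
 have "I0 G.\<pi> o ?s = I0 F.\<pi> o (F.E.jX a o ?z)" using S(10)[of ?h "F.E.jX a o ?z"] a by simp
 then have e: "I0 G.\<pi> o ?s = Int.jX a o bang V ?T" using a by simp
 have pi: "I0 G.\<pi> : G.E.X0 ~> Int.X0" and b: "bang V (G.FO i) : G.FO i ~> terminal V"
  and k: "I0 G.\<pi> o G.E.jX i = Int.jX i o bang V (G.FO i)" and T: "bang V ?T : ?T ~> terminal V"
  if "i : S" for i using G.\<pi>_simps(7)[of i "Idn V (G.FO i)"] that a by simp_all
 obtain m where m: "m : ?T ~> G.FO a" "?s = G.E.jX a o m"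
  by (rule coproduct_factor[OF small_index Int.cX G.E.cX pi[OF a] b k a s T[OF a] e]) blast
 have "\<exists>l. l : ?M ~> Exp V (F.FO a) (G.FO a) \<and>
  (\<forall>y. \<forall>h \<in> Hom V y ?M. \<forall>z \<in> Hom V y (F.FO a). sl0 F.\<pi> G.\<pi> h (F.E.jX a o z) = G.E.jX a o (eval_ar V (F.FO a) (G.FO a) o <|l o h, z|>))"
 proof (intro exI[of _ "transp V ?M (F.FO a) (G.FO a) m"] conjI allI ballI)
  show "transp V ?M (F.FO a) (G.FO a) m : ?M ~> Exp V (F.FO a) (G.FO a)" using m a by simp
  fix y h z assume t: "h : y ~> ?M" "z : y ~> F.FO a"
  have "sl0 F.\<pi> G.\<pi> h (F.E.jX a o z) = ?s o <|h, z|>" using S(4)[of ?h "F.E.jX a o ?z" "<|h, z|>"] t a by simp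
  also have "\<dots> = G.E.jX a o (m o <|h, z|>)" unfolding m(2) using m(1) t a by simp
  also have "m o <|h, z|> = eval_ar V (F.FO a) (G.FO a) o <|transp V ?M (F.FO a) (G.FO a) m o h, z|>" using m(1) t a by simp
  finally show "sl0 F.\<pi> G.\<pi> h (F.E.jX a o z) = G.E.jX a o (eval_ar V (F.FO a) (G.FO a) o <|transp V ?M (F.FO a) (G.FO a) m o h, z|>)" .
 qed
 from someI_ex[OF this, folded component_def]
 show "component F G a : over F G ~> Exp V (F.FO a) (G.FO a)"
  "[|h : y ~> over F G; z : y ~> F.FO a|] ==> sl0 F.\<pi> G.\<pi> h (F.E.jX a o z) =
   G.E.jX a o (eval_ar V (F.FO a) (G.FO a) o <|component F G a o h, z|>)" by blast+
qed

lemma component_typing [simp]: "a : S ==> component F G a : Ar V" "a : S ==> Dom V (component F G a) = over F G"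
 "a : S ==> Cod V (component F G a) = Exp V (F.FO a) (G.FO a)" "over F G : Ob V"
 using component(1)[of a] slice_hom_typing(1)[OF F.\<pi>_typing G.\<pi>_typing] by simp_all

lemma component_eqI:
 assumes a: "a : S" and h: "h : y ~> over F G" and r: "r : y ~> Exp V (F.FO a) (G.FO a)"
  and e: "!!x u z. [|u : x ~> y; z : x ~> F.FO a|] ==> sl0 F.\<pi> G.\<pi> (h o u) (F.E.jX a o z) =
   G.E.jX a o (eval_ar V (F.FO a) (G.FO a) o <|r o u, z|>)"
 shows "component F G a o h = r"
proof -
 have y: "y : Ob V" using h by (rule Hom_Ob)
 let ?u = "pr1 V y (F.FO a)" and ?z = "pr2 V y (F.FO a)"
 have t: "?u : Prod V y (F.FO a) ~> y" "?z : Prod V y (F.FO a) ~> F.FO a" "h o ?u : Prod V y (F.FO a) ~> over F G"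
  using y a h by simp_all
 have e': "eval_ar V (F.FO a) (G.FO a) o <|component F G a o (h o ?u), ?z|> = eval_ar V (F.FO a) (G.FO a) o <|r o ?u, ?z|>"
  by (rule G.E.X_mono[of a _ _ "Prod V y (F.FO a)"])
   (use component(2)[OF a t(3,2)] e[OF t(1,2)] a y h r in simp_all)
 show ?thesis by (rule exp_eqI[of _ y "F.FO a" "G.FO a"]) (use e' a y h r in simp_all)
qed

text \<open>Into a discrete fibration, an element of the hom-object is determined by its action on objects, and every
 object of the category of elements lies locally in a summand.\<close>

lemma components_eqI:
 assumes hk: "h : x ~> over F G" "k : x ~> over F G"
  and e: "!!a. a : S ==> component F G a o h = component F G a o k"
 shows "h = k"
proof (rule dfib_slice_ext[OF G.\<pi>_discrete F.\<pi>_typing G.\<pi>_typing hk])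
 fix y u a assume u: "u : y ~> x" and a: "a : y ~> IOb F.El"
 have t: "h o u : y ~> over F G" "k o u : y ~> over F G" using hk u by simp_all
 note S = sl[OF F.\<pi>_typing G.\<pi>_typing]
 show "sl0 F.\<pi> G.\<pi> (h o u) a = sl0 F.\<pi> G.\<pi> (k o u) a"
 proof (rule coproduct_cases_eqI[OF small_index F.E.cX])
  show "a : y ~> F.E.X0" using a by simp
  show "sl0 F.\<pi> G.\<pi> (h o u) a : y ~> G.E.X0" "sl0 F.\<pi> G.\<pi> (k o u) a : y ~> G.E.X0"
   using S(1-3)[of "h o u" a] S(1-3)[of "k o u" a] t a by simp_all
  fix z r i g assume *: "i : S" "r : z ~> y" "g : z ~> F.FO i" "a o r = F.E.jX i o g"
  have hr: "h o u o r : z ~> over F G" "k o u o r : z ~> over F G" using t *(2) by simp_all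
  have 1: "component F G i o (h o u o r) = component F G i o (k o u o r)"
   using Cmp_eq_precomp[OF e[OF *(1)], of "u o r"] hk u *(1,2) by simp
  have "sl0 F.\<pi> G.\<pi> (h o u o r) (a o r) = sl0 F.\<pi> G.\<pi> (k o u o r) (a o r)"
   unfolding *(4) component(2)[OF *(1) hr(1) *(3)] component(2)[OF *(1) hr(2) *(3)] 1 ..
  then show "sl0 F.\<pi> G.\<pi> (h o u) a o r = sl0 F.\<pi> G.\<pi> (k o u) a o r"
   using S(4)[of "h o u" a r] S(4)[of "k o u" a r] t a *(2) by simp
 qed
qed

text \<open>Acting on the arrow with label \<^term>\<open>f\<close> and target \<^term>\<open>z\<close> shows that the components commute with the
 action of \<^term>\<open>f\<close>.\<close>

lemma component_wedge: "psh_wedge F G (over F G) (component F G)"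
 unfolding psh_wedge_iff[OF F G]
proof (intro conjI ballI allI)
 fix a b y u f z assume t: "a : S" "b : S" "u : y ~> over F G" "f : y ~> H a b" "z : y ~> F.FO b"
 let ?w = "eval_ar V (F.FO b) (G.FO b) o <|component F G b o u, z|>"
 have w: "?w : y ~> G.FO b" using t by simp
 have x: "F.act a b o <|f, z|> : y ~> F.FO a" using t by simp
 let ?f = "F.E.jY (a, b) o <|f, z|>" and ?n = "G.E.jY (a, b) o <|f, ?w|>"
 have "ISrc G.El o ?n = sl0 F.\<pi> G.\<pi> u (ISrc F.El o ?f)"
 proof (rule dfib_slice_source[OF G.\<pi>_discrete F.\<pi>_typing G.\<pi>_typing t(3)])
  show "?f : y ~> IAr F.El" "?n : y ~> IAr G.El" "I1 G.\<pi> o ?n = I1 F.\<pi> o ?f" using t w by simp_all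
  have 1: "ITgt F.El o ?f = F.E.jX b o z" using t by simp
  show "ITgt G.El o ?n = sl0 F.\<pi> G.\<pi> u (ITgt F.El o ?f)"
   unfolding 1 component(2)[OF t(2,3,5)] using t w by simp
 qed
 moreover have 2: "ISrc F.El o ?f = F.E.jX a o (F.act a b o <|f, z|>)" "ISrc G.El o ?n = G.E.jX a o (G.act a b o <|f, ?w|>)"
  using t w by simp_all
 ultimately have "G.E.jX a o (G.act a b o <|f, ?w|>) = G.E.jX a o (eval_ar V (F.FO a) (G.FO a) o <|component F G a o u, F.act a b o <|f, z|>|>)"
  unfolding 2 component(2)[OF t(1,3) x] by simp
 then have "G.act a b o <|f, ?w|> = eval_ar V (F.FO a) (G.FO a) o <|component F G a o u, F.act a b o <|f, z|>|>"
  by (rule G.E.X_mono[OF _ t(1)]) (use t w x in simp_all)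
 then show "eval_ar V (F.FO a) (G.FO a) o <|component F G a o u, F.act a b o <|f, z|>|> = G.act a b o <|f, ?w|>" ..
qed simp_all

text \<open>A wedge prescribes the action on each summand of the objects of the category of elements; glued together, it is a map on
 objects over \<^term>\<open>IntC\<close> that satisfies the source condition.\<close>

lemma component_lift:
 assumes w: "psh_wedge F G x w"
 obtains h where "h : x ~> over F G" "!!a. a : S ==> component F G a o h = w a"
proof -
 note w = w[unfolded psh_wedge_iff[OF F G]]
 have x [simp]: "x : Ob V" and wt [simp]: "w a : Ar V" "Dom V (w a) = x" "Cod V (w a) = Exp V (F.FO a) (G.FO a)" if "a : S" for a
  using w that by simp_all
 have x [simp]: "x : Ob V" using w by blast
 let ?e = "\<lambda>a u z. eval_ar V (F.FO a) (G.FO a) o <|w a o u, z|>"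
 let ?y = "Prod V x F.E.X0" let ?u = "pr1 V x F.E.X0" and ?p = "pr2 V x F.E.X0"
 let ?val = "\<lambda>a r f. G.E.jX a o ?e a (?u o r) f"
 have p: "?p : ?y ~> F.E.X0" by simp
 have val: "?val i r f : z ~> G.E.X0 \<and> (\<forall>v s. s : v ~> z --> ?val i r f o s = ?val i (r o s) (f o s))"
  if "i : S" "r : z ~> ?y" "f : z ~> F.FO i" "?p o r = F.E.jX i o f" for i r f z
  using that(1-3) by simp
 obtain h0 where h0: "h0 : ?y ~> G.E.X0"
  "!!z r i f. [|i : S; r : z ~> ?y; f : z ~> F.FO i; ?p o r = F.E.jX i o f|] ==> h0 o r = ?val i r f"
  by (rule glues_single[OF small_index F.E.cX p G.E.X_typing(1), of ?val]) (use val in blast)+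
 note [simp] = h0(1)[unfolded Hom_iff]
 have h0e: "h0 o <|u, F.E.jX i o f|> = G.E.jX i o ?e i u f" if "i : S" "u : z ~> x" "f : z ~> F.FO i" for i u f z
  using h0(2)[of i "<|u, F.E.jX i o f|>" z f] that by simp
 obtain h where h: "h : x ~> over F G"
  "!!y u a. u : y ~> x ==> a : y ~> IOb F.El ==> sl0 F.\<pi> G.\<pi> (h o u) a = h0 o <|u, a|>"
 proof (rule dfib_slice_ex[OF G.\<pi>_discrete F.\<pi>_typing G.\<pi>_typing x, of h0])
  show "h0 : Prod V x (IOb F.El) ~> IOb G.El" by simp
  fix y u assume u: "u : y ~> x"
  { fix a assume a: "a : y ~> IOb F.El"
   show "I0 G.\<pi> o (h0 o <|u, a|>) = I0 F.\<pi> o a"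
   proof (rule coproduct_cases_eqI[OF small_index F.E.cX])
    show "a : y ~> F.E.X0" "I0 G.\<pi> o (h0 o <|u, a|>) : y ~> Int.X0" "I0 F.\<pi> o a : y ~> Int.X0" using a u by simp_all
    fix z r i g assume *: "i : S" "r : z ~> y" "g : z ~> F.FO i" "a o r = F.E.jX i o g"
    have ur: "u o r : z ~> x" using u *(2) by simp
    have "I0 G.\<pi> o (h0 o <|u o r, a o r|>) = I0 F.\<pi> o (a o r)"
     unfolding *(4) h0e[OF *(1) ur *(3)] using *(1-3) u by simp
    then show "(I0 G.\<pi> o (h0 o <|u, a|>)) o r = (I0 F.\<pi> o a) o r" using *(2) u a by simp
   qed }
  fix f n assume f: "f : y ~> IAr F.El" and n: "n : y ~> IAr G.El" "ITgt G.El o n = h0 o <|u, ITgt F.El o f|>" "I1 G.\<pi> o n = I1 F.\<pi> o f"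
  show "ISrc G.El o n = h0 o <|u, ISrc F.El o f|>"
  proof (rule F.E.cases_eqI[of f y])
   fix z r a b q assume *: "r : z ~> y" "a : S" "b : S" "q : z ~> (case (a, b) of (a, b) \<Rightarrow> Prod V (H a b) (F.FO b))" "f o r = F.E.jY (a, b) o q"
   let ?f = "pr1 V (H a b) (F.FO b) o q" and ?x = "pr2 V (H a b) (F.FO b) o q"
   have q: "?f : z ~> H a b" "?x : z ~> F.FO b" "q = <|?f, ?x|>" "F.act a b o q : z ~> F.FO a" using *(2-4) by simp_all
   have ur: "u o r : z ~> x" using u *(1) by simp
   let ?n = "G.E.jY (a, b) o <|?f, ?e b (u o r) ?x|>"
   have "G.E.tgt o (n o r) = h0 o <|u o r, F.E.tgt o (f o r)|>" using Cmp_eq_precomp[OF n(2), of r] f n(1) *(1) u by simp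
   also have "F.E.tgt o (f o r) = F.E.jX b o ?x" unfolding *(5) using *(2-4) by simp
   finally have 1: "G.E.tgt o (n o r) = G.E.tgt o ?n" unfolding h0e[OF *(3) ur q(2)] using *(2,3) q(1,2) ur by simp
   have "I1 G.\<pi> o (n o r) = I1 F.\<pi> o (f o r)" by (rule Cmp_eq_precomp[OF n(3)]) (use f n(1) *(1) in simp_all)
   then have 2: "I1 G.\<pi> o (n o r) = I1 G.\<pi> o ?n" unfolding *(5) using *(2-4) ur by simp
   have nr: "n o r = ?n"
    by (rule dfib_unique[OF G.\<pi>_discrete G.\<pi>_typing, of _ z]) (use 1 2 *(1-4) ur n(1) in simp_all)
   have "eval_ar V (F.FO a) (G.FO a) o <|w a o (u o r), F.act a b o <|?f, ?x|>|> = G.act a b o <|?f, ?e b (u o r) ?x|>"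
    using w *(2,3) ur q(1,2) by blast
   then have 3: "G.act a b o <|?f, ?e b (u o r) ?x|> = ?e a (u o r) (F.act a b o q)" unfolding q(3)[symmetric] ..
   have "G.E.src o (n o r) = G.E.jX a o (G.act a b o <|?f, ?e b (u o r) ?x|>)" unfolding nr using *(2-4) ur by simp
   also have "\<dots> = h0 o <|u o r, F.E.jX a o (F.act a b o q)|>" unfolding 3 h0e[OF *(2) ur q(4)] ..
   also have "F.E.jX a o (F.act a b o q) = F.E.src o (f o r)" unfolding *(5) using *(2-4) by simp
   finally show "(ISrc G.El o n) o r = (h0 o <|u, ISrc F.El o f|>) o r" using *(1) f n(1) u by simp
  qed (use f n(1) u in simp_all)
 qed blast
 show ?thesis
 proof (rule that[OF h(1)])
  fix a assume a: "a : S"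
  show "component F G a o h = w a"
  proof (rule component_eqI[OF a h(1)])
   show "w a : x ~> Exp V (F.FO a) (G.FO a)" using a by simp
   fix y u z assume t: "u : y ~> x" "z : y ~> F.FO a"
   have z: "F.E.jX a o z : y ~> IOb F.El" using t a by simp
   show "sl0 F.\<pi> G.\<pi> (h o u) (F.E.jX a o z) = G.E.jX a o ?e a u z"
    unfolding h(2)[OF t(1) z] by (rule h0e[OF a t])
  qed
 qed
qed

text \<open>The lift of a wedge exists by gluing and is unique because elements of the hom-object are detected on
 components.  So the ends that the enriched category of presheaves needs exist.\<close>

lemma over_end: "is_end V (vop V C) (vself V) F G (over F G) (component F G)"
 unfolding is_end_def
proof (intro conjI allI impI)
 fix x w assume "psh_wedge F G x w"
 then obtain h where "h : x ~> over F G" "!!a. a : S ==> component F G a o h = w a" by (rule component_lift) blast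
 then show "\<exists>!h. h : x ~> over F G \<and> (\<forall>a \<in> VOb (vop V C). component F G a o h = w a)"
  by (intro ex1I[of _ h]) (use components_eqI in simp_all)
qed (rule component_wedge)

text \<open>A point of the hom-object is the name of a functor, and its components are those of the functor.\<close>

lemma component_name:
 assumes H: "H' : Hom W F.El G.El" "G.\<pi> o\<^bsub>W\<^esub> H' = F.\<pi>" and a: "a : S" and r: "r : terminal V ~> Exp V (F.FO a) (G.FO a)"
  and e: "!!y z. z : y ~> F.FO a ==> I0 H' o (F.E.jX a o z) = G.E.jX a o (eval_ar V (F.FO a) (G.FO a) o <|r o bang V y, z|>)"
 shows "component F G a o slice_lift V F.\<pi> G.\<pi> (iname V H') = r"
proof (rule component_eqI[OF a slice_name(1)[OF F.\<pi>_typing G.\<pi>_typing H] r])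
 fix y u z assume t: "u : y ~> terminal V" "z : y ~> F.FO a"
 have "u = bang V y" by (rule terminal_eqI[of _ y]) (use t Hom_Ob[OF t(1)] in simp_all)
 then show "sl0 F.\<pi> G.\<pi> (slice_lift V F.\<pi> G.\<pi> (iname V H') o u) (F.E.jX a o z) = G.E.jX a o (eval_ar V (F.FO a) (G.FO a) o <|r o u, z|>)"
  using slice_name(2)[OF F.\<pi>_typing G.\<pi>_typing H, of u "F.E.jX a o z"] e[OF t(2)] t a by simp
qed

end

lemma has_ends: "has_ends (vop V C) (vself V)"
 unfolding has_ends_def using over_end by blast

lemma component_elements_map:
 assumes \<alpha>: "psh_nat F G \<alpha>" and a: "a : S"
 shows "component F G a o slice_lift V (proj F) (proj G) (iname V (emap F G \<alpha>)) = \<alpha> a"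
proof -
 have F: "psh F" and G: "psh G" using \<alpha> unfolding vnat_def by blast+
 show ?thesis
 proof (rule component_name[OF F G elements_map_typing[OF \<alpha>] elements_map_over[OF \<alpha>] a])
  show "\<alpha> a : terminal V ~> Exp V (VFOb F a) (VFOb G a)" using \<alpha> a unfolding vnat_def by simp
  show "I0 (emap F G \<alpha>) o (coin V S (VFOb F) a o z) = coin V S (VFOb G) a o (eval_ar V (VFOb F a) (VFOb G a) o <|\<alpha> a o bang V y, z|>)"
   if "z : y ~> VFOb F a" for y z
   using elements_map_component[OF \<alpha> a, of z] that by simp
 qed
qed

end

section \<open>The two equivalences\<close>

lemma (in ccc) vfun_cat_category:
 assumes A: "vcategory V A" and B: "vcategory V B" shows "category (vfun_cat V A B)"
proof -
 interpret B: vcat V B by unfold_locales (rule B)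
 let ?K = "vfun_cat V A B"
 have ext: "\<alpha> a = undefined" if "vnat V A B F G \<alpha>" "a \<notin> VOb A" for F G \<alpha> a
  using that unfolding vnat_def extensional_def by blast
 have fD: "vfunctor V A B F" "vfunctor V A B G" if "vnat V A B F G \<alpha>" for F G \<alpha> using that unfolding vnat_def by blast+
 have t: "\<alpha> a : Ar V" "Dom V (\<alpha> a) = terminal V" "Cod V (\<alpha> a) = VHom B (VFOb F a) (VFOb G a)" "VFOb F a : VOb B" "VFOb G a : VOb B"
  if "vnat V A B F G \<alpha>" "a : VOb A" for F G \<alpha> a
  using that vfunctorD(3)[OF fD(1)[OF that(1)], of a] vfunctorD(3)[OF fD(2)[OF that(1)], of a] unfolding vnat_def by simp_all
 have cmp: "vnat V A B F K (\<lambda>a \<in> VOb A. VCmp B (VFOb F a) (VFOb G a) (VFOb K a) o <|\<alpha> a, \<beta> a|>)"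
  if "vnat V A B F G \<alpha>" "vnat V A B G K \<beta>" for F G K \<alpha> \<beta>
 proof -
  note f = fD[OF that(1)] fD(2)[OF that(2)]
  have "is_wedge V A B F G (terminal V) \<alpha>" "is_wedge V A B G K (terminal V) \<beta>"
   using that unfolding vnat_iff_wedge[OF f(1,2)] vnat_iff_wedge[OF f(2,3)] by blast+
  from wedge_VCmp[OF f this] show ?thesis
   unfolding vnat_iff_wedge[OF f(1,3)] by (simp cong: wedge_cong)
 qed
 have id: "vnat V A B F F (\<lambda>a \<in> VOb A. VId B (VFOb F a))" if F: "vfunctor V A B F" for F
  unfolding vnat_iff_wedge[OF F F] using wedge_VId[OF F] by (simp cong: wedge_cong)
 show ?thesis
 proof
  fix f assume "f : Ar ?K" then show "Dom ?K f : Ob ?K" "Cod ?K f : Ob ?K" by (auto simp: vfun_cat_def vnat_def)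
 next
  fix F assume "F : Ob ?K" then show "Idn ?K F : Hom ?K F F" using id by (simp add: vfun_cat_def)
 next
  fix f g F G K assume "f : Hom ?K F G" "g : Hom ?K G K"
  then show "g o\<^bsub>?K\<^esub> f : Hom ?K F K" using cmp by (auto simp: vfun_cat_def)
 next
  fix f F G assume "f : Hom ?K F G"
  then obtain \<alpha> where f: "f = (F, G, \<alpha>)" "vnat V A B F G \<alpha>" by (auto simp: vfun_cat_def)
  have "(\<lambda>a \<in> VOb A. VCmp B (VFOb F a) (VFOb F a) (VFOb G a) o <|(\<lambda>a \<in> VOb A. VId B (VFOb F a)) a, \<alpha> a|>) = \<alpha>"
   by (rule HOL.ext) (use t[OF f(2)] ext[OF f(2)] in simp)
  then show "f o\<^bsub>?K\<^esub> Idn ?K F = f" unfolding f by (simp add: vfun_cat_def)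
  have "(\<lambda>a \<in> VOb A. VCmp B (VFOb F a) (VFOb G a) (VFOb G a) o <|\<alpha> a, (\<lambda>a \<in> VOb A. VId B (VFOb G a)) a|>) = \<alpha>"
   by (rule HOL.ext) (use t[OF f(2)] ext[OF f(2)] in simp)
  then show "Idn ?K G o\<^bsub>?K\<^esub> f = f" unfolding f by (simp add: vfun_cat_def)
 next
  fix f g h F G K L assume "f : Hom ?K F G" "g : Hom ?K G K" "h : Hom ?K K L"
  then obtain \<alpha> \<beta> \<gamma> where f: "f = (F, G, \<alpha>)" "vnat V A B F G \<alpha>" and g: "g = (G, K, \<beta>)" "vnat V A B G K \<beta>"
   and h: "h = (K, L, \<gamma>)" "vnat V A B K L \<gamma>" by (auto simp: vfun_cat_def)
  have "VCmp B (VFOb F a) (VFOb K a) (VFOb L a) o <|VCmp B (VFOb F a) (VFOb G a) (VFOb K a) o <|\<alpha> a, \<beta> a|>, \<gamma> a|> =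
   VCmp B (VFOb F a) (VFOb G a) (VFOb L a) o <|\<alpha> a, VCmp B (VFOb G a) (VFOb K a) (VFOb L a) o <|\<beta> a, \<gamma> a|>|>" if "a : VOb A" for a
   using t[OF f(2) that] t[OF g(2) that] t[OF h(2) that] by simp
  then have "(\<lambda>a \<in> VOb A. VCmp B (VFOb F a) (VFOb K a) (VFOb L a) o <|VCmp B (VFOb F a) (VFOb G a) (VFOb K a) o <|\<alpha> a, \<beta> a|>, \<gamma> a|>) =
   (\<lambda>a \<in> VOb A. VCmp B (VFOb F a) (VFOb G a) (VFOb L a) o <|\<alpha> a, VCmp B (VFOb G a) (VFOb K a) (VFOb L a) o <|\<beta> a, \<gamma> a|>|>)"
   by (rule restrict_ext)
  then show "h o\<^bsub>?K\<^esub> (g o\<^bsub>?K\<^esub> f) = (h o\<^bsub>?K\<^esub> g) o\<^bsub>?K\<^esub> f" unfolding f g h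
   by (simp add: vfun_cat_def cong: restrict_cong)
 qed
qed

lemma full_subcat_simps [simp]: "Ob (full_subcat K T) = Ob K \<inter> T" "Ar (full_subcat K T) = {f \<in> Ar K. Dom K f : T \<and> Cod K f : T}"
 "Dom (full_subcat K T) = Dom K" "Cod (full_subcat K T) = Cod K" "Idn (full_subcat K T) = Idn K" "Cmp (full_subcat K T) = Cmp K"
 by (simp_all add: full_subcat_def)

lemma full_subcat_category: "category K ==> category (full_subcat K T)"
 unfolding category_def Hom_def full_subcat_simps by (simp add: Hom_def)

context vext
begin

lemma name_VCmp:
 assumes P: "P : Hom W A X" and Q: "Q : Hom W B X" and R: "R : Hom W D X" "discrete_fibration V R"
  and H: "H' : Hom W A B" "Q o\<^bsub>W\<^esub> H' = P" and K: "K : Hom W B D" "R o\<^bsub>W\<^esub> K = Q"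
 shows "VCmp (slice_vcat V X) P Q R o <|slice_lift V P Q (iname V H'), slice_lift V Q R (iname V K)|> =
  slice_lift V P R (iname V (K o\<^bsub>W\<^esub> H'))"
proof -
 have KH: "K o\<^bsub>W\<^esub> H' : Hom W A D" "R o\<^bsub>W\<^esub> (K o\<^bsub>W\<^esub> H') = P"
  using H(1) K(1) R(1) W.Cmp_eq_precomp1[OF K(2), of H'] H(2) by simp_all
 note n = slice_name[OF P Q H] slice_name[OF Q R(1) K] slice_name[OF P R(1) KH]
 note [simp] = n(1)[unfolded Hom_iff] n(4)[unfolded Hom_iff] slice_VCmp(1)[OF P Q R(1), unfolded Hom_iff]
  H(1)[unfolded Hom_iff] K(1)[unfolded Hom_iff]
 let ?h = "slice_lift V P Q (iname V H')" and ?k = "slice_lift V Q R (iname V K)"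
 show ?thesis
 proof (rule dfib_slice_ext[OF R(2) P R(1) _ n(7)])
  show "VCmp (slice_vcat V X) P Q R o <|?h, ?k|> : terminal V ~> slice_hom V P R" by simp
  fix y u a assume t: "u : y ~> terminal V" "a : y ~> IOb A"
  have "sl0 P R ((VCmp (slice_vcat V X) P Q R o <|?h, ?k|>) o u) a = sl0 Q R (?k o u) (sl0 P Q (?h o u) a)"
   using slice_VCmp(2)[OF P Q R(1), of "?h o u" y "?k o u" a] t by simp
  also have "sl0 P Q (?h o u) a = I0 H' o a" using n(2)[of u a] t by simp
  also have "sl0 Q R (?k o u) (I0 H' o a) = I0 K o (I0 H' o a)" using n(5)[of u "I0 H' o a"] t W.Hom_Ob[OF H(1)] by simp
  finally show "sl0 P R ((VCmp (slice_vcat V X) P Q R o <|?h, ?k|>) o u) a = sl0 P R (slice_lift V P R (iname V (K o\<^bsub>W\<^esub> H')) o u) a"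
   using n(8)[of u a] t W.Hom_Ob[OF H(1)] W.Hom_Ob[OF K(1)] by simp
 qed
qed

lemma name_VId: "P : Hom W A X ==> VId (slice_vcat V X) P = slice_lift V P P (iname V (Idn W A))"
 by (simp add: slice_vcat_def)

lemma component_VCmp:
 assumes F: "psh F" and G: "psh G" and K: "psh K" and a: "a : S"
  and t: "h : y ~> over F G" "k : y ~> over G K"
 shows "component F K a o (VCmp (slice_vcat V IntC) (proj F) (proj G) (proj K) o <|h, k|>) =
  VCmp (vself V) (VFOb F a) (VFOb G a) (VFOb K a) o <|component F G a o h, component G K a o k|>"
proof -
 interpret F: presheaf V U C F by (rule presheafD[OF F])
 interpret G: presheaf V U C G by (rule presheafD[OF G])
 interpret K: presheaf V U C K by (rule presheafD[OF K])
 note C = slice_VCmp[OF F.\<pi>_typing G.\<pi>_typing K.\<pi>_typing]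
 note [simp] = component_typing[OF F G] component_typing[OF G K] C(1)[unfolded Hom_iff] t[unfolded Hom_iff]
 show ?thesis
 proof (rule component_eqI[OF F K a])
  fix x u z assume u: "u : x ~> y" and z: "z : x ~> F.FO a"
  have 1: "h o u : x ~> over F G" "k o u : x ~> over G K" "F.E.jX a o z : x ~> IOb F.El"
   "eval_ar V (F.FO a) (G.FO a) o <|component F G a o (h o u), z|> : x ~> G.FO a" using u z a by simp_all
  have "sl0 F.\<pi> K.\<pi> (VCmp (slice_vcat V IntC) F.\<pi> G.\<pi> K.\<pi> o <|h o u, k o u|>) (F.E.jX a o z) =
    K.E.jX a o (eval_ar V (G.FO a) (K.FO a) o <|component G K a o (k o u), eval_ar V (F.FO a) (G.FO a) o <|component F G a o (h o u), z|>|>)"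
   unfolding C(2)[OF 1(1-3)] component(2)[OF F G a 1(1) z] component(2)[OF G K a 1(2,4)] ..
  then show "sl0 F.\<pi> K.\<pi> ((VCmp (slice_vcat V IntC) F.\<pi> G.\<pi> K.\<pi> o <|h, k|>) o u) (F.E.jX a o z) =
   K.E.jX a o (eval_ar V (F.FO a) (K.FO a) o <|(VCmp (vself V) (F.FO a) (G.FO a) (K.FO a) o <|component F G a o h, component G K a o k|>) o u, z|>)"
   using u z a by simp
 qed (use a in simp_all)
qed

lemma component_VId:
 assumes F: "psh F" and a: "a : S"
 shows "component F F a o VId (slice_vcat V IntC) (proj F) = VId (vself V) (VFOb F a)"
proof -
 interpret F: presheaf V U C F by (rule presheafD[OF F])
 note C = slice_VId[OF F.\<pi>_typing]
 note [simp] = component_typing[OF F F] C(1)[unfolded Hom_iff]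
 show ?thesis
 proof (rule component_eqI[OF F F a])
  fix x u z assume u: "u : x ~> terminal V" and z: "z : x ~> F.FO a"
  show "sl0 F.\<pi> F.\<pi> (VId (slice_vcat V IntC) F.\<pi> o u) (F.E.jX a o z) =
   F.E.jX a o (eval_ar V (F.FO a) (F.FO a) o <|VId (vself V) (F.FO a) o u, z|>)"
   using C(2)[of u "F.E.jX a o z"] u z a by simp
 qed (use a in simp_all)
qed

text \<open>Both the chosen end and the hom-object over \<^term>\<open>IntC\<close> are ends of the same pair; this is the canonical
 isomorphism between them.\<close>

definition "end_over F G = (SOME h. h : psh_End F G ~> over F G \<and>
  (\<forall>a \<in> S. component F G a o h = psh_pr F G a))"

lemma end_over:
 assumes F: "psh F" and G: "psh G"
 shows "end_over F G : Ar V" "Dom V (end_over F G) = psh_End F G" "Cod V (end_over F G) = over F G"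
  "[|a : S; h : Ar V; Cod V h = psh_End F G|] ==> component F G a o (end_over F G o h) = psh_pr F G a o h"
proof -
 have w: "psh_wedge F G (psh_End F G) (psh_pr F G)"
  using is_end[OF has_ends F G] unfolding is_end_def by blast
 have "\<exists>h. h : psh_End F G ~> over F G \<and> (\<forall>a \<in> S. component F G a o h = psh_pr F G a)"
  by (rule component_lift[OF F G w]) blast
 from someI_ex[OF this, folded end_over_def]
 have h: "end_over F G : psh_End F G ~> over F G"
  "!!a. a : S ==> component F G a o end_over F G = psh_pr F G a" by blast+
 then show "end_over F G : Ar V" "Dom V (end_over F G) = psh_End F G" "Cod V (end_over F G) = over F G" by simp_all
 show "[|a : S; h : Ar V; Cod V h = psh_End F G|] ==> component F G a o (end_over F G o h) = psh_pr F G a o h"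
  by (rule Cmp_eq_precomp1[OF h(2)]) (use h(1) component_typing[OF F G] in simp_all)
qed

definition "elements_vfunctor = \<lparr>VFOb = restrict proj (Collect psh), VFHom = (\<lambda>F G. if psh F \<and> psh G then end_over F G else undefined)\<rparr>"

lemma elements_vfunctor:
 "vfunctor V (presheaves_vcat V C) (DFib_vcat V IntC) elements_vfunctor"
proof (rule vfunctorI)
 show "vcategory V (presheaves_vcat V C)" by (rule vfun_vcat_vcategory[OF has_ends vop_vcategory vself_vcategory])
 show "vcategory V (DFib_vcat V IntC)" unfolding DFib_vcat_def by (rule vfull_vcategory[OF slice_vcategory[OF IntC_Ob]])
 show "VFOb elements_vfunctor F : VOb (DFib_vcat V IntC)" if "F : VOb (presheaves_vcat V C)" for F
  using that proj[of F] by (simp add: elements_vfunctor_def DFib_vcat_def)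
 show "VFHom elements_vfunctor F G : VHom (presheaves_vcat V C) F G ~> VHom (DFib_vcat V IntC) (VFOb elements_vfunctor F) (VFOb elements_vfunctor G)"
  if "F : VOb (presheaves_vcat V C)" "G : VOb (presheaves_vcat V C)" for F G
  using that end_over[of F G] by (simp add: elements_vfunctor_def DFib_vcat_def)
next
 fix F G K x f g assume *: "F : VOb (presheaves_vcat V C)" "G : VOb (presheaves_vcat V C)" "K : VOb (presheaves_vcat V C)"
  "f : x ~> VHom (presheaves_vcat V C) F G" "g : x ~> VHom (presheaves_vcat V C) G K"
 then have p: "psh F" "psh G" "psh K" by simp_all
 have fg: "f : x ~> psh_End F G" "g : x ~> psh_End G K" using * by simp_all
 note E = end_over[OF p(1,2)] end_over[OF p(2,3)] end_over[OF p(1,3)]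
 note B = vfun_vcat_VCmp[OF has_ends p]
 have hk: "end_over F G o f : x ~> over F G" "end_over G K o g : x ~> over G K" using fg E by simp_all
 have D: "VCmp (slice_vcat V IntC) (proj F) (proj G) (proj K) : Prod V (over F G) (over G K) ~> over F K"
  by (rule slice_VCmp(1)) (rule proj p)+
 have "end_over F K o (VCmp (presheaves_vcat V C) F G K o <|f, g|>) =
   VCmp (slice_vcat V IntC) (proj F) (proj G) (proj K) o <|end_over F G o f, end_over G K o g|>"
 proof (rule components_eqI[OF p(1,3), of _ x])
  fix a assume a: "a : S"
  show "component F K a o (end_over F K o (VCmp (presheaves_vcat V C) F G K o <|f, g|>)) =
   component F K a o (VCmp (slice_vcat V IntC) (proj F) (proj G) (proj K) o <|end_over F G o f, end_over G K o g|>)"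
   unfolding component_VCmp[OF p a hk] using a fg E(4)[of a f] E(8)[of a g] E(12)[of a "VCmp (presheaves_vcat V C) F G K o <|f, g|>"]
    B(2)[of a f g] B(1) by simp
 qed (use fg E hk D B(1) in simp_all)
 then show "VFHom elements_vfunctor F K o (VCmp (presheaves_vcat V C) F G K o <|f, g|>) =
   VCmp (DFib_vcat V IntC) (VFOb elements_vfunctor F) (VFOb elements_vfunctor G) (VFOb elements_vfunctor K) o
    <|VFHom elements_vfunctor F G o f, VFHom elements_vfunctor G K o g|>"
  using p by (simp add: elements_vfunctor_def DFib_vcat_def)
next
 fix F assume "F : VOb (presheaves_vcat V C)"
 then have F: "psh F" by simp
 note I = vfun_vcat_VId[OF has_ends F] and J = slice_VId(1)[OF proj(1)[OF F]] and E = end_over[OF F F]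
 have "end_over F F o VId (presheaves_vcat V C) F = VId (slice_vcat V IntC) (proj F)"
 proof (rule components_eqI[OF F F, of _ "terminal V"])
  fix a assume a: "a : S"
  show "component F F a o (end_over F F o VId (presheaves_vcat V C) F) = component F F a o VId (slice_vcat V IntC) (proj F)"
   unfolding component_VId[OF F a] using E(4)[of a "VId (presheaves_vcat V C) F"] I(1,2) a by simp
 qed (use I(1) J E in simp_all)
 then show "VFHom elements_vfunctor F F o VId (presheaves_vcat V C) F = VId (DFib_vcat V IntC) (VFOb elements_vfunctor F)"
  using F by (simp add: elements_vfunctor_def DFib_vcat_def)
qed (auto simp: elements_vfunctor_def)

text \<open>The hom-maps are invertible as comparisons of ends, and every discrete fibration is isomorphic to a category
 of elements.\<close>

lemma elements_vequivalence:
 "is_vequivalence V (presheaves_vcat V C) (DFib_vcat V IntC) elements_vfunctor"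
proof (rule vequivalenceI[OF elements_vfunctor, where \<psi> = "\<lambda>F G. psh_lift F G (over F G) (component F G)"])
 fix F G assume "F : VOb (presheaves_vcat V C)" "G : VOb (presheaves_vcat V C)"
 then have p: "psh F" "psh G" by simp_all
 note E = end_over[OF p] and L = end_lift[OF has_ends p component_wedge[OF p]] and N = component_typing[OF p] and D = End_simps[OF has_ends p]
 have e: "VFHom elements_vfunctor F G = end_over F G" "VFOb elements_vfunctor F = proj F" "VFOb elements_vfunctor G = proj G"
  using p by (simp_all add: elements_vfunctor_def)
 let ?l = "psh_lift F G (over F G) (component F G)"
 show "?l : VHom (DFib_vcat V IntC) (VFOb elements_vfunctor F) (VFOb elements_vfunctor G) ~> VHom (presheaves_vcat V C) F G"
  unfolding e using L by (simp add: DFib_vcat_def)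
 have "end_over F G o ?l = Idn V (over F G)"
  by (rule components_eqI[OF p, of _ "over F G"]) (use E L N in simp_all)
 then show "VFHom elements_vfunctor F G o ?l = Idn V (VHom (DFib_vcat V IntC) (VFOb elements_vfunctor F) (VFOb elements_vfunctor G))"
  unfolding e by (simp add: DFib_vcat_def)
 have "?l o end_over F G = Idn V (psh_End F G)"
 proof (rule end_eqI[OF has_ends p])
  fix a assume a: "a : VOb (vop V C)"
  have "psh_pr F G a o (?l o end_over F G) = component F G a o end_over F G"
   by (rule Cmp_eq_precomp1[OF L(4)[OF a]]) (use a D E L in simp_all)
  then show "psh_pr F G a o (?l o end_over F G) = psh_pr F G a o Idn V (psh_End F G)"
   using E(4)[of a "Idn V (psh_End F G)"] E(1-3) a D by simp
 qed (use E L D in simp_all)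
 then show "?l o VFHom elements_vfunctor F G = Idn V (VHom (presheaves_vcat V C) F G)" unfolding e by simp
next
 fix P assume P: "P : VOb (DFib_vcat V IntC)"
 define A where "A = Dom W P"
 have P: "discrete_fibration V P" "P : Hom W A IntC" using P by (simp_all add: DFib_vcat_def A_def)
 obtain F H' K where F: "psh F" and H: "H' : Hom W (elements V C F) A" "P o\<^bsub>W\<^esub> H' = proj F"
  and K: "K : Hom W A (elements V C F)" "proj F o\<^bsub>W\<^esub> K = P"
  and HK: "H' o\<^bsub>W\<^esub> K = Idn W A" "K o\<^bsub>W\<^esub> H' = Idn W (elements V C F)" by (rule dfib_elements[OF P])
 note f = proj[OF F]
 let ?e = "slice_lift V (proj F) P (iname V H')" and ?e' = "slice_lift V P (proj F) (iname V K)"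
 have e: "VFOb elements_vfunctor F = proj F" using F by (simp add: elements_vfunctor_def)
 show "\<exists>F \<in> VOb (presheaves_vcat V C). \<exists>e e'. e : terminal V ~> VHom (DFib_vcat V IntC) (VFOb elements_vfunctor F) P \<and>
   e' : terminal V ~> VHom (DFib_vcat V IntC) P (VFOb elements_vfunctor F) \<and>
   VCmp (DFib_vcat V IntC) (VFOb elements_vfunctor F) P (VFOb elements_vfunctor F) o <|e, e'|> = VId (DFib_vcat V IntC) (VFOb elements_vfunctor F) \<and>
   VCmp (DFib_vcat V IntC) P (VFOb elements_vfunctor F) P o <|e', e|> = VId (DFib_vcat V IntC) P"
 proof (rule bexI[of _ F], rule exI[of _ ?e], rule exI[of _ ?e'], unfold e, intro conjI)
  show "?e : terminal V ~> VHom (DFib_vcat V IntC) (proj F) P"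
   using slice_name(1)[OF f(1) P(2) H] by (simp add: DFib_vcat_def)
  show "?e' : terminal V ~> VHom (DFib_vcat V IntC) P (proj F)"
   using slice_name(1)[OF P(2) f(1) K] by (simp add: DFib_vcat_def)
  show "VCmp (DFib_vcat V IntC) (proj F) P (proj F) o <|?e, ?e'|> = VId (DFib_vcat V IntC) (proj F)"
   unfolding DFib_vcat_def vfull_simps name_VCmp[OF f(1) P(2) f H K] name_VId[OF f(1)] HK ..
  show "VCmp (DFib_vcat V IntC) P (proj F) P o <|?e', ?e|> = VId (DFib_vcat V IntC) P"
   unfolding DFib_vcat_def vfull_simps name_VCmp[OF P(2) f(1) P(2,1) K H] name_VId[OF P(2)] HK ..
 qed (use F in simp)
qed

lemma DFib_simps [simp]: "Ob (DFib V IntC) = {P \<in> Ar W. Cod W P = IntC \<and> discrete_fibration V P}"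
 "(P, Q, H') : Hom (DFib V IntC) P' Q' \<longleftrightarrow> P' = P \<and> Q' = Q \<and> P : Ob (DFib V IntC) \<and> Q : Ob (DFib V IntC) \<and> H' : Hom W (Dom W P) (Dom W Q) \<and> Q o\<^bsub>W\<^esub> H' = P"
 by (auto simp: DFib_def)

lemma elements_map_eqI:
 assumes \<alpha>: "psh_nat F G \<alpha>" and H: "H' : Hom W (elements V C F) (elements V C G)" "proj G o\<^bsub>W\<^esub> H' = proj F"
  and e: "!!a. a : S ==> I0 H' o coin V S (VFOb F) a = coin V S (VFOb G) a o (eval_ar V (VFOb F a) (VFOb G a) o <|\<alpha> a o bang V (VFOb F a), Idn V (VFOb F a)|>)"
 shows "emap F G \<alpha> = H'"
proof -
 have F: "psh F" and G: "psh G" using \<alpha> unfolding vnat_def by blast+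
 interpret F: presheaf V U C F by (rule presheafD[OF F])
 interpret G: presheaf V U C G by (rule presheafD[OF G])
 note m = elements_map_typing[OF \<alpha>] elements_map_over[OF \<alpha>]
 note [simp] = H(1)[unfolded Hom_iff] m(1)[unfolded Hom_iff]
 show ?thesis
 proof (rule dfib_functor_ext[OF G.\<pi>_discrete F.\<pi>_typing G.\<pi>_typing m(1) H(1) m(2) H(2)], rule coproduct_eqI[OF F.E.cX])
  show "I0 (emap F G \<alpha>) : F.E.X0 ~> G.E.X0" "I0 H' : F.E.X0 ~> G.E.X0" by simp_all
  fix a assume a: "a : S"
  show "I0 (emap F G \<alpha>) o F.E.jX a = I0 H' o F.E.jX a"
   unfolding e[OF a] using elements_map_component[OF \<alpha> a, of "Idn V (F.FO a)"] a by simp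
 qed
qed

text \<open>Points of the hom-object are both wedges at the terminal object, that is natural transformations, and names
 of functors over \<^term>\<open>IntC\<close>.\<close>

lemma elements_map_bij:
 assumes F: "psh F" and G: "psh G"
 shows "bij_betw (emap F G) {\<alpha>. psh_nat F G \<alpha>} {H' \<in> Hom W (elements V C F) (elements V C G). proj G o\<^bsub>W\<^esub> H' = proj F}"
proof (rule bij_betw_imageI)
 interpret F: presheaf V U C F by (rule presheafD[OF F])
 interpret G: presheaf V U C G by (rule presheafD[OF G])
 show "inj_on (emap F G) {\<alpha>. psh_nat F G \<alpha>}"
 proof (rule inj_onI)
  fix \<alpha> \<beta> assume "\<alpha> : {\<alpha>. psh_nat F G \<alpha>}" "\<beta> : {\<alpha>. psh_nat F G \<alpha>}"
   and e: "emap F G \<alpha> = emap F G \<beta>"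
  then have \<alpha>\<beta>: "psh_nat F G \<alpha>" "psh_nat F G \<beta>" by simp_all
  have "\<alpha> : extensional S" "\<beta> : extensional S" using \<alpha>\<beta> unfolding vnat_def by simp_all
  then show "\<alpha> = \<beta>"
   by (rule extensionalityI) (metis component_elements_map \<alpha>\<beta> e)
 qed
 show "emap F G ` {\<alpha>. psh_nat F G \<alpha>} = {H' \<in> Hom W F.El G.El. G.\<pi> o\<^bsub>W\<^esub> H' = F.\<pi>}"
 proof (intro equalityI subsetI)
  fix H' assume "H' : emap F G ` {\<alpha>. psh_nat F G \<alpha>}"
  then show "H' : {H' \<in> Hom W F.El G.El. G.\<pi> o\<^bsub>W\<^esub> H' = F.\<pi>}" using elements_map_typing elements_map_over by blast
 next
  fix H' assume "H' : {H' \<in> Hom W F.El G.El. G.\<pi> o\<^bsub>W\<^esub> H' = F.\<pi>}"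
  then have H: "H' : Hom W F.El G.El" "G.\<pi> o\<^bsub>W\<^esub> H' = F.\<pi>" by blast+
  let ?n = "slice_lift V F.\<pi> G.\<pi> (iname V H')"
  note n = slice_name[OF F.\<pi>_typing G.\<pi>_typing H]
  let ?\<alpha> = "\<lambda>a \<in> S. component F G a o ?n"
  have \<alpha>: "psh_nat F G ?\<alpha>"
   unfolding vnat_iff_wedge[OF F G]
   by (intro conjI iffD1[OF wedge_cong wedge_precomp[OF F G component_wedge[OF F G] n(1)]]) simp_all
  note [simp] = H(1)[unfolded Hom_iff] n(1)[unfolded Hom_iff] component_typing[OF F G]
  have e: "emap F G ?\<alpha> = H'"
  proof (rule elements_map_eqI[OF \<alpha> H])
   fix a assume a: "a : S"
   let ?b = "bang V (F.FO a)" and ?i = "Idn V (F.FO a)"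
   have t: "?n o ?b : F.FO a ~> over F G" "?i : F.FO a ~> F.FO a" using a by simp_all
   show "I0 H' o F.E.jX a = G.E.jX a o (eval_ar V (F.FO a) (G.FO a) o <|?\<alpha> a o ?b, ?i|>)"
    using n(2)[of ?b "F.E.jX a o ?i"] component(2)[OF F G a t] a by simp
  qed
  show "H' : emap F G ` {\<alpha>. psh_nat F G \<alpha>}"
   by (rule image_eqI[where f="emap F G", OF e[symmetric]]) (use \<alpha> in simp)
 qed
qed

lemma presheaves_simps [simp]: "Ob (presheaves V C) = Collect psh"
 "(F, G, \<alpha>) : Ar (presheaves V C) \<longleftrightarrow> psh_nat F G \<alpha>"
 "Dom (presheaves V C) (F, G, \<alpha>) = F" "Cod (presheaves V C) (F, G, \<alpha>) = G"
 "Idn (presheaves V C) F = (F, F, \<lambda>a \<in> S. VId (vself V) (VFOb F a))"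
 "(G, K, \<beta>) o\<^bsub>presheaves V C\<^esub> (F, G', \<alpha>) = (F, K, \<lambda>a \<in> S. VCmp (vself V) (VFOb F a) (VFOb G a) (VFOb K a) o <|\<alpha> a, \<beta> a|>)"
 by (simp_all add: vfun_cat_def)

lemma grothendieck_simps [simp]: "psh F ==> FOb (grothendieck V C) F = proj F"
 "psh_nat F G \<alpha> ==> FAr (grothendieck V C) (F, G, \<alpha>) = (proj F, proj G, emap F G \<alpha>)"
 by (simp_all add: grothendieck_def)

lemma grothendieck_functor: "is_functor (presheaves V C) (DFib V IntC) (grothendieck V C)"
proof -
 have psh: "category (presheaves V C)" by (rule vfun_cat_category[OF vop_vcategory vself_vcategory])
 have dfib: "category (DFib V IntC)" unfolding DFib_def by (rule full_subcat_category[OF W.slice_category])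
 have nD: "psh F" "psh G" if "psh_nat F G \<alpha>" for F G \<alpha> using that unfolding vnat_def by blast+
 have pD: "proj F : Ar W" "Dom W (proj F) = elements V C F" "Cod W (proj F) = IntC" if "psh F" for F using proj(1)[OF that] by simp_all
 show ?thesis
  unfolding is_functor_def
 proof (intro conjI ballI allI)
  show "FOb (grothendieck V C) : Ob (presheaves V C) \<rightarrow>\<^sub>E Ob (DFib V IntC)"
   using proj by (auto simp: grothendieck_def)
  show "FAr (grothendieck V C) : extensional (Ar (presheaves V C))" by (simp add: grothendieck_def)
 next
  fix F G f assume "f : Hom (presheaves V C) F G"
  then obtain \<alpha> where f: "f = (F, G, \<alpha>)" "psh_nat F G \<alpha>" by (cases f) auto
  show "FAr (grothendieck V C) f : Hom (DFib V IntC) (FOb (grothendieck V C) F) (FOb (grothendieck V C) G)"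
   unfolding f(1) using f(2) nD[OF f(2)] pD proj(2) elements_map_typing[OF f(2)] elements_map_over[OF f(2)] by (simp del: Hom_iff add: Hom_iff[of _ W])
 next
  fix F assume F': "F : Ob (presheaves V C)"
  then have F: "psh F" by simp
  interpret F: presheaf V U C F by (rule presheafD[OF F])
  have \<alpha>: "psh_nat F F (\<lambda>a \<in> S. VId (vself V) (VFOb F a))"
   using category.Idn_Hom[OF psh F'] by simp
  have "emap F F (\<lambda>a \<in> S. VId (vself V) (VFOb F a)) = Idn W F.El"
   by (rule elements_map_eqI[OF \<alpha>]) (use F.\<pi>_typing in simp_all)
  then show "FAr (grothendieck V C) (Idn (presheaves V C) F) = Idn (DFib V IntC) (FOb (grothendieck V C) F)"
   using F \<alpha> pD[OF F] by (simp add: DFib_def)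
 next
  fix F G K f g assume f: "f : Hom (presheaves V C) F G" and g: "g : Hom (presheaves V C) G K"
  obtain \<alpha> where \<alpha>: "f = (F, G, \<alpha>)" "psh_nat F G \<alpha>" using f by (cases f) auto
  obtain \<beta> where \<beta>: "g = (G, K, \<beta>)" "psh_nat G K \<beta>" using g by (cases g) auto
  let ?\<gamma> = "\<lambda>a \<in> S. VCmp (vself V) (VFOb F a) (VFOb G a) (VFOb K a) o <|\<alpha> a, \<beta> a|>"
  have \<gamma>: "psh_nat F K ?\<gamma>"
   using category.Cmp_Hom[OF psh f g] \<alpha>(1) \<beta>(1) by simp
  have F: "psh F" and G: "psh G" and K: "psh K" using nD[OF \<alpha>(2)] nD[OF \<beta>(2)] by blast+
  interpret F: presheaf V U C F by (rule presheafD[OF F])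
  interpret G: presheaf V U C G by (rule presheafD[OF G])
  interpret K: presheaf V U C K by (rule presheafD[OF K])
  note a = elements_map_typing[OF \<alpha>(2)] elements_map_over[OF \<alpha>(2)] and b = elements_map_typing[OF \<beta>(2)] elements_map_over[OF \<beta>(2)]
  note [simp] = a(1)[unfolded Hom_iff] b(1)[unfolded Hom_iff] pD[OF K]
  have "emap F K ?\<gamma> = emap G K \<beta> o\<^bsub>W\<^esub> emap F G \<alpha>"
  proof (rule elements_map_eqI[OF \<gamma>])
   show "emap G K \<beta> o\<^bsub>W\<^esub> emap F G \<alpha> : Hom W F.El K.El" by simp
   show "K.\<pi> o\<^bsub>W\<^esub> (emap G K \<beta> o\<^bsub>W\<^esub> emap F G \<alpha>) = F.\<pi>"
    using W.Cmp_eq_precomp1[OF b(2), of "emap F G \<alpha>"] a(2) by simp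
   fix c assume c: "c : S"
   have t: "\<alpha> c : Ar V" "Dom V (\<alpha> c) = terminal V" "Cod V (\<alpha> c) = Exp V (F.FO c) (G.FO c)"
    "\<beta> c : Ar V" "Dom V (\<beta> c) = terminal V" "Cod V (\<beta> c) = Exp V (G.FO c) (K.FO c)"
    using \<alpha>(2) \<beta>(2) c unfolding vnat_def by simp_all
   show "I0 (emap G K \<beta> o\<^bsub>W\<^esub> emap F G \<alpha>) o F.E.jX c =
     K.E.jX c o (eval_ar V (F.FO c) (K.FO c) o <|?\<gamma> c o bang V (F.FO c), Idn V (F.FO c)|>)"
    using elements_map_component[OF \<alpha>(2) c, of "Idn V (F.FO c)"]
     elements_map_component[OF \<beta>(2) c, of "eval_ar V (F.FO c) (G.FO c) o <|\<alpha> c o bang V (F.FO c), Idn V (F.FO c)|>"] t c by simp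
  qed
  then show "FAr (grothendieck V C) (g o\<^bsub>presheaves V C\<^esub> f) = FAr (grothendieck V C) g o\<^bsub>DFib V IntC\<^esub> FAr (grothendieck V C) f"
   unfolding \<alpha>(1) \<beta>(1) using \<gamma> \<alpha>(2) \<beta>(2) by (simp add: DFib_def)
 qed (rule psh dfib)+
qed

lemma grothendieck_equivalence: "is_equivalence (presheaves V C) (DFib V IntC) (grothendieck V C)"
proof (rule equivalenceI[OF grothendieck_functor])
 fix F G assume "F : Ob (presheaves V C)" "G : Ob (presheaves V C)"
 then have p: "psh F" "psh G" by simp_all
 note f = proj[OF p(1)] proj[OF p(2)]
 have h: "Hom (presheaves V C) F G = (\<lambda>\<alpha>. (F, G, \<alpha>)) ` {\<alpha>. psh_nat F G \<alpha>}" by auto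
 have "Hom (DFib V IntC) (proj F) (proj G) = (\<lambda>H'. (proj F, proj G, H')) ` {H' \<in> Hom W (elements V C F) (elements V C G). proj G o\<^bsub>W\<^esub> H' = proj F}"
 proof (rule set_eqI)
  fix x show "x : Hom (DFib V IntC) (proj F) (proj G) \<longleftrightarrow>
   x : (\<lambda>H'. (proj F, proj G, H')) ` {H' \<in> Hom W (elements V C F) (elements V C G). proj G o\<^bsub>W\<^esub> H' = proj F}"
   using f by (cases x) (auto simp del: Hom_iff simp: Hom_iff[of _ W])
 qed
 also have "\<dots> = (\<lambda>H'. (proj F, proj G, H')) ` emap F G ` {\<alpha>. psh_nat F G \<alpha>}"
  unfolding bij_betw_imp_surj_on[OF elements_map_bij[OF p]] ..
 also have "\<dots> = FAr (grothendieck V C) ` Hom (presheaves V C) F G"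
  unfolding h image_image by (rule image_cong) simp_all
 finally have im: "FAr (grothendieck V C) ` Hom (presheaves V C) F G = Hom (DFib V IntC) (proj F) (proj G)" ..
 have "inj_on (FAr (grothendieck V C)) (Hom (presheaves V C) F G)"
  using bij_betw_imp_inj_on[OF elements_map_bij[OF p]] unfolding h inj_on_def by simp
 then show "bij_betw (FAr (grothendieck V C)) (Hom (presheaves V C) F G) (Hom (DFib V IntC) (FOb (grothendieck V C) F) (FOb (grothendieck V C) G))"
  using im p by (simp add: bij_betw_def)
next
 fix P assume "P : Ob (DFib V IntC)"
 then have P: "discrete_fibration V P" "P : Hom W (Dom W P) IntC" by simp_all
 obtain F H' K where F: "psh F" and H: "H' : Hom W (elements V C F) (Dom W P)" "P o\<^bsub>W\<^esub> H' = proj F"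
  and K: "K : Hom W (Dom W P) (elements V C F)" "proj F o\<^bsub>W\<^esub> K = P"
  and HK: "H' o\<^bsub>W\<^esub> K = Idn W (Dom W P)" "K o\<^bsub>W\<^esub> H' = Idn W (elements V C F)" by (rule dfib_elements[OF P])
 note f = proj[OF F]
 have Ho: "(proj F, P, H') : Hom (DFib V IntC) (proj F) P" "(P, proj F, K) : Hom (DFib V IntC) P (proj F)"
  using P f H K by (simp_all del: Hom_iff add: Hom_iff[of _ W])
 have "is_iso (DFib V IntC) (proj F, P, H')"
  unfolding is_iso_def
 proof (intro conjI bexI)
  show "(P, proj F, K) o\<^bsub>DFib V IntC\<^esub> (proj F, P, H') = Idn (DFib V IntC) (Dom (DFib V IntC) (proj F, P, H'))"
   "(proj F, P, H') o\<^bsub>DFib V IntC\<^esub> (P, proj F, K) = Idn (DFib V IntC) (Cod (DFib V IntC) (proj F, P, H'))"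
   using HK f(1) by (simp_all add: DFib_def)
  show "(proj F, P, H') : Ar (DFib V IntC)"
   "(P, proj F, K) : Hom (DFib V IntC) (Cod (DFib V IntC) (proj F, P, H')) (Dom (DFib V IntC) (proj F, P, H'))"
   using Ho unfolding Hom_iff by simp_all
 qed
 then show "\<exists>F \<in> Ob (presheaves V C). \<exists>e. e : Hom (DFib V IntC) (FOb (grothendieck V C) F) P \<and> is_iso (DFib V IntC) e"
  using F Ho(1) by (intro bexI[of _ F] exI[of _ "(proj F, P, H')"]) simp_all
qed

lemma elements_vfunctor_underlying:
 "functor_comp (presheaves V C) (underlying_functor V (presheaves_vcat V C) elements_vfunctor) (vfun_comparison V (vop V C) (vself V)) =
  functor_comp (presheaves V C) (DFib_comparison V IntC) (grothendieck V C)"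
proof -
 have ob: "FOb (underlying_functor V (presheaves_vcat V C) elements_vfunctor) (FOb (vfun_comparison V (vop V C) (vself V)) F) =
   FOb (DFib_comparison V IntC) (FOb (grothendieck V C) F)" if "psh F" for F
  using that proj[OF that] by (simp add: underlying_functor_def underlying_def vfun_comparison_def DFib_comparison_def elements_vfunctor_def)
 have ar: "FAr (underlying_functor V (presheaves_vcat V C) elements_vfunctor) (FAr (vfun_comparison V (vop V C) (vself V)) (F, G, \<alpha>)) =
   FAr (DFib_comparison V IntC) (FAr (grothendieck V C) (F, G, \<alpha>))" if \<alpha>: "psh_nat F G \<alpha>" for F G \<alpha>
 proof -
  have p: "psh F" "psh G" using \<alpha> unfolding vnat_def by blast+
  note f = proj[OF p(1)] proj[OF p(2)] and m = elements_map_typing[OF \<alpha>] elements_map_over[OF \<alpha>]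
  have w: "psh_wedge F G (terminal V) \<alpha>" using \<alpha> unfolding vnat_iff_wedge[OF p] by blast
  note L = end_lift[OF has_ends p w] and E = end_over[OF p] and n = slice_name(1)[OF f(1,3) m]
  let ?l = "psh_lift F G (terminal V) \<alpha>"
  have "end_over F G o ?l = slice_lift V (proj F) (proj G) (iname V (emap F G \<alpha>))"
   by (rule components_eqI[OF p _ n]) (use E L component_elements_map[OF \<alpha>] in simp_all)
  moreover have "FAr (DFib_comparison V IntC) (proj F, proj G, emap F G \<alpha>) =
    (proj F, proj G, slice_lift V (proj F) (proj G) (iname V (emap F G \<alpha>)))"
   using f m by (simp add: DFib_comparison_def DFib_def)
  ultimately show ?thesis
   using \<alpha> p L by (simp add: underlying_functor_def underlying_def vfun_comparison_def elements_vfunctor_def)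
 qed
 have ar': "FAr (underlying_functor V (presheaves_vcat V C) elements_vfunctor) (FAr (vfun_comparison V (vop V C) (vself V)) f) =
   FAr (DFib_comparison V IntC) (FAr (grothendieck V C) f)" if "f : Ar (presheaves V C)" for f
  using that ar by (cases f) simp
 show ?thesis
  unfolding functor_comp_def by (intro arg_cong2[where f = "\<lambda>a b. \<lparr>FOb = a, FAr = b\<rparr>"] restrict_ext) (use ob ar' in simp_all)
qed

end

theorem theorem1:
  fixes V :: "('o, 'm) cat" and C :: "('i, 'o, 'm) vcat"
  assumes "infinite (UNIV :: 'i set)"
    and "category V"
    and "extensive TYPE('i) V"
    and "cartesian_closed V"
    and "has_pullbacks V"
    and "vcategory V C"
  shows "is_equivalence (presheaves V C) (DFib V (internalization V C)) (grothendieck V C) \<and>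
    (\<exists>\<Phi>. is_vequivalence V (presheaves_vcat V C) (DFib_vcat V (internalization V C)) \<Phi> \<and>
      functor_comp (presheaves V C)
        (underlying_functor V (presheaves_vcat V C) \<Phi>)
        (vfun_comparison V (vop V C) (vself V)) =
      functor_comp (presheaves V C)
        (DFib_comparison V (internalization V C))
        (grothendieck V C))"
proof -
 interpret category V by (rule assms)
 interpret vext V "TYPE('i)" C
  by unfold_locales (use assms in \<open>auto simp: cartesian_closed_def\<close>)
 show ?thesis
  using grothendieck_equivalence elements_vequivalence elements_vfunctor_underlying by blast
qed

end
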